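(* Let $\pi_0$ be any infinite-dimensional unitary irreducible representation of $G_0=H$ on $L^2(\mathbb{R})$. Then there is a family of unitary irreducible representations $\pi_\epsilon: G_\epsilon\to\mathcal{U}(L^2(\mathbb{R}))$, $\epsilon\in[0,1]$, whose member at $\epsilon=0$ is the given $\pi_0$, such that: (a) (continuity and contraction to $\pi_0$) for every $g\in\mathbb{R}\times\mathbb{R}^2$ and every $v\in L^2(\mathbb{R})$ the map $[0,1]\ni\epsilon\mapsto \pi_\epsilon(g)v\in L^2(\mathbb{R})$ is norm continuous; in particular $\lim_{\epsilon\to0^+}\pi_\epsilon(g)v=\pi_0(g)v$; (b) (wavelets for $\epsilon\ne0$, Gabor for $\epsilon=0$) for every $\epsilon\in(0,1]$ the representation $\pi_\epsilon\circ P_\epsilon^{-1}$ of $EA$ is unitarily equivalent to $U^b\otimes\chi_a$ for some $a\in\mathbb{R}$, $b\in\mathbb{R}\setminus\{0\}$ (depending on $\epsilon$), while $\pi_0$ is a representation of the Heisenberg group $H$; (c) (the coherent state formulas vary continuously) for every nonzero $\psi\in L^2(\mathbb{R})$ with $C_{\psi,\epsilon}<\infty$ for all $\epsilon\in[0,1]$: for every $(q,p)\in\mathbb{R}^2$ the coherent state $|q,p\rangle_\epsilon$ depends norm-continuously on $\epsilon\in[0,1]$; the constant $C_{\psi,\epsilon}$ depends continuously on $\epsilon\in[0,1]$; for every $\epsilon\in[0,1]$ and all $u,v\in L^2(\mathbb{R})$ $$\langle u|v\rangle=\frac{\|\psi\|^2}{C_{\psi,\epsilon}}\int_{\mathbb{R}^2}\langle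 u|q,p\rangle_\epsilon\,{}_\epsilon\langle q,p|v\rangle\, d\mu_\epsilon(q,p),\qquad |v\rangle=\frac{\|\psi\|^2}{C_{\psi,\epsilon}}\int_{\mathbb{R}^2}{}_\epsilon\langle q,p|v\rangle\,|q,p\rangle_\epsilon\, d\mu_\epsilon(q,p)$$ (the second integral in the weak sense); and the integrals on the right-hand sides depend continuously on $\epsilon\in[0,1]$.
   Context: Unitary representations are strongly continuous. Inner products are linear in the second argument. Heisenberg group $H$: the set $\mathbb{R}\times\mathbb{R}^2$ with product $(x_1,(y_1,z_1))(x_2,(y_2,z_2))=(x_1+x_2,\,(y_1+y_2+x_1z_2,\ z_1+z_2))$. Extended affine group $EA$: the set $\mathbb{R}^+\times\mathbb{R}\times\mathbb{R}$ with product $(\alpha,\beta,\gamma)(x,y,z)=(\alpha x,\alpha y+\beta,\gamma+z)$; it is the direct product of the affine group with $\mathbb{R}$. Wavelet analysis is the coherent state analysis attached to its infinite-dimensional irreducible unitary representations $U^b\otimes\chi_a$ ($a\in\mathbb{R}$, $b\in\mathbb{R}\setminus\{0\}$), which act on $\mathcal{H}=\{f\in L^2(\mathbb{R}): \text{the Fourier transform of } f \text{ vanishes on }(-\infty,0)\}$ by $(U^b\otimes\chi_a)(\alpha,\beta,\gamma)f(x)=e^{ia\gamma}\alpha^{-1/2}f\big(\tfrac{x+b\beta}{\alpha}\big)$. Gabor analysis is the coherent state analysis attached to infinite-dimensional irreducible unitary representations of $H$. The groups $G_\epsilon$: for $\epsilon\in(0,1]$ let $P_\epsilon:\mathbb{R}\times\mathbb{R}^2\to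 EA$ be the diffeomorphism $P_\epsilon(x,(y,z))=\big(e^{-\epsilon x},\ z\tfrac{e^{-\epsilon x}-1}{-\epsilon x},\ z+\epsilon(y-\tfrac{xz}{2})\big)$, with the fraction read as $1$ when $x=0$. $G_\epsilon$ is $\mathbb{R}\times\mathbb{R}^2$ with the product $g\cdot_\epsilon h=P_\epsilon^{-1}(P_\epsilon(g)P_\epsilon(h))$, so $P_\epsilon:G_\epsilon\to EA$ is a Lie group isomorphism; $G_0=H$. The products $\cdot_\epsilon$ converge pointwise to the product of $H$ as $\epsilon\to0^+$. Coherent states: the center of every $G_\epsilon$, $\epsilon\in[0,1]$, is $Z=\{(0,(y,0)):y\in\mathbb{R}\}$, and $G_\epsilon/Z$ is identified with $\mathbb{R}^2$ through $(q,(y,p))Z\mapsto(q,p)$, with section $\sigma_\epsilon(q,p)=(q,(\tfrac{qp}{2},p))$. The invariant measure on $G_\epsilon/Z$ is $d\mu_\epsilon(q,p)=\frac{e^{\epsilon q}-1}{\epsilon q}\,dq\,dp$ for $\epsilon\in(0,1]$ (the fraction is $1$ at $q=0$) and $d\mu_0=dq\,dp$. For $\psi\in L^2(\mathbb{R})$ put $|q,p\rangle_\epsilon=\pi_\epsilon(\sigma_\epsilon(q,p))\psi$ and $C_{\psi,\epsilon}=\int_{\mathbb{R}^2}|\langle\psi|q,p\rangle_\epsilon|^2\,d\mu_\epsilon(q,p)\in[0,\infty]$; $\psi$ is admissible for $\pi_\epsilon$ if $C_{\psi,\epsilon}<\infty$. *)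

theory Defs
  imports "HOL-Analysis.Analysis" "HOL-Algebra.Group"
begin

section \<open>The complex Hilbert space $L^2(R)$\<close>

definition square_integrable :: "(real \<Rightarrow> complex) \<Rightarrow> bool" where
  "square_integrable f \<longleftrightarrow>
     f \<in> borel_measurable lborel \<and> integrable lborel (\<lambda>x. (cmod (f x))\<^sup>2)"

definition L2_eq :: "(real \<Rightarrow> complex) \<Rightarrow> (real \<Rightarrow> complex) \<Rightarrow> bool" where
  "L2_eq f g \<longleftrightarrow> square_integrable f \<and> square_integrable g \<and> (AE x in lborel. f x = g x)"

lemma square_integrable_zero: "square_integrable (\<lambda>x. 0)"
  by (simp add: square_integrable_def)

lemma square_integrable_scale:
  assumes "square_integrable f" shows "square_integrable (\<lambda>x. c * f x)"
  using assms by (auto simp: square_integrable_def norm_mult power_mult_distrib)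

lemma square_integrable_add:
  assumes "square_integrable f" "square_integrable g"
  shows "square_integrable (\<lambda>x. f x + g x)"
proof -
  have [measurable]: "f \<in> borel_measurable lborel" "g \<in> borel_measurable lborel"
    using assms by (auto simp: square_integrable_def)
  have i: "integrable lborel (\<lambda>x. 2 * (cmod (f x))\<^sup>2 + 2 * (cmod (g x))\<^sup>2)"
    using assms by (auto simp: square_integrable_def)
  have b: "(cmod (f x + g x))\<^sup>2 \<le> 2 * (cmod (f x))\<^sup>2 + 2 * (cmod (g x))\<^sup>2" for x
  proof -
    have "(cmod (f x + g x))\<^sup>2 \<le> (cmod (f x) + cmod (g x))\<^sup>2"
      by (intro power_mono norm_triangle_ineq) auto
    also have "\<dots> \<le> 2 * (cmod (f x))\<^sup>2 + 2 * (cmod (g x))\<^sup>2"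
      using zero_le_power2[of "cmod (f x) - cmod (g x)"] by (simp add: power2_eq_square algebra_simps)
    finally show ?thesis .
  qed
  have "integrable lborel (\<lambda>x. (cmod (f x + g x))\<^sup>2)"
    by (rule Bochner_Integration.integrable_bound[OF i]) (use b in \<open>auto intro!: AE_I2 order_trans[OF b]\<close>)
  then show ?thesis by (auto simp: square_integrable_def)
qed

lemma square_integrable_mult:
  assumes "square_integrable f" "square_integrable g"
  shows "integrable lborel (\<lambda>x. cnj (f x) * g x)"
proof -
  have [measurable]: "f \<in> borel_measurable borel" "g \<in> borel_measurable borel"
    using assms by (auto simp: square_integrable_def)
  have i: "integrable lborel (\<lambda>x. (cmod (f x))\<^sup>2 + (cmod (g x))\<^sup>2)"
    using assms by (auto simp: square_integrable_def)
  have m: "(\<lambda>x. cnj (f x) * g x) \<in> borel_measurable lborel"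
    by (intro borel_measurable_times borel_measurable_continuous_on[where f=cnj])
       (auto intro: continuous_intros)
  have b: "cmod (f x) * cmod (g x) \<le> (cmod (f x))\<^sup>2 + (cmod (g x))\<^sup>2" for x
  proof -
    have "0 \<le> cmod (f x) * cmod (g x)" by simp
    moreover have "2 * (cmod (f x) * cmod (g x)) \<le> (cmod (f x))\<^sup>2 + (cmod (g x))\<^sup>2"
      using zero_le_power2[of "cmod (f x) - cmod (g x)"]
      by (simp add: power2_eq_square algebra_simps)
    ultimately show ?thesis by linarith
  qed
  show ?thesis
    by (rule Bochner_Integration.integrable_bound[OF i m]) (use b in \<open>auto simp: norm_mult\<close>)
qed

quotient_type L2 = "real \<Rightarrow> complex" / partial: L2_eq
proof (rule part_equivpI)
  show "\<exists>f. L2_eq f f"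
    by (rule exI[of _ "\<lambda>x. 0"]) (simp add: L2_eq_def square_integrable_zero)
  show "symp L2_eq"
    by (auto simp: symp_def L2_eq_def)
  show "transp L2_eq"
    by (auto simp: transp_def L2_eq_def)
qed

text \<open>\<open>L2_of f\<close> is the class of \<open>f\<close>; it is meaningful for square-integrable \<open>f\<close> only.
  \<open>L2_fun u\<close> is an arbitrarily chosen representative of \<open>u\<close>.\<close>

definition L2_of :: "(real \<Rightarrow> complex) \<Rightarrow> L2" where
  "L2_of f = abs_L2 f"

definition L2_fun :: "L2 \<Rightarrow> real \<Rightarrow> complex" where
  "L2_fun u = rep_L2 u"

lemma square_integrable_L2_fun: "square_integrable (L2_fun u)"
  using Quotient_rep_reflp[OF Quotient_L2, of u] by (simp add: L2_fun_def L2_eq_def)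

lemma L2_of_L2_fun: "L2_of (L2_fun u) = u"
  using Quotient_abs_rep[OF Quotient_L2, of u] by (simp add: L2_fun_def L2_of_def)

lemma L2_fun_L2_of:
  assumes "square_integrable f" shows "AE x in lborel. L2_fun (L2_of f) x = f x"
proof -
  have "L2_eq f f" using assms by (simp add: L2_eq_def)
  then have "L2_eq (L2_fun (L2_of f)) f"
    unfolding L2_fun_def L2_of_def by (rule Quotient_rep_abs[OF Quotient_L2])
  then show ?thesis by (simp add: L2_eq_def)
qed

lift_definition scaleC_L2 :: "complex \<Rightarrow> L2 \<Rightarrow> L2" (infixr \<open>*\<^sub>C\<close> 75) is "\<lambda>c f x. c * f x"
  by (auto simp: L2_eq_def square_integrable_scale)

text \<open>The inner product is linear in the second argument.\<close>

lift_definition cinner :: "L2 \<Rightarrow> L2 \<Rightarrow> complex" is "\<lambda>f g. \<integral>x. cnj (f x) * g x \<partial>lborel"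
proof -
  fix f f' g g' assume a: "L2_eq f f'" "L2_eq g g'"
  then have [measurable]: "(\<lambda>x. cnj (f x) * g x) \<in> borel_measurable lborel"
      "(\<lambda>x. cnj (f' x) * g' x) \<in> borel_measurable lborel"
    using square_integrable_mult by (auto simp: L2_eq_def)
  show "(\<integral>x. cnj (f x) * g x \<partial>lborel) = (\<integral>x. cnj (f' x) * g' x \<partial>lborel)"
    using a by (intro integral_cong_AE) (auto simp: L2_eq_def)
qed

instantiation L2 :: real_inner
begin

lift_definition zero_L2 :: L2 is "\<lambda>x. 0"
  by (simp add: L2_eq_def square_integrable_zero)

lift_definition plus_L2 :: "L2 \<Rightarrow> L2 \<Rightarrow> L2" is "\<lambda>f g x. f x + g x"
  by (auto simp: L2_eq_def square_integrable_add)

definition uminus_L2 :: "L2 \<Rightarrow> L2" where "uminus_L2 u = (-1) *\<^sub>C u"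

definition minus_L2 :: "L2 \<Rightarrow> L2 \<Rightarrow> L2" where "minus_L2 u v = u + (- v)"

definition scaleR_L2 :: "real \<Rightarrow> L2 \<Rightarrow> L2" where "scaleR_L2 r u = of_real r *\<^sub>C u"

definition inner_L2 :: "L2 \<Rightarrow> L2 \<Rightarrow> real" where "inner_L2 u v = Re (cinner u v)"

definition norm_L2 :: "L2 \<Rightarrow> real" where "norm_L2 u = sqrt (inner u u)"

definition sgn_L2 :: "L2 \<Rightarrow> L2" where "sgn_L2 u = inverse (norm u) *\<^sub>R u"

definition dist_L2 :: "L2 \<Rightarrow> L2 \<Rightarrow> real" where "dist_L2 u v = norm (u - v)"

definition uniformity_L2 :: "(L2 \<times> L2) filter" where
  "uniformity_L2 = (INF e\<in>{0<..}. principal {(u, v). dist u v < e})"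

definition open_L2 :: "L2 set \<Rightarrow> bool" where
  "open_L2 U \<longleftrightarrow> (\<forall>u\<in>U. \<forall>\<^sub>F (u', v) in uniformity. u' = u \<longrightarrow> v \<in> U)"

instance
proof
  fix u v w :: L2 and r s :: real
  show "u + v + w = u + (v + w)"
    by transfer (auto simp: L2_eq_def add.assoc intro!: square_integrable_add)
  show "u + v = v + u"
    by transfer (auto simp: L2_eq_def add.commute intro!: square_integrable_add)
  show "0 + u = u"
    by transfer (auto simp: L2_eq_def)
  show "- u + u = 0"
    unfolding uminus_L2_def
    by transfer (auto simp: L2_eq_def square_integrable_zero)
  show "u - v = u + - v"
    by (simp add: minus_L2_def)
  show "r *\<^sub>R (u + v) = r *\<^sub>R u + r *\<^sub>R v"
    unfolding scaleR_L2_def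
    by transfer (auto simp: L2_eq_def distrib_left intro!: square_integrable_add square_integrable_scale)
  show "(r + s) *\<^sub>R u = r *\<^sub>R u + s *\<^sub>R u"
    unfolding scaleR_L2_def
    by transfer (auto simp: L2_eq_def distrib_right intro!: square_integrable_add square_integrable_scale)
  show "r *\<^sub>R s *\<^sub>R u = (r * s) *\<^sub>R u"
    unfolding scaleR_L2_def
    by transfer (auto simp: L2_eq_def mult.assoc intro!: square_integrable_scale)
  show "1 *\<^sub>R u = u"
    unfolding scaleR_L2_def by transfer (auto simp: L2_eq_def)
  show "sgn u = inverse (norm u) *\<^sub>R u"
    by (simp add: sgn_L2_def)
  show "dist u v = norm (u - v)"
    by (simp add: dist_L2_def)
  show "(uniformity :: (L2 \<times> L2) filter) = (INF e\<in>{0<..}. principal {(u, v). dist u v < e})"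
    by (simp add: uniformity_L2_def)
  show "open U \<longleftrightarrow> (\<forall>u\<in>U. \<forall>\<^sub>F (u', v) in uniformity. u' = u \<longrightarrow> v \<in> U)" for U :: "L2 set"
    by (simp add: open_L2_def)
  show "inner u v = inner v u"
    unfolding inner_L2_def
  proof transfer
    fix f g assume "L2_eq f f" "L2_eq g g"
    have "(\<integral>x. cnj (g x) * f x \<partial>lborel) = (\<integral>x. cnj (cnj (f x) * g x) \<partial>lborel)"
      by (simp add: mult.commute)
    also have "\<dots> = cnj (\<integral>x. cnj (f x) * g x \<partial>lborel)"
      by (rule Bochner_Integration.integral_cnj)
    finally show "Re (\<integral>x. cnj (f x) * g x \<partial>lborel) = Re (\<integral>x. cnj (g x) * f x \<partial>lborel)"
      by simp
  qed
  show "inner (u + v) w = inner u w + inner v w"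
    unfolding inner_L2_def
    by transfer (simp add: L2_eq_def distrib_right square_integrable_mult)
  show "inner (r *\<^sub>R u) v = r * inner u v"
    unfolding inner_L2_def scaleR_L2_def
    by transfer (simp add: L2_eq_def mult.assoc)
  have sq: "(\<integral>x. cnj (f x) * f x \<partial>lborel) = of_real (\<integral>x. (cmod (f x))\<^sup>2 \<partial>lborel)" for f :: "real \<Rightarrow> complex"
  proof -
    have "(\<integral>x. cnj (f x) * f x \<partial>lborel) = (\<integral>x. complex_of_real ((cmod (f x))\<^sup>2) \<partial>lborel)"
      by (rule Bochner_Integration.integral_cong) (auto simp: complex_norm_square mult.commute simp del: of_real_power)
    also have "\<dots> = of_real (\<integral>x. (cmod (f x))\<^sup>2 \<partial>lborel)"
      by (rule integral_complex_of_real)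
    finally show ?thesis .
  qed
  show "0 \<le> inner u u"
    unfolding inner_L2_def by transfer (simp add: sq)
  show "inner u u = 0 \<longleftrightarrow> u = 0"
    unfolding inner_L2_def
  proof transfer
    fix f assume f: "L2_eq f f"
    have "(\<integral>x. (cmod (f x))\<^sup>2 \<partial>lborel) = 0 \<longleftrightarrow> (AE x in lborel. (cmod (f x))\<^sup>2 = 0)"
      using f by (intro integral_nonneg_eq_0_iff_AE) (auto simp: L2_eq_def square_integrable_def)
    then show "Re (\<integral>x. cnj (f x) * f x \<partial>lborel) = 0 \<longleftrightarrow> L2_eq f (\<lambda>x. 0)"
      using f by (simp add: sq L2_eq_def square_integrable_zero)
  qed
  show "norm u = sqrt (inner u u)"
    by (simp add: norm_L2_def)
qed

end

lemma L2_of_eq_0_iff: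
  assumes "square_integrable f" shows "L2_of f = 0 \<longleftrightarrow> (AE x in lborel. f x = 0)"
  unfolding L2_of_def zero_L2_def
  using Quotient_rel[OF Quotient_L2, of f "\<lambda>x. 0"] assms
  by (auto simp: L2_eq_def square_integrable_zero)

lemma cinner_L2_of:
  assumes "square_integrable f" "square_integrable g"
  shows "cinner (L2_of f) (L2_of g) = (\<integral>x. cnj (f x) * g x \<partial>lborel)"
  unfolding L2_of_def
  by (rule cinner.abs_eq) (use assms in \<open>auto simp: L2_eq_def\<close>)

text \<open>By the next lemma every representation on $L^2(R)$ is infinite-dimensional.\<close>

lemma infinite_dimensional_L2: "\<nexists>B. finite B \<and> span B = (UNIV :: L2 set)"
proof
  assume "\<exists>B. finite B \<and> span B = (UNIV :: L2 set)"
  then obtain B :: "L2 set" where B: "finite B" "span B = UNIV" by blast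
  define f :: "nat \<Rightarrow> real \<Rightarrow> complex" where "f n x = of_real (indicator {real n..<real n + 1} x)" for n x
  define e where "e n = L2_of (f n)" for n
  have sq: "(cmod (f n x))\<^sup>2 = indicator {real n..<real n + 1} x" for n x
    by (simp add: f_def indicator_def)
  have f: "square_integrable (f n)" for n
    unfolding square_integrable_def sq
    by (auto simp: f_def[abs_def] intro!: integrable_real_indicator)
  have orth: "inner (e n) (e m) = 0" if "n \<noteq> m" for n m
  proof -
    have "cnj (f n x) * f m x = 0" for x
    proof (rule ccontr)
      assume "cnj (f n x) * f m x \<noteq> 0"
      then have "real n \<le> x" "x < real n + 1" "real m \<le> x" "x < real m + 1"
        by (auto simp: f_def indicator_def split: if_splits)
      then have "real n < real (Suc m)" "real m < real (Suc n)" by linarith+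
      with that show False by simp
    qed
    then have "(\<lambda>x. cnj (f n x) * f m x) = (\<lambda>x. 0)" by blast
    then show ?thesis
      by (simp only: inner_L2_def e_def cinner_L2_of[OF f f]) simp
  qed
  have nz: "inner (e n) (e n) = 1" for n
  proof -
    have "cnj (f n x) * f n x = of_real (indicator {real n..<real n + 1} x)" for x
      by (simp add: f_def indicator_def)
    then have "cinner (e n) (e n) = of_real (\<integral>x. indicator {real n..<real n + 1} x \<partial>lborel)"
      by (simp add: e_def cinner_L2_of[OF f f])
    then show ?thesis by (simp add: inner_L2_def)
  qed
  have inj: "inj e"
    using orth nz by (metis injI zero_neq_one)
  have "independent (range e)"
  proof (rule pairwise_orthogonal_independent)
    show "pairwise orthogonal (range e)"
      using orth by (auto simp: pairwise_def orthogonal_def) metis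
    show "0 \<notin> range e"
      using nz by (metis imageE inner_zero_left zero_neq_one)
  qed
  then have "finite (range e)"
    using independent_span_bound[OF B(1), of "range e"] B(2) by simp
  with inj show False
    using finite_imageD infinite_UNIV_nat by blast
qed

lemma cinner_self: "cinner u u = of_real ((norm u)\<^sup>2)"
proof (rule complex_eqI)
  show "Re (cinner u u) = Re (of_real ((norm u)\<^sup>2))"
    by (simp add: power2_norm_eq_inner inner_L2_def)
  have "cinner u u = cnj (cinner u u)"
  proof transfer
    fix f :: "real \<Rightarrow> complex"
    have "cnj (\<integral>x. cnj (f x) * f x \<partial>lborel) = (\<integral>x. cnj (cnj (f x) * f x) \<partial>lborel)"
      by (rule Bochner_Integration.integral_cnj[symmetric])
    then show "(\<integral>x. cnj (f x) * f x \<partial>lborel) = cnj (\<integral>x. cnj (f x) * f x \<partial>lborel)"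
      by (simp add: mult.commute)
  qed
  then show "Im (cinner u u) = Im (of_real ((norm u)\<^sup>2))"
    by (metis Im_complex_of_real Reals_cnj_iff complex_is_Real_iff)
qed


section \<open>Unitary representations on $L^2(R)$\<close>

definition clinear_L2 :: "(L2 \<Rightarrow> L2) \<Rightarrow> bool" where
  "clinear_L2 T \<longleftrightarrow>
     (\<forall>u v. T (u + v) = T u + T v) \<and> (\<forall>c u. T (c *\<^sub>C u) = c *\<^sub>C T u)"

definition isometric_L2 :: "(L2 \<Rightarrow> L2) \<Rightarrow> bool" where
  "isometric_L2 T \<longleftrightarrow> (\<forall>u v. cinner (T u) (T v) = cinner u v)"

definition csubspace_L2 :: "L2 set \<Rightarrow> bool" where
  "csubspace_L2 S \<longleftrightarrow>
     0 \<in> S \<and> (\<forall>u\<in>S. \<forall>v\<in>S. u + v \<in> S) \<and> (\<forall>c. \<forall>u\<in>S. c *\<^sub>C u \<in> S)"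

definition unitary_group :: "(L2 \<Rightarrow> L2) monoid" where
  "unitary_group =
     \<lparr>carrier = {T. clinear_L2 T \<and> isometric_L2 T \<and> surj T}, mult = (\<circ>), one = id\<rparr>"

definition unitary_rep ::
    "('g::topological_space, 'm) monoid_scheme \<Rightarrow> ('g \<Rightarrow> L2 \<Rightarrow> L2) \<Rightarrow> bool" where
  "unitary_rep G \<pi> \<longleftrightarrow>
     \<pi> \<in> hom G unitary_group \<and> (\<forall>v. continuous_on (carrier G) (\<lambda>g. \<pi> g v))"

definition unitary_irrep ::
    "('g::topological_space, 'm) monoid_scheme \<Rightarrow> ('g \<Rightarrow> L2 \<Rightarrow> L2) \<Rightarrow> bool" where
  "unitary_irrep G \<pi> \<longleftrightarrow>
     unitary_rep G \<pi> \<and>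
     (\<forall>S. csubspace_L2 S \<and> closed S \<and> (\<forall>g\<in>carrier G. \<pi> g ` S \<subseteq> S) \<longrightarrow> S = {0} \<or> S = UNIV)"

text \<open>Unitary equivalence of a representation \<open>\<pi>\<close> on all of $L^2(R)$ with a representation \<open>\<rho>\<close>
  acting on the subspace \<open>V\<close> of $L^2(R)$; only the values of \<open>\<rho>\<close> on \<open>V\<close> matter.\<close>

definition unitarily_equivalent ::
    "('g, 'm) monoid_scheme \<Rightarrow> ('g \<Rightarrow> L2 \<Rightarrow> L2) \<Rightarrow> ('g \<Rightarrow> L2 \<Rightarrow> L2) \<Rightarrow> L2 set \<Rightarrow> bool" where
  "unitarily_equivalent G \<pi> \<rho> V \<longleftrightarrow>
     (\<exists>W. clinear_L2 W \<and> isometric_L2 W \<and> range W = V \<and>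
          (\<forall>g\<in>carrier G. \<forall>v. W (\<pi> g v) = \<rho> g (W v)))"


section \<open>The groups\<close>

text \<open>The Lie group topologies are the ones of the underlying type \<^typ>\<open>real \<times> real \<times> real\<close>;
  the triple \<open>(x, y, z)\<close> stands for $(x,(y,z))$.\<close>

definition heisenberg :: "(real \<times> real \<times> real) monoid" where
  "heisenberg =
     \<lparr>carrier = UNIV,
      mult = (\<lambda>(x1, y1, z1) (x2, y2, z2). (x1 + x2, y1 + y2 + x1 * z2, z1 + z2)),
      one = (0, 0, 0)\<rparr>"

definition EA :: "(real \<times> real \<times> real) monoid" where
  "EA =
     \<lparr>carrier = {0<..} \<times> UNIV \<times> UNIV,
      mult = (\<lambda>(\<alpha>, \<beta>, \<gamma>) (x, y, z). (\<alpha> * x, \<alpha> * y + \<beta>, \<gamma> + z)),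
      one = (1, 0, 0)\<rparr>"

definition expquot :: "real \<Rightarrow> real" where
  "expquot t = (if t = 0 then 1 else (exp t - 1) / t)"

definition P_eps :: "real \<Rightarrow> real \<times> real \<times> real \<Rightarrow> real \<times> real \<times> real" where
  "P_eps \<epsilon> = (\<lambda>(x, y, z).
     (exp (- \<epsilon> * x), z * expquot (- \<epsilon> * x), z + \<epsilon> * (y - x * z / 2)))"

definition P_eps_inv :: "real \<Rightarrow> real \<times> real \<times> real \<Rightarrow> real \<times> real \<times> real" where
  "P_eps_inv \<epsilon> = inv_into UNIV (P_eps \<epsilon>)"

definition G_eps :: "real \<Rightarrow> (real \<times> real \<times> real) monoid" where
  "G_eps \<epsilon> =
     (if \<epsilon> = 0 then heisenberg
      else \<lparr>carrier = UNIV, mult = (\<lambda>g h. P_eps_inv \<epsilon> (P_eps \<epsilon> g \<otimes>\<^bsub>EA\<^esub> P_eps \<epsilon> h)), one = (0, 0, 0)\<rparr>)"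

lemma expquot_pos: "expquot t > 0"
  by (cases "t > 0") (auto simp: expquot_def zero_less_divide_iff)

lemma bij_betw_P_eps:
  assumes "\<epsilon> \<noteq> 0" shows "bij_betw (P_eps \<epsilon>) UNIV (carrier EA)"
proof (rule bij_betw_byWitness)
  define Q where "Q = (\<lambda>(\<alpha>, \<beta>, \<gamma>). let x = - ln \<alpha> / \<epsilon>; z = \<beta> / expquot (ln \<alpha>)
    in (x, (\<gamma> - z) / \<epsilon> + x * z / 2, z))"
  have e: "expquot t \<noteq> 0" for t using expquot_pos[of t] by simp
  show "\<forall>a\<in>UNIV. Q (P_eps \<epsilon> a) = a"
    using assms e by (auto simp: Q_def P_eps_def Let_def)
  show "\<forall>a\<in>carrier EA. P_eps \<epsilon> (Q a) = a"
    using assms e by (auto simp: Q_def P_eps_def Let_def EA_def)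
  show "P_eps \<epsilon> ` UNIV \<subseteq> carrier EA"
    by (auto simp: P_eps_def EA_def)
  show "Q ` carrier EA \<subseteq> UNIV" by simp
qed

lemma group_heisenberg: "group heisenberg"
proof (rule groupI)
  fix g assume "g \<in> carrier heisenberg"
  obtain x y z where "g = (x, y, z)" by (cases g)
  then show "\<exists>h\<in>carrier heisenberg. h \<otimes>\<^bsub>heisenberg\<^esub> g = \<one>\<^bsub>heisenberg\<^esub>"
    by (intro bexI[of _ "(- x, - y + x * z, - z)"]) (auto simp: heisenberg_def)
qed (auto simp: heisenberg_def algebra_simps)

lemma group_EA: "group EA"
proof (rule groupI)
  fix g assume g: "g \<in> carrier EA"
  obtain x y z where "g = (x, y, z)" by (cases g)
  with g show "\<exists>h\<in>carrier EA. h \<otimes>\<^bsub>EA\<^esub> g = \<one>\<^bsub>EA\<^esub>"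
    by (intro bexI[of _ "(1 / x, - y / x, - z)"]) (auto simp: EA_def)
qed (auto simp: EA_def algebra_simps)

lemma P_eps_iso:
  assumes "\<epsilon> \<noteq> 0" shows "P_eps \<epsilon> \<in> iso (G_eps \<epsilon>) EA"
proof -
  have "P_eps \<epsilon> ` UNIV = carrier EA"
    using bij_betw_P_eps[OF assms] by (simp add: bij_betw_def)
  moreover from this have "P_eps \<epsilon> g \<in> carrier EA" for g by auto
  moreover have "P_eps \<epsilon> g \<otimes>\<^bsub>EA\<^esub> P_eps \<epsilon> h \<in> carrier EA" for g h
    using calculation(2) by (intro monoid.m_closed group.is_monoid[OF group_EA])
  ultimately show ?thesis
    using assms bij_betw_P_eps[OF assms]
    by (auto simp: iso_def hom_def G_eps_def P_eps_inv_def f_inv_into_f)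
qed

lemma group_G_eps: "group (G_eps \<epsilon>)"
proof (cases "\<epsilon> = 0")
  case True
  then show ?thesis by (simp add: G_eps_def group_heisenberg)
next
  case False
  note bij = bij_betw_P_eps[OF False]
  interpret EA: group EA by (rule group_EA)
  have car: "P_eps \<epsilon> g \<in> carrier EA" for g
    using bij by (auto simp: bij_betw_def)
  have inj: "P_eps \<epsilon> g = P_eps \<epsilon> h \<Longrightarrow> g = h" for g h
    using bij by (metis UNIV_I bij_betw_def inj_onD)
  have UN: "carrier (G_eps \<epsilon>) = UNIV"
    using False by (simp add: G_eps_def)
  have P_mult: "P_eps \<epsilon> (g \<otimes>\<^bsub>G_eps \<epsilon>\<^esub> h) = P_eps \<epsilon> g \<otimes>\<^bsub>EA\<^esub> P_eps \<epsilon> h" for g h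
    using P_eps_iso[OF False] by (auto simp: iso_def UN intro: hom_mult)
  have P_one: "P_eps \<epsilon> \<one>\<^bsub>G_eps \<epsilon>\<^esub> = \<one>\<^bsub>EA\<^esub>"
    using False by (simp add: G_eps_def P_eps_def EA_def)
  show ?thesis
  proof (rule groupI)
    fix g h k
    show "(g \<otimes>\<^bsub>G_eps \<epsilon>\<^esub> h) \<otimes>\<^bsub>G_eps \<epsilon>\<^esub> k = g \<otimes>\<^bsub>G_eps \<epsilon>\<^esub> (h \<otimes>\<^bsub>G_eps \<epsilon>\<^esub> k)"
      by (rule inj) (simp add: P_mult EA.m_assoc car)
    show "\<one>\<^bsub>G_eps \<epsilon>\<^esub> \<otimes>\<^bsub>G_eps \<epsilon>\<^esub> g = g"
      by (rule inj) (simp add: P_mult P_one car)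
    have "inv\<^bsub>EA\<^esub> (P_eps \<epsilon> g) \<in> range (P_eps \<epsilon>)"
      using bij EA.inv_closed[OF car[of g]] by (simp only: bij_betw_def)
    then obtain h where h: "inv\<^bsub>EA\<^esub> (P_eps \<epsilon> g) = P_eps \<epsilon> h"
      by (rule rangeE)
    have "h \<otimes>\<^bsub>G_eps \<epsilon>\<^esub> g = \<one>\<^bsub>G_eps \<epsilon>\<^esub>"
      by (rule inj) (simp add: P_mult P_one car flip: h)
    then show "\<exists>h\<in>carrier (G_eps \<epsilon>). h \<otimes>\<^bsub>G_eps \<epsilon>\<^esub> g = \<one>\<^bsub>G_eps \<epsilon>\<^esub>"
      by (intro bexI[of _ h]) (simp_all add: UN)
  qed (auto simp: UN)
qed


section \<open>The wavelet representations of \<open>EA\<close>\<close>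

text \<open>The Fourier transform on $L^2(R)$ is the $L^2$-limit of the truncated Fourier integrals.\<close>

definition truncated_fourier :: "L2 \<Rightarrow> real \<Rightarrow> real \<Rightarrow> complex" where
  "truncated_fourier f R \<omega> =
     (LINT x:{-R..R}|lborel. L2_fun f x * exp (- \<i> * of_real (x * \<omega>))) / of_real (sqrt (2 * pi))"

definition has_fourier_transform :: "L2 \<Rightarrow> L2 \<Rightarrow> bool" where
  "has_fourier_transform f h \<longleftrightarrow>
     ((\<lambda>R. \<integral>\<^sup>+\<omega>. ennreal ((cmod (truncated_fourier f R \<omega> - L2_fun h \<omega>))\<^sup>2) \<partial>lborel) \<longlongrightarrow> 0) at_top"

definition hardy :: "L2 set" where
  "hardy = {f. \<exists>h. has_fourier_transform f h \<and> (AE \<omega> in lborel. \<omega> < 0 \<longrightarrow> L2_fun h \<omega> = 0)}"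

text \<open>$U^b \otimes \chi_a$. For \<open>\<alpha> > 0\<close> the class on the right does not depend on the representative
  \<^term>\<open>L2_fun f\<close>.\<close>

definition wavelet_rep :: "real \<Rightarrow> real \<Rightarrow> real \<times> real \<times> real \<Rightarrow> L2 \<Rightarrow> L2" where
  "wavelet_rep a b = (\<lambda>(\<alpha>, \<beta>, \<gamma>) f.
     L2_of (\<lambda>x. exp (\<i> * of_real (a * \<gamma>)) * of_real (\<alpha> powr (- 1 / 2)) * L2_fun f ((x + b * \<beta>) / \<alpha>)))"


section \<open>Coherent states\<close>

text \<open>$G_\epsilon/Z$ is identified with \<^typ>\<open>real \<times> real\<close>; note that the density is \<open>1\<close> for
  \<open>\<epsilon> = 0\<close>.\<close>

definition mu_eps :: "real \<Rightarrow> (real \<times> real) measure" where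
  "mu_eps \<epsilon> = density lborel (\<lambda>(q, p). ennreal (expquot (\<epsilon> * q)))"

definition cs_section :: "real \<times> real \<Rightarrow> real \<times> real \<times> real" where
  "cs_section = (\<lambda>(q, p). (q, q * p / 2, p))"

definition coherent :: "(real \<times> real \<times> real \<Rightarrow> L2 \<Rightarrow> L2) \<Rightarrow> L2 \<Rightarrow> real \<times> real \<Rightarrow> L2" where
  "coherent \<rho> \<psi> x = \<rho> (cs_section x) \<psi>"

definition C_adm :: "real \<Rightarrow> (real \<times> real \<times> real \<Rightarrow> L2 \<Rightarrow> L2) \<Rightarrow> L2 \<Rightarrow> ennreal" where
  "C_adm \<epsilon> \<rho> \<psi> = (\<integral>\<^sup>+x. ennreal ((cmod (cinner \<psi> (coherent \<rho> \<psi> x)))\<^sup>2) \<partial>mu_eps \<epsilon>)"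

definition admissible :: "real \<Rightarrow> (real \<times> real \<times> real \<Rightarrow> L2 \<Rightarrow> L2) \<Rightarrow> L2 \<Rightarrow> bool" where
  "admissible \<epsilon> \<rho> \<psi> \<longleftrightarrow> C_adm \<epsilon> \<rho> \<psi> < \<infinity>"

definition has_weak_integral :: "'a measure \<Rightarrow> ('a \<Rightarrow> L2) \<Rightarrow> L2 \<Rightarrow> bool" where
  "has_weak_integral M F w \<longleftrightarrow>
     (\<forall>u. integrable M (\<lambda>x. cinner u (F x)) \<and> (\<integral>x. cinner u (F x) \<partial>M) = cinner u w)"

end

theory Submission
  imports Defs "HOL-Probability.Probability"
begin

text \<open>By the Stone-von Neumann theorem \<open>\<pi>0\<close> is a Schroedinger representation
  \<open>F(t) \<mapsto> e\<^bsup>i l (y - z t)\<^esup> F(t - x)\<close> with \<open>l \<noteq> 0\<close>. On the Fourier side, and after the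
  substitution \<open>\<omega> = e\<^bsup>\<epsilon> t\<^esup>\<close>, the representation $U^b \otimes \chi_a$ with \<open>a = l / \<epsilon>\<close> and
  \<open>b = - l / \<epsilon>\<close>, composed with $P_\epsilon$, becomes a translation by the same \<open>x\<close> followed by a phase
  \<open>e\<^bsup>i l (y + z h)\<^esup>\<close>; here \<open>h = (1 - expquot(- \<epsilon> x) e\<^bsup>\<epsilon> t\<^esup>) / \<epsilon> - x / 2\<close> tends to \<open>- t\<close> as
  \<open>\<epsilon> \<rightarrow> 0\<close>. So all the representations live on one space and only a phase moves.

  For fixed \<open>q\<close>, \<open>\<langle>u|q,p\<rangle>\<close> is a Fourier integral in \<open>p\<close> of an integrable function. Plancherel in \<open>p\<close>
  and Fubini give \<open>\<integral> |\<langle>u|q,p\<rangle>|\<^sup>2 d\<mu> = (2 \<pi> / |l|) \<parallel>u\<parallel>\<^sup>2 \<integral> |\<psi>(s)|\<^sup>2 e\<^bsup>- \<epsilon> s\<^esup> ds\<close> in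
  \<open>[0, \<infinity>]\<close>. This yields irreducibility, and by polarization and dominated convergence all of (c).

  The Stone-von Neumann theorem itself follows von Neumann: averaging the Weyl operators against a Gaussian
  produces a vector whose matrix coefficient depends on the central character only.\<close>

text \<open>Why the limit exists although \<open>l / \<epsilon>\<close> blows up:
  \<open>P_eps\<close> puts the same z into the second and the third coordinate, so with opposite
  parameters a and b the contributions of order 1/\<epsilon> to the phase cancel, and what remains
  tends to the Schroedinger phase. The weight exp (- \<epsilon> s) is Calderon's admissibility
  weight 1/\<omega> of wavelet theory in the variable t. At \<epsilon> = 0 the weighted integral is
  the squared norm, and exp (- \<epsilon> s) \<le> 1 + exp (- s), so finiteness at \<epsilon> = 1
  controls the whole interval.

  The conjugate of u times a translate of \<psi> is integrable but in general not square integrable.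
  Hence Plancherel's identity is proved for integrable functions with values in [0, \<infinity>], by
  damping with Gaussians.

  The given \<open>\<pi>0\<close> is abstract. Schur's lemma provides its central character, through
  a square root of the square of a self-adjoint operator, and one unitary \<open>W\<close> from
  Stone-von Neumann conjugates the model for all \<epsilon> at once, so no choice depends on
  \<epsilon>.\<close>

lemma square_integrable_measurable [measurable_dest]: "square_integrable f \<Longrightarrow> f \<in> borel_measurable borel"
  by (simp add: square_integrable_def)

lemma measurable_L2_fun [measurable]: "L2_fun u \<in> borel_measurable borel"
  using square_integrable_L2_fun by (rule square_integrable_measurable)

lemma square_integrable_uminus: "square_integrable f \<Longrightarrow> square_integrable (\<lambda>x. - f x)"
  using square_integrable_scale[of f "-1"] by simp

lemma square_integrable_diff:
  "square_integrable f \<Longrightarrow> square_integrable g \<Longrightarrow> square_integrable (\<lambda>x. f x - g x)"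
  using square_integrable_add[of f "\<lambda>x. - g x"] square_integrable_uminus[of g] by simp

lemma square_integrable_iff_nn:
  assumes "f \<in> borel_measurable borel"
  shows "square_integrable f \<longleftrightarrow> (\<integral>\<^sup>+x. ennreal ((cmod (f x))\<^sup>2) \<partial>lborel) < \<infinity>"
  using assms unfolding square_integrable_def
  by (auto simp: integrable_iff_bounded)

lemma L2_of_cong_AE:
  assumes "square_integrable f" "square_integrable g" "AE x in lborel. f x = g x"
  shows "L2_of f = L2_of g"
  unfolding L2_of_def using Quotient_rel[OF Quotient_L2, of f g] assms by (auto simp: L2_eq_def)

lemma L2_of_add:
  assumes "square_integrable f" "square_integrable g"
  shows "L2_of f + L2_of g = L2_of (\<lambda>x. f x + g x)"
  unfolding L2_of_def by (rule plus_L2.abs_eq) (use assms in \<open>auto simp: L2_eq_def\<close>)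

lemma L2_of_scaleC:
  assumes "square_integrable f"
  shows "c *\<^sub>C L2_of f = L2_of (\<lambda>x. c * f x)"
  unfolding L2_of_def by (rule scaleC_L2.abs_eq) (use assms in \<open>auto simp: L2_eq_def\<close>)

lemma L2_of_diff:
  assumes "square_integrable f" "square_integrable g"
  shows "L2_of f - L2_of g = L2_of (\<lambda>x. f x - g x)"
  using assms
  by (simp add: minus_L2_def uminus_L2_def L2_of_scaleC L2_of_add square_integrable_uminus)

lemma norm_L2_of:
  assumes "square_integrable f"
  shows "(norm (L2_of f))\<^sup>2 = (\<integral>x. (cmod (f x))\<^sup>2 \<partial>lborel)"
proof -
  have "complex_of_real ((norm (L2_of f))\<^sup>2) = (\<integral>x. cnj (f x) * f x \<partial>lborel)"
    using cinner_self[of "L2_of f"] cinner_L2_of[OF assms assms] by simp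
  also have "\<dots> = (\<integral>x. complex_of_real ((cmod (f x))\<^sup>2) \<partial>lborel)"
    by (rule Bochner_Integration.integral_cong)
       (auto simp: complex_norm_square mult.commute simp del: of_real_power)
  also have "\<dots> = of_real (\<integral>x. (cmod (f x))\<^sup>2 \<partial>lborel)"
    by (rule integral_complex_of_real)
  finally show ?thesis using of_real_eq_iff by blast
qed

lemma nn_norm_L2_of:
  assumes "square_integrable f"
  shows "ennreal ((norm (L2_of f))\<^sup>2) = (\<integral>\<^sup>+x. ennreal ((cmod (f x))\<^sup>2) \<partial>lborel)"
  using assms unfolding norm_L2_of[OF assms]
  by (intro nn_integral_eq_integral[symmetric]) (auto simp: square_integrable_def)

lemma nn_norm_L2: "ennreal ((norm u)\<^sup>2) = (\<integral>\<^sup>+x. ennreal ((cmod (L2_fun u x))\<^sup>2) \<partial>lborel)"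
  using nn_norm_L2_of[OF square_integrable_L2_fun, of u] by (simp add: L2_of_L2_fun)

lemma cinner_L2_fun: "cinner u v = (\<integral>x. cnj (L2_fun u x) * L2_fun v x \<partial>lborel)"
  using cinner_L2_of[OF square_integrable_L2_fun square_integrable_L2_fun, of u v]
  by (simp add: L2_of_L2_fun)

lemma L2_fun_add: "AE x in lborel. L2_fun (u + v) x = L2_fun u x + L2_fun v x"
  using L2_fun_L2_of[OF square_integrable_add[OF square_integrable_L2_fun square_integrable_L2_fun], of u v]
  by (simp add: L2_of_add[symmetric] square_integrable_L2_fun L2_of_L2_fun)

lemma L2_fun_scaleC: "AE x in lborel. L2_fun (c *\<^sub>C u) x = c * L2_fun u x"
  using L2_fun_L2_of[OF square_integrable_scale[OF square_integrable_L2_fun], of c u]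
  by (simp add: L2_of_scaleC[symmetric] square_integrable_L2_fun L2_of_L2_fun)

section \<open>Complex scalar multiplication and the inner product on \<open>L2\<close>\<close>

lemma scaleC_add_right: "c *\<^sub>C (u + v) = c *\<^sub>C u + c *\<^sub>C (v::L2)"
  by transfer (auto simp: L2_eq_def distrib_left intro!: square_integrable_add square_integrable_scale)

lemma scaleC_add_left: "(c + d) *\<^sub>C u = c *\<^sub>C u + d *\<^sub>C (u::L2)"
  by transfer (auto simp: L2_eq_def distrib_right intro!: square_integrable_add square_integrable_scale)

lemma scaleC_scaleC: "c *\<^sub>C d *\<^sub>C u = (c * d) *\<^sub>C (u::L2)"
  by transfer (auto simp: L2_eq_def mult.assoc intro!: square_integrable_scale)

lemma scaleC_one [simp]: "1 *\<^sub>C u = (u::L2)"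
  by transfer (auto simp: L2_eq_def)

lemma scaleC_of_real: "complex_of_real r *\<^sub>C u = r *\<^sub>R (u::L2)"
  by (simp add: scaleR_L2_def)

lemma scaleC_zero_left [simp]: "0 *\<^sub>C u = (0::L2)"
  using scaleC_of_real[of 0 u] by simp

lemma scaleC_zero_right [simp]: "c *\<^sub>C (0::L2) = 0"
  using scaleC_scaleC[of c 0 0] by simp

lemma scaleC_minus_one: "(- 1) *\<^sub>C u = - (u::L2)"
  by (simp add: uminus_L2_def)

lemma scaleC_minus_right: "c *\<^sub>C (- u) = - (c *\<^sub>C (u::L2))"
  using scaleC_scaleC[of c "-1" u] scaleC_scaleC[of "-1" c u] by (simp add: scaleC_minus_one)

lemma scaleC_minus_left: "(- c) *\<^sub>C u = - (c *\<^sub>C (u::L2))"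
  using scaleC_scaleC[of "-1" c u] by (simp add: scaleC_minus_one)

lemma scaleC_diff_right: "c *\<^sub>C (u - v) = c *\<^sub>C u - c *\<^sub>C (v::L2)"
  by (metis scaleC_add_right scaleC_minus_right add_uminus_conv_diff)

lemma scaleC_diff_left: "(c - d) *\<^sub>C u = c *\<^sub>C u - d *\<^sub>C (u::L2)"
  by (metis scaleC_add_left scaleC_minus_left add_uminus_conv_diff)

lemma cinner_commute: "cinner u v = cnj (cinner v u)"
proof transfer
  fix f g :: "real \<Rightarrow> complex"
  have "cnj (\<integral>x. cnj (g x) * f x \<partial>lborel) = (\<integral>x. cnj (cnj (g x) * f x) \<partial>lborel)"
    by (rule Bochner_Integration.integral_cnj[symmetric])
  then show "(\<integral>x. cnj (f x) * g x \<partial>lborel) = cnj (\<integral>x. cnj (g x) * f x \<partial>lborel)"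
    by (simp add: mult.commute)
qed

lemma cinner_add_right: "cinner u (v + w) = cinner u v + cinner u w"
  by transfer (simp add: L2_eq_def distrib_left square_integrable_mult)

lemma cinner_scaleC_right: "cinner u (c *\<^sub>C v) = c * cinner u v"
  by transfer (simp add: L2_eq_def mult.left_commute)

lemma cinner_add_left: "cinner (u + v) w = cinner u w + cinner v w"
  by (subst (1 2 3) cinner_commute) (simp add: cinner_add_right)

lemma cinner_scaleC_left: "cinner (c *\<^sub>C u) v = cnj c * cinner u v"
  by (subst (1 2) cinner_commute) (simp add: cinner_scaleC_right)

lemma cinner_scaleR_right: "cinner u (r *\<^sub>R v) = r *\<^sub>R cinner u v"
  by (simp add: scaleR_L2_def cinner_scaleC_right scaleR_conv_of_real)

lemma cinner_scaleR_left: "cinner (r *\<^sub>R u) v = r *\<^sub>R cinner u v"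
  by (simp add: scaleR_L2_def cinner_scaleC_left scaleR_conv_of_real)

lemma norm_scaleC: "norm (c *\<^sub>C u) = cmod c * norm (u::L2)"
proof -
  have "complex_of_real ((norm (c *\<^sub>C u))\<^sup>2) = of_real ((cmod c * norm u)\<^sup>2)"
    unfolding cinner_self[symmetric] cinner_scaleC_left cinner_scaleC_right
    by (simp add: cinner_self power_mult_distrib complex_norm_square flip: mult.assoc of_real_power)
  then have "(norm (c *\<^sub>C u))\<^sup>2 = (cmod c * norm u)\<^sup>2" using of_real_eq_iff by blast
  then show ?thesis by (simp add: power2_eq_iff_nonneg)
qed

lemma scaleC_eq_0_iff: "c *\<^sub>C u = 0 \<longleftrightarrow> c = 0 \<or> u = (0::L2)"
  using norm_scaleC[of c u] by (metis mult_eq_0_iff norm_eq_zero)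

lemma Re_cinner: "Re (cinner u v) = inner u v"
  by (simp add: inner_L2_def)

lemma Im_cinner: "Im (cinner u v) = inner (\<i> *\<^sub>C u) v"
  by (simp add: inner_L2_def cinner_scaleC_left)

lemma cmod_cinner_le: "cmod (cinner u v) \<le> norm u * norm v"
proof (cases "cinner u v = 0")
  case False
  \<comment> \<open>The unimodular factor \<open>c\<close> rotates the inner product onto the
    nonnegative reals, where the real Cauchy-Schwarz inequality applies.\<close>
  define c where "c = cnj (cinner u v) / cmod (cinner u v)"
  have c1: "cmod c = 1" using False by (simp add: c_def norm_divide)
  have "cinner u (c *\<^sub>C v) = of_real (cmod (cinner u v))"
    using False by (simp add: cinner_scaleC_right c_def mult.commute complex_norm_square[symmetric] power2_eq_square)
  then have "cmod (cinner u v) = inner u (c *\<^sub>C v)"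
    by (metis Re_cinner Re_complex_of_real)
  also have "\<dots> \<le> norm u * norm (c *\<^sub>C v)" by (rule norm_cauchy_schwarz)
  finally show ?thesis by (simp add: norm_scaleC c1)
qed simp

lemma bounded_bilinear_cinner: "bounded_bilinear cinner"
  by standard (auto simp: cinner_add_left cinner_add_right cinner_scaleR_left cinner_scaleR_right
      intro!: exI[of _ 1] cmod_cinner_le)

lemma bounded_linear_scaleC: "bounded_linear (\<lambda>u::L2. c *\<^sub>C u)"
  by standard (auto simp: scaleC_add_right scaleR_L2_def scaleC_scaleC norm_scaleC mult.commute
      intro!: exI[of _ "cmod c"])

lemmas tendsto_cinner [tendsto_intros] = bounded_bilinear.tendsto[OF bounded_bilinear_cinner]
lemmas continuous_on_cinner [continuous_intros] = bounded_bilinear.continuous_on[OF bounded_bilinear_cinner]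
lemmas tendsto_scaleC [tendsto_intros] = bounded_linear.tendsto[OF bounded_linear_scaleC]
lemmas continuous_on_scaleC [continuous_intros] = bounded_linear.continuous_on[OF bounded_linear_scaleC]

lemma cinner_zero_left [simp]: "cinner 0 u = 0"
  by (rule bounded_bilinear.zero_left[OF bounded_bilinear_cinner])

lemma cinner_zero_right [simp]: "cinner u 0 = 0"
  by (rule bounded_bilinear.zero_right[OF bounded_bilinear_cinner])

lemma cinner_diff_left: "cinner (u - v) w = cinner u w - cinner v w"
  by (rule bounded_bilinear.diff_left[OF bounded_bilinear_cinner])

lemma cinner_diff_right: "cinner u (v - w) = cinner u v - cinner u w"
  by (rule bounded_bilinear.diff_right[OF bounded_bilinear_cinner])

lemma cinner_ext:
  assumes "\<And>u. cinner u v = cinner u w" shows "v = w"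
proof -
  have "cinner (v - w) (v - w) = 0" by (simp add: assms cinner_diff_right)
  then show ?thesis by (simp add: cinner_self)
qed

lemma exists_nonzero_L2: "\<exists>w :: L2. w \<noteq> 0"
proof (rule ccontr)
  assume "\<not> ?thesis"
  then have "span {} = (UNIV :: L2 set)" by auto
  then show False using infinite_dimensional_L2 by blast
qed

lemma tendsto_iff_norm_square: "(f \<longlongrightarrow> a) F \<longleftrightarrow> ((\<lambda>x. (norm (f x - a))\<^sup>2) \<longlongrightarrow> 0) F"
  for a :: "'a::real_normed_vector"
proof
  assume "((\<lambda>x. (norm (f x - a))\<^sup>2) \<longlongrightarrow> 0) F"
  then have "((\<lambda>x. sqrt ((norm (f x - a))\<^sup>2)) \<longlongrightarrow> sqrt 0) F" by (rule tendsto_real_sqrt)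
  then show "(f \<longlongrightarrow> a) F" by (simp add: LIM_zero_iff tendsto_norm_zero_iff)
next
  assume "(f \<longlongrightarrow> a) F"
  then have "((\<lambda>x. (norm (f x - a))\<^sup>2) \<longlongrightarrow> (norm (a - a))\<^sup>2) F" by (intro tendsto_intros)
  then show "((\<lambda>x. (norm (f x - a))\<^sup>2) \<longlongrightarrow> 0) F" by simp
qed

subsection \<open>Completeness\<close>

text \<open>Riesz-Fischer: a subsequence with geometrically small increments converges almost
  everywhere, Fatou's lemma shows that its pointwise limit is also the limit in norm, and a Cauchy
  sequence with a convergent subsequence converges.\<close>

instance L2 :: banach
proof
  fix X :: "nat \<Rightarrow> L2" assume X: "Cauchy X"
  have "\<exists>r. \<forall>n. (\<forall>m\<ge>r n. norm (X m - X (r n)) < (1/2)^n) \<and> r n < r (Suc n)"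
  proof (rule dependent_nat_choice[of "\<lambda>n k. \<forall>m\<ge>k. norm (X m - X k) < (1/2)^n" "\<lambda>n k l. k < l"])
    show "\<exists>k. \<forall>m\<ge>k. norm (X m - X k) < (1/2)^0"
      using CauchyD[OF X, of 1] by fastforce
    fix k n :: nat
    obtain M where M: "\<And>m n'. m \<ge> M \<Longrightarrow> n' \<ge> M \<Longrightarrow> norm (X m - X n') < (1/2)^Suc n"
      using CauchyD[OF X, of "(1/2)^Suc n"] by auto
    then show "\<exists>l. (\<forall>m\<ge>l. norm (X m - X l) < (1/2)^Suc n) \<and> k < l"
      by (intro exI[of _ "max M (Suc k)"]) auto
  qed
  then obtain r where r: "\<And>n m. m \<ge> r n \<Longrightarrow> norm (X m - X (r n)) < (1/2)^n" and r': "\<And>n. r n < r (Suc n)"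
    by blast
  define f where "f n = L2_fun (X (r n))" for n
  have fs: "square_integrable (f n)" for n by (simp add: f_def square_integrable_L2_fun)
  have [measurable]: "f n \<in> borel_measurable borel" for n using fs by measurable
  have nrm: "(\<integral>\<^sup>+x. ennreal ((cmod (f m x - f n x))\<^sup>2) \<partial>lborel) = ennreal ((norm (X (r m) - X (r n)))\<^sup>2)" for m n
    using nn_norm_L2_of[OF square_integrable_diff[OF fs fs], of m n]
    by (simp add: L2_of_diff[symmetric] fs) (simp add: f_def L2_of_L2_fun)
  \<comment> \<open>The weight 2^k is a compromise: the increments have squared norm at most
    (1/4)^k, so the weighted sum is still geometric, and yet it is strong enough to make the
    unsquared increments summable pointwise.\<close>
  have "(\<integral>\<^sup>+x. (\<Sum>k. ennreal (2^k * (cmod (f (Suc k) x - f k x))\<^sup>2)) \<partial>lborel)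
      = (\<Sum>k. \<integral>\<^sup>+x. ennreal (2^k * (cmod (f (Suc k) x - f k x))\<^sup>2) \<partial>lborel)"
    by (rule nn_integral_suminf) measurable
  also have "\<dots> \<le> (\<Sum>k. ennreal ((1/2)^k))"
  proof (intro suminf_le summableI)
    fix k
    have "(\<integral>\<^sup>+x. ennreal (2^k * (cmod (f (Suc k) x - f k x))\<^sup>2) \<partial>lborel)
       = ennreal (2^k) * ennreal ((norm (X (r (Suc k)) - X (r k)))\<^sup>2)"
      by (simp add: ennreal_mult' nn_integral_cmult nrm)
    also have "\<dots> \<le> ennreal (2^k) * ennreal (((1/2)^k)\<^sup>2)"
      using r[of k "r (Suc k)"] r'[of k] by (intro mult_left_mono ennreal_leI power_mono) auto
    also have "\<dots> = ennreal (2^k * ((1/2)^k)\<^sup>2)"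
      by (rule ennreal_mult[symmetric]) auto
    also have "(2::real)^k * ((1/2)^k)\<^sup>2 = (1/2)^k"
      by (simp add: power2_eq_square power_one_over field_simps)
    finally show "(\<integral>\<^sup>+x. ennreal (2^k * (cmod (f (Suc k) x - f k x))\<^sup>2) \<partial>lborel) \<le> ennreal ((1/2)^k)" .
  qed
  also have "\<dots> = ennreal (\<Sum>k. (1/2)^k)"
    by (rule suminf_ennreal2) (auto simp: summable_geometric)
  also have "\<dots> < \<infinity>" by simp
  finally have "AE x in lborel. (\<Sum>k. ennreal (2^k * (cmod (f (Suc k) x - f k x))\<^sup>2)) \<noteq> \<infinity>"
    by (intro nn_integral_PInf_AE) auto
  then have conv: "AE x in lborel. convergent (\<lambda>n. f n x)"
  proof eventually_elim
    case (elim x)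
    have sm: "summable (\<lambda>k. 2^k * (cmod (f (Suc k) x - f k x))\<^sup>2)"
      using elim by (intro summable_suminf_not_top) auto
    have "summable (\<lambda>k. (1/2::real)^k + 2^k * (cmod (f (Suc k) x - f k x))\<^sup>2)"
      by (intro summable_add sm summable_geometric) auto
    then have "summable (\<lambda>k. cmod (f (Suc k) x - f k x))"
    proof (rule summable_comparison_test'[where N=0])
      fix k :: nat
      define t where "t = cmod (f (Suc k) x - f k x)"
      \<comment> \<open>Expanding the square gives t \<le> (1/2)^k + 2^k t^2, which passes from
        squares to absolute summability.\<close>
      have "0 \<le> ((1/2)^k - t)\<^sup>2 * 2^k + t" by (simp add: t_def)
      also have "((1/2::real)^k - t)\<^sup>2 * 2^k = (1/2)^k + 2^k * t\<^sup>2 - 2 * t"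
        by (simp add: power2_eq_square algebra_simps power_one_over field_simps)
      finally show "norm (cmod (f (Suc k) x - f k x)) \<le> (1/2)^k + 2^k * (cmod (f (Suc k) x - f k x))\<^sup>2"
        by (simp add: t_def)
    qed
    then have "summable (\<lambda>k. f (Suc k) x - f k x)" by (rule summable_norm_cancel)
    then show "convergent (\<lambda>n. f n x)"
      using convergent_diff_const_right_iff[of "\<lambda>n. f n x" "f 0 x"]
      sum_lessThan_telescope[of "\<lambda>n. f n x"]
      by (simp add: summable_iff_convergent)
  qed
  \<comment> \<open>Where the sequence diverges, \<open>lim\<close> is an unspecified value; this
    concerns a null set only.\<close>
  define g where "g x = lim (\<lambda>n. f n x)" for x
  have [measurable]: "g \<in> borel_measurable borel"
    unfolding g_def by measurable
  have fg: "(\<integral>\<^sup>+x. ennreal ((cmod (g x - f n x))\<^sup>2) \<partial>lborel) \<le> ennreal (((1/2)^n)\<^sup>2)" for n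
  proof -
    have "AE x in lborel. ennreal ((cmod (g x - f n x))\<^sup>2) = liminf (\<lambda>m. ennreal ((cmod (f m x - f n x))\<^sup>2))"
      using conv
    proof eventually_elim
      case (elim x)
      then have "(\<lambda>m. f m x) \<longlonglongrightarrow> g x" by (simp add: g_def convergent_LIMSEQ_iff)
      then have "(\<lambda>m. ennreal ((cmod (f m x - f n x))\<^sup>2)) \<longlonglongrightarrow> ennreal ((cmod (g x - f n x))\<^sup>2)"
        by (intro tendsto_intros tendsto_ennrealI)
      then show ?case using lim_imp_Liminf trivial_limit_sequentially by metis
    qed
    then have "(\<integral>\<^sup>+x. ennreal ((cmod (g x - f n x))\<^sup>2) \<partial>lborel)
      = (\<integral>\<^sup>+x. liminf (\<lambda>m. ennreal ((cmod (f m x - f n x))\<^sup>2)) \<partial>lborel)"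
      by (rule nn_integral_cong_AE)
    also have "\<dots> \<le> liminf (\<lambda>m. \<integral>\<^sup>+x. ennreal ((cmod (f m x - f n x))\<^sup>2) \<partial>lborel)"
      by (rule nn_integral_liminf) measurable
    also have "\<dots> \<le> ennreal (((1/2)^n)\<^sup>2)"
    proof (rule Liminf_le[OF trivial_limit_sequentially])
      show "\<forall>\<^sub>F m in sequentially. (\<integral>\<^sup>+x. ennreal ((cmod (f m x - f n x))\<^sup>2) \<partial>lborel) \<le> ennreal (((1/2)^n)\<^sup>2)"
      proof (rule eventually_sequentiallyI[of n])
        fix m assume "m \<ge> n"
        then have "r m \<ge> r n" using r' by (simp add: lift_Suc_mono_le less_imp_le)
        then show "(\<integral>\<^sup>+x. ennreal ((cmod (f m x - f n x))\<^sup>2) \<partial>lborel) \<le> ennreal (((1/2)^n)\<^sup>2)"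
          unfolding nrm by (intro ennreal_leI power_mono less_imp_le[OF r]) auto
      qed
    qed
    finally show ?thesis .
  qed
  have "square_integrable (\<lambda>x. g x - f 0 x)"
    using le_less_trans[OF fg[of 0]] by (subst square_integrable_iff_nn) auto
  from square_integrable_add[OF this fs[of 0]] have gs: "square_integrable g" by simp
  have Lf: "L2_of (f n) = X (r n)" for n by (simp add: f_def L2_of_L2_fun)
  have "norm (X (r n) - L2_of g) \<le> (1/2)^n" for n
  proof -
    have "ennreal ((norm (L2_of g - X (r n)))\<^sup>2) \<le> ennreal (((1/2)^n)\<^sup>2)"
      using fg[of n] nn_norm_L2_of[OF square_integrable_diff[OF gs fs], of n]
      by (simp only: L2_of_diff[symmetric] fs gs Lf)
    then have "(norm (L2_of g - X (r n)))\<^sup>2 \<le> ((1/2)^n)\<^sup>2" by simp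
    then show ?thesis by (subst norm_minus_commute) (rule power2_le_imp_le, auto)
  qed
  then have "(\<lambda>n. X (r n) - L2_of g) \<longlonglongrightarrow> 0"
    by (intro Lim_null_comparison[OF _ LIMSEQ_power_zero[of "1/2::real"]]) auto
  then have lim: "(\<lambda>n. X (r n)) \<longlonglongrightarrow> L2_of g" by (simp add: LIM_zero_iff)
  have sr: "strict_mono r" using r' by (simp add: strict_mono_Suc_iff)
  show "convergent X"
    using Cauchy_converges_subseq[OF X sr] lim by (auto simp: convergent_def comp_def)
qed

subsection \<open>Continuity of translations\<close>

lemma integral_norm_triangle_sum:
  fixes f g k :: "'a \<Rightarrow> 'b::{banach, second_countable_topology}"
  assumes "integrable M f" "integrable M g" "\<And>x. x \<in> space M \<Longrightarrow> h x = f x + g x"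
  shows "(\<integral>x. norm (h x) \<partial>M) \<le> (\<integral>x. norm (f x) \<partial>M) + (\<integral>x. norm (g x) \<partial>M)"
proof -
  have "(\<integral>x. norm (h x) \<partial>M) = (\<integral>x. norm (f x + g x) \<partial>M)"
    using assms(3) by (intro Bochner_Integration.integral_cong) auto
  also have "\<dots> \<le> (\<integral>x. norm (f x) + norm (g x) \<partial>M)"
    using assms(1,2) by (intro integral_mono) (auto intro: norm_triangle_ineq)
  finally show ?thesis using assms(1,2) by simp
qed

lemma integral_shift:
  fixes f :: "real \<Rightarrow> 'b::{banach, second_countable_topology}"
  shows "(\<integral>x. f (x + h) \<partial>lborel) = (\<integral>x. f x \<partial>lborel)"
  using lborel_integral_real_affine[of 1 f h] by (simp add: add.commute)

lemma integrable_shift: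
  fixes f :: "real \<Rightarrow> 'b::{banach, second_countable_topology}"
  assumes "integrable lborel f" shows "integrable lborel (\<lambda>x. f (x + h))"
  using lborel_integrable_real_affine[OF assms, of 1 h] by (simp add: add.commute)

text \<open>Inner and outer regularity of Lebesgue measure. A compact \<open>K\<close> keeps a
  positive distance from the complement of the open \<open>U\<close>, so a small translation changes
  \<open>A\<close> only inside \<open>U - K\<close> and its translate.\<close>

lemma emeasure_sandwich_compact_open:
  fixes A :: "real set"
  assumes "A \<in> sets borel" "emeasure lborel A < \<infinity>" "e > 0"
  obtains K U where "compact K" "open U" "K \<subseteq> A" "A \<subseteq> U"
    "U - K \<in> fmeasurable lborel" "measure lborel (U - K) < e"
proof -
  have A: "A \<in> lmeasurable"
    using assms(1,2) by (simp add: fmeasurable_def)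
  obtain U where U: "open U" "A \<subseteq> U" "U - A \<in> lmeasurable" "emeasure lebesgue (U - A) < ennreal (e/2)"
    using sets_lebesgue_outer_open[of A "e/2"] A assms(3) by auto
  \<comment> \<open>The inner approximation used below yields closed sets; cutting \<open>A\<close>
    down to a bounded interval first makes the closed set compact, at a cost of
    \<open>e/4\<close>.\<close>
  have "(\<lambda>n. emeasure lborel (A - {- real n..real n})) \<longlonglongrightarrow> emeasure lborel (\<Inter>n. A - {- real n..real n})"
  proof (rule Lim_emeasure_decseq)
    show "range (\<lambda>n. A - {- real n..real n}) \<subseteq> sets lborel" using assms(1) by auto
    show "decseq (\<lambda>n. A - {- real n..real n})" by (auto simp: decseq_def)
    show "emeasure lborel (A - {- real n..real n}) \<noteq> \<infinity>" for n
      using emeasure_mono[of "A - {- real n..real n}" A lborel] assms(1,2) by auto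
  qed
  moreover have "(\<Inter>n. A - {- real n..real n}) = {}"
  proof -
    have "\<exists>n. x \<in> {- real n..real n}" for x
      using real_arch_simple[of "\<bar>x\<bar>"] by (metis abs_le_iff atLeastAtMost_iff minus_le_iff)
    then show ?thesis by blast
  qed
  ultimately have "(\<lambda>n. emeasure lborel (A - {- real n..real n})) \<longlonglongrightarrow> 0" by (simp only: emeasure_empty)
  then have "\<forall>\<^sub>F n in sequentially. emeasure lborel (A - {- real n..real n}) < ennreal (e/4)"
    using assms(3) by (intro order_tendstoD(2)) auto
  from eventually_happens'[OF sequentially_bot this]
  obtain n where n: "emeasure lborel (A - {- real n..real n}) < ennreal (e/4)" ..
  have "A \<inter> {- real n..real n} \<in> sets lebesgue" using assms(1) by simp
  moreover have "e/4 > 0" using assms(3) by simp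
  ultimately obtain K where K: "closed K" "K \<subseteq> A \<inter> {- real n..real n}"
      "emeasure lebesgue (A \<inter> {- real n..real n} - K) < ennreal (e/4)"
    by (rule sets_lebesgue_inner_closed)
  have cK: "compact K"
    using K by (auto simp: compact_eq_bounded_closed intro: bounded_subset[OF bounded_closed_interval])
  have "emeasure lborel (A - K) \<le> emeasure lborel ((A \<inter> {- real n..real n} - K) \<union> (A - {- real n..real n}))"
    using K assms(1) by (intro emeasure_mono) auto
  also have "\<dots> \<le> emeasure lborel (A \<inter> {- real n..real n} - K) + emeasure lborel (A - {- real n..real n})"
    using K assms(1) by (intro emeasure_subadditive) auto
  also have "\<dots> < ennreal (e/4) + ennreal (e/4)"
    using K(1,3) n assms(1) by (intro add_strict_mono) auto
  also have "\<dots> = ennreal (e/2)" using assms(3) by (simp flip: ennreal_plus)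
  finally have eK: "emeasure lborel (A - K) < ennreal (e/2)" .
  have eq: "U - K = (U - A) \<union> (A - K)" using U K by auto
  have b: "U - K \<in> sets borel" using U K by auto
  have "emeasure lebesgue (U - K) \<le> emeasure lebesgue (U - A) + emeasure lebesgue (A - K)"
    unfolding eq using U K assms(1) by (intro emeasure_subadditive) auto
  also have "\<dots> < ennreal (e/2) + ennreal (e/2)"
    using U(4) eK K(1) assms(1) by (intro add_strict_mono) auto
  also have "\<dots> = ennreal e" using assms(3) by (simp add: ennreal_plus[symmetric] del: ennreal_plus)
  finally have *: "emeasure lborel (U - K) < ennreal e" using b by simp
  then have "U - K \<in> fmeasurable lborel"
    using b by (auto simp: fmeasurable_def less_top[symmetric] dest: order.strict_trans[OF _ ennreal_less_top])
  moreover from emeasure_eq_measure2[OF this] * have "measure lborel (U - K) < e"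
    by (simp only: ennreal_less_iff[OF measure_nonneg])
  ultimately show ?thesis using that[OF cK U(1) _ U(2)] K(2) by blast
qed

text \<open>Induction over integrable functions: indicators by regularity, sums by the triangle
  inequality, and limits because translation is an isometry of L1.\<close>

lemma L1_continuous_translation:
  fixes f :: "real \<Rightarrow> 'b::{banach, second_countable_topology}"
  assumes "integrable lborel f" "e > 0"
  shows "\<exists>d>0. \<forall>h. \<bar>h\<bar> < d \<longrightarrow> (\<integral>x. norm (f (x + h) - f x) \<partial>lborel) < e"
  using assms
proof (induction arbitrary: e rule: integrable_induct)
  case (base A c)
  have [measurable]: "A \<in> sets borel" using base by simp
  \<comment> \<open>The summand 1 in \<open>norm c + 1\<close> keeps the tolerance meaningful when
    \<open>c\<close> is zero; the factor 2 pays for the two copies of \<open>U - K\<close>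
    below.\<close>
  obtain K U where KU: "compact K" "open U" "K \<subseteq> A" "A \<subseteq> U"
    "U - K \<in> fmeasurable lborel" "measure lborel (U - K) < e / (2 * (norm c + 1))"
    using emeasure_sandwich_compact_open[of A "e / (2 * (norm c + 1))"] base
    by (auto simp: add_nonneg_pos)
  obtain d where d: "d > 0" "\<And>x. x \<in> K \<Longrightarrow> ball x d \<subseteq> U"
    using compact_subset_open_imp_ball_epsilon_subset[OF KU(1,2)] KU(3,4)
    by (metis subset_trans UN_subset_iff)
  have mU: "U - K \<in> sets lborel" using KU(5) by auto
  have "(\<integral>x. norm (indicator A (x + h) *\<^sub>R c - indicator A x *\<^sub>R c) \<partial>lborel) < e" if h: "\<bar>h\<bar> < d" for h
  proof -
    \<comment> \<open>A point of \<open>A\<close> outside \<open>K\<close> lies in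
      \<open>U - K\<close>. A point of \<open>K\<close> is moved by \<open>h\<close> inside
      \<open>U\<close>, so if it leaves \<open>A\<close> it lands in \<open>U - K\<close>.\<close>
    have pw: "norm (indicator A (x + h) *\<^sub>R c - indicator A x *\<^sub>R c)
       \<le> norm c * indicator (U - K) (x + h) + norm c * indicator (U - K) x" for x
    proof -
      have 1: "x + h \<in> U" if "x \<in> K" using d(2)[OF that] h by (auto simp: subset_eq dist_real_def)
      have 2: "x \<in> U" if "x + h \<in> K" using d(2)[OF that] h by (auto simp: subset_eq dist_real_def)
      show ?thesis using 1 2 KU(3,4)
        by (cases "x \<in> A"; cases "x + h \<in> A") (auto simp: indicator_def subset_eq)
    qed
    have i: "integrable lborel (\<lambda>x. indicator (U - K) x :: real)"
      using KU(5) by (auto simp: fmeasurable_def intro!: integrable_real_indicator)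
    have "(\<integral>x. norm (indicator A (x + h) *\<^sub>R c - indicator A x *\<^sub>R c) \<partial>lborel)
       \<le> (\<integral>x. norm c * indicator (U - K) (x + h) + norm c * indicator (U - K) x \<partial>lborel)"
      using pw i integrable_shift[OF i, of h] 
      by (intro integral_mono_AE') auto
    also have "\<dots> = norm c * (2 * measure lborel (U - K))"
      using i integrable_shift[OF i, of h] integral_shift[of "\<lambda>x. indicator (U - K) x :: real" h] mU by simp
    also have "\<dots> \<le> (norm c + 1) * (2 * measure lborel (U - K))"
      by (intro mult_right_mono) auto
    also have "\<dots> < (norm c + 1) * (2 * (e / (2 * (norm c + 1))))"
      using KU(6) by (intro mult_strict_left_mono) (auto simp: add_nonneg_pos)
    also have "\<dots> = e"
    proof -
      have "norm c + 1 \<noteq> 0" using norm_ge_zero[of c] by linarith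
      then show ?thesis by (simp add: field_simps)
    qed
    finally show ?thesis .
  qed
  then show ?case using d by blast
next
  case (add f g)
  obtain d1 where d1: "d1 > 0" "\<And>h. \<bar>h\<bar> < d1 \<Longrightarrow> (\<integral>x. norm (f (x + h) - f x) \<partial>lborel) < e/2"
    using add.IH(1)[of "e/2"] add.prems by auto
  obtain d2 where d2: "d2 > 0" "\<And>h. \<bar>h\<bar> < d2 \<Longrightarrow> (\<integral>x. norm (g (x + h) - g x) \<partial>lborel) < e/2"
    using add.IH(2)[of "e/2"] add.prems by auto
  have "(\<integral>x. norm ((f (x + h) + g (x + h)) - (f x + g x)) \<partial>lborel) < e" if "\<bar>h\<bar> < min d1 d2" for h
  proof -
    have "(\<integral>x. norm ((f (x + h) + g (x + h)) - (f x + g x)) \<partial>lborel)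
      \<le> (\<integral>x. norm (f (x + h) - f x) \<partial>lborel) + (\<integral>x. norm (g (x + h) - g x) \<partial>lborel)"
      by (rule integral_norm_triangle_sum)
         (auto intro!: Bochner_Integration.integrable_diff integrable_shift add.hyps)
    then show ?thesis using d1(2)[of h] d2(2)[of h] that by auto
  qed
  then show ?case using d1(1) d2(1) by (intro exI[of _ "min d1 d2"]) auto
next
  case (lim f s)
  have [measurable]: "f \<in> borel_measurable borel" "\<And>i. s i \<in> borel_measurable borel"
    using lim.hyps(1,4) by (auto dest: borel_measurable_integrable)
  have "(\<lambda>i. \<integral>x. norm (s i x - f x) \<partial>lborel) \<longlonglongrightarrow> (\<integral>x. 0 \<partial>(lborel :: real measure))"
  proof (rule integral_dominated_convergence[where w="\<lambda>x. 3 * norm (f x)"])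
    show "AE x in lborel. (\<lambda>i. norm (s i x - f x)) \<longlonglongrightarrow> 0"
      using lim.hyps(2) by (auto intro!: AE_I2 tendsto_norm_zero LIM_zero)
    show "AE x in lborel. norm (norm (s i x - f x)) \<le> 3 * norm (f x)" for i
    proof (rule AE_I2)
      fix x
      show "norm (norm (s i x - f x)) \<le> 3 * norm (f x)"
        using lim.hyps(3)[of x i] norm_triangle_ineq4[of "s i x" "f x"] by simp
    qed
  qed (use lim.hyps(4) in auto)
  then have "\<forall>\<^sub>F i in sequentially. (\<integral>x. norm (s i x - f x) \<partial>lborel) < e/4"
    using lim.prems by (intro order_tendstoD(2)) auto
  from eventually_happens'[OF sequentially_bot this]
  obtain i where i: "(\<integral>x. norm (s i x - f x) \<partial>lborel) < e/4" ..
  obtain d where d: "d > 0" "\<And>h. \<bar>h\<bar> < d \<Longrightarrow> (\<integral>x. norm (s i (x + h) - s i x) \<partial>lborel) < e/4"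
    using lim.IH[of "e/4"] lim.prems by auto
  have "(\<integral>x. norm (f (x + h) - f x) \<partial>lborel) < e" if h: "\<bar>h\<bar> < d" for h
  proof -
    note ints = Bochner_Integration.integrable_diff integrable_shift lim.hyps(1,4) Bochner_Integration.integrable_add
    \<comment> \<open>The first and the last of the three errors are the same integral by
      translation invariance, so \<open>e/4\<close> for each piece is enough.\<close>
    have "(\<integral>x. norm (f (x + h) - f x) \<partial>lborel)
      \<le> (\<integral>x. norm (f (x + h) - s i (x + h)) \<partial>lborel) + (\<integral>x. norm ((s i (x + h) - s i x) + (s i x - f x)) \<partial>lborel)"
      by (rule integral_norm_triangle_sum) (intro ints, intro ints, simp)
    also have "(\<integral>x. norm (f (x + h) - s i (x + h)) \<partial>lborel) = (\<integral>x. norm (s i x - f x) \<partial>lborel)"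
      using integral_shift[of "\<lambda>x. norm (s i x - f x)" h] by (simp add: norm_minus_commute)
    also have "(\<integral>x. norm ((s i (x + h) - s i x) + (s i x - f x)) \<partial>lborel)
      \<le> (\<integral>x. norm (s i (x + h) - s i x) \<partial>lborel) + (\<integral>x. norm (s i x - f x) \<partial>lborel)"
      by (rule integral_norm_triangle_sum) (intro ints, intro ints, simp)
    finally show ?thesis using i d(2)[OF h] lim.prems by linarith
  qed
  then show ?case using d by blast
qed

text \<open>The signed square \<open>a * \<bar>a\<bar>\<close> turns a square integrable function
  into an integrable one without losing the sign, and this bound carries the L1 modulus of
  continuity back to L2. The constant 2 is attained at a = - b.\<close>

lemma real_diff_power2_le: "(a - b)\<^sup>2 \<le> 2 * \<bar>a * \<bar>a\<bar> - b * \<bar>b\<bar>\<bar>" for a b :: real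
proof -
  have "(a - b)\<^sup>2 \<le> 2 * \<bar>a * a - b * b\<bar>" if "a \<ge> 0" "b \<ge> 0" for a b :: real
  proof -
    have "(a - b)\<^sup>2 = \<bar>a - b\<bar> * \<bar>a - b\<bar>" by (simp add: power2_eq_square)
    also have "\<dots> \<le> \<bar>a - b\<bar> * \<bar>a + b\<bar>" using that by (intro mult_left_mono) auto
    also have "\<dots> = \<bar>a * a - b * b\<bar>" by (simp add: abs_mult[symmetric] algebra_simps)
    finally show ?thesis by (rule order_trans) simp
  qed
  note same = this
  have opp: "(a - b)\<^sup>2 \<le> 2 * \<bar>a * a + b * b\<bar>" for a b :: real
    using zero_le_power2[of "a + b"] by (simp add: power2_eq_square algebra_simps)
  show ?thesis
  proof (cases "a \<ge> 0"; cases "b \<ge> 0")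
    assume "\<not> a \<ge> 0" "\<not> b \<ge> 0"
    then show ?thesis
      using same[of "-a" "-b"] by (simp add: power2_commute[of b a] abs_minus_commute)
  next
    assume "a \<ge> 0" "\<not> b \<ge> 0"
    then show ?thesis using opp[of a b] by simp
  next
    assume *: "\<not> a \<ge> 0" "b \<ge> 0"
    then have "a * \<bar>a\<bar> - b * \<bar>b\<bar> = - (a * a + b * b)" by simp
    then show ?thesis using opp[of a b] by (simp only: abs_minus)
  qed (use same[of a b] in simp)
qed

lemma L2_continuous_translation_real:
  fixes f :: "real \<Rightarrow> real"
  assumes [measurable]: "f \<in> borel_measurable borel" and "integrable lborel (\<lambda>x. (f x)\<^sup>2)" "e > 0"
  shows "\<exists>d>0. \<forall>h. \<bar>h\<bar> < d \<longrightarrow> (\<integral>x. (f (x + h) - f x)\<^sup>2 \<partial>lborel) < e"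
proof -
  define g where "g x = f x * \<bar>f x\<bar>" for x
  have g: "integrable lborel g"
    using assms(2) by (rule Bochner_Integration.integrable_bound)
      (auto simp: g_def[abs_def] abs_mult power2_eq_square)
  obtain d where d: "d > 0" "\<And>h. \<bar>h\<bar> < d \<Longrightarrow> (\<integral>x. norm (g (x + h) - g x) \<partial>lborel) < e/2"
    using L1_continuous_translation[OF g, of "e/2"] assms(3) by auto
  have "(\<integral>x. (f (x + h) - f x)\<^sup>2 \<partial>lborel) < e" if h: "\<bar>h\<bar> < d" for h
  proof -
    have "(\<integral>x. (f (x + h) - f x)\<^sup>2 \<partial>lborel) \<le> (\<integral>x. 2 * norm (g (x + h) - g x) \<partial>lborel)"
      using real_diff_power2_le
      by (intro integral_mono_AE' integrable_mult_right integrable_norm Bochner_Integration.integrable_diff g integrable_shift)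
        (auto simp: g_def)
    then show ?thesis using d(2)[OF h] by simp
  qed
  then show ?thesis using d(1) by blast
qed

lemma L2_continuous_translation:
  assumes "square_integrable f" "e > 0"
  shows "\<exists>d>0. \<forall>h. \<bar>h\<bar> < d \<longrightarrow> (\<integral>x. (cmod (f (x + h) - f x))\<^sup>2 \<partial>lborel) < e"
proof -
  have [measurable]: "f \<in> borel_measurable borel" using assms by measurable
  have i: "integrable lborel (\<lambda>x. (cmod (f x))\<^sup>2)" using assms by (simp add: square_integrable_def)
  have iR: "integrable lborel (\<lambda>x. (Re (f x))\<^sup>2)" and iI: "integrable lborel (\<lambda>x. (Im (f x))\<^sup>2)"
    by (rule Bochner_Integration.integrable_bound[OF i]; auto simp: cmod_power2)+
  obtain d1 where d1: "d1 > 0" "\<And>h. \<bar>h\<bar> < d1 \<Longrightarrow> (\<integral>x. (Re (f (x + h)) - Re (f x))\<^sup>2 \<partial>lborel) < e/2"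
    using L2_continuous_translation_real[of "\<lambda>x. Re (f x)" "e/2"] iR assms by auto
  obtain d2 where d2: "d2 > 0" "\<And>h. \<bar>h\<bar> < d2 \<Longrightarrow> (\<integral>x. (Im (f (x + h)) - Im (f x))\<^sup>2 \<partial>lborel) < e/2"
    using L2_continuous_translation_real[of "\<lambda>x. Im (f x)" "e/2"] iI assms by auto
  have "(\<integral>x. (cmod (f (x + h) - f x))\<^sup>2 \<partial>lborel) < e" if "\<bar>h\<bar> < min d1 d2" for h
  proof -
    have sd: "integrable lborel (\<lambda>x. (u (x + h) - u x)\<^sup>2)"
      if [measurable]: "u \<in> borel_measurable borel" and "integrable lborel (\<lambda>x. (u x)\<^sup>2)" for u :: "real \<Rightarrow> real"
    proof (rule Bochner_Integration.integrable_bound)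
      show "integrable lborel (\<lambda>x. 2 * (u (x + h))\<^sup>2 + 2 * (u x)\<^sup>2)"
        using that integrable_shift[OF that(2), of h] by simp
      have "(a - b)\<^sup>2 \<le> 2 * a\<^sup>2 + 2 * b\<^sup>2" for a b :: real
        using zero_le_power2[of "a + b"] by (simp add: power2_eq_square algebra_simps)
      then show "AE x in lborel. norm ((u (x + h) - u x)\<^sup>2) \<le> norm (2 * (u (x + h))\<^sup>2 + 2 * (u x)\<^sup>2)"
        by (intro AE_I2) (auto intro: order_trans)
    qed measurable
    have "(\<integral>x. (cmod (f (x + h) - f x))\<^sup>2 \<partial>lborel)
      = (\<integral>x. (Re (f (x + h)) - Re (f x))\<^sup>2 + (Im (f (x + h)) - Im (f x))\<^sup>2 \<partial>lborel)"
      by (simp add: cmod_power2)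
    also have "\<dots> = (\<integral>x. (Re (f (x + h)) - Re (f x))\<^sup>2 \<partial>lborel) + (\<integral>x. (Im (f (x + h)) - Im (f x))\<^sup>2 \<partial>lborel)"
      by (intro Bochner_Integration.integral_add sd iR iI) measurable
    also have "\<dots> < e" using d1(2)[of h] d2(2)[of h] that by auto
    finally show ?thesis .
  qed
  then show ?thesis using d1(1) d2(1) by (intro exI[of _ "min d1 d2"]) auto
qed

subsection \<open>Phase-translation operators\<close>

lemma measurable_cis [measurable]: "cis \<in> borel_measurable borel"
  unfolding cis_conv_exp by measurable

lemma measurable_cnj [measurable]: "cnj \<in> borel_measurable borel"
  by (intro borel_measurable_continuous_onI continuous_intros)

lemma AE_shift:
  fixes f g :: "real \<Rightarrow> 'b::{second_countable_topology, t2_space}"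
  assumes [measurable]: "f \<in> borel_measurable borel" "g \<in> borel_measurable borel"
    and "AE t in lborel. f t = g t"
  shows "AE t in lborel. f (t + h) = g (t + h)"
  using AE_borel_affine[of 1 "\<lambda>t. f t = g t" h] assms by (simp add: add.commute)

lemma square_integrable_phase_shift:
  assumes [measurable]: "\<theta> \<in> borel_measurable borel" and f: "square_integrable f"
  shows "square_integrable (\<lambda>t. cis (\<theta> t) * f (t - x))"
proof -
  have [measurable]: "f \<in> borel_measurable borel" using f by measurable
  have "integrable lborel (\<lambda>t. (cmod (f (t + - x)))\<^sup>2)"
    by (rule integrable_shift) (use f in \<open>simp add: square_integrable_def\<close>)
  then show ?thesis by (simp add: square_integrable_def norm_mult)
qed

text \<open>The common shape of all operators of the model representations. The shape is closed
  under composition, and every measurable real phase gives a unitary operator.\<close>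

definition phase_shift :: "(real \<Rightarrow> real) \<Rightarrow> real \<Rightarrow> L2 \<Rightarrow> L2" where
  "phase_shift \<theta> x F = L2_of (\<lambda>t. cis (\<theta> t) * L2_fun F (t - x))"

lemma phase_shift_L2_of:
  assumes [measurable]: "\<theta> \<in> borel_measurable borel" and f: "square_integrable f"
  shows "phase_shift \<theta> x (L2_of f) = L2_of (\<lambda>t. cis (\<theta> t) * f (t - x))"
  unfolding phase_shift_def
proof (rule L2_of_cong_AE)
  have [measurable]: "f \<in> borel_measurable borel" using f by measurable
  show "AE t in lborel. cis (\<theta> t) * L2_fun (L2_of f) (t - x) = cis (\<theta> t) * f (t - x)"
    using AE_shift[OF _ _ L2_fun_L2_of[OF f], of "- x"] by auto
qed (auto intro!: square_integrable_phase_shift f square_integrable_L2_fun)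

lemma L2_fun_phase_shift:
  assumes "\<theta> \<in> borel_measurable borel"
  shows "AE t in lborel. L2_fun (phase_shift \<theta> x F) t = cis (\<theta> t) * L2_fun F (t - x)"
  unfolding phase_shift_def
  by (intro L2_fun_L2_of square_integrable_phase_shift square_integrable_L2_fun assms)

lemma phase_shift_comp:
  assumes [measurable]: "\<theta> \<in> borel_measurable borel" "\<eta> \<in> borel_measurable borel"
  shows "phase_shift \<theta> x (phase_shift \<eta> y F) = phase_shift (\<lambda>t. \<theta> t + \<eta> (t - x)) (x + y) F"
  unfolding phase_shift_def[of \<eta> y]
  by (subst phase_shift_L2_of)
     (auto intro!: square_integrable_phase_shift square_integrable_L2_fun
       simp: phase_shift_def cis_mult[symmetric] mult.assoc algebra_simps)

lemma phase_shift_id: "phase_shift (\<lambda>t. 0) 0 F = F"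
  by (simp add: phase_shift_def L2_of_L2_fun)

lemma cinner_phase_shift:
  assumes [measurable]: "\<theta> \<in> borel_measurable borel"
  shows "cinner (phase_shift \<theta> x F) (phase_shift \<theta> x G) = cinner F G"
proof -
  have "cinner (phase_shift \<theta> x F) (phase_shift \<theta> x G)
    = (\<integral>t. cnj (cis (\<theta> t) * L2_fun F (t - x)) * (cis (\<theta> t) * L2_fun G (t - x)) \<partial>lborel)"
    unfolding phase_shift_def
    by (rule cinner_L2_of) (auto intro!: square_integrable_phase_shift square_integrable_L2_fun)
  also have "\<dots> = (\<integral>t. cnj (L2_fun F (t + - x)) * L2_fun G (t + - x) \<partial>lborel)"
  proof (rule Bochner_Integration.integral_cong)
    fix t
    have "cnj (cis (\<theta> t)) * cis (\<theta> t) = 1" by (simp add: cis_cnj cis_mult)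
    then show "cnj (cis (\<theta> t) * L2_fun F (t - x)) * (cis (\<theta> t) * L2_fun G (t - x))
       = cnj (L2_fun F (t + - x)) * L2_fun G (t + - x)"
by (simp add: algebra_simps)
  qed simp
  also have "\<dots> = cinner F G"
    unfolding cinner_L2_fun by (rule integral_shift)
  finally show ?thesis .
qed

lemma phase_shift_in_unitary_group:
  assumes [measurable]: "\<theta> \<in> borel_measurable borel"
  shows "phase_shift \<theta> x \<in> carrier unitary_group"
proof -
  have [simp]: "square_integrable (\<lambda>t. cis (\<theta> t) * L2_fun F (t - x))" for F
    by (auto intro!: square_integrable_phase_shift square_integrable_L2_fun)
  have "phase_shift \<theta> x (F + G) = phase_shift \<theta> x F + phase_shift \<theta> x G" for F G
    unfolding phase_shift_def L2_of_add[OF square_integrable_phase_shift[OF assms square_integrable_L2_fun]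
        square_integrable_phase_shift[OF assms square_integrable_L2_fun]]
    using AE_shift[OF _ _ L2_fun_add[of F G], of "- x"]
    by (intro L2_of_cong_AE) (auto intro!: square_integrable_add elim!: eventually_mono simp: algebra_simps)
  moreover have "phase_shift \<theta> x (c *\<^sub>C F) = c *\<^sub>C phase_shift \<theta> x F" for c F
    unfolding phase_shift_def L2_of_scaleC[OF square_integrable_phase_shift[OF assms square_integrable_L2_fun]]
    using AE_shift[OF _ _ L2_fun_scaleC[of c F], of "- x"]
    by (intro L2_of_cong_AE) (auto intro!: square_integrable_scale elim!: eventually_mono simp: algebra_simps)
  \<comment> \<open>Surjectivity by an explicit preimage: shift back, and undo the phase at the
    point to which it will be shifted.\<close>
  moreover have "phase_shift \<theta> x (phase_shift (\<lambda>t. - \<theta> (t + x)) (- x) F) = F" for F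
    by (subst phase_shift_comp) (auto simp: phase_shift_id)
  ultimately show ?thesis
    unfolding unitary_group_def clinear_L2_def isometric_L2_def surj_def
    by (simp add: cinner_phase_shift) metis
qed

lemma power2_norm_add_le: "(cmod (a + b))\<^sup>2 \<le> 2 * (cmod a)\<^sup>2 + 2 * (cmod b)\<^sup>2"
proof -
  have "(cmod (a + b))\<^sup>2 \<le> (cmod a + cmod b)\<^sup>2"
    by (intro power_mono norm_triangle_ineq) auto
  also have "\<dots> \<le> 2 * (cmod a)\<^sup>2 + 2 * (cmod b)\<^sup>2"
    using zero_le_power2[of "cmod a - cmod b"] by (simp add: power2_eq_square algebra_simps)
  finally show ?thesis .
qed

text \<open>Pointwise convergence of the phases suffices. The error splits into \<open>a\<close>, a
  translation error, and \<open>b\<close>, a phase error at the fixed shift \<open>y\<close>; the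
  first tends to zero by L2 continuity of translations, the second by dominated convergence, as
  phases differ by at most 2.\<close>

lemma tendsto_phase_shift:
  assumes m [measurable]: "\<And>n. \<theta> n \<in> borel_measurable borel" "\<eta> \<in> borel_measurable borel"
    and \<theta>: "\<And>t. (\<lambda>n. \<theta> n t) \<longlonglongrightarrow> \<eta> t" and x: "x \<longlonglongrightarrow> y"
  shows "(\<lambda>n::nat. phase_shift (\<theta> n) (x n) F) \<longlonglongrightarrow> phase_shift \<eta> y F"
proof -
  define f where "f = L2_fun F"
  have f: "square_integrable f" and [measurable]: "f \<in> borel_measurable borel"
    by (auto simp: f_def square_integrable_L2_fun)
  have fi: "integrable lborel (\<lambda>t. (cmod (f t))\<^sup>2)" using f by (simp add: square_integrable_def)
  define a where "a n = (\<integral>t. (cmod (f (t + (y - x n)) - f t))\<^sup>2 \<partial>lborel)" for n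
  define b where "b n = (\<integral>t. (cmod (cis (\<theta> n t) - cis (\<eta> t)))\<^sup>2 * (cmod (f (t - y)))\<^sup>2 \<partial>lborel)" for n
  have a: "a \<longlonglongrightarrow> 0"
  proof (rule LIMSEQ_I)
    fix e :: real assume "e > 0"
    then obtain d where d: "d > 0" "\<And>h. \<bar>h\<bar> < d \<Longrightarrow> (\<integral>x. (cmod (f (x + h) - f x))\<^sup>2 \<partial>lborel) < e"
      using L2_continuous_translation[OF f] by blast
    obtain N where "\<And>n. n \<ge> N \<Longrightarrow> norm (x n - y) < d"
      using LIMSEQ_D[OF x d(1)] by blast
    then have "norm (a n - 0) < e" if "n \<ge> N" for n
      using d(2)[of "y - x n"] that by (simp add: a_def abs_minus_commute)
    then show "\<exists>N. \<forall>n\<ge>N. norm (a n - 0) < e" by blast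
  qed
  have fiy: "integrable lborel (\<lambda>t. (cmod (f (t - y)))\<^sup>2)" using integrable_shift[OF fi, of "- y"] by simp
  have c2: "(cmod (cis r - cis s))\<^sup>2 \<le> 4" for r s
    using power_mono[OF norm_triangle_ineq4[of "cis r" "cis s"], of 2] by simp
  have bi: "integrable lborel (\<lambda>t. (cmod (cis (\<theta> n t) - cis (\<eta> t)))\<^sup>2 * (cmod (f (t - y)))\<^sup>2)" for n
    by (rule Bochner_Integration.integrable_bound[where f="\<lambda>t. 4 * (cmod (f (t - y)))\<^sup>2"])
       (auto simp: fiy c2 intro!: mult_right_mono)
  have "b \<longlonglongrightarrow> (\<integral>t. 0 \<partial>(lborel::real measure))"
    unfolding b_def
  proof (rule integral_dominated_convergence[where w="\<lambda>t. 4 * (cmod (f (t - y)))\<^sup>2"])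
    have "(\<lambda>n. (cmod (cis (\<theta> n t) - cis (\<eta> t)))\<^sup>2 * (cmod (f (t - y)))\<^sup>2)
        \<longlonglongrightarrow> (cmod (cis (\<eta> t) - cis (\<eta> t)))\<^sup>2 * (cmod (f (t - y)))\<^sup>2" for t
      by (intro tendsto_intros \<theta>)
    then show "AE t in lborel. (\<lambda>n. (cmod (cis (\<theta> n t) - cis (\<eta> t)))\<^sup>2 * (cmod (f (t - y)))\<^sup>2) \<longlonglongrightarrow> 0"
      by simp
  qed (auto simp: fiy c2 intro!: mult_right_mono)
  then have b: "b \<longlonglongrightarrow> 0" by simp
  have bound: "(norm (phase_shift (\<theta> n) (x n) F - phase_shift \<eta> y F))\<^sup>2 \<le> 2 * a n + 2 * b n" for n
  proof -
    have s: "square_integrable (\<lambda>t. cis (\<theta> n t) * f (t - x n))" "square_integrable (\<lambda>t. cis (\<eta> t) * f (t - y))"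
      by (auto intro!: square_integrable_phase_shift f)
    have d: "square_integrable (\<lambda>t. f (t - x n) - f (t - y))"
      using square_integrable_diff[OF square_integrable_phase_shift[OF _ f, of "\<lambda>_. 0" "x n"]
          square_integrable_phase_shift[OF _ f, of "\<lambda>_. 0" y]] by simp
    have "(norm (phase_shift (\<theta> n) (x n) F - phase_shift \<eta> y F))\<^sup>2
      = (\<integral>t. (cmod (cis (\<theta> n t) * f (t - x n) - cis (\<eta> t) * f (t - y)))\<^sup>2 \<partial>lborel)"
      unfolding phase_shift_def f_def[symmetric] L2_of_diff[OF s]
      by (rule norm_L2_of[OF square_integrable_diff[OF s]])
    also have "\<dots> \<le> (\<integral>t. 2 * (cmod (f (t - x n) - f (t - y)))\<^sup>2
        + 2 * ((cmod (cis (\<theta> n t) - cis (\<eta> t)))\<^sup>2 * (cmod (f (t - y)))\<^sup>2) \<partial>lborel)"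
    proof (rule integral_mono)
      show "integrable lborel (\<lambda>t. (cmod (cis (\<theta> n t) * f (t - x n) - cis (\<eta> t) * f (t - y)))\<^sup>2)"
        using square_integrable_diff[OF s] by (simp add: square_integrable_def)
      show "integrable lborel (\<lambda>t. 2 * (cmod (f (t - x n) - f (t - y)))\<^sup>2
        + 2 * ((cmod (cis (\<theta> n t) - cis (\<eta> t)))\<^sup>2 * (cmod (f (t - y)))\<^sup>2))"
        using d bi[of n] by (simp add: square_integrable_def)
      fix t
      have "cis (\<theta> n t) * f (t - x n) - cis (\<eta> t) * f (t - y)
        = cis (\<theta> n t) * (f (t - x n) - f (t - y)) + (cis (\<theta> n t) - cis (\<eta> t)) * f (t - y)"
        by (simp add: algebra_simps)
      then show "(cmod (cis (\<theta> n t) * f (t - x n) - cis (\<eta> t) * f (t - y)))\<^sup>2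
        \<le> 2 * (cmod (f (t - x n) - f (t - y)))\<^sup>2 + 2 * ((cmod (cis (\<theta> n t) - cis (\<eta> t)))\<^sup>2 * (cmod (f (t - y)))\<^sup>2)"
        using power2_norm_add_le[of "cis (\<theta> n t) * (f (t - x n) - f (t - y))" "(cis (\<theta> n t) - cis (\<eta> t)) * f (t - y)"]
        by (simp add: norm_mult power_mult_distrib)
    qed
    also have "\<dots> = 2 * (\<integral>t. (cmod (f (t - x n) - f (t - y)))\<^sup>2 \<partial>lborel) + 2 * b n"
      using d bi[of n] by (simp add: square_integrable_def b_def)
    also have "(\<integral>t. (cmod (f (t - x n) - f (t - y)))\<^sup>2 \<partial>lborel) = a n"
      using integral_shift[of "\<lambda>t. (cmod (f (t - x n) - f (t - y)))\<^sup>2" y] by (simp add: a_def algebra_simps)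
    finally show ?thesis .
  qed
  have "(\<lambda>n. (norm (phase_shift (\<theta> n) (x n) F - phase_shift \<eta> y F))\<^sup>2) \<longlonglongrightarrow> 0"
  proof (rule tendsto_sandwich[OF _ _ tendsto_const])
    show "(\<lambda>n. 2 * a n + 2 * b n) \<longlonglongrightarrow> 0"
      using tendsto_add[OF tendsto_mult_left[OF a, of 2] tendsto_mult_left[OF b, of 2]] by simp
  qed (use bound in auto)
  then show ?thesis by (subst tendsto_iff_norm_square)
qed

subsection \<open>Plancherel's theorem for integrable functions\<close>

text \<open>Positive exponent and no constant in front, so that coherent state coefficients are
  literally of this form; \<open>fourier_fun\<close> adds the choice of sign and the
  normalization.\<close>

definition fourier_int :: "(real \<Rightarrow> complex) \<Rightarrow> real \<Rightarrow> complex" where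
  "fourier_int g p = (\<integral>t. cis (p * t) * g t \<partial>lborel)"

lemma measurable_fourier_int [measurable (raw)]:
  assumes [measurable]: "g \<in> borel_measurable borel"
  shows "fourier_int g \<in> borel_measurable borel"
  unfolding fourier_int_def by measurable

lemma integrable_lborel_prodI:
  fixes f :: "'a::euclidean_space \<Rightarrow> 'b::euclidean_space \<Rightarrow> 'c::{banach, second_countable_topology}"
  assumes [measurable]: "(\<lambda>(x, y). f x y) \<in> borel_measurable (lborel \<Otimes>\<^sub>M lborel)"
    and "(\<integral>\<^sup>+y. (\<integral>\<^sup>+x. ennreal (norm (f x y)) \<partial>lborel) \<partial>lborel) < \<infinity>"
  shows "integrable (lborel \<Otimes>\<^sub>M lborel) (\<lambda>(x, y). f x y)"
  unfolding integrable_iff_bounded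
proof
  have "(\<integral>\<^sup>+z. ennreal (norm (case z of (x, y) \<Rightarrow> f x y)) \<partial>(lborel \<Otimes>\<^sub>M lborel))
     = (\<integral>\<^sup>+y. (\<integral>\<^sup>+x. ennreal (norm (f x y)) \<partial>lborel) \<partial>lborel)"
    using lborel_pair.nn_integral_snd[of "\<lambda>(x, y). ennreal (norm (f x y))"] by (simp add: split_beta')
  then show "(\<integral>\<^sup>+z. ennreal (norm (case z of (x, y) \<Rightarrow> f x y)) \<partial>(lborel \<Otimes>\<^sub>M lborel)) < \<infinity>"
    using assms(2) by simp
qed measurable

lemma integral_product_lborel:
  fixes f :: "'a::euclidean_space \<Rightarrow> complex" and h :: "'b::euclidean_space \<Rightarrow> complex"
  assumes f: "integrable lborel f" and h: "integrable lborel h"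
  shows "integrable lborel (\<lambda>(s, t). f s * h t)"
    and "(\<integral>(s, t). f s * h t \<partial>lborel) = (\<integral>s. f s \<partial>lborel) * (\<integral>t. h t \<partial>lborel)"
proof -
  have [measurable]: "f \<in> borel_measurable borel" "h \<in> borel_measurable borel"
    using f h by (auto dest: borel_measurable_integrable)
  have i: "integrable (lborel \<Otimes>\<^sub>M lborel) (\<lambda>(s, t). f s * h t)"
  proof (rule integrable_lborel_prodI)
    have "(\<integral>\<^sup>+t. (\<integral>\<^sup>+s. ennreal (norm (f s * h t)) \<partial>lborel) \<partial>lborel)
      = (\<integral>\<^sup>+s. ennreal (norm (f s)) \<partial>lborel) * (\<integral>\<^sup>+t. ennreal (norm (h t)) \<partial>lborel)"
      by (simp add: norm_mult ennreal_mult nn_integral_cmult nn_integral_multc)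
    also have "\<dots> < \<infinity>"
      using f h by (auto simp: integrable_iff_bounded ennreal_mult_less_top)
    finally show "(\<integral>\<^sup>+t. (\<integral>\<^sup>+s. ennreal (norm (f s * h t)) \<partial>lborel) \<partial>lborel) < \<infinity>" .
  qed measurable
  then show "integrable lborel (\<lambda>(s, t). f s * h t)" by (simp add: lborel_prod)
  have "(\<integral>s. (\<integral>t. f s * h t \<partial>lborel) \<partial>lborel) = (\<integral>(s, t). f s * h t \<partial>(lborel \<Otimes>\<^sub>M lborel))"
    by (rule lborel_pair.integral_fst[OF i])
  then show "(\<integral>(s, t). f s * h t \<partial>lborel) = (\<integral>s. f s \<partial>lborel) * (\<integral>t. h t \<partial>lborel)"
    by (simp add: lborel_prod)
qed

text \<open>Fubini: a weighted squared norm of \<open>F\<close> is a quadratic form in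
  \<open>g\<close> whose kernel is the Gram kernel of \<open>k\<close>. Two different pairs of
  kernel and weight with proportional Gram kernels therefore give proportional norms, and this is
  how \<open>gaussian_plancherel\<close> is obtained.\<close>

lemma integral_quadratic_kernel:
  fixes g :: "real \<Rightarrow> complex" and k :: "real \<Rightarrow> real \<Rightarrow> complex" and w :: "real \<Rightarrow> real"
  assumes g: "integrable lborel g"
    and [measurable]: "(\<lambda>(a, t). k a t) \<in> borel_measurable (borel \<Otimes>\<^sub>M borel)" "w \<in> borel_measurable borel"
    and kb: "\<And>a t. cmod (k a t) \<le> B"
    and C: "\<And>s t. (\<integral>\<^sup>+a. ennreal (\<bar>w a\<bar> * (cmod (k a s) * cmod (k a t))) \<partial>lborel) \<le> ennreal C"
  defines "F \<equiv> \<lambda>a. (\<integral>t. k a t * g t \<partial>lborel)"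
  shows "integrable lborel (\<lambda>a. of_real (w a) * (cnj (F a) * F a))"
    and "(\<integral>a. of_real (w a) * (cnj (F a) * F a) \<partial>lborel)
      = (\<integral>(s, t). cnj (g s) * g t * (\<integral>a. of_real (w a) * (cnj (k a s) * k a t) \<partial>lborel) \<partial>lborel)"
proof -
  have [measurable]: "g \<in> borel_measurable borel" using g by (auto dest: borel_measurable_integrable)
  define H where "H a = (\<lambda>(s, t). cnj (g s) * g t * (of_real (w a) * (cnj (k a s) * k a t)))" for a
  define K where "K = (\<lambda>(a, t). k a t)"
  have [measurable]: "K \<in> borel_measurable (borel \<Otimes>\<^sub>M borel)" by (simp add: K_def)
  have "(\<lambda>(a, s, t). cnj (g s) * g t * (of_real (w a) * (cnj (K (a, s)) * K (a, t))))
      \<in> borel_measurable (borel \<Otimes>\<^sub>M (borel \<Otimes>\<^sub>M borel))"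
    by measurable
  then have [measurable]: "(\<lambda>(a, z). H a z) \<in> borel_measurable (lborel \<Otimes>\<^sub>M (lborel :: (real \<times> real) measure))"
    by (simp add: H_def K_def borel_prod lborel_prod split_beta')
  have kg: "integrable lborel (\<lambda>t. k a t * g t)" for a
    by (rule Bochner_Integration.integrable_bound[where f="\<lambda>t. B * norm (g t)"])
      (use g kb in \<open>auto simp: norm_mult intro!: mult_right_mono order_trans[OF _ abs_ge_self]\<close>)
  have HF: "(\<integral>z. H a z \<partial>lborel) = of_real (w a) * (cnj (F a) * F a)" for a
  proof -
    have "(\<integral>z. H a z \<partial>lborel) = (\<integral>z. of_real (w a) * (case z of (s, t) \<Rightarrow> cnj (k a s * g s) * (k a t * g t)) \<partial>lborel)"
      by (rule Bochner_Integration.integral_cong) (auto simp: H_def)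
    also have "\<dots> = of_real (w a) * ((\<integral>s. cnj (k a s * g s) \<partial>lborel) * (\<integral>t. k a t * g t \<partial>lborel))"
      using integral_product_lborel(2)[OF Bochner_Integration.integrable_cnj[OF kg[of a]] kg[of a]]
      by (simp only: integral_mult_right_zero)
    also have "(\<integral>s. cnj (k a s * g s) \<partial>lborel) = cnj (F a)"
      unfolding F_def by (rule Bochner_Integration.integral_cnj)
    finally show ?thesis by (simp only: F_def)
  qed
  have "integrable (lborel \<Otimes>\<^sub>M (lborel :: (real \<times> real) measure)) (\<lambda>(a, z). H a z)"
  proof (rule integrable_lborel_prodI)
    \<comment> \<open>The bound \<open>C\<close> is uniform in (s, t), so after integration over
      \<open>a\<close> only the integrable tensor product of \<open>g\<close> with itself is
      left.\<close>
    have "(\<integral>\<^sup>+a. ennreal (norm (H a z)) \<partial>lborel) \<le> ennreal (norm (case z of (s, t) \<Rightarrow> cnj (g s) * g t)) * ennreal C" for z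
    proof -
      obtain s t where z: "z = (s, t)" by (cases z)
      have "(\<integral>\<^sup>+a. ennreal (norm (H a z)) \<partial>lborel)
        = (\<integral>\<^sup>+a. ennreal (norm (cnj (g s) * g t)) * ennreal (\<bar>w a\<bar> * (cmod (k a s) * cmod (k a t))) \<partial>lborel)"
        by (simp add: H_def z norm_mult flip: ennreal_mult)
      also have "\<dots> = ennreal (norm (cnj (g s) * g t)) * (\<integral>\<^sup>+a. ennreal (\<bar>w a\<bar> * (cmod (k a s) * cmod (k a t))) \<partial>lborel)"
        by (rule nn_integral_cmult) measurable
      also have "\<dots> \<le> ennreal (norm (cnj (g s) * g t)) * ennreal C" by (intro mult_left_mono C) auto
      finally show ?thesis by (simp add: z)
    qed
    then have "(\<integral>\<^sup>+z. (\<integral>\<^sup>+a. ennreal (norm (H a z)) \<partial>lborel) \<partial>lborel)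
      \<le> (\<integral>\<^sup>+z. ennreal (norm (case z of (s, t) \<Rightarrow> cnj (g s) * g t)) * ennreal C \<partial>lborel)"
      by (intro nn_integral_mono) auto
    also have "\<dots> = (\<integral>\<^sup>+z. ennreal (norm (case z of (s, t) \<Rightarrow> cnj (g s) * g t)) \<partial>lborel) * ennreal C"
      by (rule nn_integral_multc) (simp add: borel_prod[symmetric])
    also have "\<dots> < \<infinity>"
      using integral_product_lborel(1)[OF Bochner_Integration.integrable_cnj[OF g] g]
      by (auto simp: integrable_iff_bounded ennreal_mult_less_top)
    finally show "(\<integral>\<^sup>+z. (\<integral>\<^sup>+a. ennreal (norm (H a z)) \<partial>lborel) \<partial>lborel) < \<infinity>" .
  qed measurable
  note i = this
  show "integrable lborel (\<lambda>a. of_real (w a) * (cnj (F a) * F a))"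
    using lborel_pair.integrable_fst[OF i] by (simp add: HF)
  have "(\<integral>a. of_real (w a) * (cnj (F a) * F a) \<partial>lborel) = (\<integral>z. (\<integral>a. H a z \<partial>lborel) \<partial>lborel)"
    using lborel_pair.Fubini_integral[OF i] by (simp add: HF)
  also have "\<dots> = (\<integral>(s, t). cnj (g s) * g t * (\<integral>a. of_real (w a) * (cnj (k a s) * k a t) \<partial>lborel) \<partial>lborel)"
    by (simp add: H_def split_beta')
  finally show "(\<integral>a. of_real (w a) * (cnj (F a) * F a) \<partial>lborel)
      = (\<integral>(s, t). cnj (g s) * g t * (\<integral>a. of_real (w a) * (cnj (k a s) * k a t) \<partial>lborel) \<partial>lborel)" .
qed

text \<open>The characteristic function of the standard normal distribution, rescaled by
  \<open>\<rho> * sqrt 2\<close>, the factor that turns the standard normal density into a multiple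
  of exp (- (\<rho> p)^2).\<close>

lemma integral_gaussian_cis:
  assumes "\<rho> > 0"
  shows "(\<integral>p. of_real (exp (- (\<rho> * p)\<^sup>2)) * cis (p * s) \<partial>lborel) = of_real (2 * pi * normal_density 0 (\<rho> * sqrt 2) s)"
proof -
  define c where "c = \<rho> * sqrt 2"
  have c: "c > 0" using assms by (simp add: c_def)
  have "complex_of_real (exp (- (s / c)\<^sup>2 / 2)) = (\<integral>x. iexp (s / c * x) \<partial>std_normal_distribution)"
    using fun_cong[OF char_std_normal_distribution, of "s / c"] by (simp only: char_def)
  also have "\<dots> = (\<integral>x. std_normal_density x *\<^sub>R iexp (s / c * x) \<partial>lborel)"
    by (rule integral_density) auto
  also have "\<dots> = \<bar>c\<bar> *\<^sub>R (\<integral>p. std_normal_density (0 + c * p) *\<^sub>R iexp (s / c * (0 + c * p)) \<partial>lborel)"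
    using c by (intro lborel_integral_real_affine) auto
  also have "(\<lambda>p. std_normal_density (0 + c * p) *\<^sub>R iexp (s / c * (0 + c * p)))
     = (\<lambda>p. of_real (1 / sqrt (2 * pi)) * (of_real (exp (- (\<rho> * p)\<^sup>2)) * cis (p * s)))"
    using c by (auto simp: fun_eq_iff std_normal_density_def cis_conv_exp scaleR_conv_of_real c_def power_mult_distrib mult.commute)
  also have "\<bar>c\<bar> *\<^sub>R (\<integral>p. of_real (1 / sqrt (2 * pi)) * (of_real (exp (- (\<rho> * p)\<^sup>2)) * cis (p * s)) \<partial>lborel)
    = of_real (c / sqrt (2 * pi)) * (\<integral>p. of_real (exp (- (\<rho> * p)\<^sup>2)) * cis (p * s) \<partial>lborel)"
    using c by (simp add: scaleR_conv_of_real)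
  finally have "(\<integral>p. of_real (exp (- (\<rho> * p)\<^sup>2)) * cis (p * s) \<partial>lborel)
    = complex_of_real (sqrt (2 * pi) / c) * of_real (exp (- (s / c)\<^sup>2 / 2))"
    using c by (simp add: field_simps)
  also have "\<dots> = of_real (2 * pi * normal_density 0 c s)"
  proof -
    have "sqrt (2 * pi) * sqrt (2 * pi) = 2 * pi" by simp
    then have "sqrt (2 * pi) / c = 2 * pi * (1 / sqrt (2 * pi * c\<^sup>2))"
      using c by (simp add: real_sqrt_mult field_simps)
    then show ?thesis
      by (simp add: normal_density_def power_divide)
  qed
  finally show ?thesis by (simp add: c_def)
qed

lemma integrable_gaussian:
  fixes \<rho> :: real
  assumes "\<rho> > 0"
  shows "integrable lborel (\<lambda>p. exp (- (\<rho> * p)\<^sup>2))"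
proof -
  have "(\<lambda>p. exp (- (\<rho> * p)\<^sup>2)) = (\<lambda>p. sqrt (2 * pi) * std_normal_density (0 + (\<rho> * sqrt 2) * p))"
    by (simp add: fun_eq_iff std_normal_density_def power_mult_distrib)
  moreover have "integrable lborel (\<lambda>p. std_normal_density (0 + (\<rho> * sqrt 2) * p))"
    using assms by (intro lborel_integrable_real_affine) auto
  ultimately show ?thesis by simp
qed

text \<open>Variances add under convolution. The resulting deviation \<open>\<rho> * sqrt 2\<close>
  is the one that also appears in \<open>integral_gaussian_cis\<close>, which is what makes the two
  Gram kernels proportional.\<close>

lemma nn_integral_normal_density_product:
  assumes "\<rho> > 0"
  shows "(\<integral>\<^sup>+a. ennreal (normal_density 0 \<rho> (a - s) * normal_density 0 \<rho> (a - t)) \<partial>lborel)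
    = ennreal (normal_density 0 (\<rho> * sqrt 2) (t - s))"
proof -
  have "sqrt (\<rho>\<^sup>2 + \<rho>\<^sup>2) = \<rho> * sqrt 2"
    using assms by (simp add: real_sqrt_mult mult_2[symmetric] mult.commute del: mult_2)
  moreover have "(\<integral>\<^sup>+y. ennreal (normal_density 0 \<rho> ((t - s) - y) * normal_density 0 \<rho> y) \<partial>lborel)
    = ennreal (normal_density 0 (sqrt (\<rho>\<^sup>2 + \<rho>\<^sup>2)) (t - s))"
    using conv_normal_density_zero_mean[OF assms assms] by (simp add: fun_eq_iff)
  moreover have "(\<integral>\<^sup>+a. ennreal (normal_density 0 \<rho> (a - s) * normal_density 0 \<rho> (a - t)) \<partial>lborel)
    = ennreal \<bar>1\<bar> * (\<integral>\<^sup>+y. ennreal (normal_density 0 \<rho> ((s + 1 * y) - s) * normal_density 0 \<rho> ((s + 1 * y) - t)) \<partial>lborel)"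
    by (rule nn_integral_real_affine) auto
  moreover have "normal_density 0 \<rho> ((s + 1 * y) - t) = normal_density 0 \<rho> ((t - s) - y)" for y
    by (simp add: normal_density_def power2_commute[of "s + y" t] algebra_simps)
  ultimately show ?thesis by (simp add: mult.commute)
qed

text \<open>Damping the transform by a Gaussian corresponds to smoothing \<open>g\<close> by a
  Gaussian: both sides are quadratic forms in \<open>g\<close> with a normal density of deviation
  \<open>\<rho> * sqrt 2\<close> as kernel, up to the factor 2 pi. For integrable \<open>g\<close>
  both sides are finite.\<close>

lemma gaussian_plancherel:
  fixes g :: "real \<Rightarrow> complex"
  assumes g: "integrable lborel g" and \<rho>: "\<rho> > 0"
  shows "(\<integral>\<^sup>+p. ennreal (exp (- (\<rho> * p)\<^sup>2) * (cmod (fourier_int g p))\<^sup>2) \<partial>lborel)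
    = ennreal (2 * pi) * (\<integral>\<^sup>+x. ennreal ((cmod (\<integral>t. normal_density 0 \<rho> (x - t) * g t \<partial>lborel))\<^sup>2) \<partial>lborel)"
proof -
  define N where "N = normal_density 0 \<rho>"
  define G where "G x = (\<integral>t. complex_of_real (N (x - t)) * g t \<partial>lborel)" for x
  have Nn: "N x \<ge> 0" for x using \<rho> by (simp add: N_def normal_density_nonneg)
  have [measurable]: "N \<in> borel_measurable borel" by (simp add: N_def)
  have [measurable]: "g \<in> borel_measurable borel" using g by (auto dest: borel_measurable_integrable)
  have nb: "normal_density 0 \<sigma> x \<le> 1 / sqrt (2 * pi * \<sigma>\<^sup>2)" for \<sigma> x
    unfolding normal_density_def by (intro mult_left_le) auto
  have csq: "cnj z * z = complex_of_real ((cmod z)\<^sup>2)" for z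
    by (metis complex_norm_square mult.commute of_real_power)
  have A: "integrable lborel (\<lambda>p. of_real (exp (- (\<rho> * p)\<^sup>2)) * (cnj (fourier_int g p) * fourier_int g p))"
    "(\<integral>p. of_real (exp (- (\<rho> * p)\<^sup>2)) * (cnj (fourier_int g p) * fourier_int g p) \<partial>lborel)
     = (\<integral>(s, t). cnj (g s) * g t * (\<integral>a. of_real (exp (- (\<rho> * a)\<^sup>2)) * (cnj (cis (a * s)) * cis (a * t)) \<partial>lborel) \<partial>lborel)"
    unfolding fourier_int_def
    by (rule integral_quadratic_kernel[OF g, where B=1 and C="\<integral>p. exp (- (\<rho> * p)\<^sup>2) \<partial>lborel"];
        use integrable_gaussian[OF \<rho>] in \<open>simp add: nn_integral_eq_integral split_beta'\<close>)+
  have B: "integrable lborel (\<lambda>x. of_real 1 * (cnj (G x) * G x))"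
    "(\<integral>x. of_real 1 * (cnj (G x) * G x) \<partial>lborel)
     = (\<integral>(s, t). cnj (g s) * g t * (\<integral>a. of_real 1 * (cnj (complex_of_real (N (a - s))) * complex_of_real (N (a - t))) \<partial>lborel) \<partial>lborel)"
    unfolding G_def
    by (rule integral_quadratic_kernel[OF g, where B="1 / sqrt (2 * pi * \<rho>\<^sup>2)" and C="1 / sqrt (2 * pi * (\<rho> * sqrt 2)\<^sup>2)"];
        use Nn nb \<rho> nn_integral_normal_density_product[OF \<rho>]
        in \<open>simp add: split_beta' N_def ennreal_leI del: real_sqrt_mult\<close>)+
  have kA: "(\<integral>a. of_real (exp (- (\<rho> * a)\<^sup>2)) * (cnj (cis (a * s)) * cis (a * t)) \<partial>lborel)
      = complex_of_real (2 * pi * normal_density 0 (\<rho> * sqrt 2) (t - s))" for s t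
    using integral_gaussian_cis[OF \<rho>, of "t - s"] by (simp add: cis_cnj cis_mult algebra_simps)
  have kB: "(\<integral>a. of_real 1 * (cnj (complex_of_real (N (a - s))) * complex_of_real (N (a - t))) \<partial>lborel)
      = complex_of_real (normal_density 0 (\<rho> * sqrt 2) (t - s))" for s t
  proof -
    have "(\<integral>a. N (a - s) * N (a - t) \<partial>lborel) = normal_density 0 (\<rho> * sqrt 2) (t - s)"
      using nn_integral_normal_density_product[OF \<rho>, of s t] Nn \<rho>
      by (intro nn_integral_eq_integrable[THEN iffD1, THEN conjunct2]) (auto simp: N_def normal_density_nonneg)
    then show ?thesis by (simp flip: of_real_mult)
  qed
  have "(\<integral>p. exp (- (\<rho> * p)\<^sup>2) * (cmod (fourier_int g p))\<^sup>2 \<partial>lborel) = 2 * pi * (\<integral>x. (cmod (G x))\<^sup>2 \<partial>lborel)"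
  proof -
    have "complex_of_real (\<integral>p. exp (- (\<rho> * p)\<^sup>2) * (cmod (fourier_int g p))\<^sup>2 \<partial>lborel)
      = (\<integral>(s, t). cnj (g s) * g t * complex_of_real (2 * pi * normal_density 0 (\<rho> * sqrt 2) (t - s)) \<partial>lborel)"
      using A(2) unfolding csq kA by (simp flip: of_real_mult of_real_power)
    also have "\<dots> = 2 * pi * (\<integral>(s, t). cnj (g s) * g t * complex_of_real (normal_density 0 (\<rho> * sqrt 2) (t - s)) \<partial>lborel)"
      by (simp add: split_beta' mult_ac flip: integral_mult_right_zero)
    also have "(\<integral>(s, t). cnj (g s) * g t * complex_of_real (normal_density 0 (\<rho> * sqrt 2) (t - s)) \<partial>lborel)
      = complex_of_real (\<integral>x. (cmod (G x))\<^sup>2 \<partial>lborel)"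
      using B(2) unfolding csq kB by (simp flip: of_real_mult of_real_power)
    also have "complex_of_real (2 * pi) * \<dots> = complex_of_real (2 * pi * (\<integral>x. (cmod (G x))\<^sup>2 \<partial>lborel))"
      by simp
    finally show ?thesis using of_real_eq_iff by blast
  qed
  moreover have "integrable lborel (\<lambda>p. exp (- (\<rho> * p)\<^sup>2) * (cmod (fourier_int g p))\<^sup>2)"
    using integrable_Re[OF A(1)] unfolding csq by (simp flip: of_real_mult of_real_power)
  moreover have "integrable lborel (\<lambda>x. (cmod (G x))\<^sup>2)"
    using integrable_Re[OF B(1)] unfolding csq by (simp flip: of_real_mult of_real_power)
  ultimately have "(\<integral>\<^sup>+p. ennreal (exp (- (\<rho> * p)\<^sup>2) * (cmod (fourier_int g p))\<^sup>2) \<partial>lborel)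
      = ennreal (2 * pi * (\<integral>x. (cmod (G x))\<^sup>2 \<partial>lborel))"
    and "(\<integral>\<^sup>+x. ennreal ((cmod (G x))\<^sup>2) \<partial>lborel) = ennreal (\<integral>x. (cmod (G x))\<^sup>2 \<partial>lborel)"
    using nn_integral_eq_integral[of lborel "\<lambda>p. exp (- (\<rho> * p)\<^sup>2) * (cmod (fourier_int g p))\<^sup>2"]
      nn_integral_eq_integral[of lborel "\<lambda>x. (cmod (G x))\<^sup>2"] by simp_all
  then show ?thesis
    by (simp only: G_def N_def ennreal_mult'[of "2 * pi"] pi_ge_zero mult_nonneg_nonneg zero_le_numeral)
qed

text \<open>Convolution with a normal density, written as an average over a fixed probability
  measure so that the limit in \<open>\<rho>\<close> can be taken under the integral; at
  \<open>\<rho> = 0\<close> it returns \<open>g\<close>.\<close>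

definition mollify :: "real \<Rightarrow> (real \<Rightarrow> complex) \<Rightarrow> real \<Rightarrow> complex" where
  "mollify \<rho> g x = (\<integral>u. complex_of_real (std_normal_density u) * g (x - \<rho> * u) \<partial>lborel)"

lemma mollify_eq:
  assumes "\<rho> > 0"
  shows "mollify \<rho> g x = (\<integral>t. complex_of_real (normal_density 0 \<rho> (x - t)) * g t \<partial>lborel)"
proof -
  have e: "\<rho> * normal_density 0 \<rho> (\<rho> * u) = std_normal_density u" for u
    using assms by (simp add: normal_density_def real_sqrt_mult power_mult_distrib)
  have "(\<integral>t. complex_of_real (normal_density 0 \<rho> (x - t)) * g t \<partial>lborel)
    = \<bar>- \<rho>\<bar> *\<^sub>R (\<integral>u. complex_of_real (normal_density 0 \<rho> (x - (x + (- \<rho>) * u))) * g (x + (- \<rho>) * u) \<partial>lborel)"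
    using assms by (intro lborel_integral_real_affine) auto
  also have "\<dots> = (\<integral>u. of_real (\<rho> * normal_density 0 \<rho> (\<rho> * u)) * g (x - \<rho> * u) \<partial>lborel)"
    using assms by (simp add: scaleR_conv_of_real mult.assoc flip: integral_mult_right_zero)
  finally show ?thesis by (simp only: mollify_def e)
qed

lemma measurable_mollify [measurable]:
  assumes [measurable]: "g \<in> borel_measurable borel"
  shows "mollify \<rho> g \<in> borel_measurable borel"
  unfolding mollify_def by measurable

lemma nn_integral_std_normal_density: "(\<integral>\<^sup>+u. ennreal (std_normal_density u) \<partial>lborel) = 1"
  by (subst nn_integral_eq_integral) auto

lemma nn_integral_shift:
  assumes [measurable]: "f \<in> borel_measurable borel"
  shows "(\<integral>\<^sup>+x. f (x + h) \<partial>lborel) = (\<integral>\<^sup>+x. f x \<partial>(lborel :: real measure))"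
  using nn_integral_real_affine[of f 1 h] by (simp add: add.commute)

lemma integral_norm_le_nn_integral:
  fixes f :: "'a \<Rightarrow> 'b::{banach, second_countable_topology}"
  shows "ennreal (norm (\<integral>x. f x \<partial>M)) \<le> (\<integral>\<^sup>+x. ennreal (norm (f x)) \<partial>M)"
  by (cases "integrable M f") (auto simp: integral_norm_bound_ennreal not_integrable_integral_eq)

text \<open>Jensen's inequality for an average of translates, by Cauchy-Schwarz after splitting the
  density into two square roots. The bound is in [0, \<infinity>], so it also covers
  \<open>g\<close> of infinite norm.\<close>

lemma mollify_L2_le:
  assumes [measurable]: "g \<in> borel_measurable borel"
  shows "(\<integral>\<^sup>+x. ennreal ((cmod (mollify \<rho> g x))\<^sup>2) \<partial>lborel) \<le> (\<integral>\<^sup>+x. ennreal ((cmod (g x))\<^sup>2) \<partial>lborel)"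
proof -
  have pw: "ennreal ((cmod (mollify \<rho> g x))\<^sup>2) \<le> (\<integral>\<^sup>+u. ennreal (std_normal_density u) * ennreal ((cmod (g (x - \<rho> * u)))\<^sup>2) \<partial>lborel)" for x
  proof -
    have sq: "ennreal (sqrt (std_normal_density u)) * ennreal (sqrt (std_normal_density u)) = ennreal (std_normal_density u)" for u
      by (simp flip: ennreal_mult)
    have "ennreal (cmod (mollify \<rho> g x)) \<le> (\<integral>\<^sup>+u. ennreal (cmod (std_normal_density u * g (x - \<rho> * u))) \<partial>lborel)"
      unfolding mollify_def by (rule integral_norm_le_nn_integral)
    also have "\<dots> = (\<integral>\<^sup>+u. ennreal (sqrt (std_normal_density u)) * (ennreal (sqrt (std_normal_density u)) * ennreal (cmod (g (x - \<rho> * u)))) \<partial>lborel)"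
      by (simp add: norm_mult ennreal_mult sq flip: mult.assoc)
    finally have "(ennreal (cmod (mollify \<rho> g x)))\<^sup>2 \<le> (\<integral>\<^sup>+u. ennreal (sqrt (std_normal_density u)) * (ennreal (sqrt (std_normal_density u)) * ennreal (cmod (g (x - \<rho> * u)))) \<partial>lborel)\<^sup>2"
      by (intro power_mono) auto
    also have "\<dots> \<le> (\<integral>\<^sup>+u. (ennreal (sqrt (std_normal_density u)))\<^sup>2 \<partial>lborel) *
        (\<integral>\<^sup>+u. (ennreal (sqrt (std_normal_density u)) * ennreal (cmod (g (x - \<rho> * u))))\<^sup>2 \<partial>lborel)"
      by (rule Cauchy_Schwarz_nn_integral) auto
    also have "\<dots> = (\<integral>\<^sup>+u. ennreal (std_normal_density u) * ennreal ((cmod (g (x - \<rho> * u)))\<^sup>2) \<partial>lborel)"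
      by (simp add: power_mult_distrib nn_integral_std_normal_density sq power2_eq_square ennreal_mult mult_ac)
         (simp add: sq nn_integral_std_normal_density flip: mult.assoc)
    finally show ?thesis by (simp add: ennreal_power)
  qed
  have "(\<integral>\<^sup>+x. ennreal ((cmod (mollify \<rho> g x))\<^sup>2) \<partial>lborel)
    \<le> (\<integral>\<^sup>+x. (\<integral>\<^sup>+u. ennreal (std_normal_density u) * ennreal ((cmod (g (x - \<rho> * u)))\<^sup>2) \<partial>lborel) \<partial>lborel)"
    by (intro nn_integral_mono pw)
  also have "\<dots> = (\<integral>\<^sup>+u. (\<integral>\<^sup>+x. ennreal (std_normal_density u) * ennreal ((cmod (g (x - \<rho> * u)))\<^sup>2) \<partial>lborel) \<partial>lborel)"
    by (rule lborel_pair.Fubini') measurable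
  also have "\<dots> = (\<integral>\<^sup>+u. ennreal (std_normal_density u) * (\<integral>\<^sup>+x. ennreal ((cmod (g x))\<^sup>2) \<partial>lborel) \<partial>lborel)"
    using nn_integral_shift[of "\<lambda>x. ennreal ((cmod (g x))\<^sup>2)" "- (\<rho> * _)"] by (simp add: nn_integral_cmult)
  also have "\<dots> = (\<integral>\<^sup>+x. ennreal ((cmod (g x))\<^sup>2) \<partial>lborel)"
    by (simp add: nn_integral_multc nn_integral_std_normal_density)
  finally show ?thesis .
qed

text \<open>The error is at most the Gaussian average of the L1 modulus of continuity
  \<open>\<Omega>\<close>, which tends to zero by dominated convergence with the bound
  \<open>2 * L\<close>.\<close>

lemma tendsto_mollify_L1:
  assumes g: "integrable lborel g" and r: "r \<longlonglongrightarrow> 0"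
  shows "(\<lambda>n. \<integral>x. norm (mollify (r n) g x - g x) \<partial>lborel) \<longlonglongrightarrow> 0"
    and "integrable lborel (mollify (r n) g)"
proof -
  have [measurable]: "g \<in> borel_measurable borel" using g by (auto dest: borel_measurable_integrable)
  define \<Omega> where "\<Omega> h = (\<integral>x. norm (g (x + h) - g x) \<partial>lborel)" for h
  define L where "L = (\<integral>x. norm (g x) \<partial>lborel)"
  have [measurable]: "\<Omega> \<in> borel_measurable borel" unfolding \<Omega>_def by measurable
  have di: "integrable lborel (\<lambda>x. g (x + h) - g x)" for h
    by (intro Bochner_Integration.integrable_diff integrable_shift g)
  have \<Omega>0: "0 \<le> \<Omega> h" for h by (simp add: \<Omega>_def)
  have n\<Omega>: "(\<integral>\<^sup>+x. ennreal (norm (g (x + h) - g x)) \<partial>lborel) = ennreal (\<Omega> h)" for h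
    unfolding \<Omega>_def using di[of h] by (intro nn_integral_eq_integral) auto
  have \<Omega>L: "\<Omega> h \<le> 2 * L" for h
  proof -
    have "\<Omega> h \<le> (\<integral>x. norm (g (x + h)) \<partial>lborel) + (\<integral>x. norm (- g x) \<partial>lborel)"
      unfolding \<Omega>_def by (rule integral_norm_triangle_sum) (auto intro: integrable_shift g)
    then show ?thesis using integral_shift[of "\<lambda>x. norm (g x)" h] by (simp add: L_def)
  qed
  have N\<Omega>: "integrable lborel (\<lambda>u. std_normal_density u * \<Omega> (- (\<rho> * u)))" for \<rho>
    by (rule Bochner_Integration.integrable_bound[where f="\<lambda>u. std_normal_density u * (2 * L)"])
       (auto intro!: mult_left_mono order_trans[OF \<Omega>L] simp: abs_mult \<Omega>0)
  have nn: "(\<integral>\<^sup>+x. ennreal (norm (mollify \<rho> g x - g x)) \<partial>lborel)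
      \<le> ennreal (\<integral>u. std_normal_density u * \<Omega> (- (\<rho> * u)) \<partial>lborel)" for \<rho>
  \<comment> \<open>The integrand in \<open>u\<close> is integrable by an affine substitution with
    slope \<open>- \<rho>\<close>, which degenerates at zero; there the mollification is
    \<open>g\<close> itself.\<close>
  proof (cases "\<rho> = 0")
    case True
    have "mollify \<rho> g = g" using True by (simp add: mollify_def fun_eq_iff)
    then show ?thesis using True by simp
  next
    case False
    have gi: "integrable lborel (\<lambda>u. complex_of_real (std_normal_density u) * g (x - \<rho> * u))" for x
    proof (rule Bochner_Integration.integrable_bound)
      show "integrable lborel (\<lambda>u. g (x + (- \<rho>) * u))"
        using False g by (intro lborel_integrable_real_affine) auto
      have "std_normal_density u \<le> 1" for u
        using pi_ge_two by (auto simp: std_normal_density_def divide_simps exp_le_one_iff intro: order_trans[of _ 1])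
      then show "AE u in lborel. norm (complex_of_real (std_normal_density u) * g (x - \<rho> * u)) \<le> norm (g (x + (- \<rho>) * u))"
        by (auto simp: norm_mult intro!: mult_left_le_one_le)
    qed measurable
    have pw: "ennreal (norm (mollify \<rho> g x - g x)) \<le> (\<integral>\<^sup>+u. ennreal (std_normal_density u * norm (g (x + - (\<rho> * u)) - g x)) \<partial>lborel)" for x
    proof -
      have "g x = (\<integral>u. complex_of_real (std_normal_density u) * g x \<partial>lborel)"
        by simp
      then have "mollify \<rho> g x - g x = (\<integral>u. complex_of_real (std_normal_density u) * (g (x - \<rho> * u) - g x) \<partial>lborel)"
        using gi[of x] by (simp add: mollify_def right_diff_distrib)
      then show ?thesis
        using integral_norm_le_nn_integral[of lborel "\<lambda>u. complex_of_real (std_normal_density u) * (g (x - \<rho> * u) - g x)"]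
        by (simp add: norm_mult)
    qed
    have "(\<integral>\<^sup>+x. ennreal (norm (mollify \<rho> g x - g x)) \<partial>lborel)
      \<le> (\<integral>\<^sup>+x. (\<integral>\<^sup>+u. ennreal (std_normal_density u * norm (g (x + - (\<rho> * u)) - g x)) \<partial>lborel) \<partial>lborel)"
      by (intro nn_integral_mono pw)
    also have "\<dots> = (\<integral>\<^sup>+u. (\<integral>\<^sup>+x. ennreal (std_normal_density u * norm (g (x + - (\<rho> * u)) - g x)) \<partial>lborel) \<partial>lborel)"
      by (rule lborel_pair.Fubini') measurable
    also have "\<dots> = (\<integral>\<^sup>+u. ennreal (std_normal_density u * \<Omega> (- (\<rho> * u))) \<partial>lborel)"
      using n\<Omega>[of "- (\<rho> * _)"] by (simp add: ennreal_mult nn_integral_cmult \<Omega>0)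
    also have "\<dots> = ennreal (\<integral>u. std_normal_density u * \<Omega> (- (\<rho> * u)) \<partial>lborel)"
      using N\<Omega> \<Omega>0 by (intro nn_integral_eq_integral) auto
    finally show ?thesis .
  qed
  have int: "integrable lborel (\<lambda>x. mollify \<rho> g x - g x)" for \<rho>
    unfolding integrable_iff_bounded using le_less_trans[OF nn[of \<rho>]] by simp
  then show "integrable lborel (mollify (r n) g)"
    using Bochner_Integration.integrable_add[OF int[of "r n"] g] by simp
  have "(\<lambda>n. \<integral>u. std_normal_density u * \<Omega> (- (r n * u)) \<partial>lborel) \<longlonglongrightarrow> (\<integral>u. 0 \<partial>(lborel::real measure))"
  proof (rule integral_dominated_convergence[where w="\<lambda>u. std_normal_density u * (2 * L)"])
    have "(\<lambda>n. \<Omega> (- (r n * u))) \<longlonglongrightarrow> 0" for u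
    proof (rule LIMSEQ_I)
      fix e :: real assume "e > 0"
      then obtain d where d: "d > 0" "\<And>h. \<bar>h\<bar> < d \<Longrightarrow> \<Omega> h < e"
        using L1_continuous_translation[OF g] unfolding \<Omega>_def by blast
      have "(\<lambda>n. - (r n * u)) \<longlonglongrightarrow> - (0 * u)" by (intro tendsto_intros r)
      then obtain N where "\<And>n. n \<ge> N \<Longrightarrow> \<bar>r n * u\<bar> < d"
        using LIMSEQ_D[of _ _ d] d(1) by fastforce
      then show "\<exists>N. \<forall>n\<ge>N. norm (\<Omega> (- (r n * u)) - 0) < e"
        using d(2) \<Omega>0 by (intro exI[of _ N]) auto
    qed
    then show "AE u in lborel. (\<lambda>n. std_normal_density u * \<Omega> (- (r n * u))) \<longlonglongrightarrow> 0"
      by (auto intro!: AE_I2 tendsto_mult_right_zero)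
  qed (auto intro!: mult_left_mono simp: abs_mult \<Omega>0 \<Omega>L)
  then have lim: "(\<lambda>n. \<integral>u. std_normal_density u * \<Omega> (- (r n * u)) \<partial>lborel) \<longlonglongrightarrow> 0" by simp
  have le: "(\<integral>x. norm (mollify \<rho> g x - g x) \<partial>lborel) \<le> (\<integral>u. std_normal_density u * \<Omega> (- (\<rho> * u)) \<partial>lborel)" for \<rho>
    using nn[of \<rho>] int[of \<rho>] \<Omega>0 by (simp add: nn_integral_eq_integral)
  show "(\<lambda>n. \<integral>x. norm (mollify (r n) g x - g x) \<partial>lborel) \<longlonglongrightarrow> 0"
    by (rule tendsto_sandwich[OF always_eventually always_eventually tendsto_const lim]) (simp_all add: le)
qed

text \<open>The damping factors increase to 1, so the damped left sides converge monotonically to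
  the full one. The upper bound follows since mollification contracts the norm, the lower bound by
  Fatou's lemma along an almost everywhere convergent subsequence.\<close>

theorem plancherel_nn:
  fixes g :: "real \<Rightarrow> complex"
  assumes g: "integrable lborel g"
  shows "(\<integral>\<^sup>+p. ennreal ((cmod (fourier_int g p))\<^sup>2) \<partial>lborel) = ennreal (2 * pi) * (\<integral>\<^sup>+t. ennreal ((cmod (g t))\<^sup>2) \<partial>lborel)"
proof -
  have [measurable]: "g \<in> borel_measurable borel" using g by (auto dest: borel_measurable_integrable)
  define r where "r n = 1 / real (Suc n)" for n
  have r: "r \<longlonglongrightarrow> 0" "\<And>n. r n > 0"
    unfolding r_def using LIMSEQ_inverse_real_of_nat by (auto simp: inverse_eq_divide)
  define J where "J n = (\<integral>\<^sup>+x. ennreal ((cmod (mollify (r n) g x))\<^sup>2) \<partial>lborel)" for n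
  define I where "I n p = ennreal (exp (- (r n * p)\<^sup>2) * (cmod (fourier_int g p))\<^sup>2)" for n p
  have IJ: "(\<integral>\<^sup>+p. I n p \<partial>lborel) = ennreal (2 * pi) * J n" for n
    unfolding I_def J_def mollify_eq[OF r(2)] by (rule gaussian_plancherel[OF g r(2)])
  have [measurable]: "I n \<in> borel_measurable borel" for n unfolding I_def by measurable
  have "(r (Suc n) * p)\<^sup>2 \<le> (r n * p)\<^sup>2" for n p
  proof (rule abs_le_square_iff[THEN iffD1])
    have "r (Suc n) \<le> r n" by (simp add: r_def frac_le)
    then show "\<bar>r (Suc n) * p\<bar> \<le> \<bar>r n * p\<bar>"
      using r(2)[of n] r(2)[of "Suc n"] by (simp add: abs_mult mult_right_mono)
  qed
  then have Iinc: "incseq I"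
    by (auto simp: incseq_Suc_iff le_fun_def I_def intro!: ennreal_leI mult_right_mono)
  have Ilim: "(\<lambda>n. I n p) \<longlonglongrightarrow> ennreal ((cmod (fourier_int g p))\<^sup>2)" for p
  proof -
    have "(\<lambda>n. exp (- (r n * p)\<^sup>2) * (cmod (fourier_int g p))\<^sup>2) \<longlonglongrightarrow> exp (- (0 * p)\<^sup>2) * (cmod (fourier_int g p))\<^sup>2"
      by (intro tendsto_intros r)
    then show ?thesis unfolding I_def by (intro tendsto_ennrealI) simp
  qed
  have lim: "(\<lambda>n. ennreal (2 * pi) * J n) \<longlonglongrightarrow> (\<integral>\<^sup>+p. ennreal ((cmod (fourier_int g p))\<^sup>2) \<partial>lborel)"
    unfolding IJ[symmetric]
    by (rule nn_integral_LIMSEQ[OF Iinc]) (auto intro: Ilim)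
  show ?thesis
  proof (rule antisym)
    show "(\<integral>\<^sup>+p. ennreal ((cmod (fourier_int g p))\<^sup>2) \<partial>lborel) \<le> ennreal (2 * pi) * (\<integral>\<^sup>+t. ennreal ((cmod (g t))\<^sup>2) \<partial>lborel)"
      by (rule LIMSEQ_le_const2[OF lim]) (auto simp: J_def intro!: mult_left_mono mollify_L2_le)
    \<comment> \<open>Convergence in L1 gives almost everywhere convergence only along a
      subsequence; that is enough, because the full sequence on the frequency side is already known
      to converge.\<close>
    obtain s where s: "strict_mono s" "AE x in lborel. (\<lambda>n. mollify (r (s n)) g x - g x) \<longlonglongrightarrow> 0"
      using tendsto_L1_AE_subseq[of lborel "\<lambda>n x. mollify (r n) g x - g x"]
        tendsto_mollify_L1[OF g r(1)] g by auto
    have "ennreal (2 * pi) * (\<integral>\<^sup>+t. ennreal ((cmod (g t))\<^sup>2) \<partial>lborel) = (\<integral>\<^sup>+t. ennreal (2 * pi * (cmod (g t))\<^sup>2) \<partial>lborel)"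
      by (simp only: ennreal_mult' pi_ge_zero mult_nonneg_nonneg zero_le_numeral nn_integral_cmult) (simp add: nn_integral_cmult)
    also have "\<dots> = (\<integral>\<^sup>+t. liminf (\<lambda>n. ennreal (2 * pi * (cmod (mollify (r (s n)) g t))\<^sup>2)) \<partial>lborel)"
    proof (rule nn_integral_cong_AE, use s(2) in eventually_elim)
      case (elim t)
      then have "(\<lambda>n. mollify (r (s n)) g t) \<longlonglongrightarrow> g t" by (simp add: LIM_zero_iff)
      then have "(\<lambda>n. ennreal (2 * pi * (cmod (mollify (r (s n)) g t))\<^sup>2)) \<longlonglongrightarrow> ennreal (2 * pi * (cmod (g t))\<^sup>2)"
        by (intro tendsto_intros tendsto_ennrealI)
      then show ?case using lim_imp_Liminf trivial_limit_sequentially by metis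
    qed
    also have "\<dots> \<le> liminf (\<lambda>n. \<integral>\<^sup>+t. ennreal (2 * pi * (cmod (mollify (r (s n)) g t))\<^sup>2) \<partial>lborel)"
      by (rule nn_integral_liminf) measurable
    also have "\<dots> = liminf (\<lambda>n. ennreal (2 * pi) * J (s n))"
      unfolding J_def by (simp add: ennreal_mult nn_integral_cmult mult.assoc)
    also have "\<dots> = (\<integral>\<^sup>+p. ennreal ((cmod (fourier_int g p))\<^sup>2) \<partial>lborel)"
      using LIMSEQ_subseq_LIMSEQ[OF lim s(1)] by (intro lim_imp_Liminf) (auto simp: comp_def)
    finally show "ennreal (2 * pi) * (\<integral>\<^sup>+t. ennreal ((cmod (g t))\<^sup>2) \<partial>lborel) \<le> (\<integral>\<^sup>+p. ennreal ((cmod (fourier_int g p))\<^sup>2) \<partial>lborel)" .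
  qed
qed

subsection \<open>The substitution $\omega = e^{\epsilon t}$\<close>

text \<open>The substitution is made at the level of measures, so that nonnegative integrals,
  complex integrals and almost everywhere statements all transfer from this one identity. It is
  proved on compact intervals, where the substitution rule applies, and then exhausted.\<close>

lemma distr_exp:
  fixes \<epsilon> :: real assumes \<epsilon>: "\<epsilon> > 0"
  shows "distr (density lborel (\<lambda>t. ennreal (\<epsilon> * exp (\<epsilon> * t)))) borel (\<lambda>t. exp (\<epsilon> * t))
    = density lborel (indicator {0<..})"
proof (rule measure_eqI)
  fix A assume "A \<in> sets (distr (density lborel (\<lambda>t. ennreal (\<epsilon> * exp (\<epsilon> * t)))) borel (\<lambda>t. exp (\<epsilon> * t)))"
  then have [measurable]: "A \<in> sets borel" by simp
  define c where "c n = (\<integral>\<^sup>+t. ennreal (indicator A (exp (\<epsilon> * t)) * (\<epsilon> * exp (\<epsilon> * t)) * indicator {- real n..real n} t) \<partial>lborel)" for n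
  have c: "c n = (\<integral>\<^sup>+\<omega>. ennreal (indicator A \<omega> * indicator {exp (\<epsilon> * - real n)..exp (\<epsilon> * real n)} \<omega>) \<partial>lborel)" for n
    unfolding c_def
  proof (rule nn_integral_substitution[symmetric])
    show "set_borel_measurable borel {exp (\<epsilon> * - real n)..exp (\<epsilon> * real n)} (indicator A :: real \<Rightarrow> real)"
      unfolding set_borel_measurable_def by measurable
    show "((\<lambda>t. exp (\<epsilon> * t)) has_real_derivative \<epsilon> * exp (\<epsilon> * x)) (at x)" for x
      by (auto intro!: derivative_eq_intros)
  qed (use \<epsilon> in \<open>auto intro!: continuous_intros\<close>)
  have i1: "indicator {- real n..real n} t \<le> (indicator {- real (Suc n)..real (Suc n)} t :: real)" for n t
    by (auto simp: indicator_def)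
  have l1: "c \<longlonglongrightarrow> (\<integral>\<^sup>+t. ennreal (\<epsilon> * exp (\<epsilon> * t)) * indicator A (exp (\<epsilon> * t)) \<partial>lborel)"
    unfolding c_def
  proof (rule nn_integral_LIMSEQ)
    show "incseq (\<lambda>n t. ennreal (indicator A (exp (\<epsilon> * t)) * (\<epsilon> * exp (\<epsilon> * t)) * indicator {- real n..real n} t))"
      unfolding incseq_Suc_iff le_fun_def using \<epsilon> by (intro allI ennreal_leI mult_left_mono i1) simp
    fix t
    obtain N where N: "\<bar>t\<bar> \<le> real N" using real_arch_simple by blast
    have "ennreal (indicator A (exp (\<epsilon> * t)) * (\<epsilon> * exp (\<epsilon> * t)) * indicator {- real n..real n} t)
       = ennreal (\<epsilon> * exp (\<epsilon> * t)) * indicator A (exp (\<epsilon> * t))" if "n \<ge> N" for n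
      using N that by (auto simp: indicator_def)
    then show "(\<lambda>n. ennreal (indicator A (exp (\<epsilon> * t)) * (\<epsilon> * exp (\<epsilon> * t)) * indicator {- real n..real n} t))
       \<longlonglongrightarrow> ennreal (\<epsilon> * exp (\<epsilon> * t)) * indicator A (exp (\<epsilon> * t))"
      by (intro tendsto_eventually eventually_sequentiallyI[of N])
  qed measurable
  have l2: "c \<longlonglongrightarrow> (\<integral>\<^sup>+\<omega>. indicator {0<..} \<omega> * indicator A \<omega> \<partial>lborel)"
    unfolding c
  proof (rule nn_integral_LIMSEQ)
    have "{exp (\<epsilon> * - real n)..exp (\<epsilon> * real n)} \<subseteq> {exp (\<epsilon> * - real (Suc n))..exp (\<epsilon> * real (Suc n))}" (is "?A n \<subseteq> ?B n") for n
      using \<epsilon> by (intro atLeastatMost_subset_iff[THEN iffD2] disjI2 conjI) (simp_all add: algebra_simps)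
    note sub = this
    show "incseq (\<lambda>n \<omega>. ennreal (indicator A \<omega> * indicator {exp (\<epsilon> * - real n)..exp (\<epsilon> * real n)} \<omega>))"
      unfolding incseq_Suc_iff le_fun_def
      by (intro allI ennreal_leI mult_left_mono indicator_leI subsetD[OF sub]) simp_all
    fix \<omega> :: real
    show "(\<lambda>n. ennreal (indicator A \<omega> * indicator {exp (\<epsilon> * - real n)..exp (\<epsilon> * real n)} \<omega>))
       \<longlonglongrightarrow> indicator {0<..} \<omega> * indicator A \<omega>"
    proof (cases "\<omega> > 0")
      case True
      obtain N where N: "\<bar>ln \<omega> / \<epsilon>\<bar> \<le> real N" using real_arch_simple by blast
      have "\<omega> \<in> {exp (\<epsilon> * - real n)..exp (\<epsilon> * real n)}" if "n \<ge> N" for n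
      proof -
        have "\<bar>ln \<omega> / \<epsilon>\<bar> \<le> real n" using N that by linarith
        then have "\<epsilon> * - real n \<le> ln \<omega>" "ln \<omega> \<le> \<epsilon> * real n"
          using \<epsilon> by (auto simp: abs_le_iff field_simps)
        then show ?thesis using True by (metis atLeastAtMost_iff exp_le_cancel_iff exp_ln)
      qed
      then show ?thesis using True
        by (intro tendsto_eventually eventually_sequentiallyI[of N]) (auto simp: indicator_def)
    next
      case False
      then have "\<omega> \<notin> {exp (\<epsilon> * - real n)..exp (\<epsilon> * real n)}" for n
        by (smt (verit) atLeastAtMost_iff exp_gt_zero)
      then have "indicator {exp (\<epsilon> * - real n)..exp (\<epsilon> * real n)} \<omega> = (0 :: real)" for n
        by (rule indicator_simps(2))
      then show ?thesis using False by (simp only: mult_zero_right ennreal_0) simp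
    qed
  qed measurable
  have "emeasure (distr (density lborel (\<lambda>t. ennreal (\<epsilon> * exp (\<epsilon> * t)))) borel (\<lambda>t. exp (\<epsilon> * t))) A
      = (\<integral>\<^sup>+t. ennreal (\<epsilon> * exp (\<epsilon> * t)) * indicator A (exp (\<epsilon> * t)) \<partial>lborel)"
  proof -
    have "(\<lambda>t. exp (\<epsilon> * t)) -` A \<in> sets borel"
      using measurable_sets_borel[of "\<lambda>t. exp (\<epsilon> * t)" borel A] by simp
    then show ?thesis by (simp add: emeasure_distr emeasure_density indicator_def of_bool_def if_distrib cong: if_cong)
  qed
  also have "\<dots> = emeasure (density lborel (indicator {0<..})) A"
    using LIMSEQ_unique[OF l1 l2] by (simp add: emeasure_density)
  finally show "emeasure (distr (density lborel (\<lambda>t. ennreal (\<epsilon> * exp (\<epsilon> * t)))) borel (\<lambda>t. exp (\<epsilon> * t))) A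
     = emeasure (density lborel (indicator {0<..})) A" .
qed simp

lemma nn_integral_exp_subst:
  fixes \<epsilon> :: real assumes "\<epsilon> > 0" and [measurable]: "f \<in> borel_measurable borel"
  shows "(\<integral>\<^sup>+\<omega>. indicator {0<..} \<omega> * f \<omega> \<partial>lborel) = (\<integral>\<^sup>+t. ennreal (\<epsilon> * exp (\<epsilon> * t)) * f (exp (\<epsilon> * t)) \<partial>lborel)"
proof -
  have "(\<integral>\<^sup>+\<omega>. indicator {0<..} \<omega> * f \<omega> \<partial>lborel) = (\<integral>\<^sup>+\<omega>. f \<omega> \<partial>density lborel (indicator {0<..}))"
    by (simp add: nn_integral_density)
  also have "\<dots> = (\<integral>\<^sup>+t. ennreal (\<epsilon> * exp (\<epsilon> * t)) * f (exp (\<epsilon> * t)) \<partial>lborel)"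
    unfolding distr_exp[OF assms(1), symmetric] by (simp add: nn_integral_distr nn_integral_density)
  finally show ?thesis .
qed

lemma integral_exp_subst:
  fixes f :: "real \<Rightarrow> complex" and \<epsilon> :: real
  assumes \<epsilon>: "\<epsilon> > 0" and [measurable]: "f \<in> borel_measurable borel"
  shows "(\<integral>\<omega>. indicator {0<..} \<omega> *\<^sub>R f \<omega> \<partial>lborel) = (\<integral>t. (\<epsilon> * exp (\<epsilon> * t)) *\<^sub>R f (exp (\<epsilon> * t)) \<partial>lborel)"
    and "integrable lborel (\<lambda>\<omega>. indicator {0<..} \<omega> *\<^sub>R f \<omega>) \<longleftrightarrow> integrable lborel (\<lambda>t. (\<epsilon> * exp (\<epsilon> * t)) *\<^sub>R f (exp (\<epsilon> * t)))"
proof -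
  have e: "(\<lambda>x. ennreal (indicator {0<..} x)) = (indicator {0::real<..} :: real \<Rightarrow> ennreal)"
    by (auto simp: indicator_def)
  have "(\<integral>\<omega>. indicator {0<..} \<omega> *\<^sub>R f \<omega> \<partial>lborel) = (\<integral>\<omega>. f \<omega> \<partial>density lborel (indicator {0<..}))"
    by (subst integral_density[of f lborel "indicator {0<..}", symmetric]) (auto simp: e)
  also have "\<dots> = (\<integral>t. (\<epsilon> * exp (\<epsilon> * t)) *\<^sub>R f (exp (\<epsilon> * t)) \<partial>lborel)"
    unfolding distr_exp[OF assms(1), symmetric] using \<epsilon> by (simp add: integral_distr integral_density)
  finally show "(\<integral>\<omega>. indicator {0<..} \<omega> *\<^sub>R f \<omega> \<partial>lborel) = (\<integral>t. (\<epsilon> * exp (\<epsilon> * t)) *\<^sub>R f (exp (\<epsilon> * t)) \<partial>lborel)" .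
  have "integrable lborel (\<lambda>\<omega>. indicator {0<..} \<omega> *\<^sub>R f \<omega>) \<longleftrightarrow> integrable (density lborel (indicator {0<..})) f"
    by (subst integrable_density[of f lborel "indicator {0<..}", symmetric]) (auto simp: e)
  also have "\<dots> \<longleftrightarrow> integrable lborel (\<lambda>t. (\<epsilon> * exp (\<epsilon> * t)) *\<^sub>R f (exp (\<epsilon> * t)))"
    unfolding distr_exp[OF assms(1), symmetric] using \<epsilon> by (simp add: integrable_distr_eq integrable_density)
  finally show "integrable lborel (\<lambda>\<omega>. indicator {0<..} \<omega> *\<^sub>R f \<omega>) \<longleftrightarrow> integrable lborel (\<lambda>t. (\<epsilon> * exp (\<epsilon> * t)) *\<^sub>R f (exp (\<epsilon> * t)))" .
qed

section \<open>The phase of the coherent states and its Plancherel identity\<close>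

lemma measurable_expquot [measurable]: "expquot \<in> borel_measurable borel"
  unfolding expquot_def[abs_def] by measurable

text \<open>The phase of the model operator at the section point of (q, p), divided by
  \<open>l * p\<close>. The value at \<epsilon> = 0 is the limit of the other branch: minus the
  derivative at 0 of \<open>expquot (- \<epsilon> * q) * exp (\<epsilon> * t)\<close>.\<close>

definition cs_phase :: "real \<Rightarrow> real \<Rightarrow> real \<Rightarrow> real" where
  "cs_phase \<epsilon> q t = (if \<epsilon> = 0 then q / 2 - t else (1 - expquot (- \<epsilon> * q) * exp (\<epsilon> * t)) / \<epsilon>)"

lemma measurable_cs_phase [measurable (raw)]:
  assumes [measurable]: "f \<in> borel_measurable M" "g \<in> borel_measurable M"
  shows "(\<lambda>x. cs_phase \<epsilon> (f x) (g x)) \<in> borel_measurable M"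
  unfolding cs_phase_def by measurable

text \<open>The phase is affine in t or in \<omega> = exp (\<epsilon> t), so the inner integral is a
  Fourier integral at a multiple of p. For \<epsilon> > 0 the substitution preserves the L1
  integral, not the L2 norm; the mismatch is the weight exp (- \<epsilon> t), and its factor
  1/\<epsilon> cancels against the frequency scale \<open>l * c / \<epsilon>\<close>.\<close>

lemma plancherel_cs_phase:
  fixes \<phi> :: "real \<Rightarrow> complex"
  assumes \<phi>: "integrable lborel \<phi>" and \<epsilon>: "\<epsilon> \<ge> 0" and l: "l \<noteq> 0"
  shows "(\<integral>\<^sup>+p. ennreal ((cmod (\<integral>t. cis (l * p * cs_phase \<epsilon> q t) * \<phi> t \<partial>lborel))\<^sup>2) \<partial>lborel)
    = ennreal (2 * pi / (\<bar>l\<bar> * expquot (- \<epsilon> * q))) * (\<integral>\<^sup>+t. ennreal ((cmod (\<phi> t))\<^sup>2 * exp (- \<epsilon> * t)) \<partial>lborel)"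
proof -
  have [measurable]: "\<phi> \<in> borel_measurable borel" using \<phi> by (auto dest: borel_measurable_integrable)
  \<comment> \<open>In both cases the inner integral is, up to a phase, a Fourier integral at a multiple of \<open>p\<close>.\<close>
  have scale: "(\<integral>\<^sup>+p. ennreal ((cmod (fourier_int g (c * p)))\<^sup>2) \<partial>lborel)
     = ennreal (2 * pi / \<bar>c\<bar>) * (\<integral>\<^sup>+t. ennreal ((cmod (g t))\<^sup>2) \<partial>lborel)"
    if g: "integrable lborel g" and c: "c \<noteq> 0" for g c
  proof -
    have [measurable]: "g \<in> borel_measurable borel" using g by (auto dest: borel_measurable_integrable)
    have "ennreal \<bar>c\<bar> * (\<integral>\<^sup>+p. ennreal ((cmod (fourier_int g (c * p)))\<^sup>2) \<partial>lborel)
      = ennreal (2 * pi) * (\<integral>\<^sup>+t. ennreal ((cmod (g t))\<^sup>2) \<partial>lborel)"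
      using nn_integral_real_affine[of "\<lambda>p. ennreal ((cmod (fourier_int g p))\<^sup>2)" c 0] c plancherel_nn[OF g] by simp
    then have "ennreal (1 / \<bar>c\<bar>) * (ennreal \<bar>c\<bar> * (\<integral>\<^sup>+p. ennreal ((cmod (fourier_int g (c * p)))\<^sup>2) \<partial>lborel))
      = ennreal (1 / \<bar>c\<bar>) * (ennreal (2 * pi) * (\<integral>\<^sup>+t. ennreal ((cmod (g t))\<^sup>2) \<partial>lborel))" by simp
    moreover have "ennreal (1 / \<bar>c\<bar>) * ennreal \<bar>c\<bar> = 1" "ennreal (1 / \<bar>c\<bar>) * ennreal (2 * pi) = ennreal (2 * pi / \<bar>c\<bar>)"
      using c by (simp_all add: ennreal_mult'[symmetric] del: ennreal_mult')
    ultimately show ?thesis by (simp only: mult.assoc[symmetric] mult_1_left)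
  qed
  show ?thesis
  proof (cases "\<epsilon> = 0")
    case True
    have "(\<integral>t. cis (l * p * cs_phase \<epsilon> q t) * \<phi> t \<partial>lborel) = cis (l * p * q / 2) * fourier_int \<phi> (- l * p)" for p
    proof -
      have e: "cis (l * p * cs_phase \<epsilon> q t) * \<phi> t = cis (l * p * q / 2) * (cis (- l * p * t) * \<phi> t)" for t
      proof -
        have "l * p * cs_phase \<epsilon> q t = l * p * q / 2 + (- l * p * t)"
          by (simp add: cs_phase_def True algebra_simps)
        then show ?thesis by (simp only: cis_mult[symmetric] mult.assoc)
      qed
      show ?thesis by (simp only: e fourier_int_def integral_mult_right_zero)
    qed
    then show ?thesis using scale[OF \<phi>, of "- l"] l True by (simp add: norm_mult expquot_def)
  next
    case False
    then have \<epsilon>: "\<epsilon> > 0" using \<epsilon> by simp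
    define c where "c = expquot (- \<epsilon> * q)"
    have c: "c > 0" by (simp add: c_def expquot_pos)
    \<comment> \<open>The full Jacobian is divided out, so that integrating \<open>g\<close> against
      a character of \<omega> equals integrating \<phi> against the same character at \<omega> = exp
      (\<epsilon> t).\<close>
    define g where "g \<omega> = indicator {0<..} \<omega> *\<^sub>R (\<phi> (ln \<omega> / \<epsilon>) / of_real (\<epsilon> * \<omega>))" for \<omega>
    have g: "integrable lborel g"
      unfolding g_def using integral_exp_subst(2)[OF \<epsilon>, of "\<lambda>\<omega>. \<phi> (ln \<omega> / \<epsilon>) / of_real (\<epsilon> * \<omega>)"] \<phi> \<epsilon>
      by (simp add: scaleR_conv_of_real)
    have fg: "fourier_int g P = (\<integral>t. cis (P * exp (\<epsilon> * t)) * \<phi> t \<partial>lborel)" for P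
    proof -
      have "fourier_int g P = (\<integral>\<omega>. indicator {0<..} \<omega> *\<^sub>R (cis (P * \<omega>) * (\<phi> (ln \<omega> / \<epsilon>) / of_real (\<epsilon> * \<omega>))) \<partial>lborel)"
        by (simp add: fourier_int_def g_def)
      also have "\<dots> = (\<integral>t. (\<epsilon> * exp (\<epsilon> * t)) *\<^sub>R (cis (P * exp (\<epsilon> * t)) * (\<phi> (ln (exp (\<epsilon> * t)) / \<epsilon>) / of_real (\<epsilon> * exp (\<epsilon> * t)))) \<partial>lborel)"
        by (rule integral_exp_subst(1)[OF \<epsilon>]) measurable
      finally show ?thesis using \<epsilon> by (simp add: scaleR_conv_of_real)
    qed
    have "cmod (\<integral>t. cis (l * p * cs_phase \<epsilon> q t) * \<phi> t \<partial>lborel) = cmod (fourier_int g (- (l * c / \<epsilon>) * p))" for p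
    proof -
      have e: "cis (l * p * cs_phase \<epsilon> q t) * \<phi> t = cis (l * p / \<epsilon>) * (cis (- (l * c / \<epsilon>) * p * exp (\<epsilon> * t)) * \<phi> t)" for t
      proof -
        have "l * p * cs_phase \<epsilon> q t = l * p / \<epsilon> + (- (l * c / \<epsilon>) * p * exp (\<epsilon> * t))"
          using False by (simp add: cs_phase_def c_def diff_divide_distrib algebra_simps)
        then show ?thesis by (simp only: cis_mult[symmetric] mult.assoc)
      qed
      show ?thesis by (simp only: e fg integral_mult_right_zero norm_mult norm_cis mult_1_left)
    qed
    then have "(\<integral>\<^sup>+p. ennreal ((cmod (\<integral>t. cis (l * p * cs_phase \<epsilon> q t) * \<phi> t \<partial>lborel))\<^sup>2) \<partial>lborel)
      = ennreal (2 * pi / \<bar>- (l * c / \<epsilon>)\<bar>) * (\<integral>\<^sup>+\<omega>. ennreal ((cmod (g \<omega>))\<^sup>2) \<partial>lborel)"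
      using scale[OF g, of "- (l * c / \<epsilon>)"] l c \<epsilon> by simp
    also have "(\<integral>\<^sup>+\<omega>. ennreal ((cmod (g \<omega>))\<^sup>2) \<partial>lborel)
      = (\<integral>\<^sup>+\<omega>. indicator {0<..} \<omega> * ennreal ((cmod (\<phi> (ln \<omega> / \<epsilon>)))\<^sup>2 / (\<epsilon> * \<omega>)\<^sup>2) \<partial>lborel)"
      by (intro nn_integral_cong) (auto simp: g_def indicator_def norm_divide power_divide norm_mult power_mult_distrib)
    also have "\<dots> = (\<integral>\<^sup>+t. ennreal (\<epsilon> * exp (\<epsilon> * t)) * ennreal ((cmod (\<phi> (ln (exp (\<epsilon> * t)) / \<epsilon>)))\<^sup>2 / (\<epsilon> * exp (\<epsilon> * t))\<^sup>2) \<partial>lborel)"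
      by (rule nn_integral_exp_subst[OF \<epsilon>]) measurable
    also have "\<dots> = (\<integral>\<^sup>+t. ennreal (1 / \<epsilon>) * ennreal ((cmod (\<phi> t))\<^sup>2 * exp (- \<epsilon> * t)) \<partial>lborel)"
    proof (rule nn_integral_cong)
      fix t
      have "\<epsilon> * exp (\<epsilon> * t) * ((cmod (\<phi> t))\<^sup>2 / (\<epsilon> * exp (\<epsilon> * t))\<^sup>2) = 1 / \<epsilon> * ((cmod (\<phi> t))\<^sup>2 * exp (- \<epsilon> * t))"
        using \<epsilon> by (simp add: power2_eq_square exp_minus field_simps)
      then show "ennreal (\<epsilon> * exp (\<epsilon> * t)) * ennreal ((cmod (\<phi> (ln (exp (\<epsilon> * t)) / \<epsilon>)))\<^sup>2 / (\<epsilon> * exp (\<epsilon> * t))\<^sup>2)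
        = ennreal (1 / \<epsilon>) * ennreal ((cmod (\<phi> t))\<^sup>2 * exp (- \<epsilon> * t))"
        using \<epsilon> by (simp flip: ennreal_mult)
    qed
    also have "\<dots> = ennreal (1 / \<epsilon>) * (\<integral>\<^sup>+t. ennreal ((cmod (\<phi> t))\<^sup>2 * exp (- \<epsilon> * t)) \<partial>lborel)"
      by (rule nn_integral_cmult) measurable
    also have "ennreal (2 * pi / \<bar>- (l * c / \<epsilon>)\<bar>) * (ennreal (1 / \<epsilon>) * (\<integral>\<^sup>+t. ennreal ((cmod (\<phi> t))\<^sup>2 * exp (- \<epsilon> * t)) \<partial>lborel))
      = ennreal (2 * pi / \<bar>- (l * c / \<epsilon>)\<bar> * (1 / \<epsilon>)) * (\<integral>\<^sup>+t. ennreal ((cmod (\<phi> t))\<^sup>2 * exp (- \<epsilon> * t)) \<partial>lborel)"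
      using \<epsilon> by (subst ennreal_mult) (auto simp: mult.assoc)
    also have "2 * pi / \<bar>- (l * c / \<epsilon>)\<bar> * (1 / \<epsilon>) = 2 * pi / (\<bar>l\<bar> * expquot (- \<epsilon> * q))"
      using \<epsilon> c by (simp add: abs_mult c_def)
    finally show ?thesis .
  qed
qed

subsection \<open>The model representations\<close>

definition model_rep :: "real \<Rightarrow> real \<Rightarrow> real \<times> real \<times> real \<Rightarrow> L2 \<Rightarrow> L2" where
  "model_rep l \<epsilon> = (\<lambda>(x, y, z). phase_shift (\<lambda>t. l * (y + z * (cs_phase \<epsilon> x t - x / 2))) x)"

lemma L2_fun_coherent_model:
  "AE t in lborel. L2_fun (coherent (model_rep l \<epsilon>) \<psi> (q, p)) t = cis (l * p * cs_phase \<epsilon> q t) * L2_fun \<psi> (t - q)"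
proof -
  have e: "l * (q * p / 2 + p * (cs_phase \<epsilon> q t - q / 2)) = l * p * cs_phase \<epsilon> q t" for t
    by (simp add: algebra_simps)
  show ?thesis
    unfolding coherent_def cs_section_def model_rep_def split_conv e
    by (rule L2_fun_phase_shift) measurable
qed

lemma cinner_coherent_model:
  "cinner u (coherent (model_rep l \<epsilon>) \<psi> (q, p))
    = (\<integral>t. cis (l * p * cs_phase \<epsilon> q t) * (cnj (L2_fun u t) * L2_fun \<psi> (t - q)) \<partial>lborel)"
  unfolding cinner_L2_fun
  by (rule integral_cong_AE) (use L2_fun_coherent_model[of l \<epsilon> \<psi> q p] in \<open>auto elim!: eventually_mono\<close>)

text \<open>The invariant measure contributes \<open>expquot\<close> at \<epsilon> q and
  Plancherel's identity its inverse at - \<epsilon> q. Their quotient exp (\<epsilon> q) is the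
  factor that turns the weight exp (- \<epsilon> t) into exp (- \<epsilon> (t - q)).\<close>

lemma expquot_minus: "expquot t = exp t * expquot (- t)"
  by (simp add: expquot_def exp_minus field_simps)

text \<open>After Plancherel in p the weight depends on s = t - q only, so Tonelli and the
  substitution from q to s separate the double integral into a norm and a moment. The identity is in
  [0, \<infinity>] and includes vectors that are not admissible, as the proof of irreducibility
  requires.\<close>

lemma nn_coherent_model:
  assumes \<epsilon>: "\<epsilon> \<ge> 0" and l: "l \<noteq> 0"
  shows "(\<integral>\<^sup>+x. ennreal ((cmod (cinner u (coherent (model_rep l \<epsilon>) \<psi> x)))\<^sup>2) \<partial>mu_eps \<epsilon>)
    = ennreal (2 * pi / \<bar>l\<bar>) * ennreal ((norm u)\<^sup>2) * (\<integral>\<^sup>+s. ennreal ((cmod (L2_fun \<psi> s))\<^sup>2 * exp (- \<epsilon> * s)) \<partial>lborel)"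
proof -
  define f where "f = L2_fun u"
  define h where "h = L2_fun \<psi>"
  have [measurable]: "f \<in> borel_measurable borel" "h \<in> borel_measurable borel" by (simp_all add: f_def h_def)
  define c where "c q p = (\<integral>t. cis (l * p * cs_phase \<epsilon> q t) * (cnj (f t) * h (t - q)) \<partial>lborel)" for q p
  have c: "cinner u (coherent (model_rep l \<epsilon>) \<psi> (q, p)) = c q p" for q p
    unfolding c_def f_def h_def by (rule cinner_coherent_model)
  have cm [measurable]: "(\<lambda>x. c (fst x) (snd x)) \<in> borel_measurable (borel \<Otimes>\<^sub>M borel)"
    unfolding c_def by measurable
  \<comment> \<open>A product of two square integrable functions is integrable, which is what
    Plancherel's identity asks for.\<close>
  have int: "integrable lborel (\<lambda>t. cnj (f t) * h (t - q))" for q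
  proof (rule square_integrable_mult)
    show "square_integrable (\<lambda>t. h (t - q))"
      using square_integrable_phase_shift[of "\<lambda>_. 0" h q] by (simp add: h_def square_integrable_L2_fun)
  qed (simp add: f_def square_integrable_L2_fun)
  have "(\<integral>\<^sup>+x. ennreal ((cmod (cinner u (coherent (model_rep l \<epsilon>) \<psi> x)))\<^sup>2) \<partial>mu_eps \<epsilon>)
     = (\<integral>\<^sup>+x. ennreal (expquot (\<epsilon> * fst x)) * ennreal ((cmod (c (fst x) (snd x)))\<^sup>2) \<partial>(lborel \<Otimes>\<^sub>M lborel))"
  proof -
    have m: "(\<lambda>x. ennreal ((cmod (c (fst x) (snd x)))\<^sup>2)) \<in> borel_measurable lborel"
      using cm by (simp add: borel_prod)
    have m': "(\<lambda>x :: real \<times> real. ennreal (expquot (\<epsilon> * fst x))) \<in> borel_measurable lborel"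
      by (simp add: borel_prod[symmetric])
    have "cinner u (coherent (model_rep l \<epsilon>) \<psi> x) = c (fst x) (snd x)" for x
      using c[of "fst x" "snd x"] by simp
    then show ?thesis
      using nn_integral_density[OF m' m] by (simp add: mu_eps_def lborel_prod split_beta')
  qed
  also have "\<dots> = (\<integral>\<^sup>+q. (\<integral>\<^sup>+p. ennreal (expquot (\<epsilon> * q)) * ennreal ((cmod (c q p))\<^sup>2) \<partial>lborel) \<partial>lborel)"
  proof -
    have "(\<lambda>x. ennreal (expquot (\<epsilon> * fst x)) * ennreal ((cmod (c (fst x) (snd x)))\<^sup>2)) \<in> borel_measurable (borel \<Otimes>\<^sub>M borel)"
      by measurable
    then have "(\<lambda>x. ennreal (expquot (\<epsilon> * fst x)) * ennreal ((cmod (c (fst x) (snd x)))\<^sup>2)) \<in> borel_measurable (lborel \<Otimes>\<^sub>M lborel)"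
      by (simp add: lborel_prod borel_prod)
    from lborel.nn_integral_fst[OF this] show ?thesis by simp
  qed
  also have "\<dots> = (\<integral>\<^sup>+q. (\<integral>\<^sup>+t. ennreal (2 * pi / \<bar>l\<bar>) * ennreal ((cmod (f t))\<^sup>2 * ((cmod (h (t - q)))\<^sup>2 * exp (- \<epsilon> * (t - q)))) \<partial>lborel) \<partial>lborel)"
  proof (rule nn_integral_cong)
    fix q
    have m: "(\<lambda>p. c q p) \<in> borel_measurable borel" unfolding c_def by measurable
    have e: "expquot (\<epsilon> * q) * (2 * pi / (\<bar>l\<bar> * expquot (- \<epsilon> * q))) = 2 * pi / \<bar>l\<bar> * exp (\<epsilon> * q)"
      using expquot_minus[of "\<epsilon> * q"] expquot_pos[of "- (\<epsilon> * q)"] by (simp add: field_simps)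
    have "(\<integral>\<^sup>+p. ennreal (expquot (\<epsilon> * q)) * ennreal ((cmod (c q p))\<^sup>2) \<partial>lborel)
      = ennreal (expquot (\<epsilon> * q)) * (\<integral>\<^sup>+p. ennreal ((cmod (c q p))\<^sup>2) \<partial>lborel)"
      using m by (intro nn_integral_cmult) measurable
    also have "(\<integral>\<^sup>+p. ennreal ((cmod (c q p))\<^sup>2) \<partial>lborel)
      = ennreal (2 * pi / (\<bar>l\<bar> * expquot (- \<epsilon> * q))) * (\<integral>\<^sup>+t. ennreal ((cmod (cnj (f t) * h (t - q)))\<^sup>2 * exp (- \<epsilon> * t)) \<partial>lborel)"
      unfolding c_def by (rule plancherel_cs_phase[OF int \<epsilon> l])
    also have "ennreal (expquot (\<epsilon> * q)) * \<dots>
      = ennreal (2 * pi / \<bar>l\<bar> * exp (\<epsilon> * q)) * (\<integral>\<^sup>+t. ennreal ((cmod (cnj (f t) * h (t - q)))\<^sup>2 * exp (- \<epsilon> * t)) \<partial>lborel)"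
      unfolding e[symmetric] using expquot_pos[of "\<epsilon> * q"] by (subst ennreal_mult') (simp_all add: mult.assoc)
    also have "\<dots> = (\<integral>\<^sup>+t. ennreal (2 * pi / \<bar>l\<bar> * exp (\<epsilon> * q)) * ennreal ((cmod (cnj (f t) * h (t - q)))\<^sup>2 * exp (- \<epsilon> * t)) \<partial>lborel)"
      by (rule nn_integral_cmult[symmetric]) measurable
    also have "\<dots> = (\<integral>\<^sup>+t. ennreal (2 * pi / \<bar>l\<bar>) * ennreal ((cmod (f t))\<^sup>2 * ((cmod (h (t - q)))\<^sup>2 * exp (- \<epsilon> * (t - q)))) \<partial>lborel)"
    proof (rule nn_integral_cong)
      fix t
      have "exp (- \<epsilon> * (t - q)) = exp (\<epsilon> * q) * exp (- \<epsilon> * t)"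
        by (simp add: algebra_simps flip: exp_add)
      then show "ennreal (2 * pi / \<bar>l\<bar> * exp (\<epsilon> * q)) * ennreal ((cmod (cnj (f t) * h (t - q)))\<^sup>2 * exp (- \<epsilon> * t))
        = ennreal (2 * pi / \<bar>l\<bar>) * ennreal ((cmod (f t))\<^sup>2 * ((cmod (h (t - q)))\<^sup>2 * exp (- \<epsilon> * (t - q))))"
        by (simp add: norm_mult power_mult_distrib mult_ac flip: ennreal_mult)
    qed
    finally show "(\<integral>\<^sup>+p. ennreal (expquot (\<epsilon> * q)) * ennreal ((cmod (c q p))\<^sup>2) \<partial>lborel)
      = (\<integral>\<^sup>+t. ennreal (2 * pi / \<bar>l\<bar>) * ennreal ((cmod (f t))\<^sup>2 * ((cmod (h (t - q)))\<^sup>2 * exp (- \<epsilon> * (t - q)))) \<partial>lborel)" .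
  qed
  also have "\<dots> = (\<integral>\<^sup>+t. (\<integral>\<^sup>+q. ennreal (2 * pi / \<bar>l\<bar>) * ennreal ((cmod (f t))\<^sup>2 * ((cmod (h (t - q)))\<^sup>2 * exp (- \<epsilon> * (t - q)))) \<partial>lborel) \<partial>lborel)"
    by (rule lborel_pair.Fubini') measurable
  also have "\<dots> = (\<integral>\<^sup>+t. ennreal (2 * pi / \<bar>l\<bar>) * ennreal ((cmod (f t))\<^sup>2) * (\<integral>\<^sup>+s. ennreal ((cmod (h s))\<^sup>2 * exp (- \<epsilon> * s)) \<partial>lborel) \<partial>lborel)"
  proof (rule nn_integral_cong)
    fix t
    have "(\<integral>\<^sup>+s. ennreal ((cmod (h s))\<^sup>2 * exp (- \<epsilon> * s)) \<partial>lborel)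
       = (\<integral>\<^sup>+q. ennreal ((cmod (h (t - q)))\<^sup>2 * exp (- \<epsilon> * (t - q))) \<partial>lborel)"
      using nn_integral_real_affine[of "\<lambda>s. ennreal ((cmod (h s))\<^sup>2 * exp (- \<epsilon> * s))" "- 1" t] by simp
    then show "(\<integral>\<^sup>+q. ennreal (2 * pi / \<bar>l\<bar>) * ennreal ((cmod (f t))\<^sup>2 * ((cmod (h (t - q)))\<^sup>2 * exp (- \<epsilon> * (t - q)))) \<partial>lborel)
       = ennreal (2 * pi / \<bar>l\<bar>) * ennreal ((cmod (f t))\<^sup>2) * (\<integral>\<^sup>+s. ennreal ((cmod (h s))\<^sup>2 * exp (- \<epsilon> * s)) \<partial>lborel)"
      by (simp add: ennreal_mult'[of "(cmod (f t))\<^sup>2"] nn_integral_cmult mult.assoc)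
  qed
  also have "\<dots> = ennreal (2 * pi / \<bar>l\<bar>) * (\<integral>\<^sup>+t. ennreal ((cmod (f t))\<^sup>2) \<partial>lborel) * (\<integral>\<^sup>+s. ennreal ((cmod (h s))\<^sup>2 * exp (- \<epsilon> * s)) \<partial>lborel)"
    by (simp add: nn_integral_multc nn_integral_cmult)
  finally show ?thesis unfolding f_def h_def nn_norm_L2[symmetric] .
qed

subsection \<open>Continuity in the group element and in $\epsilon$\<close>

text \<open>The second order Taylor coefficient of the exponential, by l'Hopital's rule. It is the
  origin of the term q/2 in \<open>cs_phase\<close> at \<epsilon> = 0.\<close>

lemma expquot_derivative_0: "(expquot has_real_derivative 1 / 2) (at 0)"
proof -
  have 1: "((\<lambda>h::real. (exp h - 1) / (2 * h)) \<longlongrightarrow> 1 / 2) (at 0)"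
  proof -
    have "((\<lambda>h::real. (exp (0 + h) - exp 0) / h) \<longlongrightarrow> exp 0) (at 0)"
      using DERIV_exp[of "0::real"] by (simp add: DERIV_def)
    then have "((\<lambda>h::real. 1 / 2 * ((exp h - 1) / h)) \<longlongrightarrow> 1 / 2 * 1) (at 0)"
      by (intro tendsto_mult tendsto_const) simp
    then show ?thesis by (simp add: field_simps)
  qed
  have "((\<lambda>h::real. (exp h - 1 - h) / h\<^sup>2) \<longlongrightarrow> 1 / 2) (at 0)"
  proof (rule lhopital[where f'="\<lambda>h. exp h - 1" and g'="\<lambda>h. 2 * h"])
    show "((\<lambda>h::real. exp h - 1 - h) \<longlongrightarrow> 0) (at 0)"
      by (rule tendsto_eq_intros refl | simp)+
    show "((\<lambda>h::real. h\<^sup>2) \<longlongrightarrow> 0) (at 0)"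
      by (rule tendsto_eq_intros refl | simp)+
    show "\<forall>\<^sub>F x::real in at 0. x\<^sup>2 \<noteq> 0" "\<forall>\<^sub>F x::real in at 0. 2 * x \<noteq> 0"
      by (auto simp: eventually_at_filter)
    show "\<forall>\<^sub>F x::real in at 0. ((\<lambda>h. exp h - 1 - h) has_real_derivative exp x - 1) (at x)"
      by (intro always_eventually allI) (auto intro!: derivative_eq_intros)
    show "\<forall>\<^sub>F x::real in at 0. ((\<lambda>h. h\<^sup>2) has_real_derivative 2 * x) (at x)"
      by (intro always_eventually allI) (auto intro!: derivative_eq_intros)
  qed (rule 1)
  then have "((\<lambda>h. (expquot (0 + h) - expquot 0) / h) \<longlongrightarrow> 1 / 2) (at 0)"
    by (rule tendsto_cong[THEN iffD1, rotated])
       (auto simp: eventually_at_filter expquot_def power2_eq_square field_simps)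
  then show ?thesis by (simp add: DERIV_def)
qed

lemma isCont_expquot: "isCont expquot t"
proof (cases "t = 0")
  case True
  then show ?thesis using DERIV_isCont[OF expquot_derivative_0] by simp
next
  case False
  have "isCont (\<lambda>t::real. (exp t - 1) / t) t" using False by (intro continuous_intros) auto
  moreover have "\<forall>\<^sub>F s in nhds t. (exp s - 1) / s = expquot s"
    using t1_space_nhds[OF False] by (rule eventually_mono) (simp add: expquot_def)
  ultimately show ?thesis by (rule isCont_cong[THEN iffD1, rotated])
qed

lemma tendsto_expquot [tendsto_intros]: "(f \<longlongrightarrow> a) F \<Longrightarrow> ((\<lambda>x. expquot (f x)) \<longlongrightarrow> expquot a) F"
  by (rule isCont_tendsto_compose[OF isCont_expquot])

lemma tendsto_cs_phase:
  assumes "(f \<longlongrightarrow> q) F"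
  shows "((\<lambda>x. cs_phase \<epsilon> (f x) t) \<longlongrightarrow> cs_phase \<epsilon> q t) F"
  unfolding cs_phase_def by (cases "\<epsilon> = 0") (auto intro!: tendsto_intros assms)

text \<open>At \<epsilon> = 0 this is a derivative: for \<epsilon> other than 0,
  \<open>cs_phase\<close> is minus the difference quotient of
  \<open>expquot (- \<epsilon> * q) * exp (\<epsilon> * t)\<close>, a function with value 1 and
  derivative t - q/2 at the origin.\<close>

lemma isCont_cs_phase: "isCont (\<lambda>\<epsilon>. cs_phase \<epsilon> q t) \<epsilon>"
proof (cases "\<epsilon> = 0")
  case True
  have "((\<lambda>\<epsilon>. expquot (- \<epsilon> * q) * exp (\<epsilon> * t)) has_real_derivative
      (1 / 2 * (- q)) * exp (0 * t) + (exp (0 * t) * t) * expquot (- 0 * q)) (at 0)"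
  proof (rule DERIV_mult)
    show "((\<lambda>\<epsilon>. expquot (- \<epsilon> * q)) has_real_derivative 1 / 2 * - q) (at 0)"
      by (rule DERIV_chain2[where f=expquot]) (auto simp: expquot_derivative_0 intro!: derivative_eq_intros)
    show "((\<lambda>\<epsilon>. exp (\<epsilon> * t)) has_real_derivative exp (0 * t) * t) (at 0)"
      by (auto intro!: derivative_eq_intros)
  qed
  note deriv = this
  have "((\<lambda>\<epsilon>. (expquot (- \<epsilon> * q) * exp (\<epsilon> * t) - 1) / \<epsilon>) \<longlongrightarrow> t - q / 2) (at 0)"
  proof -
    have "expquot 0 = 1" by (simp add: expquot_def)
    with deriv show ?thesis by (simp add: DERIV_def)
  qed
  then have "((\<lambda>\<epsilon>. - ((expquot (- \<epsilon> * q) * exp (\<epsilon> * t) - 1) / \<epsilon>)) \<longlongrightarrow> - (t - q / 2)) (at 0)"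
    by (rule tendsto_minus)
  then have "((\<lambda>\<epsilon>. cs_phase \<epsilon> q t) \<longlongrightarrow> - (t - q / 2)) (at 0)"
    by (rule tendsto_cong[THEN iffD1, rotated])
       (auto simp: eventually_at_filter cs_phase_def field_simps)
  then show ?thesis using True by (simp add: isCont_def cs_phase_def)
next
  case False
  have "isCont (\<lambda>\<epsilon>. (1 - expquot (- \<epsilon> * q) * exp (\<epsilon> * t)) / \<epsilon>) \<epsilon>"
    unfolding isCont_def by (intro tendsto_intros) (use False in auto)
  moreover have "\<forall>\<^sub>F s in nhds \<epsilon>. (1 - expquot (- s * q) * exp (s * t)) / s = cs_phase s q t"
    using t1_space_nhds[OF False] by (rule eventually_mono) (simp add: cs_phase_def)
  ultimately show ?thesis by (rule isCont_cong[THEN iffD1, rotated])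
qed

lemma continuous_on_sequentiallyI:
  fixes f :: "'a::metric_space \<Rightarrow> 'b::topological_space"
  assumes "\<And>u a. (\<forall>n. u n \<in> S) \<Longrightarrow> a \<in> S \<Longrightarrow> u \<longlonglongrightarrow> a \<Longrightarrow> (\<lambda>n. f (u n)) \<longlonglongrightarrow> f a"
  shows "continuous_on S f"
  unfolding continuous_on_sequentially using assms by (auto simp: comp_def)

lemma continuous_model_rep_group: "continuous_on UNIV (\<lambda>g. model_rep l \<epsilon> g v)"
proof (rule continuous_on_sequentiallyI)
  fix u :: "nat \<Rightarrow> real \<times> real \<times> real" and a assume u: "u \<longlonglongrightarrow> a"
  note f = tendsto_fst[OF u] and s = tendsto_fst[OF tendsto_snd[OF u]] and t = tendsto_snd[OF tendsto_snd[OF u]]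
  have "(\<lambda>n. phase_shift (\<lambda>t. l * (fst (snd (u n)) + snd (snd (u n)) * (cs_phase \<epsilon> (fst (u n)) t - fst (u n) / 2))) (fst (u n)) v)
    \<longlonglongrightarrow> phase_shift (\<lambda>t. l * (fst (snd a) + snd (snd a) * (cs_phase \<epsilon> (fst a) t - fst a / 2))) (fst a) v"
    by (rule tendsto_phase_shift) (auto intro!: tendsto_intros tendsto_cs_phase f s t)
  then show "(\<lambda>n. model_rep l \<epsilon> (u n) v) \<longlonglongrightarrow> model_rep l \<epsilon> a v"
    by (simp add: model_rep_def split_beta')
qed

lemma continuous_model_rep_eps: "continuous_on UNIV (\<lambda>\<epsilon>. model_rep l \<epsilon> g v)"
proof (rule continuous_on_sequentiallyI)
  fix u :: "nat \<Rightarrow> real" and a assume u: "u \<longlonglongrightarrow> a"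
  obtain x y z where g: "g = (x, y, z)" by (cases g)
  have "(\<lambda>n. phase_shift (\<lambda>t. l * (y + z * (cs_phase (u n) x t - x / 2))) x v)
    \<longlonglongrightarrow> phase_shift (\<lambda>t. l * (y + z * (cs_phase a x t - x / 2))) x v"
    by (rule tendsto_phase_shift)
       (auto intro!: tendsto_intros isCont_tendsto_compose[OF isCont_cs_phase] u)
  then show "(\<lambda>n. model_rep l (u n) g v) \<longlonglongrightarrow> model_rep l a g v"
    by (simp add: model_rep_def g)
qed

subsection \<open>The homomorphism property\<close>

text \<open>The wavelet representation seen after the Fourier transform and in the logarithmic
  frequency t with \<omega> = exp (\<epsilon> t): dilation by \<alpha> becomes a translation of t,
  and translation by b \<beta> with b = - l / \<epsilon> becomes a phase linear in \<omega>.\<close>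

definition affine_rep :: "real \<Rightarrow> real \<Rightarrow> real \<times> real \<times> real \<Rightarrow> L2 \<Rightarrow> L2" where
  "affine_rep l \<epsilon> = (\<lambda>(\<alpha>, \<beta>, \<gamma>). phase_shift (\<lambda>t. l / \<epsilon> * (\<gamma> - \<beta> * exp (\<epsilon> * t))) (- ln \<alpha> / \<epsilon>))"

lemma model_rep_eq_affine_rep:
  assumes "\<epsilon> \<noteq> 0" shows "model_rep l \<epsilon> g = affine_rep l \<epsilon> (P_eps \<epsilon> g)"
proof -
  obtain x y z where g: "g = (x, y, z)" by (cases g)
  have "l * (y + z * (cs_phase \<epsilon> x t - x / 2))
     = l / \<epsilon> * (z + \<epsilon> * (y - x * z / 2) - z * expquot (- \<epsilon> * x) * exp (\<epsilon> * t))" for t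
    using assms by (simp add: cs_phase_def field_simps)
  then show ?thesis using assms by (simp add: g model_rep_def affine_rep_def P_eps_def)
qed

lemma affine_rep_mult:
  assumes "\<epsilon> \<noteq> 0" "g \<in> carrier EA" "h \<in> carrier EA"
  shows "affine_rep l \<epsilon> (g \<otimes>\<^bsub>EA\<^esub> h) = affine_rep l \<epsilon> g \<circ> affine_rep l \<epsilon> h"
proof -
  obtain a b c where g: "g = (a, b, c)" by (cases g)
  obtain a' b' c' where h: "h = (a', b', c')" by (cases h)
  have p: "a > 0" "a' > 0" using assms by (auto simp: g h EA_def)
  have e: "exp (\<epsilon> * (t - - ln a / \<epsilon>)) = a * exp (\<epsilon> * t)" for t
    using p assms(1) by (simp add: distrib_left exp_add)
  have "l / \<epsilon> * (c - b * exp (\<epsilon> * t)) + l / \<epsilon> * (c' - b' * exp (\<epsilon> * (t - - ln a / \<epsilon>)))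
      = l / \<epsilon> * (c + c' - (a * b' + b) * exp (\<epsilon> * t))" for t
    unfolding e by (simp add: ring_distribs add_divide_distrib diff_divide_distrib mult_ac)
  moreover have "- ln a / \<epsilon> + - ln a' / \<epsilon> = - ln (a * a') / \<epsilon>"
    using p by (simp add: ln_mult diff_divide_distrib)
  ultimately show ?thesis
    by (simp add: fun_eq_iff g h EA_def affine_rep_def phase_shift_comp)
qed

lemma carrier_G_eps [simp]: "carrier (G_eps \<epsilon>) = UNIV"
  by (simp add: G_eps_def heisenberg_def)

text \<open>For \<epsilon> other than 0 the product of \<open>G_eps\<close> is known only through
  the inverse of \<open>P_eps\<close>, so the homomorphism property is checked in \<open>EA\<close>
  and pulled back; the Heisenberg case is a direct computation.\<close>

lemma model_rep_hom: "model_rep l \<epsilon> \<in> hom (G_eps \<epsilon>) unitary_group"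
proof (rule homI)
  show "model_rep l \<epsilon> g \<in> carrier unitary_group" for g
    unfolding model_rep_def split_beta' by (rule phase_shift_in_unitary_group) measurable
  fix g h
  show "model_rep l \<epsilon> (g \<otimes>\<^bsub>G_eps \<epsilon>\<^esub> h) = model_rep l \<epsilon> g \<otimes>\<^bsub>unitary_group\<^esub> model_rep l \<epsilon> h"
  proof (cases "\<epsilon> = 0")
    case True
    obtain a b c where g: "g = (a, b, c)" by (cases g)
    obtain a' b' c' where h: "h = (a', b', c')" by (cases h)
    have "l * (b + c * (cs_phase 0 a t - a / 2)) + l * (b' + c' * (cs_phase 0 a' (t - a) - a' / 2))
       = l * (b + b' + a * c' + (c + c') * (cs_phase 0 (a + a') t - (a + a') / 2))" for t
      by (simp add: cs_phase_def algebra_simps add_divide_distrib)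
    then show ?thesis
      by (simp add: True unitary_group_def G_eps_def heisenberg_def g h model_rep_def phase_shift_comp fun_eq_iff)
  next
    case False
    have car: "P_eps \<epsilon> g \<in> carrier EA" for g
      using bij_betw_P_eps[OF False] by (auto simp: bij_betw_def)
    have "P_eps \<epsilon> (g \<otimes>\<^bsub>G_eps \<epsilon>\<^esub> h) = P_eps \<epsilon> g \<otimes>\<^bsub>EA\<^esub> P_eps \<epsilon> h"
      using P_eps_iso[OF False] by (intro hom_mult) (auto simp: iso_def)
    then show ?thesis
      by (simp add: model_rep_eq_affine_rep[OF False] affine_rep_mult[OF False car car] unitary_group_def)
  qed
qed

lemma model_rep_unitary: "unitary_rep (G_eps \<epsilon>) (model_rep l \<epsilon>)"
  by (simp add: unitary_rep_def model_rep_hom continuous_model_rep_group)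

subsection \<open>Orthogonal projection and Riesz representation\<close>

lemma csubspace_scaleR: "csubspace_L2 S \<Longrightarrow> u \<in> S \<Longrightarrow> r *\<^sub>R u \<in> S"
  unfolding csubspace_L2_def scaleR_L2_def by blast

text \<open>A minimizing sequence is Cauchy: midpoints stay in the subspace, hence at distance at
  least \<open>d\<close>, and the parallelogram law \<open>par\<close> then bounds the distance of
  two members by their excesses \<open>b\<close>.\<close>

lemma closed_csubspace_nearest:
  assumes S: "csubspace_L2 S" "closed S"
  shows "\<exists>s\<in>S. \<forall>t\<in>S. norm (u - s) \<le> norm (u - t)"
proof -
  define d where "d = (INF t\<in>S. norm (u - t))"
  have ne: "S \<noteq> {}" using S(1) by (auto simp: csubspace_L2_def)
  have bdd: "bdd_below ((\<lambda>t. norm (u - t)) ` S)" by (auto intro: bdd_belowI[of _ 0])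
  have d: "d \<le> norm (u - t)" if "t \<in> S" for t
    unfolding d_def using bdd that by (rule cINF_lower)
  have d0: "d \<ge> 0" unfolding d_def using ne by (intro cINF_greatest) auto
  have "\<exists>s\<in>S. norm (u - s) < d + 1 / real (Suc n)" for n
    using cINF_less_iff[OF ne bdd, of "d + 1 / real (Suc n)"] by (simp add: d_def)
  then obtain s where s: "\<And>n. s n \<in> S" "\<And>n. norm (u - s n) < d + 1 / real (Suc n)" by metis
  have par: "(norm (x - y))\<^sup>2 = 2 * (norm (u - x))\<^sup>2 + 2 * (norm (u - y))\<^sup>2 - 4 * (norm (u - (1/2) *\<^sub>R (x + y)))\<^sup>2" for x y
    by (simp add: power2_norm_eq_inner inner_diff_left inner_diff_right inner_add_left inner_add_right
        inner_commute[of x y] inner_commute[of x u] inner_commute[of y u] algebra_simps)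
  define b where "b n = (d + 1 / real (Suc n))\<^sup>2 - d\<^sup>2" for n
  have sq: "(norm (u - s n))\<^sup>2 \<le> d\<^sup>2 + b n" for n
    using power_mono[OF less_imp_le[OF s(2)[of n]], of 2] by (simp add: b_def)
  have b0: "b \<longlonglongrightarrow> 0"
  proof -
    have "(\<lambda>n. (d + 1 / real (Suc n))\<^sup>2 - d\<^sup>2) \<longlonglongrightarrow> (d + 0)\<^sup>2 - d\<^sup>2"
      by (intro tendsto_intros LIMSEQ_Suc[OF lim_inverse_n', simplified inverse_eq_divide] )
    then show ?thesis by (simp add: b_def[abs_def])
  qed
  have close: "(norm (s m - s n))\<^sup>2 \<le> 2 * b m + 2 * b n" for m n
  proof -
    have "(1/2) *\<^sub>R (s m + s n) \<in> S"
      using s(1) S(1) by (intro csubspace_scaleR[OF S(1)]) (simp add: csubspace_L2_def)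
    then have "d\<^sup>2 \<le> (norm (u - (1/2) *\<^sub>R (s m + s n)))\<^sup>2" using d d0 by (intro power_mono) auto
    then show ?thesis using par[of "s m" "s n"] sq[of m] sq[of n] by linarith
  qed
  have "Cauchy s"
  proof (rule CauchyI)
    fix e :: real assume e: "e > 0"
    have "\<forall>\<^sub>F n in sequentially. b n < e\<^sup>2 / 4" using e by (intro order_tendstoD(2)[OF b0]) auto
    then obtain N where N: "\<And>n. n \<ge> N \<Longrightarrow> b n < e\<^sup>2 / 4" by (auto simp: eventually_sequentially)
    have "norm (s m - s n) < e" if "m \<ge> N" "n \<ge> N" for m n
    proof (rule power2_less_imp_less)
      show "(norm (s m - s n))\<^sup>2 < e\<^sup>2" using close[of m n] N[OF that(1)] N[OF that(2)] by linarith
    qed (use e in auto)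
    then show "\<exists>M. \<forall>m\<ge>M. \<forall>n\<ge>M. norm (s m - s n) < e" by blast
  qed
  then obtain l where l: "s \<longlonglongrightarrow> l" using Cauchy_convergent_iff convergent_def by blast
  have lS: "l \<in> S" using S(2) s(1) l by (metis closed_sequentially)
  have "norm (u - l) \<le> d + 0"
  proof (rule LIMSEQ_le)
    show "(\<lambda>n. norm (u - s n)) \<longlonglongrightarrow> norm (u - l)" by (intro tendsto_intros l)
    show "(\<lambda>n. d + 1 / real (Suc n)) \<longlonglongrightarrow> d + 0"
      by (intro tendsto_intros LIMSEQ_Suc[OF lim_inverse_n', simplified inverse_eq_divide])
  qed (use s(2) in \<open>auto intro!: exI[of _ 0] less_imp_le\<close>)
  then show ?thesis using lS d by (intro bexI[of _ l]) (auto intro: order_trans)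
qed

lemma exists_orthogonal:
  assumes S: "csubspace_L2 S" "closed S" "S \<noteq> UNIV"
  shows "\<exists>w. w \<noteq> 0 \<and> (\<forall>s\<in>S. cinner s w = 0)"
proof -
  obtain u where u: "u \<notin> S" using S(3) by auto
  obtain s where s: "s \<in> S" "\<And>t. t \<in> S \<Longrightarrow> norm (u - s) \<le> norm (u - t)"
    using closed_csubspace_nearest[OF S(1,2)] by blast
  define w where "w = u - s"
  have w: "w \<noteq> 0" using u s(1) by (auto simp: w_def)
  have inn: "inner t w = 0" if t: "t \<in> S" for t
  proof (rule ccontr)
    assume nz: "inner t w \<noteq> 0"
    then have t0: "inner t t \<noteq> 0" by auto
    \<comment> \<open>The coefficient of the projection of \<open>w\<close> to \<open>t\<close>:
      moving the nearest point by \<open>r *\<^sub>R t\<close> would shorten the distance unless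
      \<open>inner t w\<close> vanishes.\<close>
    define r where "r = inner t w / inner t t"
    have "s + r *\<^sub>R t \<in> S" using S(1) s(1) t csubspace_scaleR[OF S(1) t] by (simp add: csubspace_L2_def)
    then have "norm w \<le> norm (w - r *\<^sub>R t)" using s(2) by (fastforce simp: w_def algebra_simps)
    then have "inner w w \<le> inner (w - r *\<^sub>R t) (w - r *\<^sub>R t)" by (simp add: norm_le)
    also have "\<dots> = inner w w - (inner t w)\<^sup>2 / inner t t"
      using t0 by (simp add: inner_diff_left inner_diff_right inner_commute[of w t] r_def power2_eq_square field_simps)
    finally have "(inner t w)\<^sup>2 / inner t t \<le> 0" by simp
    moreover have "(inner t w)\<^sup>2 / inner t t > 0"
      using nz t0 inner_ge_zero[of t] by (intro divide_pos_pos) (auto simp: less_le)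
    ultimately show False by simp
  qed
  have "cinner t w = 0" if t: "t \<in> S" for t
  proof (rule complex_eqI)
    \<comment> \<open>Real orthogonality to both \<open>t\<close> and i times \<open>t\<close>
      amounts to complex orthogonality.\<close>
    have "\<i> *\<^sub>C t \<in> S" using S(1) t by (simp add: csubspace_L2_def)
    then show "Im (cinner t w) = Im 0" using inn by (simp add: Im_cinner)
  qed (use inn[OF t] in \<open>simp add: Re_cinner\<close>)
  then show ?thesis using w by blast
qed

text \<open>If the functional is not zero, its kernel has codimension one, so a vector orthogonal to
  the kernel represents it up to scaling. This is what makes sense of the operator averages that
  define the vacuum vector.\<close>

lemma riesz_representation:
  fixes f :: "L2 \<Rightarrow> complex"
  assumes add: "\<And>u v. f (u + v) = f u + f v" and scale: "\<And>c u. f (c *\<^sub>C u) = c * f u"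
    and bound: "\<And>u. cmod (f u) \<le> K * norm u"
  shows "\<exists>w. \<forall>u. f u = cinner w u"
proof -
  have bl: "bounded_linear f"
    by standard (auto simp: add scaleR_L2_def scale scaleR_conv_of_real mult.commute[of _ K] intro!: exI[of _ K] bound)
  define S where "S = {u. f u = 0}"
  have z: "f 0 = 0" using scale[of 0 0] by simp
  have S: "csubspace_L2 S" by (auto simp: csubspace_L2_def S_def add scale z)
  have "closed S" unfolding S_def
    by (intro closed_Collect_eq continuous_intros linear_continuous_on[OF bl])
  show ?thesis
  proof (cases "S = UNIV")
    case True
    then have "\<forall>u. f u = cinner 0 u" by (auto simp: S_def)
    then show ?thesis by blast
  next
    case False
    then obtain w where w: "w \<noteq> 0" "\<And>s. s \<in> S \<Longrightarrow> cinner s w = 0"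
      using exists_orthogonal[OF S \<open>closed S\<close>] by blast
    define a where "a = f w / cinner w w"
    have ww: "cinner w w \<noteq> 0" using w(1) by (simp add: cinner_self)
    have fw: "f w \<noteq> 0" using w ww by (auto simp: S_def)
    have "f u = cinner (cnj a *\<^sub>C w) u" for u
    proof -
      have "f (u - (f u / f w) *\<^sub>C w) = 0"
        using fw add[of "u - (f u / f w) *\<^sub>C w" "(f u / f w) *\<^sub>C w"] by (simp add: scale)
      then have "cinner (u - (f u / f w) *\<^sub>C w) w = 0" using w(2) by (simp add: S_def)
      then have "cinner w (u - (f u / f w) *\<^sub>C w) = 0" by (metis cinner_commute complex_cnj_zero)
      then have "cinner w u = f u / f w * cinner w w" by (simp add: cinner_diff_right cinner_scaleC_right)
      then show ?thesis using fw ww by (simp add: cinner_scaleC_left a_def)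
    qed
    then show ?thesis by blast
  qed
qed

subsection \<open>Irreducibility of the model\<close>

text \<open>If \<psi> lies in an invariant subspace and u is orthogonal to it, all coefficients of u
  against the coherent states of \<psi> vanish. By \<open>nn_coherent_model\<close> the product of
  the squared norm of u and the moment of \<psi> is then zero; the moment may be infinite, but it is
  zero only for \<psi> = 0.\<close>

lemma model_rep_irreducible:
  assumes \<epsilon>: "\<epsilon> \<ge> 0" and l: "l \<noteq> 0"
  shows "unitary_irrep (G_eps \<epsilon>) (model_rep l \<epsilon>)"
  unfolding unitary_irrep_def
proof (intro conjI model_rep_unitary allI impI, elim conjE)
  fix S assume S: "csubspace_L2 S" "closed S" and inv: "\<forall>g\<in>carrier (G_eps \<epsilon>). model_rep l \<epsilon> g ` S \<subseteq> S"
  show "S = {0} \<or> S = UNIV"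
  proof (rule ccontr)
    assume *: "\<not> (S = {0} \<or> S = UNIV)"
    moreover have "0 \<in> S" using S(1) by (simp add: csubspace_L2_def)
    ultimately obtain \<psi> where \<psi>: "\<psi> \<in> S" "\<psi> \<noteq> 0" by auto
    obtain u where u: "u \<noteq> 0" "\<And>s. s \<in> S \<Longrightarrow> cinner s u = 0"
      using exists_orthogonal[OF S] * by blast
    have "cinner u (coherent (model_rep l \<epsilon>) \<psi> x) = 0" for x
    proof -
      have "cs_section x \<in> carrier (G_eps \<epsilon>)" by simp
      then have "coherent (model_rep l \<epsilon>) \<psi> x \<in> S"
        using bspec[OF inv] \<psi>(1) unfolding coherent_def by blast
      then show ?thesis using u(2) cinner_commute[of u] by simp
    qed
    then have "ennreal (2 * pi / \<bar>l\<bar>) * ennreal ((norm u)\<^sup>2) * (\<integral>\<^sup>+s. ennreal ((cmod (L2_fun \<psi> s))\<^sup>2 * exp (- \<epsilon> * s)) \<partial>lborel) = 0"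
      using nn_coherent_model[OF \<epsilon> l, of u \<psi>] by simp
    then have "(\<integral>\<^sup>+s. ennreal ((cmod (L2_fun \<psi> s))\<^sup>2 * exp (- \<epsilon> * s)) \<partial>lborel) = 0"
      using l u(1) by (auto simp: ennreal_eq_0_iff divide_le_0_iff not_le[of pi 0, THEN iffD2, OF pi_gt_zero])
    then have "AE s in lborel. L2_fun \<psi> s = 0"
      by (subst (asm) nn_integral_0_iff_AE) (auto simp: ennreal_eq_0_iff mult_le_0_iff elim!: eventually_mono)
    then have "L2_of (L2_fun \<psi>) = 0" by (simp add: L2_of_eq_0_iff square_integrable_L2_fun)
    then show False using \<psi>(2) by (simp add: L2_of_L2_fun)
  qed
qed

subsection \<open>The Fourier transform on $L^2(R)$\<close>

text \<open>Real polarization recovers \<open>inner\<close> from the norm, and complex linearity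
  recovers the imaginary part of \<open>cinner\<close>.\<close>

lemma isometric_L2I:
  assumes "clinear_L2 T" and n: "\<And>u. norm (T u) = norm u"
  shows "isometric_L2 T"
proof -
  have add: "T (u + v) = T u + T v" and sc: "T (c *\<^sub>C u) = c *\<^sub>C T u" for u v c
    using assms(1) by (auto simp: clinear_L2_def)
  have pol: "inner u v = ((norm (u + v))\<^sup>2 - (norm u)\<^sup>2 - (norm v)\<^sup>2) / 2" for u v :: L2
    by (simp add: power2_norm_eq_inner inner_add_left inner_add_right inner_commute)
  have in': "inner (T u) (T v) = inner u v" for u v
    by (simp only: pol n flip: add)
  have "cinner (T u) (T v) = cinner u v" for u v
    by (rule complex_eqI) (simp_all only: Re_cinner Im_cinner in' flip: sc)
  then show ?thesis by (simp add: isometric_L2_def)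
qed

definition L1_L2 :: "(real \<Rightarrow> complex) \<Rightarrow> bool" where
  "L1_L2 g \<longleftrightarrow> integrable lborel g \<and> square_integrable g"

definition cutoff :: "real \<Rightarrow> (real \<Rightarrow> complex) \<Rightarrow> real \<Rightarrow> complex" where
  "cutoff R f x = indicator {-R..R} x *\<^sub>R f x"

text \<open>The sign treats the transform and its inverse together: \<open>- 1\<close> is the
  convention of \<open>truncated_fourier\<close>, and \<open>1\<close> is its inverse.\<close>

definition fourier_fun :: "real \<Rightarrow> (real \<Rightarrow> complex) \<Rightarrow> real \<Rightarrow> complex" where
  "fourier_fun \<sigma> g \<omega> = fourier_int g (\<sigma> * \<omega>) / of_real (sqrt (2 * pi))"

lemma L1_L2D [dest]: "L1_L2 g \<Longrightarrow> integrable lborel g" "L1_L2 g \<Longrightarrow> square_integrable g"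
  by (simp_all add: L1_L2_def)

lemma L1_L2_add: "L1_L2 f \<Longrightarrow> L1_L2 g \<Longrightarrow> L1_L2 (\<lambda>x. f x + g x)"
  by (simp add: L1_L2_def square_integrable_add)

lemma L1_L2_diff: "L1_L2 f \<Longrightarrow> L1_L2 g \<Longrightarrow> L1_L2 (\<lambda>x. f x - g x)"
  by (simp add: L1_L2_def square_integrable_diff)

lemma L1_L2_scale: "L1_L2 f \<Longrightarrow> L1_L2 (\<lambda>x. c * f x)"
  by (simp add: L1_L2_def square_integrable_scale)

lemma L1_L2_cutoff:
  assumes f: "square_integrable f" shows "L1_L2 (cutoff R f)"
proof -
  have [measurable]: "f \<in> borel_measurable borel" using f by measurable
  have fi: "integrable lborel (\<lambda>x. (cmod (f x))\<^sup>2)" using f by (simp add: square_integrable_def)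
  have ii: "integrable lborel (\<lambda>x. indicator {-R..R} x :: real)"
    by (rule integrable_real_indicator) (auto simp: emeasure_lborel_Icc_eq)
  have "integrable lborel (cutoff R f)"
  proof (rule Bochner_Integration.integrable_bound[OF Bochner_Integration.integrable_add[OF fi ii]])
    have "t \<le> t\<^sup>2 + 1" for t :: real
      using zero_le_power2[of "t - 1/2"] by (simp add: power2_eq_square algebra_simps)
    then show "AE x in lborel. norm (cutoff R f x) \<le> norm ((cmod (f x))\<^sup>2 + indicator {-R..R} x)"
      by (auto simp: cutoff_def indicator_def)
  qed (simp add: cutoff_def[abs_def])
  moreover have "square_integrable (cutoff R f)"
    unfolding square_integrable_def
    by (intro conjI Bochner_Integration.integrable_bound[OF fi])
       (auto simp: cutoff_def[abs_def] indicator_def)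
  ultimately show ?thesis by (simp add: L1_L2_def)
qed

lemma fourier_int_add: "integrable lborel f \<Longrightarrow> integrable lborel g \<Longrightarrow>
    fourier_int (\<lambda>x. f x + g x) p = fourier_int f p + fourier_int g p"
  and fourier_int_diff: "integrable lborel f \<Longrightarrow> integrable lborel g \<Longrightarrow>
    fourier_int (\<lambda>x. f x - g x) p = fourier_int f p - fourier_int g p"
proof -
  have i: "integrable lborel (\<lambda>t. cis (p * t) * f t)" if f: "integrable lborel f" for f :: "real \<Rightarrow> complex"
    using f by (intro Bochner_Integration.integrable_bound[OF f]) (auto simp: norm_mult dest: borel_measurable_integrable)
  show "integrable lborel f \<Longrightarrow> integrable lborel g \<Longrightarrow>
    fourier_int (\<lambda>x. f x + g x) p = fourier_int f p + fourier_int g p"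
    "integrable lborel f \<Longrightarrow> integrable lborel g \<Longrightarrow>
    fourier_int (\<lambda>x. f x - g x) p = fourier_int f p - fourier_int g p"
    by (simp_all add: fourier_int_def distrib_left right_diff_distrib i)
qed

lemma fourier_int_scale: "fourier_int (\<lambda>x. c * f x) p = c * fourier_int f p"
  by (simp add: fourier_int_def mult.left_commute)

lemma fourier_fun_square_integrable:
  assumes g: "L1_L2 g" and \<sigma>: "\<bar>\<sigma>\<bar> = 1"
  shows "square_integrable (fourier_fun \<sigma> g)"
    and "norm (L2_of (fourier_fun \<sigma> g)) = norm (L2_of g)"
proof -
  have [measurable]: "g \<in> borel_measurable borel" using g by (auto dest: borel_measurable_integrable)
  have [measurable]: "fourier_int g \<in> borel_measurable borel" by (rule measurable_fourier_int) measurable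
  have m [measurable]: "fourier_fun \<sigma> g \<in> borel_measurable borel"
    unfolding fourier_fun_def[abs_def] by measurable
  have "(\<integral>\<^sup>+\<omega>. ennreal ((cmod (fourier_fun \<sigma> g \<omega>))\<^sup>2) \<partial>lborel)
     = (\<integral>\<^sup>+\<omega>. ennreal (1 / (2 * pi)) * ennreal ((cmod (fourier_int g (0 + \<sigma> * \<omega>)))\<^sup>2) \<partial>lborel)"
    by (simp add: fourier_fun_def norm_divide power_divide flip: ennreal_mult)
  also have "\<dots> = ennreal (1 / (2 * pi)) * (\<integral>\<^sup>+\<omega>. ennreal ((cmod (fourier_int g (0 + \<sigma> * \<omega>)))\<^sup>2) \<partial>lborel)"
    by (rule nn_integral_cmult) measurable
  also have "(\<integral>\<^sup>+\<omega>. ennreal ((cmod (fourier_int g (0 + \<sigma> * \<omega>)))\<^sup>2) \<partial>lborel) = (\<integral>\<^sup>+\<omega>. ennreal ((cmod (fourier_int g \<omega>))\<^sup>2) \<partial>lborel)"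
    using nn_integral_real_affine[of "\<lambda>p. ennreal ((cmod (fourier_int g p))\<^sup>2)" \<sigma> 0] \<sigma> by fastforce
  also have "\<dots> = ennreal (2 * pi) * (\<integral>\<^sup>+t. ennreal ((cmod (g t))\<^sup>2) \<partial>lborel)"
    using g by (intro plancherel_nn) auto
  also have "ennreal (1 / (2 * pi)) * \<dots> = (\<integral>\<^sup>+t. ennreal ((cmod (g t))\<^sup>2) \<partial>lborel)"
    by (subst mult.assoc[symmetric], subst ennreal_mult[symmetric]) (auto simp: divide_nonneg_pos)
  finally have e: "(\<integral>\<^sup>+\<omega>. ennreal ((cmod (fourier_fun \<sigma> g \<omega>))\<^sup>2) \<partial>lborel) = (\<integral>\<^sup>+t. ennreal ((cmod (g t))\<^sup>2) \<partial>lborel)" .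
  have gs: "square_integrable g" using g by auto
  have "(\<integral>\<^sup>+t. ennreal ((cmod (g t))\<^sup>2) \<partial>lborel) < \<infinity>" using gs by (subst square_integrable_iff_nn[symmetric]) auto
  then show s: "square_integrable (fourier_fun \<sigma> g)" using e by (simp add: square_integrable_iff_nn)
  show "norm (L2_of (fourier_fun \<sigma> g)) = norm (L2_of g)"
    using e unfolding nn_norm_L2_of[OF s, symmetric] nn_norm_L2_of[OF gs, symmetric]
    by (simp add: power2_eq_iff_nonneg)
qed

lemma norm_fourier_fun_diff:
  assumes g: "L1_L2 g" and h: "L1_L2 h" and \<sigma>: "\<bar>\<sigma>\<bar> = 1"
  shows "norm (L2_of (fourier_fun \<sigma> g) - L2_of (fourier_fun \<sigma> h)) = norm (L2_of g - L2_of h)"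
proof -
  have "fourier_fun \<sigma> (\<lambda>x. g x - h x) = (\<lambda>\<omega>. fourier_fun \<sigma> g \<omega> - fourier_fun \<sigma> h \<omega>)"
    using g h by (simp add: fun_eq_iff fourier_fun_def fourier_int_diff[OF L1_L2D(1) L1_L2D(1)] diff_divide_distrib)
  then show ?thesis
    using fourier_fun_square_integrable(2)[OF L1_L2_diff[OF g h] \<sigma>]
    by (simp add: L2_of_diff fourier_fun_square_integrable(1)[OF _ \<sigma>] g h L1_L2D)
qed

lemma tendsto_cutoff: "((\<lambda>R. L2_of (cutoff R (L2_fun f))) \<longlongrightarrow> f) at_top"
proof -
  define h where "h = L2_fun f"
  have h: "square_integrable h" by (simp add: h_def square_integrable_L2_fun)
  have [measurable]: "h \<in> borel_measurable borel" using h by measurable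
  have hi: "integrable lborel (\<lambda>x. (cmod (h x))\<^sup>2)" using h by (simp add: square_integrable_def)
  have L1_L2: "square_integrable (cutoff R h)" for R using L1_L2_cutoff[OF h] by auto
  have sq: "(norm (L2_of (cutoff R h) - f))\<^sup>2 = (\<integral>x. (cmod (cutoff R h x - h x))\<^sup>2 \<partial>lborel)" for R
    using norm_L2_of[OF square_integrable_diff[OF L1_L2[of R] h]]
    by (simp add: L2_of_diff[symmetric] L1_L2 h) (simp add: h_def L2_of_L2_fun)
  have "((\<lambda>R. \<integral>x. (cmod (cutoff R h x - h x))\<^sup>2 \<partial>lborel) \<longlongrightarrow> (\<integral>x. 0 \<partial>(lborel::real measure))) at_top"
  proof (rule integral_dominated_convergence_at_top[where w="\<lambda>x. (cmod (h x))\<^sup>2"])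
    have "\<forall>\<^sub>F R in at_top. (cmod (cutoff R h x - h x))\<^sup>2 = 0" for x
      using eventually_ge_at_top[of "\<bar>x\<bar>"] by eventually_elim (auto simp: cutoff_def indicator_def)
    then show "AE x in lborel. ((\<lambda>R. (cmod (cutoff R h x - h x))\<^sup>2) \<longlongrightarrow> 0) at_top"
      by (intro AE_I2 tendsto_eventually)
    show "\<forall>\<^sub>F R in at_top. AE x in lborel. norm ((cmod (cutoff R h x - h x))\<^sup>2) \<le> (cmod (h x))\<^sup>2"
      by (intro always_eventually allI AE_I2) (auto simp: cutoff_def indicator_def)
  qed (auto simp: hi cutoff_def)
  then have "((\<lambda>R. (norm (L2_of (cutoff R h) - f))\<^sup>2) \<longlongrightarrow> 0) at_top" by (simp add: sq)
  then show ?thesis unfolding h_def by (subst tendsto_iff_norm_square)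
qed

lemma L1_L2_dense: "\<exists>g. (\<forall>n::nat. L1_L2 (g n)) \<and> (\<lambda>n. L2_of (g n)) \<longlonglongrightarrow> f"
proof (intro exI conjI allI)
  show "L1_L2 (cutoff (real n) (L2_fun f))" for n by (intro L1_L2_cutoff square_integrable_L2_fun)
  show "(\<lambda>n. L2_of (cutoff (real n) (L2_fun f))) \<longlonglongrightarrow> f"
    using filterlim_compose[OF tendsto_cutoff filterlim_real_sequentially] by simp
qed

section \<open>Extension of the Fourier transform to all of \<open>L2\<close> and its
  inversion\<close>

definition fourier :: "real \<Rightarrow> L2 \<Rightarrow> L2" where
  "fourier \<sigma> f = lim (\<lambda>n. L2_of (fourier_fun \<sigma> (cutoff (real n) (L2_fun f))))"

text \<open>A mixed isometry between the integral transform and its extension. It yields convergence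
  along arbitrary approximations and filters, linearity, and with \<open>g\<close> zero the
  preservation of norms.\<close>

lemma norm_fourier_diff_L1_L2:
  assumes g: "L1_L2 g" and \<sigma>: "\<bar>\<sigma>\<bar> = 1"
  shows "norm (L2_of (fourier_fun \<sigma> g) - fourier \<sigma> f) = norm (L2_of g - f)"
proof -
  define c where "c n = cutoff (real n) (L2_fun f)" for n
  have c: "L1_L2 (c n)" for n unfolding c_def by (intro L1_L2_cutoff square_integrable_L2_fun)
  have lim: "(\<lambda>n. L2_of (c n)) \<longlonglongrightarrow> f"
    unfolding c_def using filterlim_compose[OF tendsto_cutoff filterlim_real_sequentially] by simp
  have "Cauchy (\<lambda>n. L2_of (fourier_fun \<sigma> (c n)))"
    using LIMSEQ_imp_Cauchy[OF lim] unfolding Cauchy_def dist_norm norm_fourier_fun_diff[OF c c \<sigma>] .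
  then have "(\<lambda>n. L2_of (fourier_fun \<sigma> (c n))) \<longlonglongrightarrow> fourier \<sigma> f"
    unfolding fourier_def c_def[symmetric] by (metis Cauchy_convergent_iff convergent_LIMSEQ_iff)
  then have "(\<lambda>n. norm (L2_of (fourier_fun \<sigma> g) - L2_of (fourier_fun \<sigma> (c n)))) \<longlonglongrightarrow> norm (L2_of (fourier_fun \<sigma> g) - fourier \<sigma> f)"
    by (intro tendsto_intros)
  moreover have "(\<lambda>n. norm (L2_of g - L2_of (c n))) \<longlonglongrightarrow> norm (L2_of g - f)"
    by (intro tendsto_intros lim)
  ultimately show ?thesis
    unfolding norm_fourier_fun_diff[OF g c \<sigma>] by (rule LIMSEQ_unique)
qed

lemma tendsto_fourier_L1_L2:
  assumes "\<And>x. L1_L2 (g x)" and \<sigma>: "\<bar>\<sigma>\<bar> = 1" and "((\<lambda>x. L2_of (g x)) \<longlongrightarrow> f) F"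
  shows "((\<lambda>x. L2_of (fourier_fun \<sigma> (g x))) \<longlongrightarrow> fourier \<sigma> f) F"
  using assms(3) norm_fourier_diff_L1_L2[OF assms(1) \<sigma>] by (simp add: tendsto_iff dist_norm)

lemma norm_fourier:
  assumes \<sigma>: "\<bar>\<sigma>\<bar> = 1" shows "norm (fourier \<sigma> f) = norm f"
proof -
  have "L1_L2 (\<lambda>x. 0)" by (simp add: L1_L2_def square_integrable_zero)
  moreover have "L2_of (\<lambda>x. 0) = 0" by (simp add: L2_of_eq_0_iff square_integrable_zero)
  moreover have "fourier_fun \<sigma> (\<lambda>x. 0) = (\<lambda>x. 0)" by (simp add: fourier_fun_def fun_eq_iff fourier_int_def)
  ultimately show ?thesis using norm_fourier_diff_L1_L2[of "\<lambda>x. 0" \<sigma> f] \<sigma> by simp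
qed

lemma clinear_fourier:
  assumes \<sigma>: "\<bar>\<sigma>\<bar> = 1" shows "clinear_L2 (fourier \<sigma>)"
  unfolding clinear_L2_def
proof (intro conjI allI)
  fix f h c
  obtain g where g: "\<And>n::nat. L1_L2 (g n)" "(\<lambda>n. L2_of (g n)) \<longlonglongrightarrow> f" using L1_L2_dense by blast
  obtain k where k: "\<And>n::nat. L1_L2 (k n)" "(\<lambda>n. L2_of (k n)) \<longlonglongrightarrow> h" using L1_L2_dense by blast
  have "(\<lambda>n. L2_of (\<lambda>x. g n x + k n x)) \<longlonglongrightarrow> f + h"
    using tendsto_add[OF g(2) k(2)] by (simp add: L2_of_add L1_L2D g k)
  then have "(\<lambda>n. L2_of (fourier_fun \<sigma> (\<lambda>x. g n x + k n x))) \<longlonglongrightarrow> fourier \<sigma> (f + h)"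
    by (intro tendsto_fourier_L1_L2 L1_L2_add g k \<sigma>)
  moreover have "L2_of (fourier_fun \<sigma> (\<lambda>x. g n x + k n x)) = L2_of (fourier_fun \<sigma> (g n)) + L2_of (fourier_fun \<sigma> (k n))" for n
    by (simp add: L2_of_add fourier_fun_square_integrable g k \<sigma>)
       (simp add: fourier_fun_def[abs_def] fourier_int_add L1_L2D g k add_divide_distrib)
  moreover have "(\<lambda>n. L2_of (fourier_fun \<sigma> (g n)) + L2_of (fourier_fun \<sigma> (k n))) \<longlonglongrightarrow> fourier \<sigma> f + fourier \<sigma> h"
    by (intro tendsto_add tendsto_fourier_L1_L2 g k \<sigma>)
  ultimately show "fourier \<sigma> (f + h) = fourier \<sigma> f + fourier \<sigma> h" using LIMSEQ_unique by simp
  have "(\<lambda>n. L2_of (\<lambda>x. c * g n x)) \<longlonglongrightarrow> c *\<^sub>C f"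
    using tendsto_scaleC[OF g(2), of c] by (simp add: L2_of_scaleC L1_L2D g)
  then have "(\<lambda>n. L2_of (fourier_fun \<sigma> (\<lambda>x. c * g n x))) \<longlonglongrightarrow> fourier \<sigma> (c *\<^sub>C f)"
    by (intro tendsto_fourier_L1_L2 L1_L2_scale g \<sigma>)
  moreover have "L2_of (fourier_fun \<sigma> (\<lambda>x. c * g n x)) = c *\<^sub>C L2_of (fourier_fun \<sigma> (g n))" for n
    by (simp add: L2_of_scaleC fourier_fun_square_integrable g \<sigma>)
       (simp add: fourier_fun_def[abs_def] fourier_int_scale)
  moreover have "(\<lambda>n. c *\<^sub>C L2_of (fourier_fun \<sigma> (g n))) \<longlonglongrightarrow> c *\<^sub>C fourier \<sigma> f"
    by (intro tendsto_scaleC tendsto_fourier_L1_L2 g \<sigma>)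
  ultimately show "fourier \<sigma> (c *\<^sub>C f) = c *\<^sub>C fourier \<sigma> f" using LIMSEQ_unique by simp
qed

lemma isometric_fourier: "\<bar>\<sigma>\<bar> = 1 \<Longrightarrow> isometric_L2 (fourier \<sigma>)"
  by (intro isometric_L2I clinear_fourier norm_fourier)

text \<open>Fubini: moving the kernel to the other argument conjugates it, which reverses the sign
  of the exponent.\<close>

lemma fourier_adjoint_L1_L2:
  assumes g: "L1_L2 g" and h: "L1_L2 h" and \<sigma>: "\<bar>\<sigma>\<bar> = 1"
  shows "cinner (L2_of h) (L2_of (fourier_fun \<sigma> g)) = cinner (L2_of (fourier_fun (- \<sigma>) h)) (L2_of g)"
proof -
  have \<sigma>': "\<bar>- \<sigma>\<bar> = 1" using \<sigma> by simp
  have [measurable]: "g \<in> borel_measurable borel" "h \<in> borel_measurable borel"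
    using g h by (auto dest: borel_measurable_integrable)
  define H where "H \<omega> t = cnj (h \<omega>) * (cis (\<sigma> * \<omega> * t) * g t) / of_real (sqrt (2 * pi))" for \<omega> t
  have "integrable (lborel \<Otimes>\<^sub>M lborel) (\<lambda>(\<omega>, t). cnj (h \<omega>) * g t)"
    using integral_product_lborel(1)[OF Bochner_Integration.integrable_cnj[OF L1_L2D(1)[OF h]] L1_L2D(1)[OF g]]
    by (simp add: lborel_prod)
  then have "integrable (lborel \<Otimes>\<^sub>M lborel) (\<lambda>z. (case z of (\<omega>, t) \<Rightarrow> cnj (h \<omega>) * g t) / of_real (sqrt (2 * pi)))"
    by simp
  then have i: "integrable (lborel \<Otimes>\<^sub>M lborel) (\<lambda>(\<omega>, t). H \<omega> t)"
  proof (rule Bochner_Integration.integrable_bound)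
    show "(\<lambda>(\<omega>, t). H \<omega> t) \<in> borel_measurable (lborel \<Otimes>\<^sub>M lborel)" unfolding H_def by measurable
  qed (auto simp: H_def norm_mult norm_divide)
  have "cinner (L2_of h) (L2_of (fourier_fun \<sigma> g)) = (\<integral>\<omega>. (\<integral>t. H \<omega> t \<partial>lborel) \<partial>lborel)"
    using g h by (simp add: cinner_L2_of L1_L2D fourier_fun_square_integrable \<sigma> fourier_fun_def fourier_int_def H_def)
  also have "\<dots> = (\<integral>t. (\<integral>\<omega>. H \<omega> t \<partial>lborel) \<partial>lborel)"
    by (rule lborel_pair.Fubini_integral[OF i, symmetric])
  also have "\<dots> = cinner (L2_of (fourier_fun (- \<sigma>) h)) (L2_of g)"
  proof -
    have "(\<integral>\<omega>. H \<omega> t \<partial>lborel) = cnj (fourier_fun (- \<sigma>) h t) * g t" for t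
    proof -
      have "cnj (fourier_int h (- \<sigma> * t)) = (\<integral>\<omega>. cnj (cis (- \<sigma> * t * \<omega>) * h \<omega>) \<partial>lborel)"
        unfolding fourier_int_def by (rule Bochner_Integration.integral_cnj[symmetric])
      also have "\<dots> = (\<integral>\<omega>. cnj (h \<omega>) * cis (\<sigma> * \<omega> * t) \<partial>lborel)"
        by (simp add: cis_cnj mult_ac)
      finally have "cnj (fourier_fun (- \<sigma>) h t) * g t = (\<integral>\<omega>. cnj (h \<omega>) * cis (\<sigma> * \<omega> * t) \<partial>lborel) * (g t / of_real (sqrt (2 * pi)))"
        by (simp add: fourier_fun_def)
      also have "\<dots> = (\<integral>\<omega>. cnj (h \<omega>) * cis (\<sigma> * \<omega> * t) * (g t / of_real (sqrt (2 * pi))) \<partial>lborel)"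
        by (rule integral_mult_left_zero[symmetric])
      finally show ?thesis by (simp add: H_def mult_ac)
    qed
    then show ?thesis
      using g h by (simp add: cinner_L2_of L1_L2D fourier_fun_square_integrable[OF _ \<sigma>'])
  qed
  finally show ?thesis .
qed

lemma fourier_adjoint:
  assumes \<sigma>: "\<bar>\<sigma>\<bar> = 1"
  shows "cinner h (fourier \<sigma> f) = cinner (fourier (- \<sigma>) h) f"
proof -
  have \<sigma>': "\<bar>- \<sigma>\<bar> = 1" using \<sigma> by simp
  obtain g where g: "\<And>n::nat. L1_L2 (g n)" "(\<lambda>n. L2_of (g n)) \<longlonglongrightarrow> f" using L1_L2_dense by blast
  obtain k where k: "\<And>n::nat. L1_L2 (k n)" "(\<lambda>n. L2_of (k n)) \<longlonglongrightarrow> h" using L1_L2_dense by blast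
  have "(\<lambda>n. cinner (L2_of (k n)) (L2_of (fourier_fun \<sigma> (g n)))) \<longlonglongrightarrow> cinner h (fourier \<sigma> f)"
    by (intro tendsto_cinner k tendsto_fourier_L1_L2 g \<sigma>)
  moreover have "(\<lambda>n. cinner (L2_of (fourier_fun (- \<sigma>) (k n))) (L2_of (g n))) \<longlonglongrightarrow> cinner (fourier (- \<sigma>) h) f"
    by (intro tendsto_cinner k tendsto_fourier_L1_L2 g \<sigma>')
  ultimately show ?thesis
    unfolding fourier_adjoint_L1_L2[OF g(1) k(1) \<sigma>] by (rule LIMSEQ_unique)
qed

text \<open>The transform with the opposite sign is the adjoint, and the adjoint of an isometry is a
  left inverse; so inversion follows from duality and not from a pointwise inversion formula.
  Applied with both signs it gives unitarity.\<close>

lemma fourier_inverse: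
  assumes \<sigma>: "\<bar>\<sigma>\<bar> = 1" shows "fourier (- \<sigma>) (fourier \<sigma> f) = f"
proof (rule cinner_ext)
  fix u
  have "cinner (fourier (- \<sigma>) (fourier \<sigma> f)) u = cinner (fourier \<sigma> f) (fourier \<sigma> u)"
    by (rule fourier_adjoint[OF \<sigma>, symmetric])
  also have "\<dots> = cinner f u" using isometric_fourier[OF \<sigma>] by (simp add: isometric_L2_def)
  finally show "cinner u (fourier (- \<sigma>) (fourier \<sigma> f)) = cinner u f" by (metis cinner_commute)
qed

text \<open>The truncated integrals are the integral transforms of cutoffs, and the cutoffs converge
  as the real parameter R tends to infinity. The relation thus becomes an equation with a total
  operator, and \<open>hardy\<close> becomes a support condition.\<close>

lemma has_fourier_transform_iff: "has_fourier_transform f h \<longleftrightarrow> h = fourier (- 1) f"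
proof -
  define c where "c R = cutoff R (L2_fun f)" for R
  have c: "L1_L2 (c R)" for R unfolding c_def by (intro L1_L2_cutoff square_integrable_L2_fun)
  have tr: "truncated_fourier f R = fourier_fun (- 1) (c R)" for R
  proof
    fix \<omega>
    have "indicator {-R..R} x *\<^sub>R (L2_fun f x * exp (- \<i> * of_real (x * \<omega>)))
      = cis (- 1 * \<omega> * x) * (indicator {-R..R} x *\<^sub>R L2_fun f x)" for x
      by (simp add: cis_conv_exp mult_ac)
    then show "truncated_fourier f R \<omega> = fourier_fun (- 1) (c R) \<omega>"
      unfolding truncated_fourier_def fourier_fun_def fourier_int_def c_def cutoff_def set_lebesgue_integral_def
      by presburger
  qed
  have lim: "((\<lambda>R. L2_of (fourier_fun (- 1) (c R))) \<longlongrightarrow> fourier (- 1) f) at_top"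
    using tendsto_cutoff[of f] by (intro tendsto_fourier_L1_L2 c) (simp_all add: c_def)
  have s: "square_integrable (fourier_fun (- 1) (c R))" for R
    by (rule fourier_fun_square_integrable[OF c]) simp
  have e: "(\<integral>\<^sup>+\<omega>. ennreal ((cmod (truncated_fourier f R \<omega> - L2_fun h \<omega>))\<^sup>2) \<partial>lborel)
      = ennreal ((norm (L2_of (fourier_fun (- 1) (c R)) - h))\<^sup>2)" for R
    using nn_norm_L2_of[OF square_integrable_diff[OF s square_integrable_L2_fun], of R h]
    by (simp add: L2_of_diff[symmetric] s square_integrable_L2_fun L2_of_L2_fun tr)
  have "has_fourier_transform f h \<longleftrightarrow> ((\<lambda>R. (norm (L2_of (fourier_fun (- 1) (c R)) - h))\<^sup>2) \<longlongrightarrow> 0) at_top"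
    unfolding has_fourier_transform_def e
    using tendsto_ennreal_iff[of "\<lambda>R. (norm (L2_of (fourier_fun (- 1) (c R)) - h))\<^sup>2" at_top 0] by simp
  also have "\<dots> \<longleftrightarrow> ((\<lambda>R. L2_of (fourier_fun (- 1) (c R))) \<longlongrightarrow> h) at_top"
    by (rule tendsto_iff_norm_square[symmetric])
  also have "\<dots> \<longleftrightarrow> h = fourier (- 1) f"
    using lim tendsto_unique[OF trivial_limit_at_top_linorder lim, of h] by auto
  finally show ?thesis .
qed

lemma hardy_eq: "hardy = {f. AE \<omega> in lborel. \<omega> < 0 \<longrightarrow> L2_fun (fourier (- 1) f) \<omega> = 0}"
  by (simp add: hardy_def has_fourier_transform_iff)

subsection \<open>Weighted affine substitutions\<close>

text \<open>One form for the operators on both sides of the Fourier transform. With a multiplier of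
  constant modulus \<open>sqrt \<bar>c\<bar>\<close> it is isometric, so identities can be checked
  on a dense set.\<close>

definition affine_op :: "(real \<Rightarrow> complex) \<Rightarrow> real \<Rightarrow> real \<Rightarrow> L2 \<Rightarrow> L2" where
  "affine_op m c d f = L2_of (\<lambda>x. m x * L2_fun f (d + c * x))"

context
  fixes m :: "real \<Rightarrow> complex" and c d :: real
  assumes m [measurable]: "m \<in> borel_measurable borel" and mc: "\<And>x. (cmod (m x))\<^sup>2 = \<bar>c\<bar>" and c: "c \<noteq> 0"
begin

lemma nn_affine_op:
  assumes [measurable]: "f \<in> borel_measurable borel"
  shows "(\<integral>\<^sup>+x. ennreal ((cmod (m x * f (d + c * x)))\<^sup>2) \<partial>lborel) = (\<integral>\<^sup>+x. ennreal ((cmod (f x))\<^sup>2) \<partial>lborel)"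
proof -
  have "(\<integral>\<^sup>+x. ennreal ((cmod (m x * f (d + c * x)))\<^sup>2) \<partial>lborel)
     = (\<integral>\<^sup>+x. ennreal \<bar>c\<bar> * ennreal ((cmod (f (d + c * x)))\<^sup>2) \<partial>lborel)"
    by (simp add: norm_mult power_mult_distrib mc ennreal_mult)
  also have "\<dots> = ennreal \<bar>c\<bar> * (\<integral>\<^sup>+x. ennreal ((cmod (f (d + c * x)))\<^sup>2) \<partial>lborel)"
    by (rule nn_integral_cmult) measurable
  also have "\<dots> = (\<integral>\<^sup>+x. ennreal ((cmod (f x))\<^sup>2) \<partial>lborel)"
    by (rule nn_integral_real_affine[symmetric]) (use c in auto)
  finally show ?thesis .
qed

lemma square_integrable_affine:
  assumes f: "square_integrable f" shows "square_integrable (\<lambda>x. m x * f (d + c * x))"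
proof -
  have [measurable]: "f \<in> borel_measurable borel" using f by measurable
  show ?thesis using f nn_affine_op[of f] by (simp add: square_integrable_iff_nn)
qed

lemma affine_op_L2_of:
  assumes f: "square_integrable f"
  shows "affine_op m c d (L2_of f) = L2_of (\<lambda>x. m x * f (d + c * x))"
  unfolding affine_op_def
proof (rule L2_of_cong_AE)
  have [measurable]: "f \<in> borel_measurable borel" using f by measurable
  have "AE x in lborel. L2_fun (L2_of f) (d + c * x) = f (d + c * x)"
    by (rule AE_borel_affine[OF c _ L2_fun_L2_of[OF f]]) measurable
  then show "AE x in lborel. m x * L2_fun (L2_of f) (d + c * x) = m x * f (d + c * x)" by auto
qed (intro square_integrable_affine f square_integrable_L2_fun)+

lemma tendsto_affine_op:
  assumes "(u \<longlongrightarrow> f) F" shows "((\<lambda>x. affine_op m c d (u x)) \<longlongrightarrow> affine_op m c d f) F"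
proof -
  have "norm (affine_op m c d v - affine_op m c d w) = norm (v - w)" for v w
  proof -
    define g where "g x = L2_fun v x - L2_fun w x" for x
    have g: "square_integrable g" unfolding g_def by (intro square_integrable_diff square_integrable_L2_fun)
    have [measurable]: "g \<in> borel_measurable borel" using g by measurable
    have 1: "v - w = L2_of g"
      using L2_of_diff[OF square_integrable_L2_fun square_integrable_L2_fun, of v w]
      by (simp add: L2_of_L2_fun g_def[abs_def])
    have 2: "affine_op m c d v - affine_op m c d w = L2_of (\<lambda>x. m x * g (d + c * x))"
      unfolding affine_op_def g_def
      by (subst L2_of_diff) (auto intro!: square_integrable_affine square_integrable_L2_fun simp: right_diff_distrib)
    have "ennreal ((norm (affine_op m c d v - affine_op m c d w))\<^sup>2) = ennreal ((norm (v - w))\<^sup>2)"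
      unfolding 1 2 nn_norm_L2_of[OF g] nn_norm_L2_of[OF square_integrable_affine[OF g]]
      by (rule nn_affine_op) measurable
    then show ?thesis by (simp add: power2_eq_iff_nonneg)
  qed
  then show ?thesis using assms by (simp add: tendsto_iff dist_norm)
qed

end

lemma L1_L2_affine:
  assumes g: "L1_L2 g" and m [measurable]: "m \<in> borel_measurable borel"
    and mc: "\<And>x. (cmod (m x))\<^sup>2 = \<bar>c\<bar>" and c: "c \<noteq> 0"
  shows "L1_L2 (\<lambda>x. m x * g (d + c * x))"
proof -
  have [measurable]: "g \<in> borel_measurable borel" using g by (auto dest: borel_measurable_integrable)
  have n: "cmod (m x) = sqrt \<bar>c\<bar>" for x using mc[of x] by (metis norm_ge_zero real_sqrt_unique)
  have "integrable lborel (\<lambda>x. of_real (sqrt \<bar>c\<bar>) * g (d + c * x))"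
    by (intro integrable_mult_right lborel_integrable_real_affine L1_L2D g c)
  then have "integrable lborel (\<lambda>x. m x * g (d + c * x))"
    by (rule Bochner_Integration.integrable_bound) (auto simp: norm_mult n)
  then show ?thesis using square_integrable_affine[OF m mc c L1_L2D(2)[OF g]] by (simp add: L1_L2_def)
qed

text \<open>The Fourier integral exchanges modulation with translation and a dilation with its
  inverse; a substitution proves this for functions in L1 and L2, and both sides are continuous in
  \<open>h\<close>.\<close>

lemma fourier_affine_op:
  assumes \<alpha>: "\<alpha> > 0"
  shows "fourier 1 (affine_op (\<lambda>\<omega>. cis \<theta> * cis (s * \<omega>) * of_real (sqrt \<alpha>)) \<alpha> 0 h)
    = affine_op (\<lambda>x. cis \<theta> * of_real (\<alpha> powr (- 1 / 2))) (1 / \<alpha>) (s / \<alpha>) (fourier 1 h)"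
proof -
  let ?m = "\<lambda>\<omega>. cis \<theta> * cis (s * \<omega>) * of_real (sqrt \<alpha>)"
  let ?k = "\<lambda>x::real. cis \<theta> * of_real (\<alpha> powr (- 1 / 2))"
  have pr: "\<alpha> powr (- 1 / 2) = 1 / sqrt \<alpha>"
    using powr_minus_divide[of \<alpha> "1 / 2"] powr_half_sqrt[of \<alpha>] \<alpha> by simp
  have m: "?m \<in> borel_measurable borel" "\<And>x. (cmod (?m x))\<^sup>2 = \<bar>\<alpha>\<bar>" "\<alpha> \<noteq> 0"
    using \<alpha> by (auto simp: norm_mult power_mult_distrib)
  have k: "?k \<in> borel_measurable borel" "\<And>x. (cmod (?k x))\<^sup>2 = \<bar>1 / \<alpha>\<bar>" "1 / \<alpha> \<noteq> 0"
    unfolding pr using \<alpha> by (auto simp: norm_mult power_mult_distrib norm_divide power_divide)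
  obtain g where g: "\<And>n::nat. L1_L2 (g n)" "(\<lambda>n. L2_of (g n)) \<longlonglongrightarrow> h" using L1_L2_dense by blast
  have eq: "L2_of (fourier_fun 1 (\<lambda>x. ?m x * g n (0 + \<alpha> * x))) = affine_op ?k (1 / \<alpha>) (s / \<alpha>) (L2_of (fourier_fun 1 (g n)))" for n
  proof -
    have "fourier_fun 1 (\<lambda>x. ?m x * g n (0 + \<alpha> * x)) x = ?k x * fourier_fun 1 (g n) (s / \<alpha> + 1 / \<alpha> * x)" for x
    proof -
      have "fourier_int (g n) (s / \<alpha> + 1 / \<alpha> * x) = \<bar>\<alpha>\<bar> *\<^sub>R (\<integral>t. cis ((s / \<alpha> + 1 / \<alpha> * x) * (0 + \<alpha> * t)) * g n (0 + \<alpha> * t) \<partial>lborel)"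
        unfolding fourier_int_def using \<alpha> by (intro lborel_integral_real_affine) auto
      moreover have "fourier_int (\<lambda>x. ?m x * g n (0 + \<alpha> * x)) x
         = cis \<theta> * of_real (sqrt \<alpha>) * (\<integral>t. cis ((s / \<alpha> + 1 / \<alpha> * x) * (0 + \<alpha> * t)) * g n (0 + \<alpha> * t) \<partial>lborel)"
      proof -
        have "cis (x * t) * (?m t * g n (0 + \<alpha> * t))
          = cis \<theta> * of_real (sqrt \<alpha>) * (cis ((s / \<alpha> + 1 / \<alpha> * x) * (0 + \<alpha> * t)) * g n (0 + \<alpha> * t))" for t
        proof -
          have a: "(s / \<alpha> + 1 / \<alpha> * x) * (0 + \<alpha> * t) = x * t + s * t" using \<alpha> by (simp add: field_simps)
          show ?thesis unfolding a cis_mult[symmetric] by (simp add: mult_ac)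
        qed
        then show ?thesis by (simp only: fourier_int_def integral_mult_right_zero)
      qed
      \<comment> \<open>The Jacobian \<alpha> of the substitution turns the unitary factor of the
        dilation by \<alpha> into the one of the inverse dilation.\<close>
      moreover have "of_real (sqrt \<alpha>) = complex_of_real (\<alpha> powr (- 1 / 2)) * of_real \<alpha>"
        unfolding pr of_real_mult[symmetric] of_real_eq_iff using \<alpha> by (simp add: real_div_sqrt)
      ultimately show ?thesis
        using \<alpha> by (simp add: fourier_fun_def scaleR_conv_of_real)
    qed
    then have fe: "fourier_fun 1 (\<lambda>x. ?m x * g n (0 + \<alpha> * x)) = (\<lambda>x. ?k x * fourier_fun 1 (g n) (s / \<alpha> + 1 / \<alpha> * x))"
      by (rule ext)
    show ?thesis
      unfolding fe by (rule affine_op_L2_of[OF k, symmetric]) (rule fourier_fun_square_integrable[OF g(1)], simp)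
  qed
  have "(\<lambda>n. affine_op ?m \<alpha> 0 (L2_of (g n))) \<longlonglongrightarrow> affine_op ?m \<alpha> 0 h"
    by (rule tendsto_affine_op[OF m g(2)])
  then have "(\<lambda>n. L2_of (\<lambda>x. ?m x * g n (0 + \<alpha> * x))) \<longlonglongrightarrow> affine_op ?m \<alpha> 0 h"
    unfolding affine_op_L2_of[OF m L1_L2D(2)[OF g(1)]] .
  then have "(\<lambda>n. L2_of (fourier_fun 1 (\<lambda>x. ?m x * g n (0 + \<alpha> * x)))) \<longlonglongrightarrow> fourier 1 (affine_op ?m \<alpha> 0 h)"
    by (intro tendsto_fourier_L1_L2 L1_L2_affine g m) auto
  moreover have "(\<lambda>n. affine_op ?k (1 / \<alpha>) (s / \<alpha>) (L2_of (fourier_fun 1 (g n)))) \<longlonglongrightarrow> affine_op ?k (1 / \<alpha>) (s / \<alpha>) (fourier 1 h)"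
    by (intro tendsto_affine_op k tendsto_fourier_L1_L2 g) auto
  ultimately show ?thesis unfolding eq by (rule LIMSEQ_unique)
qed

lemma wavelet_rep_eq_affine_op:
  assumes "\<alpha> > 0"
  shows "wavelet_rep a b (\<alpha>, \<beta>, \<gamma>) f = affine_op (\<lambda>x. cis (a * \<gamma>) * of_real (\<alpha> powr (- 1 / 2))) (1 / \<alpha>) (b * \<beta> / \<alpha>) f"
  by (simp add: wavelet_rep_def affine_op_def cis_conv_exp add_divide_distrib add.commute)

subsection \<open>The exponential change of variables on $L^2$\<close>

text \<open>Only the square root of the Jacobian is divided out here, which makes the change of
  variables unitary from the line onto the half-line.\<close>

definition exp_pull :: "real \<Rightarrow> (real \<Rightarrow> complex) \<Rightarrow> real \<Rightarrow> complex" where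
  "exp_pull \<epsilon> f \<omega> = (if \<omega> > 0 then f (ln \<omega> / \<epsilon>) / of_real (sqrt (\<epsilon> * \<omega>)) else 0)"

lemma measurable_exp_pull:
  assumes [measurable]: "f \<in> borel_measurable borel" shows "exp_pull \<epsilon> f \<in> borel_measurable borel"
  unfolding exp_pull_def[abs_def] by measurable

lemma nn_exp_pull:
  assumes \<epsilon>: "\<epsilon> > 0" and [measurable]: "f \<in> borel_measurable borel"
  shows "(\<integral>\<^sup>+\<omega>. ennreal ((cmod (exp_pull \<epsilon> f \<omega>))\<^sup>2) \<partial>lborel) = (\<integral>\<^sup>+t. ennreal ((cmod (f t))\<^sup>2) \<partial>lborel)"
proof -
  have "(\<integral>\<^sup>+\<omega>. ennreal ((cmod (exp_pull \<epsilon> f \<omega>))\<^sup>2) \<partial>lborel)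
    = (\<integral>\<^sup>+\<omega>. indicator {0<..} \<omega> * ennreal ((cmod (f (ln \<omega> / \<epsilon>)))\<^sup>2 / (\<epsilon> * \<omega>)) \<partial>lborel)"
    using \<epsilon> by (intro nn_integral_cong) (auto simp: exp_pull_def indicator_def norm_divide power_divide)
  also have "\<dots> = (\<integral>\<^sup>+t. ennreal (\<epsilon> * exp (\<epsilon> * t)) * ennreal ((cmod (f (ln (exp (\<epsilon> * t)) / \<epsilon>)))\<^sup>2 / (\<epsilon> * exp (\<epsilon> * t))) \<partial>lborel)"
    by (rule nn_integral_exp_subst[OF \<epsilon>]) measurable
  also have "\<dots> = (\<integral>\<^sup>+t. ennreal ((cmod (f t))\<^sup>2) \<partial>lborel)"
    using \<epsilon> by (simp flip: ennreal_mult)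
  finally show ?thesis .
qed

lemma square_integrable_exp_pull:
  assumes \<epsilon>: "\<epsilon> > 0" and f: "square_integrable f" shows "square_integrable (exp_pull \<epsilon> f)"
proof -
  have [measurable]: "f \<in> borel_measurable borel" using f by measurable
  show ?thesis using f nn_exp_pull[OF \<epsilon>, of f]
    by (simp add: square_integrable_iff_nn measurable_exp_pull)
qed

lemma exp_pull_cong_AE:
  assumes \<epsilon>: "\<epsilon> > 0" and [measurable]: "f \<in> borel_measurable borel" "g \<in> borel_measurable borel"
    and ae: "AE t in lborel. f t = g t"
  shows "AE \<omega> in lborel. exp_pull \<epsilon> f \<omega> = exp_pull \<epsilon> g \<omega>"
proof -
  have "AE t in density lborel (\<lambda>t. ennreal (\<epsilon> * exp (\<epsilon> * t))). f (ln (exp (\<epsilon> * t)) / \<epsilon>) = g (ln (exp (\<epsilon> * t)) / \<epsilon>)"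
    using ae \<epsilon> by (simp add: AE_density)
  then have "AE \<omega> in distr (density lborel (\<lambda>t. ennreal (\<epsilon> * exp (\<epsilon> * t)))) borel (\<lambda>t. exp (\<epsilon> * t)). f (ln \<omega> / \<epsilon>) = g (ln \<omega> / \<epsilon>)"
    by (subst AE_distr_iff) measurable
  then have "AE \<omega> in density lborel (indicator {0<..}). f (ln \<omega> / \<epsilon>) = g (ln \<omega> / \<epsilon>)"
    unfolding distr_exp[OF \<epsilon>] .
  then have "AE \<omega> in lborel. 0 < \<omega> \<longrightarrow> f (ln \<omega> / \<epsilon>) = g (ln \<omega> / \<epsilon>)"
    by (subst (asm) AE_density) (auto elim!: eventually_mono)
  then show ?thesis by eventually_elim (simp add: exp_pull_def)
qed

definition exp_op :: "real \<Rightarrow> L2 \<Rightarrow> L2" where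
  "exp_op \<epsilon> F = L2_of (exp_pull \<epsilon> (L2_fun F))"

lemma exp_op_L2_of:
  assumes \<epsilon>: "\<epsilon> > 0" and f: "square_integrable f" shows "exp_op \<epsilon> (L2_of f) = L2_of (exp_pull \<epsilon> f)"
  unfolding exp_op_def
  by (rule L2_of_cong_AE)
     (auto intro!: square_integrable_exp_pull exp_pull_cong_AE[OF \<epsilon>] L2_fun_L2_of f \<epsilon> square_integrable_L2_fun
       square_integrable_measurable[OF f])

lemma clinear_exp_op:
  assumes \<epsilon>: "\<epsilon> > 0" shows "clinear_L2 (exp_op \<epsilon>)"
proof -
  have "exp_op \<epsilon> (u + v) = exp_op \<epsilon> u + exp_op \<epsilon> v" for u v
  proof -
    have "u + v = L2_of (\<lambda>x. L2_fun u x + L2_fun v x)"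
      by (simp add: square_integrable_L2_fun L2_of_L2_fun flip: L2_of_add)
    then have "exp_op \<epsilon> (u + v) = L2_of (exp_pull \<epsilon> (\<lambda>x. L2_fun u x + L2_fun v x))"
      by (simp add: exp_op_L2_of \<epsilon> square_integrable_add square_integrable_L2_fun)
    also have "exp_pull \<epsilon> (\<lambda>x. L2_fun u x + L2_fun v x) = (\<lambda>\<omega>. exp_pull \<epsilon> (L2_fun u) \<omega> + exp_pull \<epsilon> (L2_fun v) \<omega>)"
      by (auto simp: exp_pull_def add_divide_distrib)
    finally show ?thesis
      by (simp add: exp_op_def L2_of_add square_integrable_exp_pull \<epsilon> square_integrable_L2_fun)
  qed
  moreover have "exp_op \<epsilon> (c *\<^sub>C u) = c *\<^sub>C exp_op \<epsilon> u" for c u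
  proof -
    have "c *\<^sub>C u = L2_of (\<lambda>x. c * L2_fun u x)"
      by (simp add: square_integrable_L2_fun L2_of_L2_fun flip: L2_of_scaleC)
    then have "exp_op \<epsilon> (c *\<^sub>C u) = L2_of (exp_pull \<epsilon> (\<lambda>x. c * L2_fun u x))"
      by (simp add: exp_op_L2_of \<epsilon> square_integrable_scale square_integrable_L2_fun)
    also have "exp_pull \<epsilon> (\<lambda>x. c * L2_fun u x) = (\<lambda>\<omega>. c * exp_pull \<epsilon> (L2_fun u) \<omega>)"
      by (auto simp: exp_pull_def)
    finally show ?thesis
      by (simp add: exp_op_def L2_of_scaleC square_integrable_exp_pull \<epsilon> square_integrable_L2_fun)
  qed
  ultimately show ?thesis by (simp add: clinear_L2_def)
qed

lemma norm_exp_op: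
  assumes \<epsilon>: "\<epsilon> > 0" shows "norm (exp_op \<epsilon> u) = norm u"
proof -
  have "ennreal ((norm (exp_op \<epsilon> u))\<^sup>2) = ennreal ((norm u)\<^sup>2)"
    unfolding exp_op_def nn_norm_L2_of[OF square_integrable_exp_pull[OF \<epsilon> square_integrable_L2_fun]] nn_norm_L2[of u]
    by (rule nn_exp_pull[OF \<epsilon>]) measurable
  then show ?thesis by (simp add: power2_eq_iff_nonneg)
qed

lemma range_exp_op:
  assumes \<epsilon>: "\<epsilon> > 0"
  shows "range (exp_op \<epsilon>) = {h. AE \<omega> in lborel. \<omega> < 0 \<longrightarrow> L2_fun h \<omega> = 0}"
proof (intro equalityI subsetI; clarsimp)
  fix u
  have "AE \<omega> in lborel. L2_fun (exp_op \<epsilon> u) \<omega> = exp_pull \<epsilon> (L2_fun u) \<omega>"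
    unfolding exp_op_def by (intro L2_fun_L2_of square_integrable_exp_pull \<epsilon> square_integrable_L2_fun)
  then show "AE \<omega> in lborel. \<omega> < 0 \<longrightarrow> L2_fun (exp_op \<epsilon> u) \<omega> = 0"
    by eventually_elim (simp add: exp_pull_def)
next
  fix h assume h: "AE \<omega> in lborel. \<omega> < 0 \<longrightarrow> L2_fun h \<omega> = 0"
  \<comment> \<open>The inverse substitution, with the square root of the Jacobian restored.\<close>
  define f where "f t = of_real (sqrt (\<epsilon> * exp (\<epsilon> * t))) * L2_fun h (exp (\<epsilon> * t))" for t
  have [measurable]: "f \<in> borel_measurable borel" unfolding f_def by measurable
  have pos: "exp_pull \<epsilon> f \<omega> = L2_fun h \<omega>" if "\<omega> > 0" for \<omega>
    using that \<epsilon> by (simp add: exp_pull_def f_def)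
  \<comment> \<open>The support condition speaks of negative frequencies and the substitution
    reaches positive ones; the remaining frequency 0 is a null set.\<close>
  have "AE \<omega> in lborel. \<omega> \<noteq> (0::real)" by (rule AE_lborel_singleton)
  from this h have ae: "AE \<omega> in lborel. exp_pull \<epsilon> f \<omega> = L2_fun h \<omega>"
  proof eventually_elim
    case (elim \<omega>)
    show ?case
    proof (cases "\<omega> > 0")
      case False
      with elim show ?thesis by (simp add: exp_pull_def)
    qed (rule pos)
  qed
  have "(\<integral>\<^sup>+t. ennreal ((cmod (f t))\<^sup>2) \<partial>lborel) = (\<integral>\<^sup>+\<omega>. ennreal ((cmod (L2_fun h \<omega>))\<^sup>2) \<partial>lborel)"
    unfolding nn_exp_pull[OF \<epsilon>, of f, symmetric, OF \<open>f \<in> borel_measurable borel\<close>]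
    using ae by (intro nn_integral_cong_AE) auto
  then have f: "square_integrable f"
    using square_integrable_L2_fun[of h] by (simp add: square_integrable_iff_nn)
  have "exp_op \<epsilon> (L2_of f) = L2_of (L2_fun h)"
    unfolding exp_op_L2_of[OF \<epsilon> f]
    using ae by (intro L2_of_cong_AE square_integrable_exp_pull \<epsilon> f square_integrable_L2_fun)
  then show "h \<in> range (exp_op \<epsilon>)" by (metis L2_of_L2_fun rangeI)
qed

lemma exp_op_affine_rep:
  assumes \<epsilon>: "\<epsilon> > 0" and \<alpha>: "\<alpha> > 0"
  shows "exp_op \<epsilon> (affine_rep l \<epsilon> (\<alpha>, \<beta>, \<gamma>) F)
    = affine_op (\<lambda>\<omega>. cis (l / \<epsilon> * \<gamma>) * cis (- (l / \<epsilon>) * \<beta> * \<omega>) * of_real (sqrt \<alpha>)) \<alpha> 0 (exp_op \<epsilon> F)"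
    (is "_ = affine_op ?m \<alpha> 0 _")
proof -
  have m: "?m \<in> borel_measurable borel" "\<And>x. (cmod (?m x))\<^sup>2 = \<bar>\<alpha>\<bar>" "\<alpha> \<noteq> 0"
    using \<alpha> by (auto simp: norm_mult power_mult_distrib)
  define \<theta> where "\<theta> t = l / \<epsilon> * (\<gamma> - \<beta> * exp (\<epsilon> * t))" for t
  have [measurable]: "\<theta> \<in> borel_measurable borel" unfolding \<theta>_def by measurable
  have s: "square_integrable (\<lambda>t. cis (\<theta> t) * L2_fun F (t - - ln \<alpha> / \<epsilon>))"
    by (intro square_integrable_phase_shift square_integrable_L2_fun) measurable
  have "exp_op \<epsilon> (affine_rep l \<epsilon> (\<alpha>, \<beta>, \<gamma>) F) = L2_of (exp_pull \<epsilon> (\<lambda>t. cis (\<theta> t) * L2_fun F (t - - ln \<alpha> / \<epsilon>)))"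
    unfolding affine_rep_def split_conv phase_shift_def \<theta>_def[symmetric] by (rule exp_op_L2_of[OF \<epsilon> s])
  also have "exp_pull \<epsilon> (\<lambda>t. cis (\<theta> t) * L2_fun F (t - - ln \<alpha> / \<epsilon>)) = (\<lambda>\<omega>. ?m \<omega> * exp_pull \<epsilon> (L2_fun F) (0 + \<alpha> * \<omega>))"
  proof
    fix \<omega>
    show "exp_pull \<epsilon> (\<lambda>t. cis (\<theta> t) * L2_fun F (t - - ln \<alpha> / \<epsilon>)) \<omega> = ?m \<omega> * exp_pull \<epsilon> (L2_fun F) (0 + \<alpha> * \<omega>)"
    proof (cases "\<omega> > 0")
      case True
      have 1: "ln \<omega> / \<epsilon> - - ln \<alpha> / \<epsilon> = ln (\<alpha> * \<omega>) / \<epsilon>"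
        using True \<alpha> by (simp add: ln_mult add_divide_distrib)
      have "\<theta> (ln \<omega> / \<epsilon>) = l / \<epsilon> * \<gamma> + - (l / \<epsilon>) * \<beta> * \<omega>"
        using True \<epsilon> by (simp add: \<theta>_def algebra_simps)
      then have 2: "cis (\<theta> (ln \<omega> / \<epsilon>)) = cis (l / \<epsilon> * \<gamma>) * cis (- (l / \<epsilon>) * \<beta> * \<omega>)"
        by (simp only: cis_mult)
      have 3: "sqrt (\<epsilon> * (\<alpha> * \<omega>)) = sqrt \<alpha> * sqrt (\<epsilon> * \<omega>)"
        by (simp add: real_sqrt_mult)
      show ?thesis
        using True \<alpha> \<epsilon> unfolding exp_pull_def 1 2 by (simp add: 3 del: real_sqrt_mult)
    next
      case False
      then show ?thesis using \<alpha> by (simp add: exp_pull_def zero_less_mult_iff)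
    qed
  qed
  also have "L2_of (\<lambda>\<omega>. ?m \<omega> * exp_pull \<epsilon> (L2_fun F) (0 + \<alpha> * \<omega>)) = affine_op ?m \<alpha> 0 (exp_op \<epsilon> F)"
    unfolding exp_op_def by (rule affine_op_L2_of[OF m, symmetric]) (intro square_integrable_exp_pull \<epsilon> square_integrable_L2_fun)
  finally show ?thesis .
qed

text \<open>The intertwiner is the exponential change of variables followed by the inverse Fourier
  transform. The change of variables maps onto the functions supported on the nonnegative half-line,
  and these are the transforms of Hardy functions.\<close>

theorem affine_rep_wavelet:
  assumes \<epsilon>: "\<epsilon> > 0"
  shows "unitarily_equivalent EA (affine_rep l \<epsilon>) (wavelet_rep (l / \<epsilon>) (- (l / \<epsilon>))) hardy"
  unfolding unitarily_equivalent_def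
proof (intro exI conjI ballI allI)
  let ?W = "\<lambda>F. fourier 1 (exp_op \<epsilon> F)"
  show lin: "clinear_L2 ?W"
    using clinear_fourier[of 1] clinear_exp_op[OF \<epsilon>] by (simp add: clinear_L2_def)
  show "isometric_L2 ?W"
    by (intro isometric_L2I lin) (simp add: norm_fourier norm_exp_op \<epsilon>)
  have inv: "fourier (- 1) (fourier 1 f) = f" "fourier 1 (fourier (- 1) f) = f" for f
    using fourier_inverse[of 1 f] fourier_inverse[of "- 1" f] by simp_all
  show "range ?W = hardy"
  proof (intro equalityI subsetI)
    fix f assume "f \<in> range ?W"
    then show "f \<in> hardy" using range_exp_op[OF \<epsilon>] by (auto simp: hardy_eq inv)
  next
    fix f assume "f \<in> hardy"
    then have "fourier (- 1) f \<in> range (exp_op \<epsilon>)" unfolding range_exp_op[OF \<epsilon>] by (simp add: hardy_eq)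
    then obtain F where "fourier (- 1) f = exp_op \<epsilon> F" by blast
    then have "f = ?W F" by (metis inv(2))
    then show "f \<in> range ?W" by blast
  qed
  fix g v assume "g \<in> carrier EA"
  then obtain \<alpha> \<beta> \<gamma> where g: "g = (\<alpha>, \<beta>, \<gamma>)" "\<alpha> > 0" by (cases g) (auto simp: EA_def)
  show "?W (affine_rep l \<epsilon> g v) = wavelet_rep (l / \<epsilon>) (- (l / \<epsilon>)) g (?W v)"
    using g(2) by (simp only: g(1) exp_op_affine_rep[OF \<epsilon>] wavelet_rep_eq_affine_op fourier_affine_op)
qed

subsection \<open>Schur's lemma\<close>

definition irreducible_family :: "(L2 \<Rightarrow> L2) set \<Rightarrow> bool" where
  "irreducible_family R \<longleftrightarrow> (\<forall>S. csubspace_L2 S \<and> closed S \<and> (\<forall>T\<in>R. T ` S \<subseteq> S) \<longrightarrow> S = {0} \<or> S = UNIV)"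

lemma clinear_L2D:
  assumes "clinear_L2 T"
  shows "T (u + v) = T u + T v" "T (c *\<^sub>C u) = c *\<^sub>C T u" "T (u - v) = T u - T v" "T 0 = 0" "T (r *\<^sub>R u) = r *\<^sub>R T u"
proof -
  show a: "T (u + v) = T u + T v" and s: "T (c *\<^sub>C u) = c *\<^sub>C T u" for u v c
    using assms by (auto simp: clinear_L2_def)
  show "T (u - v) = T u - T v"
    using a[of u "(- 1) *\<^sub>C v"] s[of "- 1" v] by (simp add: scaleC_minus_one)
  show "T 0 = 0" using s[of 0 0] by simp
  show "T (r *\<^sub>R u) = r *\<^sub>R T u" by (simp add: scaleR_L2_def s)
qed

lemma bounded_linear_clinear:
  assumes "clinear_L2 T" "\<And>u. norm (T u) \<le> K * norm u"
  shows "bounded_linear T"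
  by standard (auto simp: clinear_L2D[OF assms(1)] mult.commute[of _ K] intro!: exI[of _ K] assms(2))

text \<open>The iteration below converges to \<open>1 - sqrt (1 - B)\<close>. It is dominated by the same iteration for
  the scalar \<open>1\<close> in place of \<open>B\<close>: both the norms of the iterates and the norms of the increments.\<close>

primrec sqrt_iter :: "(L2 \<Rightarrow> L2) \<Rightarrow> nat \<Rightarrow> L2 \<Rightarrow> L2" where
  "sqrt_iter B 0 u = 0"
| "sqrt_iter B (Suc n) u = (1/2) *\<^sub>R (B u + sqrt_iter B n (sqrt_iter B n u))"

primrec sqrt_iter_scalar :: "nat \<Rightarrow> real" where
  "sqrt_iter_scalar 0 = 0"
| "sqrt_iter_scalar (Suc n) = (1 + (sqrt_iter_scalar n)\<^sup>2) / 2"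

lemma sqrt_iter_scalar_bounds: "0 \<le> sqrt_iter_scalar n" "sqrt_iter_scalar n \<le> 1"
proof -
  have "0 \<le> sqrt_iter_scalar n \<and> sqrt_iter_scalar n \<le> 1"
    by (induction n) (auto simp: power_le_one)
  then show "0 \<le> sqrt_iter_scalar n" "sqrt_iter_scalar n \<le> 1" by auto
qed

text \<open>The equation for \<open>Y\<close> says that the square of 1 - Y is 1 - B. As a strong
  limit of polynomials in \<open>B\<close>, the operator \<open>Y\<close> commutes with every
  bounded operator that commutes with \<open>B\<close>; the last clause records this because the
  proof of Schur's lemma needs invariance of a kernel built from \<open>Y\<close>.\<close>

lemma operator_sqrt_exists:
  assumes B: "clinear_L2 B" and Bc: "\<And>u. norm (B u) \<le> norm u"
  shows "\<exists>Y. clinear_L2 Y \<and> (\<forall>u. norm (Y u) \<le> norm u) \<and> (\<forall>u. 2 *\<^sub>R Y u = B u + Y (Y u)) \<and>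
    (\<forall>T. clinear_L2 T \<and> (\<forall>u. norm (T u) \<le> K * norm u) \<and> (\<forall>u. T (B u) = B (T u)) \<longrightarrow> (\<forall>u. T (Y u) = Y (T u)))"
proof -
  let ?Y = "sqrt_iter B" and ?y = sqrt_iter_scalar
  note Bl = clinear_L2D[OF B]
  have lin: "clinear_L2 (?Y n)" for n
  proof (induction n)
    case 0 show ?case by (simp add: clinear_L2_def)
  next
    case (Suc n)
    note Yl = clinear_L2D[OF Suc]
    have c: "r *\<^sub>R c *\<^sub>C u = c *\<^sub>C r *\<^sub>R u" for r c and u :: L2
      by (simp add: scaleR_L2_def scaleC_scaleC mult.commute)
    show ?case
      by (simp add: clinear_L2_def Bl Yl scaleR_add_right scaleC_add_right c add_ac)
  qed
  note Yl = clinear_L2D[OF lin]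
  have nb: "norm (?Y n u) \<le> ?y n * norm u" for n u
  proof (induction n arbitrary: u)
    case (Suc n)
    have "norm (?Y n (?Y n u)) \<le> ?y n * (?y n * norm u)"
      using Suc[of "?Y n u"] Suc[of u] sqrt_iter_scalar_bounds(1)[of n]
      by (meson mult_left_mono order_trans)
    then have "norm (B u + ?Y n (?Y n u)) \<le> norm u + ?y n * (?y n * norm u)"
      using norm_triangle_ineq[of "B u" "?Y n (?Y n u)"] Bc[of u] by linarith
    then show ?case
      unfolding sqrt_iter.simps sqrt_iter_scalar.simps norm_scaleR by (simp add: power2_eq_square field_simps)
  qed simp
  have nb1: "norm (?Y n u) \<le> norm u" for n u
    using nb[of n u] sqrt_iter_scalar_bounds[of n] mult_right_mono[of "?y n" 1 "norm u"] by simp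
  have inc: "norm (?Y (Suc n) u - ?Y n u) \<le> (?y (Suc n) - ?y n) * norm u \<and> ?y n \<le> ?y (Suc n)" for n u
  proof (induction n arbitrary: u)
    case 0
    show ?case using Bc[of u] by simp
  next
    case (Suc n)
    let ?D = "\<lambda>u. ?Y (Suc n) u - ?Y n u"
    have "(1 + p\<^sup>2) / 2 - (1 + q\<^sup>2) / 2 = (p + q) * (p - q) / 2" for p q :: real
      by (simp add: power2_eq_square field_simps)
    from this[of "?y (Suc n)" "?y n", folded sqrt_iter_scalar.simps(2)]
    have yd: "?y (Suc (Suc n)) - ?y (Suc n) = (?y (Suc n) + ?y n) * (?y (Suc n) - ?y n) / 2" .
    have mono: "?y (Suc n) - ?y n \<ge> 0" using Suc by simp
    have "?Y (Suc (Suc n)) u - ?Y (Suc n) u = (1/2) *\<^sub>R (?Y (Suc n) (?Y (Suc n) u) - ?Y n (?Y n u))"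
      by (simp add: scaleR_diff_right[symmetric])
    \<comment> \<open>The operator version of p^2 - q^2 = p (p - q) + (p - q) q. The two terms are
      dominated by the two terms of the scalar identity \<open>yd\<close>.\<close>
    also have "?Y (Suc n) (?Y (Suc n) u) - ?Y n (?Y n u) = ?Y (Suc n) (?D u) + ?D (?Y n u)"
      by (simp only: Yl(3)) simp
    finally have e: "norm (?Y (Suc (Suc n)) u - ?Y (Suc n) u) = norm (?Y (Suc n) (?D u) + ?D (?Y n u)) / 2"
      by simp
    have "norm (?Y (Suc n) (?D u)) \<le> ?y (Suc n) * norm (?D u)" by (rule nb)
    also have "\<dots> \<le> ?y (Suc n) * ((?y (Suc n) - ?y n) * norm u)"
      using Suc[of u] sqrt_iter_scalar_bounds(1)[of "Suc n"] by (intro mult_left_mono) auto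
    finally have 1: "norm (?Y (Suc n) (?D u)) \<le> ?y (Suc n) * ((?y (Suc n) - ?y n) * norm u)" .
    have "norm (?D (?Y n u)) \<le> (?y (Suc n) - ?y n) * norm (?Y n u)" using Suc[of "?Y n u"] by blast
    also have "\<dots> \<le> (?y (Suc n) - ?y n) * (?y n * norm u)" using mono nb[of n u] by (rule mult_left_mono[rotated])
    finally have 2: "norm (?D (?Y n u)) \<le> (?y (Suc n) - ?y n) * (?y n * norm u)" .
    have "norm (?Y (Suc n) (?D u) + ?D (?Y n u)) / 2
      \<le> (?y (Suc n) * ((?y (Suc n) - ?y n) * norm u) + (?y (Suc n) - ?y n) * (?y n * norm u)) / 2"
      by (intro divide_right_mono order_trans[OF norm_triangle_ineq] add_mono 1 2) simp
    also have "\<dots> = (?y (Suc n) + ?y n) * (?y (Suc n) - ?y n) / 2 * norm u"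
      by (simp add: algebra_simps del: sqrt_iter_scalar.simps)
    finally have "norm (?Y (Suc n) (?D u) + ?D (?Y n u)) / 2 \<le> (?y (Suc n) + ?y n) * (?y (Suc n) - ?y n) / 2 * norm u" .
    moreover have "?y (Suc n) \<le> ?y (Suc (Suc n))"
      using yd mono sqrt_iter_scalar_bounds(1)[of n] sqrt_iter_scalar_bounds(1)[of "Suc n"]
      by (smt (verit) divide_nonneg_nonneg mult_nonneg_nonneg)
    ultimately show ?case unfolding e yd by blast
  qed
  have "incseq ?y" using inc by (auto simp: incseq_Suc_iff)
  then have cy: "convergent ?y"
    using sqrt_iter_scalar_bounds by (intro Bseq_mono_convergent[OF BseqI'[of _ 1]]) (auto simp: incseq_def)
  have conv: "convergent (\<lambda>n. ?Y n u)" for u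
  proof -
    \<comment> \<open>The scalar increments telescope, so boundedness of the scalar iteration alone
      makes the operator increments summable at each vector.\<close>
    have "summable (\<lambda>n. (?y (Suc n) - ?y n) * norm u)"
      using cy telescope_summable[of ?y] by (intro summable_mult2) (auto simp: convergent_def)
    then have "summable (\<lambda>n. norm (?Y (Suc n) u - ?Y n u))"
    proof (rule summable_comparison_test'[where N=0])
      show "norm (norm (?Y (Suc n) u - ?Y n u)) \<le> (?y (Suc n) - ?y n) * norm u" for n
        unfolding real_norm_def abs_norm_cancel using inc by blast
    qed
    then have "summable (\<lambda>n. ?Y (Suc n) u - ?Y n u)" by (rule summable_norm_cancel)
    then show ?thesis
      using convergent_diff_const_right_iff[of "\<lambda>n. ?Y n u" "?Y 0 u"] sum_lessThan_telescope[of "\<lambda>n. ?Y n u"]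
      by (simp only: summable_iff_convergent)
  qed
  define Y where "Y u = lim (\<lambda>n. ?Y n u)" for u
  have Y: "(\<lambda>n. ?Y n u) \<longlonglongrightarrow> Y u" for u
    using conv unfolding Y_def convergent_LIMSEQ_iff .
  have "Y (u + v) = Y u + Y v" for u v
    using LIMSEQ_unique[OF Y[of "u + v"]] tendsto_add[OF Y[of u] Y[of v]] by (simp add: Yl)
  moreover have "Y (c *\<^sub>C u) = c *\<^sub>C Y u" for c u
    using LIMSEQ_unique[OF Y[of "c *\<^sub>C u"]] tendsto_scaleC[OF Y[of u]] by (simp add: Yl)
  ultimately have Ylin: "clinear_L2 Y" by (simp add: clinear_L2_def)
  have Yn: "norm (Y u) \<le> norm u" for u
    by (rule LIMSEQ_le_const2[OF tendsto_norm[OF Y]]) (auto intro: nb1)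
  \<comment> \<open>Strong convergence passes to the composition because all iterates are
    contractions.\<close>
  have YY: "(\<lambda>n. ?Y n (?Y n u)) \<longlonglongrightarrow> Y (Y u)" for u
  proof -
    have "(\<lambda>n. ?Y n (?Y n u - Y u)) \<longlonglongrightarrow> 0"
    proof (rule Lim_null_comparison)
      show "\<forall>\<^sub>F n in sequentially. norm (?Y n (?Y n u - Y u)) \<le> norm (?Y n u - Y u)"
        by (intro always_eventually allI nb1)
      show "(\<lambda>n. norm (?Y n u - Y u)) \<longlonglongrightarrow> 0"
        using Y[of u] by (simp add: LIM_zero tendsto_norm_zero)
    qed
    from tendsto_add[OF this Y[of "Y u"]] show ?thesis by (simp add: Yl)
  qed
  have Yeq: "2 *\<^sub>R Y u = B u + Y (Y u)" for u
  proof -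
    have "(\<lambda>n. 2 *\<^sub>R ?Y (Suc n) u) \<longlonglongrightarrow> 2 *\<^sub>R Y u"
      by (intro tendsto_scaleR tendsto_const LIMSEQ_Suc[OF Y])
    moreover have "(\<lambda>n. B u + ?Y n (?Y n u)) \<longlonglongrightarrow> B u + Y (Y u)" by (intro tendsto_add tendsto_const YY)
    ultimately show ?thesis using LIMSEQ_unique by (simp del: scaleR_add_right) blast
  qed
  have "T (Y u) = Y (T u)"
    if T: "clinear_L2 T" "\<And>u. norm (T u) \<le> K * norm u" and TB: "\<And>u. T (B u) = B (T u)" for T u
  proof -
    have "T (?Y n u) = ?Y n (T u)" for n u
      by (induction n arbitrary: u) (simp_all add: clinear_L2D[OF T(1)] TB)
    moreover have "(\<lambda>n. T (?Y n u)) \<longlonglongrightarrow> T (Y u)"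
      by (rule bounded_linear.tendsto[OF bounded_linear_clinear[OF T] Y])
    ultimately show ?thesis using Y[of "T u"] LIMSEQ_unique by simp
  qed
  then show ?thesis using Ylin Yn Yeq by blast
qed

section \<open>Schur's lemma by way of the modulus of a self-adjoint operator\<close>

definition commutes_with :: "(L2 \<Rightarrow> L2) set \<Rightarrow> (L2 \<Rightarrow> L2) \<Rightarrow> bool" where
  "commutes_with R A \<longleftrightarrow> (\<forall>T\<in>R. \<forall>u. T (A u) = A (T u))"

text \<open>With \<open>P\<close> the modulus of \<open>A\<close>, the product of P - A and P + A is
  zero. The kernel of P - A is closed and invariant, so irreducibility leaves A = P or A = - P, and
  \<open>P\<close> is positive. This replaces a splitting by spectral projections.\<close>

lemma schur_definite:
  assumes irr: "irreducible_family R"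
    and R: "\<And>T. T \<in> R \<Longrightarrow> clinear_L2 T" "\<And>T u. T \<in> R \<Longrightarrow> norm (T u) \<le> norm u"
    and A: "clinear_L2 A" and Ac: "\<And>u. norm (A u) \<le> norm u" and sa: "\<And>u v. inner (A u) v = inner u (A v)"
    and com: "commutes_with R A"
  shows "(\<forall>u. inner (A u) u \<ge> 0) \<or> (\<forall>u. inner (A u) u \<le> 0)"
proof -
  note Al = clinear_L2D[OF A]
  \<comment> \<open>Chosen so that \<open>Y\<close> from the square root lemma gives P = 1 - Y with
    P^2 = 1 - B = A^2.\<close>
  define B where "B u = u - A (A u)" for u
  have B: "clinear_L2 B" by (simp add: clinear_L2_def B_def Al scaleC_diff_right)
  have Bc: "norm (B u) \<le> norm u" for u
  proof -
    have "inner u (A (A u)) = inner (A u) (A u)" "inner (A (A u)) u = inner (A u) (A u)"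
      using sa[of u "A u"] inner_commute[of u "A (A u)"] by simp_all
    then have "(norm (B u))\<^sup>2 = (norm u)\<^sup>2 - 2 * (norm (A u))\<^sup>2 + (norm (A (A u)))\<^sup>2"
      by (simp add: B_def power2_norm_eq_inner inner_diff_left inner_diff_right)
    also have "\<dots> \<le> (norm u)\<^sup>2"
      using power_mono[OF Ac[of "A u"] norm_ge_zero, of 2] zero_le_power2[of "norm (A u)"] by linarith
    finally show ?thesis by (rule power2_le_imp_le) simp
  qed
  obtain Y where Y: "clinear_L2 Y" "\<And>u. norm (Y u) \<le> norm u" "\<And>u. 2 *\<^sub>R Y u = B u + Y (Y u)"
    "\<And>T u. clinear_L2 T \<Longrightarrow> (\<And>u. norm (T u) \<le> 1 * norm u) \<Longrightarrow> (\<And>u. T (B u) = B (T u)) \<Longrightarrow> T (Y u) = Y (T u)"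
    using operator_sqrt_exists[OF B Bc, of 1] by metis
  note Yl = clinear_L2D[OF Y(1)]
  define P where "P u = u - Y u" for u
  have PP: "P (P u) = A (A u)" for u
    using Y(3)[of u] by (simp add: P_def Yl B_def scaleR_2 algebra_simps)
  have AY: "A (Y u) = Y (A u)" for u
    using Y(4)[of A u] A Ac by (simp add: B_def Al)
  have Ppos: "inner (P u) u \<ge> 0" for u
  proof -
    have "inner (Y u) u \<le> norm (Y u) * norm u" by (rule norm_cauchy_schwarz)
    also have "\<dots> \<le> norm u * norm u" using Y(2)[of u] by (intro mult_right_mono) auto
    finally show ?thesis by (simp add: P_def inner_diff_left power2_norm_eq_inner[symmetric] power2_eq_square)
  qed
  define S where "S = {u. P u - A u = 0}"
  have bY: "bounded_linear Y" "bounded_linear A"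
    using bounded_linear_clinear[of _ 1] Y(1,2) A Ac by simp_all
  have Ssub: "csubspace_L2 S"
  proof -
    have "P (u + v) - A (u + v) = (P u - A u) + (P v - A v)" for u v by (simp add: P_def Yl Al)
    moreover have "P (c *\<^sub>C u) - A (c *\<^sub>C u) = c *\<^sub>C (P u - A u)" for c u by (simp add: P_def Yl Al scaleC_diff_right)
    moreover have "P 0 - A 0 = 0" by (simp add: P_def Yl Al)
    ultimately show ?thesis unfolding csubspace_L2_def S_def mem_Collect_eq by simp
  qed
  have Scl: "closed S" unfolding S_def P_def
    by (intro closed_Collect_eq continuous_intros linear_continuous_on bY)
  have Sinv: "T ` S \<subseteq> S" if T: "T \<in> R" for T
  proof -
    note Tl = clinear_L2D[OF R(1)[OF T]]
    have TA: "T (A u) = A (T u)" for u using com T by (simp add: commutes_with_def)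
    have "T (Y u) = Y (T u)" for u
      using Y(4)[OF R(1)[OF T]] R(2)[OF T] by (simp add: B_def Tl TA)
    then have e: "P (T u) - A (T u) = T (P u - A u)" for u by (simp add: P_def Tl TA)
    show ?thesis
    proof (rule image_subsetI)
      fix u assume "u \<in> S"
      then have "P u - A u = 0" unfolding S_def mem_Collect_eq .
      then have "P (T u) - A (T u) = 0" by (simp only: e Tl(4))
      then show "T u \<in> S" unfolding S_def mem_Collect_eq .
    qed
  qed
  consider "S = {0}" | "S = UNIV" using irr Ssub Scl Sinv unfolding irreducible_family_def by blast
  then show ?thesis
  proof cases
    case 1
    \<comment> \<open>P commutes with A, hence (P - A)(P + A) = P^2 - A^2 = 0.\<close>
    have "P u + A u \<in> S" for u
    proof -
      have "P (P u + A u) - A (P u + A u) = 0"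
        using PP[of u] by (simp add: P_def Yl Al AY algebra_simps)
      then show ?thesis by (simp add: S_def)
    qed
    then have "P u + A u = 0" for u using 1 by blast
    then have "A u = - P u" for u by (metis add.commute eq_neg_iff_add_eq_0)
    then show ?thesis using Ppos by simp
  next
    case 2
    then have "P u - A u = 0" for u by (auto simp: S_def)
    then have "A u = P u" for u by simp
    then show ?thesis using Ppos by simp
  qed
qed

text \<open>By \<open>schur_definite\<close> applied to A - c, every real c in range is a lower or
  an upper bound of the Rayleigh quotient of \<open>A\<close>. Hence the quotient is constant, and
  polarization makes \<open>A\<close> a scalar.\<close>

lemma schur_selfadjoint:
  assumes irr: "irreducible_family R"
    and R: "\<And>T. T \<in> R \<Longrightarrow> clinear_L2 T" "\<And>T u. T \<in> R \<Longrightarrow> norm (T u) \<le> norm u"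
    and A: "clinear_L2 A" and Ac: "\<And>u. norm (A u) \<le> K * norm u" and sa: "\<And>u v. inner (A u) v = inner u (A v)"
    and com: "commutes_with R A"
  shows "\<exists>a::real. \<forall>u. A u = a *\<^sub>R u"
proof -
  note Al = clinear_L2D[OF A]
  define k where "k = \<bar>K\<bar> + 1"
  have k: "k > 0" by (simp add: k_def)
  have Ak: "norm (A u) \<le> k * norm u" for u
  proof -
    have "K * norm u \<le> k * norm u" by (intro mult_right_mono) (auto simp: k_def)
    then show ?thesis using Ac[of u] by linarith
  qed
  have q: "\<bar>inner (A u) u\<bar> \<le> k * inner u u" for u
    using Cauchy_Schwarz_ineq2[of "A u" u] mult_right_mono[OF Ak[of u], of "norm u"]
    by (simp add: power2_norm_eq_inner[symmetric] power2_eq_square mult.assoc)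
  have split: "(\<forall>u. inner (A u) u \<ge> c * inner u u) \<or> (\<forall>u. inner (A u) u \<le> c * inner u u)" if c: "\<bar>c\<bar> \<le> k" for c
  proof -
    \<comment> \<open>Division by \<open>2 * k\<close> makes A - c a contraction, as both
      \<open>A\<close> and \<open>c\<close> are bounded by \<open>k\<close>.\<close>
    define A' where "A' u = (1 / (2 * k)) *\<^sub>R (A u - c *\<^sub>R u)" for u
    have sc: "r *\<^sub>R d *\<^sub>C u = d *\<^sub>C r *\<^sub>R u" for r d and u :: L2
      by (simp add: scaleR_L2_def scaleC_scaleC mult.commute)
    have "clinear_L2 A'"
      by (simp add: clinear_L2_def A'_def Al sc scaleC_diff_right scaleR_diff_right scaleR_add_right)
    moreover have "norm (A' u) \<le> norm u" for u
    proof -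
      have "norm (A u - c *\<^sub>R u) \<le> norm (A u) + \<bar>c\<bar> * norm u"
        using norm_triangle_ineq4[of "A u" "c *\<^sub>R u"] by simp
      also have "\<dots> \<le> k * norm u + k * norm u" using Ak c by (intro add_mono mult_right_mono) auto
      finally show ?thesis using k unfolding A'_def norm_scaleR by (simp add: field_simps)
    qed
    moreover have "inner (A' u) v = inner u (A' v)" for u v
      by (simp add: A'_def inner_diff_left inner_diff_right sa)
    moreover have "commutes_with R A'"
      using com R(1) by (simp add: commutes_with_def A'_def clinear_L2D)
    ultimately have "(\<forall>u. inner (A' u) u \<ge> 0) \<or> (\<forall>u. inner (A' u) u \<le> 0)"
      by (intro schur_definite[OF irr]) (auto intro: R)
    moreover have "inner (A' u) u = (inner (A u) u - c * inner u u) / (2 * k)" for u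
      by (simp add: A'_def inner_diff_left)
    ultimately show ?thesis using k by (simp add: zero_le_divide_iff divide_le_0_iff)
  qed
  have cross: "inner (A u) u * inner v v \<le> inner (A v) v * inner u u" if u: "u \<noteq> 0" and v: "v \<noteq> 0" for u v
  proof (rule ccontr)
    \<comment> \<open>If two Rayleigh quotients differed, their midpoint would be neither a lower
      nor an upper bound.\<close>
    assume n: "\<not> ?thesis"
    define a where "a = inner (A u) u / inner u u"
    define b where "b = inner (A v) v / inner v v"
    have p: "inner u u > 0" "inner v v > 0" using u v by simp_all
    have ab: "b < a" using n p by (simp add: a_def b_def field_simps)
    have "\<bar>a\<bar> \<le> k" "\<bar>b\<bar> \<le> k" using q[of u] q[of v] p by (simp_all add: a_def b_def abs_div divide_le_eq)
    then have "\<bar>a + b\<bar> \<le> 2 * k" using abs_triangle_ineq[of a b] by linarith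
    then have "\<bar>(a + b) / 2\<bar> \<le> k" by simp
    from split[OF this] show False
    proof
      assume "\<forall>u. (a + b) / 2 * inner u u \<le> inner (A u) u"
      then have "(a + b) / 2 * inner v v \<le> b * inner v v" using p by (simp add: b_def)
      then show False using ab p by (simp add: mult_le_cancel_right)
    next
      assume "\<forall>u. inner (A u) u \<le> (a + b) / 2 * inner u u"
      then have "a * inner u u \<le> (a + b) / 2 * inner u u" using p by (simp add: a_def)
      then show False using ab p by (simp add: mult_le_cancel_right)
    qed
  qed
  obtain w :: L2 where w: "w \<noteq> 0" using exists_nonzero_L2 by blast
  define a where "a = inner (A w) w / inner w w"
  have quad: "inner (A u) u = a * inner u u" for u
  proof (cases "u = 0")
    case False
    then show ?thesis using cross[OF False w] cross[OF w False] w by (simp add: a_def field_simps)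
  qed (simp add: Al)
  have "inner (A u) v = a * inner u v" for u v
  proof -
    have "inner (A (u + v)) (u + v) = inner (A u) u + inner (A v) v + 2 * inner (A u) v"
      using sa[of v u] by (simp add: Al inner_add_left inner_add_right inner_commute)
    moreover have "inner (u + v) (u + v) = inner u u + inner v v + 2 * inner u v"
      by (simp add: inner_add_left inner_add_right inner_commute)
    ultimately have "a * (inner u u + inner v v + 2 * inner u v) = a * inner u u + a * inner v v + 2 * inner (A u) v"
      by (simp only: quad)
    then show ?thesis by (simp add: distrib_left)
  qed
  then have "inner (A u - a *\<^sub>R u) (A u - a *\<^sub>R u) = 0" for u by (simp add: inner_diff_left)
  then have "A u = a *\<^sub>R u" for u by (metis eq_iff_diff_eq_0 inner_eq_zero_iff)
  then show ?thesis by blast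
qed

text \<open>The inverse \<open>V\<close> is the adjoint of \<open>U\<close>, so U + V and i (U - V)
  are self-adjoint and commute with the family. Both are real scalars, and \<open>U\<close> is a
  combination of them.\<close>

theorem schur_unitary:
  assumes irr: "irreducible_family R"
    and R: "\<And>T. T \<in> R \<Longrightarrow> clinear_L2 T" "\<And>T u. T \<in> R \<Longrightarrow> norm (T u) \<le> norm u"
    and U: "clinear_L2 U" "isometric_L2 U" and V: "clinear_L2 V" "isometric_L2 V"
    and inv: "\<And>u. U (V u) = u" "\<And>u. V (U u) = u"
    and com: "commutes_with R U" "commutes_with R V"
  shows "\<exists>c. \<forall>u. U u = c *\<^sub>C u"
proof -
  note Ul = clinear_L2D[OF U(1)] and Vl = clinear_L2D[OF V(1)]
  have adj: "cinner (U u) v = cinner u (V v)" for u v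
    using U(2) inv(1)[of v] by (metis isometric_L2_def)
  have adj': "cinner (V u) v = cinner u (U v)" for u v
    using adj[of v u] by (metis cinner_commute)
  have n: "norm (U u) = norm u" "norm (V u) = norm u" for u
    using U(2) V(2) by (simp_all add: norm_eq_sqrt_inner inner_L2_def isometric_L2_def)
  have "\<exists>a::real. \<forall>u. (\<lambda>u. U u + V u) u = a *\<^sub>R u"
  proof (rule schur_selfadjoint[OF irr])
    show "clinear_L2 T" "norm (T u) \<le> norm u" if "T \<in> R" for T u using R that by auto
    show "clinear_L2 (\<lambda>u. U u + V u)" by (simp add: clinear_L2_def Ul Vl scaleC_add_right)
    show "norm (U u + V u) \<le> 2 * norm u" for u using norm_triangle_ineq[of "U u" "V u"] n by simp
    show "inner (U u + V u) v = inner u (U v + V v)" for u v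
      by (simp add: inner_L2_def cinner_add_left cinner_add_right adj adj')
    show "commutes_with R (\<lambda>u. U u + V u)" using com R(1) by (simp add: commutes_with_def clinear_L2D)
  qed
  then obtain a where a: "\<And>u. U u + V u = a *\<^sub>R u" by blast
  have "\<exists>a::real. \<forall>u. (\<lambda>u. \<i> *\<^sub>C (U u - V u)) u = a *\<^sub>R u"
  proof (rule schur_selfadjoint[OF irr])
    show "clinear_L2 T" "norm (T u) \<le> norm u" if "T \<in> R" for T u using R that by auto
    show "clinear_L2 (\<lambda>u. \<i> *\<^sub>C (U u - V u))"
      by (simp add: clinear_L2_def Ul Vl scaleC_add_right scaleC_diff_right scaleC_scaleC mult.commute)
    show "norm (\<i> *\<^sub>C (U u - V u)) \<le> 2 * norm u" for u using norm_triangle_ineq4[of "U u" "V u"] n by (simp add: norm_scaleC)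
    show "inner (\<i> *\<^sub>C (U u - V u)) v = inner u (\<i> *\<^sub>C (U v - V v))" for u v
      by (simp add: inner_L2_def cinner_diff_left cinner_diff_right cinner_scaleC_left cinner_scaleC_right adj adj' algebra_simps)
    show "commutes_with R (\<lambda>u. \<i> *\<^sub>C (U u - V u))" using com R(1) by (simp add: commutes_with_def clinear_L2D)
  qed
  then obtain b where b: "\<And>u. \<i> *\<^sub>C (U u - V u) = b *\<^sub>R u" by blast
  have "U u = ((a - \<i> * b) / 2) *\<^sub>C u" for u
  proof -
    have "- \<i> *\<^sub>C (\<i> *\<^sub>C (U u - V u)) = (- \<i> * b) *\<^sub>C u" unfolding b by (simp add: scaleR_L2_def scaleC_scaleC)
    then have "U u - V u = (- \<i> * b) *\<^sub>C u" by (simp add: scaleC_scaleC)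
    then have "U u + V u + (U u - V u) = (a - \<i> * b) *\<^sub>C u"
      unfolding a by (simp add: scaleR_L2_def scaleC_add_left[symmetric])
    then have "2 *\<^sub>C U u = (a - \<i> * b) *\<^sub>C u" using scaleC_add_left[of 1 1 "U u"] by simp
    then have "(1/2) *\<^sub>C 2 *\<^sub>C U u = (1/2) *\<^sub>C (a - \<i> * b) *\<^sub>C u" by simp
    then show ?thesis by (simp add: scaleC_scaleC)
  qed
  then show ?thesis by blast
qed

subsection \<open>Characters of the real line\<close>

text \<open>Integrating the functional equation expresses the character through its own primitive
  \<open>\<Phi>\<close>, so continuity improves to differentiability. The character then solves ch'
  = k ch, and modulus one forces k to be imaginary.\<close>

lemma continuous_character:
  fixes ch :: "real \<Rightarrow> complex"
  assumes cont: "continuous_on UNIV ch" and mult: "\<And>x y. ch (x + y) = ch x * ch y" and norm: "\<And>x. cmod (ch x) = 1"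
  shows "\<exists>l. \<forall>y. ch y = cis (l * y)"
proof -
  have nz: "ch x \<noteq> 0" for x using norm[of x] by auto
  have one: "ch 0 = 1" using mult[of 0 0] nz[of 0] by simp
  have ex: "\<exists>\<Phi>. \<forall>x. - \<infinity> < ereal x \<longrightarrow> ereal x < \<infinity> \<longrightarrow> (\<Phi> has_vector_derivative ch x) (at x)"
    by (rule einterval_antiderivative) (use cont in \<open>auto simp: continuous_on_eq_continuous_at\<close>)
  then obtain \<Phi> where \<Phi>: "\<And>x. (\<Phi> has_vector_derivative ch x) (at x)" by auto
  have shift: "((\<lambda>a. \<Phi> (a + y)) has_vector_derivative ch (a + y)) (at a)" for a y
  proof -
    have "((\<lambda>a. a + y) has_vector_derivative 1) (at a)" by (auto intro!: derivative_eq_intros)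
    from vector_diff_chain_at[OF this, of \<Phi> "ch (a + y)"] show ?thesis using \<Phi> by (simp add: comp_def)
  qed
  have key: "ch y * (\<Phi> a - \<Phi> 0) = \<Phi> (a + y) - \<Phi> y" for y a
  proof -
    have "((\<lambda>a. ch y * \<Phi> a - \<Phi> (a + y)) has_vector_derivative ch y * ch a - ch (a + y)) (at a)" for a
      by (intro has_vector_derivative_diff has_vector_derivative_mult_right \<Phi> shift)
    then have "((\<lambda>a. ch y * \<Phi> a - \<Phi> (a + y)) has_vector_derivative 0) (at a within UNIV)" for a
      by (simp add: mult mult.commute)
    then obtain c where "\<And>a. ch y * \<Phi> a - \<Phi> (a + y) = c"
      using has_vector_derivative_zero_constant[of UNIV "\<lambda>a. ch y * \<Phi> a - \<Phi> (a + y)"] by auto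
    from this[of a] this[of 0] show ?thesis by (simp add: algebra_simps)
  qed
  \<comment> \<open>The primitive is not constant because its derivative at 0 is ch 0 = 1; the
    increment at such an \<open>a\<close> may be divided by.\<close>
  obtain a where a: "\<Phi> a \<noteq> \<Phi> 0"
  proof (rule ccontr)
    assume "\<not> thesis"
    then have "\<Phi> = (\<lambda>_. \<Phi> 0)" using that by blast
    then have "(\<Phi> has_vector_derivative 0) (at 0)" using has_vector_derivative_const by metis
    then show False using vector_derivative_unique_at[OF \<Phi>[of 0]] one by force
  qed
  define c where "c = \<Phi> a - \<Phi> 0"
  have c: "c \<noteq> 0" using a by (simp add: c_def)
  define k where "k = (ch a - 1) / c"
  have ch: "ch = (\<lambda>y. (1 / c) * (\<Phi> (y + a) - \<Phi> y))"
    using key[of _ a] c by (auto simp: fun_eq_iff c_def[symmetric] field_simps)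
  have dch: "(ch has_vector_derivative ch y * k) (at y)" for y
  proof -
    have "((\<lambda>y. (1 / c) * (\<Phi> (y + a) - \<Phi> y)) has_vector_derivative (1 / c) * (ch (y + a) - ch y)) (at y)"
      by (intro has_vector_derivative_diff has_vector_derivative_mult_right \<Phi> shift)
    moreover have "(1 / c) * (ch (y + a) - ch y) = ch y * k" by (simp add: mult k_def algebra_simps diff_divide_distrib)
    ultimately show ?thesis by (simp only: ch[symmetric])
  qed
  have dE: "((\<lambda>y. exp (- (k * of_real y))) has_vector_derivative - k * exp (- (k * of_real y))) (at y)" for y
    by (rule has_vector_derivative_real_field) (auto intro!: derivative_eq_intros)
  \<comment> \<open>Uniqueness for the linear equation: the quotient of the two candidate solutions
    has derivative zero.\<close>
  have "((\<lambda>y. ch y * exp (- (k * of_real y))) has_vector_derivative 0) (at y within UNIV)" for y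
  proof -
    have "((\<lambda>y. ch y * exp (- (k * of_real y))) has_vector_derivative
        ch y * (- k * exp (- (k * of_real y))) + ch y * k * exp (- (k * of_real y))) (at y)"
      by (rule has_vector_derivative_mult[OF dch dE])
    then show ?thesis by simp
  qed
  then obtain d where d: "\<And>y. ch y * exp (- (k * of_real y)) = d"
    using has_vector_derivative_zero_constant[of UNIV "\<lambda>y. ch y * exp (- (k * of_real y))"] by auto
  have "d = 1" using d[of 0] one by simp
  then have che: "ch y = exp (k * of_real y)" for y using d[of y] by (simp add: exp_minus field_simps)
  have "exp (Re k) = 1" using norm[of 1] che[of 1] by simp
  then have "Re k = 0" by simp
  then have k: "k = \<i> * of_real (Im k)" by (simp add: complex_eq_iff)
  have "ch y = cis (Im k * y)" for y
    by (subst che, subst k) (simp add: cis_conv_exp mult.assoc)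
  then show ?thesis by blast
qed

subsection \<open>Unitary representations with equal matrix coefficients\<close>

lemma unitary_rep_facts:
  assumes G: "group G" "carrier G = UNIV" and \<rho>: "unitary_rep G \<rho>"
  shows "clinear_L2 (\<rho> g)" "isometric_L2 (\<rho> g)" "cinner (\<rho> g u) (\<rho> g v) = cinner u v"
    "\<rho> (g \<otimes>\<^bsub>G\<^esub> h) u = \<rho> g (\<rho> h u)" "\<rho> \<one>\<^bsub>G\<^esub> u = u" "norm (\<rho> g u) = norm u"
    "cinner (\<rho> g u) v = cinner u (\<rho> (inv\<^bsub>G\<^esub> g) v)" "continuous_on UNIV (\<lambda>g. \<rho> g u)"
proof -
  interpret group G by (rule G)
  have hom: "\<rho> \<in> hom G unitary_group" using \<rho> by (simp add: unitary_rep_def)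
  have car: "\<rho> g \<in> carrier unitary_group" for g using hom_in_carrier[OF hom] G(2) by auto
  show lin: "clinear_L2 (\<rho> g)" and iso: "isometric_L2 (\<rho> g)" for g
    using car[of g] by (auto simp: unitary_group_def)
  have surj: "surj (\<rho> g)" for g using car[of g] by (auto simp: unitary_group_def)
  show ip: "cinner (\<rho> g u) (\<rho> g v) = cinner u v" for g u v using iso[of g] by (simp add: isometric_L2_def)
  show mult: "\<rho> (g \<otimes>\<^bsub>G\<^esub> h) u = \<rho> g (\<rho> h u)" for g h u
    using hom_mult[OF hom, of g h] G(2) by (simp add: unitary_group_def)
  show one: "\<rho> \<one>\<^bsub>G\<^esub> u = u" for u
  proof -
    obtain w where w: "u = \<rho> \<one>\<^bsub>G\<^esub> w" using surj by (metis surj_def)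
    show ?thesis using mult[of "\<one>\<^bsub>G\<^esub>" "\<one>\<^bsub>G\<^esub>" w] w by simp
  qed
  show "norm (\<rho> g u) = norm u" using ip[of g u u] by (simp add: norm_eq_sqrt_inner inner_L2_def)
  have "\<rho> g (\<rho> (inv\<^bsub>G\<^esub> g) v) = v" using mult[of g "inv\<^bsub>G\<^esub> g" v] one[of v] G(2) by simp
  then show "cinner (\<rho> g u) v = cinner u (\<rho> (inv\<^bsub>G\<^esub> g) v)" using ip[of g u "\<rho> (inv\<^bsub>G\<^esub> g) v"] by simp
  show "continuous_on UNIV (\<lambda>g. \<rho> g u)" using \<rho> G(2) by (simp add: unitary_rep_def)
qed

text \<open>The graph of the intertwiner on finite combinations of the two orbits. As a relation it
  is symmetric in the two representations, and that it is single-valued can be derived afterwards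
  from the preservation of inner products.\<close>

inductive_set orbit_pairs :: "('g \<Rightarrow> L2 \<Rightarrow> L2) \<Rightarrow> L2 \<Rightarrow> ('g \<Rightarrow> L2 \<Rightarrow> L2) \<Rightarrow> L2 \<Rightarrow> (L2 \<times> L2) set"
  for \<rho> v \<tau> w where
  zero: "(0, 0) \<in> orbit_pairs \<rho> v \<tau> w"
| step: "(u, u') \<in> orbit_pairs \<rho> v \<tau> w \<Longrightarrow> (c *\<^sub>C \<rho> g v + u, c *\<^sub>C \<tau> g w + u') \<in> orbit_pairs \<rho> v \<tau> w"

lemma orbit_pairs_swap: "(u, u') \<in> orbit_pairs \<rho> v \<tau> w \<Longrightarrow> (u', u) \<in> orbit_pairs \<tau> w \<rho> v"
  by (induction rule: orbit_pairs.induct) (auto intro: orbit_pairs.intros)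

lemma orbit_pairs_add:
  assumes "(u, u') \<in> orbit_pairs \<rho> v \<tau> w" "(x, x') \<in> orbit_pairs \<rho> v \<tau> w"
  shows "(u + x, u' + x') \<in> orbit_pairs \<rho> v \<tau> w"
  using assms by (induction rule: orbit_pairs.induct) (auto simp: add.assoc intro: orbit_pairs.intros)

lemma orbit_pairs_scale:
  assumes "(u, u') \<in> orbit_pairs \<rho> v \<tau> w"
  shows "(c *\<^sub>C u, c *\<^sub>C u') \<in> orbit_pairs \<rho> v \<tau> w"
  using assms by (induction rule: orbit_pairs.induct) (auto simp: scaleC_add_right scaleC_scaleC intro: orbit_pairs.intros)

context
  fixes G :: "('g::topological_space, 'm) monoid_scheme" and \<rho> \<tau> :: "'g \<Rightarrow> L2 \<Rightarrow> L2" and v w :: L2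
  assumes G: "group G" "carrier G = UNIV" and \<rho>: "unitary_rep G \<rho>" and \<tau>: "unitary_rep G \<tau>"
    and coeff: "\<And>g. cinner v (\<rho> g v) = cinner w (\<tau> g w)"
begin

private lemmas rep_facts = unitary_rep_facts[OF G \<rho>]
private lemmas t = unitary_rep_facts[OF G \<tau>]

lemma orbit_pairs_act:
  assumes "(u, u') \<in> orbit_pairs \<rho> v \<tau> w"
  shows "(\<rho> g u, \<tau> g u') \<in> orbit_pairs \<rho> v \<tau> w"
  using assms
proof (induction rule: orbit_pairs.induct)
  case zero
  show ?case by (simp add: clinear_L2D[OF rep_facts(1)] clinear_L2D[OF t(1)] orbit_pairs.zero)
next
  case (step u u' c h)
  show ?case
    using orbit_pairs.step[OF step.IH, of c "g \<otimes>\<^bsub>G\<^esub> h"]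
    by (simp add: clinear_L2D[OF rep_facts(1)] clinear_L2D[OF t(1)] rep_facts(4) t(4))
qed

text \<open>An inner product of two orbit vectors at g and h is the matrix coefficient at the
  inverse of g times h, and the coefficients agree by assumption.\<close>

lemma orbit_pairs_cinner:
  assumes "(u, u') \<in> orbit_pairs \<rho> v \<tau> w" "(x, x') \<in> orbit_pairs \<rho> v \<tau> w"
  shows "cinner u x = cinner u' x'"
proof -
  have gen: "cinner (\<rho> g v) x = cinner (\<tau> g w) x'" if "(x, x') \<in> orbit_pairs \<rho> v \<tau> w" for g x x'
    using that
  proof (induction rule: orbit_pairs.induct)
    case (step u u' c h)
    have "cinner (\<rho> g v) (\<rho> h v) = cinner (\<tau> g w) (\<tau> h w)"
      by (simp add: rep_facts(7) t(7) coeff flip: rep_facts(4) t(4))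
    then show ?case using step.IH by (simp add: cinner_add_right cinner_scaleC_right)
  qed simp
  show ?thesis
    using assms(1)
  proof (induction rule: orbit_pairs.induct)
    case (step u u' c h)
    then show ?case using gen[OF assms(2)] by (simp add: cinner_add_left cinner_scaleC_left)
  qed simp
qed

private definition "C = closure (orbit_pairs \<rho> v \<tau> w)"

private lemma C_seq: "(u, u') \<in> C \<longleftrightarrow> (\<exists>x y. (\<forall>n. (x n, y n) \<in> orbit_pairs \<rho> v \<tau> w) \<and> x \<longlonglongrightarrow> u \<and> y \<longlonglongrightarrow> u')"
proof
  assume "(u, u') \<in> C"
  then obtain z where z: "\<And>n. z n \<in> orbit_pairs \<rho> v \<tau> w" "z \<longlonglongrightarrow> (u, u')"
    unfolding C_def closure_sequential by blast
  show "\<exists>x y. (\<forall>n. (x n, y n) \<in> orbit_pairs \<rho> v \<tau> w) \<and> x \<longlonglongrightarrow> u \<and> y \<longlonglongrightarrow> u'"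
    using z(1) tendsto_fst[OF z(2)] tendsto_snd[OF z(2)]
    by (intro exI[of _ "\<lambda>n. fst (z n)"] exI[of _ "\<lambda>n. snd (z n)"]) simp
next
  assume "\<exists>x y. (\<forall>n. (x n, y n) \<in> orbit_pairs \<rho> v \<tau> w) \<and> x \<longlonglongrightarrow> u \<and> y \<longlonglongrightarrow> u'"
  then obtain x y where xy: "\<And>n. (x n, y n) \<in> orbit_pairs \<rho> v \<tau> w" "x \<longlonglongrightarrow> u" "y \<longlonglongrightarrow> u'" by blast
  then show "(u, u') \<in> C"
    unfolding C_def closure_sequential by (intro exI[of _ "\<lambda>n. (x n, y n)"]) (auto intro: tendsto_Pair)
qed

private lemma C_add: "(u, u') \<in> C \<Longrightarrow> (x, x') \<in> C \<Longrightarrow> (u + x, u' + x') \<in> C"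
  unfolding C_seq
proof (elim exE conjE)
  fix a b c d
  assume *: "\<forall>n. (a n, b n) \<in> orbit_pairs \<rho> v \<tau> w" "\<forall>n. (c n, d n) \<in> orbit_pairs \<rho> v \<tau> w"
    "a \<longlonglongrightarrow> u" "b \<longlonglongrightarrow> u'" "c \<longlonglongrightarrow> x" "d \<longlonglongrightarrow> x'"
  show "\<exists>p q. (\<forall>n. (p n, q n) \<in> orbit_pairs \<rho> v \<tau> w) \<and> p \<longlonglongrightarrow> u + x \<and> q \<longlonglongrightarrow> u' + x'"
    by (rule exI[of _ "\<lambda>n. a n + c n"], rule exI[of _ "\<lambda>n. b n + d n"])
       (use * in \<open>auto intro: orbit_pairs_add tendsto_add\<close>)
qed

private lemma C_scale: "(u, u') \<in> C \<Longrightarrow> (c *\<^sub>C u, c *\<^sub>C u') \<in> C"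
  unfolding C_seq
proof (elim exE conjE)
  fix a b
  assume *: "\<forall>n. (a n, b n) \<in> orbit_pairs \<rho> v \<tau> w" "a \<longlonglongrightarrow> u" "b \<longlonglongrightarrow> u'"
  show "\<exists>p q. (\<forall>n. (p n, q n) \<in> orbit_pairs \<rho> v \<tau> w) \<and> p \<longlonglongrightarrow> c *\<^sub>C u \<and> q \<longlonglongrightarrow> c *\<^sub>C u'"
    by (rule exI[of _ "\<lambda>n. c *\<^sub>C a n"], rule exI[of _ "\<lambda>n. c *\<^sub>C b n"])
       (use * in \<open>auto intro: orbit_pairs_scale tendsto_scaleC\<close>)
qed

private lemma C_act: "(u, u') \<in> C \<Longrightarrow> (\<rho> g u, \<tau> g u') \<in> C"
  unfolding C_seq
proof (elim exE conjE)
  fix a b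
  assume *: "\<forall>n. (a n, b n) \<in> orbit_pairs \<rho> v \<tau> w" "a \<longlonglongrightarrow> u" "b \<longlonglongrightarrow> u'"
  have bl: "bounded_linear (\<rho> g)" "bounded_linear (\<tau> g)"
    using bounded_linear_clinear[OF rep_facts(1), of g 1] bounded_linear_clinear[OF t(1), of g 1] rep_facts(6) t(6) by simp_all
  show "\<exists>p q. (\<forall>n. (p n, q n) \<in> orbit_pairs \<rho> v \<tau> w) \<and> p \<longlonglongrightarrow> \<rho> g u \<and> q \<longlonglongrightarrow> \<tau> g u'"
    by (rule exI[of _ "\<lambda>n. \<rho> g (a n)"], rule exI[of _ "\<lambda>n. \<tau> g (b n)"])
       (use * in \<open>auto intro: orbit_pairs_act bounded_linear.tendsto bl\<close>)
qed

private lemma C_cinner: "(u, u') \<in> C \<Longrightarrow> (x, x') \<in> C \<Longrightarrow> cinner u x = cinner u' x'"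
  unfolding C_seq
proof (elim exE conjE)
  fix a b c d
  assume *: "\<forall>n. (a n, b n) \<in> orbit_pairs \<rho> v \<tau> w" "\<forall>n. (c n, d n) \<in> orbit_pairs \<rho> v \<tau> w"
    "a \<longlonglongrightarrow> u" "b \<longlonglongrightarrow> u'" "c \<longlonglongrightarrow> x" "d \<longlonglongrightarrow> x'"
  have "cinner (a n) (c n) = cinner (b n) (d n)" for n using *(1,2) by (blast intro: orbit_pairs_cinner)
  then have "(\<lambda>n. cinner (a n) (c n)) \<longlonglongrightarrow> cinner u' x'" using tendsto_cinner[OF *(4,6)] by simp
  then show "cinner u x = cinner u' x'" using tendsto_cinner[OF *(3,5)] LIMSEQ_unique by blast
qed

private lemma C_diff: "(u, u') \<in> C \<Longrightarrow> (x, x') \<in> C \<Longrightarrow> (u - x, u' - x') \<in> C"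
  using C_add[OF _ C_scale[of x x' "- 1"]] by (simp add: scaleC_minus_one)

private lemma C_norm: "(u, u') \<in> C \<Longrightarrow> norm u = norm u'"
  using C_cinner[of u u' u u'] by (simp add: norm_eq_sqrt_inner inner_L2_def)

private lemma C_zero: "(0, 0) \<in> C"
  unfolding C_def using closure_subset orbit_pairs.zero by blast

private lemma C_gen: "(v, w) \<in> C"
proof -
  have "(1 *\<^sub>C \<rho> \<one>\<^bsub>G\<^esub> v + 0, 1 *\<^sub>C \<tau> \<one>\<^bsub>G\<^esub> w + 0) \<in> orbit_pairs \<rho> v \<tau> w"
    by (intro orbit_pairs.step orbit_pairs.zero)
  then show ?thesis unfolding C_def using closure_subset by (auto simp: rep_facts(5) t(5))
qed

text \<open>The domain of the closed graph is invariant and contains \<open>v\<close>. It is closed,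
  because the graph is isometric: if the first components converge, the second components form a
  Cauchy sequence and the limit pair stays in the graph.\<close>

lemma orbit_closure_total:
  assumes irr: "unitary_irrep G \<rho>" and v: "v \<noteq> 0"
  shows "\<exists>u'. (u, u') \<in> closure (orbit_pairs \<rho> v \<tau> w)"
proof -
  define D where "D = {u. \<exists>u'. (u, u') \<in> C}"
  have "csubspace_L2 D"
    using C_zero C_add C_scale unfolding csubspace_L2_def D_def by blast
  moreover have "closed D"
    unfolding closed_sequential_limits
  proof (intro allI impI, elim conjE)
    fix x u assume x: "\<forall>n. x n \<in> D" "x \<longlonglongrightarrow> u"
    then obtain y where y: "\<And>n. (x n, y n) \<in> C" unfolding D_def mem_Collect_eq by metis
    have "norm (y m - y n) = norm (x m - x n)" for m n using C_norm[OF C_diff[OF y y]] by simp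
    then have "Cauchy y" using LIMSEQ_imp_Cauchy[OF x(2)] by (simp add: Cauchy_def dist_norm)
    then obtain u' where u': "y \<longlonglongrightarrow> u'" using Cauchy_convergent_iff convergent_def by blast
    have "closed C" by (simp add: C_def)
    from closed_sequentially[OF this y tendsto_Pair[OF x(2) u']] have "(u, u') \<in> C" .
    then show "u \<in> D" by (auto simp: D_def)
  qed
  moreover have "\<forall>g\<in>carrier G. \<rho> g ` D \<subseteq> D" using C_act by (fastforce simp: D_def)
  ultimately have "D = {0} \<or> D = UNIV" using irr unfolding unitary_irrep_def by blast
  moreover have "v \<in> D" using C_gen by (auto simp: D_def)
  ultimately have "D = UNIV" using v by auto
  then show ?thesis by (auto simp: D_def C_def)
qed

lemma orbit_closure_unique:
  assumes "(u, x) \<in> closure (orbit_pairs \<rho> v \<tau> w)" "(u, y) \<in> closure (orbit_pairs \<rho> v \<tau> w)"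
  shows "x = y"
  using C_norm[OF C_diff[of u x u y]] assms by (simp add: C_def)

lemmas orbit_closure_linear = C_add[unfolded C_def] C_scale[unfolded C_def] C_act[unfolded C_def] C_cinner[unfolded C_def]

end

lemma orbit_closure_swap:
  assumes "(u, u') \<in> closure (orbit_pairs \<rho> v \<tau> w)" shows "(u', u) \<in> closure (orbit_pairs \<tau> w \<rho> v)"
proof -
  obtain z where z: "\<And>n. z n \<in> orbit_pairs \<rho> v \<tau> w" "z \<longlonglongrightarrow> (u, u')"
    using assms unfolding closure_sequential by blast
  have "(snd (z n), fst (z n)) \<in> orbit_pairs \<tau> w \<rho> v" for n
    using orbit_pairs_swap[of "fst (z n)" "snd (z n)" \<rho> v \<tau> w] z(1)[of n] by simp
  moreover have "(\<lambda>n. (snd (z n), fst (z n))) \<longlonglongrightarrow> (u', u)"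
    using tendsto_Pair[OF tendsto_snd[OF z(2)] tendsto_fst[OF z(2)]] by simp
  ultimately show ?thesis
    unfolding closure_sequential by (intro exI[of _ "\<lambda>n. (snd (z n), fst (z n))"] conjI allI)
qed

text \<open>The uniqueness part of the GNS construction: a cyclic representation is determined by
  one matrix coefficient, and in an irreducible one every nonzero vector is cyclic. Surjectivity is
  totality for the swapped graph.\<close>

theorem irreps_with_equal_coefficients:
  fixes \<rho> \<tau> :: "'g::topological_space \<Rightarrow> L2 \<Rightarrow> L2"
  assumes G: "group G" "carrier G = UNIV" and \<rho>: "unitary_irrep G \<rho>" and \<tau>: "unitary_irrep G \<tau>"
    and coeff: "\<And>g. cinner v (\<rho> g v) = cinner w (\<tau> g w)" and nz: "v \<noteq> 0" "w \<noteq> 0"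
  shows "\<exists>W. W \<in> carrier unitary_group \<and> (\<forall>g u. W (\<rho> g u) = \<tau> g (W u))"
proof -
  let ?C = "closure (orbit_pairs \<rho> v \<tau> w)"
  have \<rho>': "unitary_rep G \<rho>" and \<tau>': "unitary_rep G \<tau>" using \<rho> \<tau> by (auto simp: unitary_irrep_def)
  note lin = orbit_closure_linear[OF G \<rho>' \<tau>' coeff] and uniq = orbit_closure_unique[OF G \<rho>' \<tau>' coeff]
  define W where "W u = (SOME u'. (u, u') \<in> ?C)" for u
  have W: "(u, W u) \<in> ?C" for u
    unfolding W_def using orbit_closure_total[OF G \<rho>' \<tau>' coeff \<rho> nz(1)] by (rule someI_ex)
  have W_eq: "W u = u'" if "(u, u') \<in> ?C" for u u' using uniq[OF W that] .
  have "clinear_L2 W"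
    unfolding clinear_L2_def using W_eq[OF lin(1)[OF W W]] W_eq[OF lin(2)[OF W]] by blast
  moreover have "isometric_L2 W" unfolding isometric_L2_def using lin(4)[OF W W] by metis
  moreover have "surj W"
  unfolding surj_def
  proof (intro allI)
    fix y
    have "\<exists>x. (y, x) \<in> closure (orbit_pairs \<tau> w \<rho> v)"
      by (rule orbit_closure_total[OF G \<tau>' \<rho>' coeff[symmetric] \<tau> nz(2)])
    then obtain x where "(y, x) \<in> closure (orbit_pairs \<tau> w \<rho> v)" ..
    from W_eq[OF orbit_closure_swap[OF this]] show "\<exists>x. y = W x" by metis
  qed
  moreover have "W (\<rho> g u) = \<tau> g (W u)" for g u by (rule W_eq[OF lin(3)[OF W]])
  ultimately show ?thesis by (auto simp: unitary_group_def)
qed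

subsection \<open>Gaussian integrals on the plane\<close>

text \<open>The standard symplectic form of the plane. Half of it, times \<open>l\<close>, is the
  cocycle of the Weyl operators.\<close>

definition sympl :: "real \<times> real \<Rightarrow> real \<times> real \<Rightarrow> real" where
  "sympl a b = fst a * snd b - fst b * snd a"

lemma sympl_minus_left: "sympl (- a) b = - sympl a b"
  by (simp add: sympl_def)

lemma sympl_commute: "sympl a b = - sympl b a"
  by (simp add: sympl_def)

lemma power2_norm_pair: "(norm (a :: real \<times> real))\<^sup>2 = (fst a)\<^sup>2 + (snd a)\<^sup>2"
  by (cases a) (simp add: norm_Pair)

lemma integral_gaussian_cis_plane:
  assumes \<rho>: "\<rho> > 0"
  shows "integrable lborel (\<lambda>a :: real \<times> real. of_real (exp (- (\<rho> * norm a)\<^sup>2)) * cis (sympl e a))"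
    and "(\<integral>a. of_real (exp (- (\<rho> * norm a)\<^sup>2)) * cis (sympl e a) \<partial>(lborel :: (real \<times> real) measure))
      = of_real (pi / \<rho>\<^sup>2 * exp (- (norm e)\<^sup>2 / (4 * \<rho>\<^sup>2)))"
proof -
  define f where "f r s = complex_of_real (exp (- (\<rho> * s)\<^sup>2)) * cis (s * r)" for r s :: real
  have fi: "integrable lborel (f r)" for r
    by (rule Bochner_Integration.integrable_bound[OF integrable_gaussian[OF \<rho>]])
       (auto simp: f_def[abs_def] norm_mult)
  have fv: "(\<integral>s. f r s \<partial>lborel) = of_real (2 * pi * normal_density 0 (\<rho> * sqrt 2) r)" for r
    unfolding f_def by (rule integral_gaussian_cis[OF \<rho>])
  have eq: "of_real (exp (- (\<rho> * norm a)\<^sup>2)) * cis (sympl e a) = (case a of (s, t) \<Rightarrow> f (- snd e) s * f (fst e) t)" for a :: "real \<times> real"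
  proof -
    obtain s t where a: "a = (s, t)" by (cases a)
    have "exp (- (\<rho> * norm a)\<^sup>2) = exp (- (\<rho> * s)\<^sup>2) * exp (- (\<rho> * t)\<^sup>2)"
      by (simp add: power_mult_distrib power2_norm_pair a distrib_left flip: exp_add)
    moreover have "cis (sympl e a) = cis (s * - snd e) * cis (t * fst e)"
      by (simp add: sympl_def a cis_mult algebra_simps)
    ultimately show ?thesis by (simp add: f_def a)
  qed
  show "integrable lborel (\<lambda>a :: real \<times> real. of_real (exp (- (\<rho> * norm a)\<^sup>2)) * cis (sympl e a))"
    unfolding eq by (rule integral_product_lborel(1)[OF fi fi])
  have "2 * pi * normal_density 0 (\<rho> * sqrt 2) (- snd e) * (2 * pi * normal_density 0 (\<rho> * sqrt 2) (fst e))
    = pi / \<rho>\<^sup>2 * exp (- (norm e)\<^sup>2 / (4 * \<rho>\<^sup>2))"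
  proof -
    have 1: "normal_density 0 (\<rho> * sqrt 2) x = 1 / sqrt (4 * pi * \<rho>\<^sup>2) * exp (- x\<^sup>2 / (4 * \<rho>\<^sup>2))" for x
      by (simp add: normal_density_def power_mult_distrib mult.commute mult.left_commute)
    have 2: "sqrt (4 * pi * \<rho>\<^sup>2) * sqrt (4 * pi * \<rho>\<^sup>2) = 4 * pi * \<rho>\<^sup>2" by simp
    have 3: "exp (- (- snd e)\<^sup>2 / (4 * \<rho>\<^sup>2)) * exp (- (fst e)\<^sup>2 / (4 * \<rho>\<^sup>2)) = exp (- (norm e)\<^sup>2 / (4 * \<rho>\<^sup>2))"
    proof -
      have "- (- snd e)\<^sup>2 / (4 * \<rho>\<^sup>2) + - (fst e)\<^sup>2 / (4 * \<rho>\<^sup>2) = - (norm e)\<^sup>2 / (4 * \<rho>\<^sup>2)"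
        unfolding power2_norm_pair by (simp add: add_divide_distrib diff_divide_distrib)
      then show ?thesis by (simp only: exp_add[symmetric])
    qed
    have 4: "2 * pi * (1 / sqrt (4 * pi * \<rho>\<^sup>2) * x) * (2 * pi * (1 / sqrt (4 * pi * \<rho>\<^sup>2) * y))
      = 4 * pi\<^sup>2 / (sqrt (4 * pi * \<rho>\<^sup>2) * sqrt (4 * pi * \<rho>\<^sup>2)) * (x * y)" for x y
      by (simp add: power2_eq_square)
    show ?thesis unfolding 1 4 2 3 using \<rho> by (simp add: power2_eq_square)
  qed
  then show "(\<integral>a. of_real (exp (- (\<rho> * norm a)\<^sup>2)) * cis (sympl e a) \<partial>(lborel :: (real \<times> real) measure))
      = of_real (pi / \<rho>\<^sup>2 * exp (- (norm e)\<^sup>2 / (4 * \<rho>\<^sup>2)))"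
    unfolding eq integral_product_lborel(2)[OF fi fi] fv by (simp flip: of_real_mult)
qed

lemma integral_affine_plane:
  fixes f :: "real \<times> real \<Rightarrow> complex"
  assumes c: "c \<noteq> 0" and [measurable]: "f \<in> borel_measurable borel"
  shows "(\<integral>x. f x \<partial>lborel) = of_real (c\<^sup>2) * (\<integral>x. f (t + c *\<^sub>R x) \<partial>lborel)"
proof -
  have e: "(lborel :: (real \<times> real) measure) = density (distr lborel borel (\<lambda>x. t + c *\<^sub>R x)) (\<lambda>_. ennreal (c\<^sup>2))"
    using lborel_affine[OF c, of t] by (simp add: power2_eq_square)
  have "(\<integral>x. f x \<partial>lborel) = (\<integral>x. f x \<partial>density (distr lborel borel (\<lambda>x :: real \<times> real. t + c *\<^sub>R x)) (\<lambda>_. ennreal (c\<^sup>2)))"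
    by (rule arg_cong[where f="\<lambda>M. integral\<^sup>L M f", OF e])
  also have "\<dots> = (\<integral>x. c\<^sup>2 *\<^sub>R f (t + c *\<^sub>R x) \<partial>lborel)"
    by (subst integral_density) (auto simp: integral_distr)
  finally show ?thesis by (simp add: scaleR_conv_of_real)
qed

lemma integral_translate_plane:
  fixes f :: "real \<times> real \<Rightarrow> complex"
  assumes "f \<in> borel_measurable borel"
  shows "(\<integral>x. f (x + t) \<partial>lborel) = (\<integral>x. f x \<partial>lborel)"
  using integral_affine_plane[of 1 f t] assms by (simp add: add.commute)

lemma nn_integral_translate_plane:
  fixes f :: "real \<times> real \<Rightarrow> ennreal"
  assumes [measurable]: "f \<in> borel_measurable borel"
  shows "(\<integral>\<^sup>+x. f (x + t) \<partial>lborel) = (\<integral>\<^sup>+x. f x \<partial>lborel)"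
proof -
  have "(\<integral>\<^sup>+x. f x \<partial>lborel) = (\<integral>\<^sup>+x. f x \<partial>distr lborel borel ((+) t))"
    by (simp add: lborel_distr_plus)
  also have "\<dots> = (\<integral>\<^sup>+x. f (t + x) \<partial>lborel)" by (rule nn_integral_distr) measurable
  finally show ?thesis by (simp add: add.commute)
qed

subsection \<open>The vacuum vector of a representation with nontrivial central character\<close>

locale heisenberg_rep =
  fixes \<rho> :: "real \<times> real \<times> real \<Rightarrow> L2 \<Rightarrow> L2" and l :: real
  assumes rep: "unitary_rep heisenberg \<rho>" and central: "\<rho> (0, y, 0) u = cis (l * y) *\<^sub>C u" and l: "l \<noteq> 0"
begin

lemma carrier_heisenberg: "carrier heisenberg = UNIV"
  by (simp add: heisenberg_def)

lemmas rep_facts = unitary_rep_facts[OF group_heisenberg carrier_heisenberg rep]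
lemmas rep_linear = clinear_L2D[OF rep_facts(1)]

text \<open>The Weyl operators. With the middle entry q p / 2 of the section, the section point of -
  a is the Heisenberg inverse of that of a, so V (- a) is the adjoint of V a and the cocycle is
  antisymmetric.\<close>

definition V :: "real \<times> real \<Rightarrow> L2 \<Rightarrow> L2" where "V a = \<rho> (cs_section a)"

lemma V_V: "V a (V b u) = cis (l / 2 * sympl a b) *\<^sub>C V (a + b) u"
proof -
  have "cs_section a \<otimes>\<^bsub>heisenberg\<^esub> cs_section b = (0, sympl a b / 2, 0) \<otimes>\<^bsub>heisenberg\<^esub> cs_section (a + b)"
    by (cases a; cases b) (simp add: cs_section_def heisenberg_def sympl_def field_simps)
  then have "V a (V b u) = \<rho> (0, sympl a b / 2, 0) (\<rho> (cs_section (a + b)) u)"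
    unfolding V_def by (simp only: rep_facts(4)[symmetric])
  then show ?thesis by (simp add: V_def central)
qed

lemma V_0: "V 0 u = u"
  using central[of 0 u] by (simp add: V_def cs_section_def zero_prod_def cis_zero)

lemma V_linear: "V a (c *\<^sub>C u) = c *\<^sub>C V a u"
  by (simp add: V_def rep_linear)

lemma V_unitary: "cinner (V a u) (V a v) = cinner u v" "norm (V a u) = norm u"
  by (simp_all add: V_def rep_facts(3) rep_facts(6))

lemma V_adjoint: "cinner (V a u) v = cinner u (V (- a) v)"
proof -
  have "V a (V (- a) v) = v" by (simp add: V_V V_0 sympl_def)
  then show ?thesis by (metis V_unitary(1))
qed

lemma continuous_V: "continuous_on UNIV (\<lambda>a. V a u)"
proof -
  have "continuous_on UNIV (\<lambda>a. \<rho> (cs_section a) u)"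
    by (rule continuous_on_compose2[OF rep_facts(8)]) (auto simp: cs_section_def split_beta' intro!: continuous_intros)
  then show ?thesis by (simp add: V_def)
qed

text \<open>The rate \<open>\<bar>l\<bar> / 4\<close> is forced: it is the one for which the two
  Gaussians in |c - b| and |b + c| produced by \<open>gaussian_phase_integral\<close> have equal
  rates, so that their product splits as G b times G c.\<close>

definition G :: "real \<times> real \<Rightarrow> real" where "G a = exp (- (\<bar>l\<bar> / 4 * (norm a)\<^sup>2))"

lemma G_pos: "G a > 0" and G_le: "G a \<le> 1"
  by (simp_all add: G_def)

lemma measurable_G [measurable]: "G \<in> borel_measurable borel"
  unfolding G_def by measurable

lemma G_eq: "G a = exp (- (sqrt \<bar>l\<bar> / 2 * norm a)\<^sup>2)"
  by (simp add: G_def power_mult_distrib power_divide)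

lemma integrable_G: "integrable lborel G"
  using integrable_norm[OF integral_gaussian_cis_plane(1)[of "sqrt \<bar>l\<bar> / 2" 0]] l
  by (simp add: norm_mult G_eq[abs_def])

lemma nn_G: "(\<integral>\<^sup>+a. ennreal (G a) \<partial>lborel) < \<infinity>"
  using integrable_G G_pos by (simp add: integrable_iff_bounded abs_of_pos)

text \<open>The weak integral of G a times V a w, up to a constant von Neumann's projection of
  \<open>w\<close> to the vacuum line. It is given by its inner products, and
  \<open>riesz_representation\<close> supplies existence.\<close>

definition vac :: "L2 \<Rightarrow> L2" where
  "vac w = (SOME v. \<forall>u. (\<integral>a. of_real (G a) * cinner (V a w) u \<partial>lborel) = cinner v u)"

lemma measurable_cinner_V [measurable]: "(\<lambda>a. cinner (V a w) u) \<in> borel_measurable borel"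
  by (intro borel_measurable_continuous_onI continuous_intros continuous_V)

lemma integrable_G_V: "integrable lborel (\<lambda>a. of_real (G a) * cinner (V a w) u)"
proof (rule Bochner_Integration.integrable_bound)
  show "integrable lborel (\<lambda>a. G a * (norm w * norm u))" using integrable_G by simp
  show "AE a in lborel. norm (of_real (G a) * cinner (V a w) u) \<le> norm (G a * (norm w * norm u))"
    using cmod_cinner_le[of "V _ w" u] G_pos by (auto simp: norm_mult V_unitary abs_of_pos less_imp_le intro!: mult_left_mono)
qed measurable

lemma vac: "cinner (vac w) u = (\<integral>a. of_real (G a) * cinner (V a w) u \<partial>lborel)"
proof -
  let ?f = "\<lambda>u. \<integral>a. of_real (G a) * cinner (V a w) u \<partial>lborel"
  have "\<exists>v. \<forall>u. ?f u = cinner v u"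
  proof (rule riesz_representation)
    show "?f (u + v) = ?f u + ?f v" for u v by (simp add: cinner_add_right distrib_left integrable_G_V)
    show "?f (c *\<^sub>C u) = c * ?f u" for c u by (simp add: cinner_scaleC_right mult.left_commute)
    fix u
    have "cmod (?f u) \<le> (\<integral>a. norm (of_real (G a) * cinner (V a w) u) \<partial>lborel)" by (rule integral_norm_bound)
    also have "\<dots> \<le> (\<integral>a. G a * (norm w * norm u) \<partial>lborel)"
      using cmod_cinner_le[of "V _ w" u] G_pos integrable_G integrable_norm[OF integrable_G_V]
      by (intro integral_mono) (auto simp: norm_mult V_unitary abs_of_pos less_imp_le intro!: mult_left_mono)
    also have "\<dots> = ((\<integral>a. G a \<partial>lborel) * norm w) * norm u" by simp
    finally show "cmod (?f u) \<le> ((\<integral>a. G a \<partial>lborel) * norm w) * norm u" .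
  qed
  then have "\<forall>u. ?f u = cinner (vac w) u" unfolding vac_def by (rule someI_ex)
  from spec[OF this, of u] show ?thesis by (rule sym)
qed

text \<open>With \<open>c = b + a' - a\<close> the matrix coefficient of \<open>w\<close> at \<open>V(-a) V(b) V(a')\<close> is a phase times the one at
  \<open>V(c)\<close>. Integrating the phase against \<open>G a * G a'\<close> gives a multiple of \<open>G b * G c\<close>.\<close>

lemma V_triple:
  "cinner (V a w) (V b (V (c + (a - b)) w)) = cis (l / 2 * (sympl b c + sympl (b + c) a)) * cinner w (V c w)"
proof -
  have 1: "V b (V (c + (a - b)) w) = cis (l / 2 * sympl b (c + (a - b))) *\<^sub>C V (c + a) w"
    by (simp add: V_V)
  have 2: "V (- a) (cis (l / 2 * sympl b (c + (a - b))) *\<^sub>C V (c + a) w)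
    = (cis (l / 2 * sympl b (c + (a - b))) * cis (l / 2 * sympl (- a) (c + a))) *\<^sub>C V c w"
    by (simp add: V_linear V_V scaleC_scaleC)
  have 3: "cis (l / 2 * sympl b (c + (a - b))) * cis (l / 2 * sympl (- a) (c + a)) = cis (l / 2 * (sympl b c + sympl (b + c) a))"
  proof -
    have "sympl b (c + (a - b)) + sympl (- a) (c + a) = sympl b c + sympl (b + c) a"
      by (simp add: sympl_def algebra_simps)
    then show ?thesis by (simp only: cis_mult distrib_left[symmetric])
  qed
  show ?thesis by (subst V_adjoint, subst 1, subst 2, subst 3, rule cinner_scaleC_right)
qed

text \<open>Completing the square leaves a Gaussian in b - c, and the Fourier integral of the
  remaining Gaussian gives one in b + c with the same rate. The parallelogram law then removes the
  mixed term.\<close>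

lemma gaussian_phase_integral:
  "(\<integral>a. of_real (G a * G (c + (a - b))) * cis (l / 2 * (sympl b c + sympl (b + c) a)) \<partial>lborel)
    = of_real (2 * pi / \<bar>l\<bar> * (G b * G c))"
proof -
  \<comment> \<open>The midpoint of 0 and b - c, the centers of the two Gaussian factors in the
    variable \<open>a\<close>.\<close>
  define d where "d = (1/2) *\<^sub>R (b - c)"
  define r where "r = sqrt (\<bar>l\<bar> / 2)"
  have r: "r > 0" "r\<^sup>2 = \<bar>l\<bar> / 2" using l by (simp_all add: r_def)
  let ?f = "\<lambda>a. of_real (G a * G (c + (a - b))) * cis (l / 2 * (sympl b c + sympl (b + c) a))"
  have pw: "?f (a + d) = of_real (exp (- (\<bar>l\<bar> / 8 * (norm (c - b))\<^sup>2))) * (of_real (exp (- (r * norm a)\<^sup>2)) * cis (sympl ((l / 2) *\<^sub>R (b + c)) a))" for a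
  proof -
    have e1: "c + (a + d - b) = a - d" by (simp add: d_def prod_eq_iff field_simps)
    have e2: "(norm (a + d))\<^sup>2 + (norm (a - d))\<^sup>2 = 2 * (norm a)\<^sup>2 + (norm (c - b))\<^sup>2 / 2"
      unfolding d_def power2_norm_pair by (simp add: power2_eq_square field_simps)
    have "G (a + d) * G (c + (a + d - b)) = exp (- (\<bar>l\<bar> / 4 * ((norm (a + d))\<^sup>2 + (norm (a - d))\<^sup>2)))"
      by (simp only: G_def e1 exp_add[symmetric] distrib_left minus_add_distrib)
    also have "\<dots> = exp (- (\<bar>l\<bar> / 4 * (2 * (norm a)\<^sup>2 + (norm (c - b))\<^sup>2 / 2)))"
      by (simp only: e2)
    also have "\<dots> = exp (- (\<bar>l\<bar> / 8 * (norm (c - b))\<^sup>2)) * exp (- (r * norm a)\<^sup>2)"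
      by (simp add: power_mult_distrib r(2) field_simps flip: exp_add)
    finally have 1: "G (a + d) * G (c + (a + d - b)) = exp (- (\<bar>l\<bar> / 8 * (norm (c - b))\<^sup>2)) * exp (- (r * norm a)\<^sup>2)" .
    have 2: "l / 2 * (sympl b c + sympl (b + c) (a + d)) = sympl ((l / 2) *\<^sub>R (b + c)) a"
      by (simp add: d_def sympl_def field_simps)
    show ?thesis unfolding 1 2 by simp
  qed
  have "(\<integral>a. ?f a \<partial>lborel) = (\<integral>a. ?f (a + d) \<partial>lborel)"
  proof (rule integral_translate_plane[symmetric])
    have "continuous_on UNIV ?f"
      unfolding G_def sympl_def cis_conv_exp by (intro continuous_intros)
    then show "?f \<in> borel_measurable borel" by (rule borel_measurable_continuous_onI)
  qed
  also have "\<dots> = (\<integral>a. of_real (exp (- (\<bar>l\<bar> / 8 * (norm (c - b))\<^sup>2))) * (of_real (exp (- (r * norm a)\<^sup>2)) * cis (sympl ((l / 2) *\<^sub>R (b + c)) a)) \<partial>lborel)"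
    by (simp only: pw)
  also have "\<dots>
    = of_real (exp (- (\<bar>l\<bar> / 8 * (norm (c - b))\<^sup>2)) * (pi / r\<^sup>2 * exp (- (norm ((l / 2) *\<^sub>R (b + c)))\<^sup>2 / (4 * r\<^sup>2))))"
    by (simp only: integral_mult_right_zero integral_gaussian_cis_plane(2)[OF r(1)] of_real_mult)
  also have "exp (- (\<bar>l\<bar> / 8 * (norm (c - b))\<^sup>2)) * (pi / r\<^sup>2 * exp (- (norm ((l / 2) *\<^sub>R (b + c)))\<^sup>2 / (4 * r\<^sup>2)))
    = 2 * pi / \<bar>l\<bar> * (G b * G c)"
  proof -
    have e3: "(norm ((l / 2) *\<^sub>R (b + c)))\<^sup>2 = \<bar>l\<bar> * \<bar>l\<bar> / 4 * (norm (b + c))\<^sup>2"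
      by (simp add: power_mult_distrib power_divide power2_eq_square)
    have e6: "(norm ((l / 2) *\<^sub>R (b + c)))\<^sup>2 / (4 * r\<^sup>2) = \<bar>l\<bar> / 8 * (norm (b + c))\<^sup>2"
      unfolding e3 r(2) using l by (simp add: field_simps)
    have e4: "(norm (c - b))\<^sup>2 + (norm (b + c))\<^sup>2 = 2 * ((norm b)\<^sup>2 + (norm c)\<^sup>2)"
      unfolding power2_norm_pair by (simp add: power2_eq_square algebra_simps)
    have e5: "\<bar>l\<bar> / 8 * (norm (c - b))\<^sup>2 + \<bar>l\<bar> / 8 * (norm (b + c))\<^sup>2 = \<bar>l\<bar> / 4 * (norm b)\<^sup>2 + \<bar>l\<bar> / 4 * (norm c)\<^sup>2"
      unfolding distrib_left[symmetric] e4 by simp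
    have e7: "exp (- (\<bar>l\<bar> / 8 * (norm (c - b))\<^sup>2)) * exp (- (\<bar>l\<bar> / 8 * (norm (b + c))\<^sup>2)) = G b * G c"
      unfolding G_def exp_add[symmetric] minus_add_distrib[symmetric] e5 ..
    show ?thesis
      unfolding minus_divide_left[symmetric] e6 mult.left_commute[of _ "pi / r\<^sup>2"] e7 by (simp add: r(2))
  qed
  finally show ?thesis .
qed

text \<open>Expanding both vacuum vectors gives a double integral over a and a'. With a' = c + (a -
  b) the coefficient of \<open>w\<close> depends on c only, the integral over a is
  \<open>gaussian_phase_integral\<close>, and b survives only in the factor G b.\<close>

lemma vac_coefficient_aux:
  "cinner (vac w) (V b (vac w)) = of_real (2 * pi / \<bar>l\<bar> * G b) * (\<integral>c. of_real (G c) * cinner w (V c w) \<partial>lborel)"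
proof -
  define H where "H a a' = of_real (G a * G a') * cinner (V a w) (V b (V a' w))" for a a'
  have cV: "continuous_on UNIV (\<lambda>x. V (f x) w)" if "continuous_on UNIV f" for f :: "(real \<times> real) \<times> (real \<times> real) \<Rightarrow> real \<times> real"
    by (rule continuous_on_compose2[OF continuous_V that]) auto
  have cbV: "continuous_on UNIV (\<lambda>x. V b (V (f x) w))" if "continuous_on UNIV f" for f :: "(real \<times> real) \<times> (real \<times> real) \<Rightarrow> real \<times> real"
  proof -
    have "bounded_linear (V b)"
      unfolding V_def using bounded_linear_clinear[OF rep_facts(1), of _ 1] rep_facts(6) by simp
    from bounded_linear.continuous_on[OF this cV[OF that]] show ?thesis .
  qed
  have m: "(\<lambda>x. case x of (a, a') \<Rightarrow> H a a') \<in> borel_measurable (borel \<Otimes>\<^sub>M borel)"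
  proof -
    have "continuous_on UNIV (\<lambda>x. H (fst x) (snd x))"
      unfolding H_def G_def by (intro continuous_intros cV cbV)
    then show ?thesis unfolding borel_prod by (simp add: borel_measurable_continuous_onI split_beta')
  qed
  have nb: "norm (H a a') \<le> G a * (G a' * (norm w * norm w))" for a a'
    using cmod_cinner_le[of "V a w" "V b (V a' w)"] G_pos[of a] G_pos[of a']
    by (simp add: H_def norm_mult V_unitary abs_of_pos mult.assoc)
  have fin: "(\<integral>\<^sup>+y. (\<integral>\<^sup>+x. ennreal (G x * (G y * (norm w * norm w))) \<partial>lborel) \<partial>lborel) < \<infinity>"
  proof -
    have "(\<integral>\<^sup>+y. (\<integral>\<^sup>+x. ennreal (G x * (G y * (norm w * norm w))) \<partial>lborel) \<partial>lborel)
      = (\<integral>\<^sup>+x. ennreal (G x) \<partial>lborel) * ((\<integral>\<^sup>+y. ennreal (G y) \<partial>lborel) * ennreal (norm w * norm w))"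
      using G_pos by (simp add: ennreal_mult less_imp_le nn_integral_multc nn_integral_cmult)
    also have "\<dots> < \<infinity>" using nn_G by (auto simp: ennreal_mult_less_top)
    finally show ?thesis .
  qed
  have i1: "integrable (lborel \<Otimes>\<^sub>M lborel) (\<lambda>(a, a'). H a a')"
  proof (rule integrable_lborel_prodI)
    show "(\<lambda>(a, a'). H a a') \<in> borel_measurable (lborel \<Otimes>\<^sub>M lborel)" using m by (simp add: lborel_prod borel_prod)
    have "(\<integral>\<^sup>+y. (\<integral>\<^sup>+x. ennreal (norm (H x y)) \<partial>lborel) \<partial>lborel) \<le> (\<integral>\<^sup>+y. (\<integral>\<^sup>+x. ennreal (G x * (G y * (norm w * norm w))) \<partial>lborel) \<partial>lborel)"
      by (intro nn_integral_mono ennreal_leI nb)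
    then show "(\<integral>\<^sup>+y. (\<integral>\<^sup>+x. ennreal (norm (H x y)) \<partial>lborel) \<partial>lborel) < \<infinity>" using fin by (rule le_less_trans)
  qed
  have m2: "(\<lambda>(a, c). H a (c + (a - b))) \<in> borel_measurable (borel \<Otimes>\<^sub>M borel)"
  proof -
    have "continuous_on UNIV (\<lambda>x. H (fst x) (snd x + (fst x - b)))"
      unfolding H_def G_def by (intro continuous_intros cV cbV)
    then show ?thesis unfolding borel_prod by (simp add: borel_measurable_continuous_onI split_beta')
  qed
  have i2: "integrable (lborel \<Otimes>\<^sub>M lborel) (\<lambda>(c, a). H a (c + (a - b)))"
  proof (rule integrable_lborel_prodI)
    have "(\<lambda>(c, a). H a (c + (a - b))) \<in> borel_measurable (borel \<Otimes>\<^sub>M borel)"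
      using measurable_pair_swap[OF m2] by (simp add: split_beta')
    then show "(\<lambda>(c, a). H a (c + (a - b))) \<in> borel_measurable (lborel \<Otimes>\<^sub>M lborel)" by (simp add: lborel_prod borel_prod)
    have "(\<integral>\<^sup>+a. (\<integral>\<^sup>+c. ennreal (norm (H a (c + (a - b)))) \<partial>lborel) \<partial>lborel)
      \<le> (\<integral>\<^sup>+a. (\<integral>\<^sup>+c. ennreal (G a * (G (c + (a - b)) * (norm w * norm w))) \<partial>lborel) \<partial>lborel)"
      by (intro nn_integral_mono ennreal_leI nb)
    also have "\<dots> = (\<integral>\<^sup>+a. (\<integral>\<^sup>+c. ennreal (G a * (G c * (norm w * norm w))) \<partial>lborel) \<partial>lborel)"
      by (intro nn_integral_cong nn_integral_translate_plane[of "\<lambda>c. ennreal (G _ * (G c * (norm w * norm w)))"]) measurable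
    also have "\<dots> < \<infinity>" using fin by (simp add: mult.left_commute)
    finally show "(\<integral>\<^sup>+a. (\<integral>\<^sup>+c. ennreal (norm (H a (c + (a - b)))) \<partial>lborel) \<partial>lborel) < \<infinity>" .
  qed
  have ma: "H a \<in> borel_measurable borel" for a
    using measurable_Pair2[OF m, of a] by simp
  have "cinner (vac w) (V b (vac w)) = (\<integral>a'. (\<integral>a. H a a' \<partial>lborel) \<partial>lborel)"
  proof -
    \<comment> \<open>The vector \<open>vac w\<close> is characterized only in the first argument of
      \<open>cinner\<close>, so the second occurrence is expanded after conjugation.\<close>
    have "cinner (vac w) (V b (vac w)) = cnj (cinner (vac w) (V (- b) (vac w)))"
      using V_adjoint[of b "vac w" "vac w"] cinner_commute by metis
    also have "\<dots> = (\<integral>a'. cnj (of_real (G a') * cinner (V a' w) (V (- b) (vac w))) \<partial>lborel)"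
      unfolding vac by (rule Bochner_Integration.integral_cnj[symmetric])
    also have "\<dots> = (\<integral>a'. (\<integral>a. H a a' \<partial>lborel) \<partial>lborel)"
    proof (rule Bochner_Integration.integral_cong)
      fix a'
      have "cinner (V a' w) (V (- b) (vac w)) = cinner (V b (V a' w)) (vac w)" by (rule V_adjoint[symmetric])
      then have "cnj (of_real (G a') * cinner (V a' w) (V (- b) (vac w))) = of_real (G a') * cinner (vac w) (V b (V a' w))"
        by (simp add: cinner_commute[of "vac w"])
      also have "\<dots> = (\<integral>a. H a a' \<partial>lborel)" unfolding vac H_def by (simp add: mult_ac flip: integral_mult_right_zero)
      finally show "cnj (of_real (G a') * cinner (V a' w) (V (- b) (vac w))) = (\<integral>a. H a a' \<partial>lborel)" .
    qed simp
    finally show ?thesis .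
  qed
  also have "\<dots> = (\<integral>a. (\<integral>a'. H a a' \<partial>lborel) \<partial>lborel)" by (rule lborel_pair.Fubini_integral[OF i1])
  \<comment> \<open>For fixed a the substitution from a' to c is a translation of the plane.\<close>
  also have "\<dots> = (\<integral>a. (\<integral>c. H a (c + (a - b)) \<partial>lborel) \<partial>lborel)"
    by (intro Bochner_Integration.integral_cong refl integral_translate_plane[symmetric] ma)
  also have "\<dots> = (\<integral>c. (\<integral>a. H a (c + (a - b)) \<partial>lborel) \<partial>lborel)" by (rule lborel_pair.Fubini_integral[OF i2])
  also have "\<dots> = (\<integral>c. of_real (2 * pi / \<bar>l\<bar> * G b) * (of_real (G c) * cinner w (V c w)) \<partial>lborel)"
  proof (rule Bochner_Integration.integral_cong)
    fix c
    have "(\<integral>a. H a (c + (a - b)) \<partial>lborel)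
      = (\<integral>a. (of_real (G a * G (c + (a - b))) * cis (l / 2 * (sympl b c + sympl (b + c) a))) * cinner w (V c w) \<partial>lborel)"
      unfolding H_def V_triple by (simp add: mult_ac)
    also have "\<dots> = of_real (2 * pi / \<bar>l\<bar> * (G b * G c)) * cinner w (V c w)"
      by (simp only: integral_mult_left_zero gaussian_phase_integral)
    finally show "(\<integral>a. H a (c + (a - b)) \<partial>lborel) = of_real (2 * pi / \<bar>l\<bar> * G b) * (of_real (G c) * cinner w (V c w))"
      by (simp add: mult_ac)
  qed simp
  finally show ?thesis by (simp only: integral_mult_right_zero)
qed

text \<open>The remaining integral is a constant depending on \<open>w\<close> alone; b = 0
  identifies it with the squared norm.\<close>

lemma vac_coefficient: "cinner (vac w) (V b (vac w)) = of_real (G b * (norm (vac w))\<^sup>2)"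
proof -
  have "G 0 = 1" by (simp add: G_def)
  then have "of_real ((norm (vac w))\<^sup>2) = of_real (2 * pi / \<bar>l\<bar>) * (\<integral>c. of_real (G c) * cinner w (V c w) \<partial>lborel)"
    using vac_coefficient_aux[of w 0] by (simp add: V_0 cinner_self)
  then show ?thesis using vac_coefficient_aux[of w b] by (simp add: mult_ac)
qed

text \<open>If every average vanished, inserting translated vectors would make the symplectic
  Fourier transform of \<open>F\<close> vanish identically. Gaussian averages of \<open>F\<close>
  that concentrate at the origin are then zero, and so is F 0, which is the squared norm of
  \<open>w\<close>.\<close>

lemma vac_nonzero: "\<exists>w. vac w \<noteq> 0"
proof (rule ccontr)
  assume "\<nexists>w. vac w \<noteq> 0"
  then have z: "(\<integral>a. of_real (G a) * cinner (V a w) u \<partial>lborel) = 0" for w u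
    using vac[of w u] by simp
  obtain w :: L2 where w: "w \<noteq> 0" using exists_nonzero_L2 by blast
  define F where "F a = of_real (G a) * cinner (V a w) w" for a
  have Fi: "integrable lborel F" unfolding F_def by (rule integrable_G_V)
  have Fc: "continuous_on UNIV F" unfolding F_def G_def by (intro continuous_intros continuous_V)
  then have [measurable]: "F \<in> borel_measurable borel" by (rule borel_measurable_continuous_onI)
  have Fb: "cmod (F a) \<le> norm w * norm w" for a
    using cmod_cinner_le[of "V a w" w] G_pos[of a] G_le[of a] mult_left_le_one_le[of "norm w * norm w" "G a"]
    by (auto simp: F_def norm_mult V_unitary abs_of_pos intro: order_trans[OF mult_left_mono])
  have Fz: "(\<integral>a. F a * cis (sympl b a) \<partial>lborel) = 0" for b
  proof -
    \<comment> \<open>Conjugation of V a by V b' multiplies it by a character with frequency l b';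
      division by \<open>l\<close> reaches every frequency.\<close>
    define b' where "b' = (1 / l) *\<^sub>R b"
    have "cinner (V a (V b' w)) (V b' w) = cis (sympl b a) * cinner (V a w) w" for a
    proof -
      have "cinner (V a (V b' w)) (V b' w) = cinner (V (- b') (V a (V b' w))) w"
        using V_adjoint[of "- b'" "V a (V b' w)" w] by simp
      also have "V (- b') (V a (V b' w)) = cis (l * sympl a b') *\<^sub>C V a w"
        by (simp add: V_V V_linear scaleC_scaleC cis_mult sympl_def algebra_simps)
      finally have "cinner (V a (V b' w)) (V b' w) = cis (- (l * sympl a b')) * cinner (V a w) w"
        by (simp add: cinner_scaleC_left cis_cnj)
      moreover have "- (l * sympl a b') = sympl b a" using l by (simp add: b'_def sympl_def field_simps)
      ultimately show ?thesis by simp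
    qed
    then show ?thesis using z[of "V b' w" "V b' w"] by (simp add: F_def mult_ac)
  qed
  \<comment> \<open>Integrating the vanishing transform against a Gaussian in b and exchanging the
    integrals leaves a Gaussian average of \<open>F\<close>.\<close>
  have gauss0: "(\<integral>a. F a * of_real (exp (- (norm a)\<^sup>2 / (4 * \<rho>\<^sup>2))) \<partial>lborel) = 0" if \<rho>: "\<rho> > 0" for \<rho>
  proof -
    define g where "g b = complex_of_real (exp (- (\<rho> * norm b)\<^sup>2))" for b :: "real \<times> real"
    have gi: "integrable lborel g"
      using integral_gaussian_cis_plane(1)[OF \<rho>, of 0] by (simp add: g_def[abs_def] sympl_def)
    have "integrable (lborel \<Otimes>\<^sub>M lborel) (\<lambda>(b, a). g b * F a)"
      using integral_product_lborel(1)[OF gi Fi] by (simp add: lborel_prod)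
    then have i: "integrable (lborel \<Otimes>\<^sub>M lborel) (\<lambda>(b, a). g b * (F a * cis (sympl b a)))"
    proof (rule Bochner_Integration.integrable_bound)
      have "continuous_on UNIV (\<lambda>x. g (fst x) * (F (snd x) * cis (sympl (fst x) (snd x))))"
        unfolding g_def F_def G_def sympl_def cis_conv_exp
        by (intro continuous_intros continuous_on_compose2[OF continuous_V]) auto
      then show "(\<lambda>(b, a). g b * (F a * cis (sympl b a))) \<in> borel_measurable (lborel \<Otimes>\<^sub>M lborel)"
        by (simp add: lborel_prod borel_measurable_continuous_onI split_beta')
    qed (auto simp: norm_mult)
    have "0 = (\<integral>b. g b * (\<integral>a. F a * cis (sympl b a) \<partial>lborel) \<partial>lborel)" by (simp add: Fz)
    also have "\<dots> = (\<integral>b. (\<integral>a. g b * (F a * cis (sympl b a)) \<partial>lborel) \<partial>lborel)" by simp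
    also have "\<dots> = (\<integral>a. (\<integral>b. g b * (F a * cis (sympl b a)) \<partial>lborel) \<partial>lborel)"
      by (rule lborel_pair.Fubini_integral[OF i, symmetric])
    also have "\<dots> = (\<integral>a. of_real (pi / \<rho>\<^sup>2) * (F a * of_real (exp (- (norm a)\<^sup>2 / (4 * \<rho>\<^sup>2)))) \<partial>lborel)"
    proof (rule Bochner_Integration.integral_cong)
      fix a
      have "g b * (F a * cis (sympl b a)) = (of_real (exp (- (\<rho> * norm b)\<^sup>2)) * cis (sympl (- a) b)) * F a" for b
        by (simp add: g_def sympl_minus_left sympl_commute[of a b] mult_ac)
      then have "(\<integral>b. g b * (F a * cis (sympl b a)) \<partial>lborel)
        = of_real (pi / \<rho>\<^sup>2 * exp (- (norm (- a))\<^sup>2 / (4 * \<rho>\<^sup>2))) * F a"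
        by (simp only: integral_mult_left_zero integral_gaussian_cis_plane(2)[OF \<rho>])
      then show "(\<integral>b. g b * (F a * cis (sympl b a)) \<partial>lborel)
        = of_real (pi / \<rho>\<^sup>2) * (F a * of_real (exp (- (norm a)\<^sup>2 / (4 * \<rho>\<^sup>2))))" by (simp add: mult_ac)
    qed simp
    finally show ?thesis using \<rho> by simp
  qed
  define s where "s n = 1 / real (Suc n)" for n
  have s: "s \<longlonglongrightarrow> 0" "\<And>n. s n > 0"
    unfolding s_def using LIMSEQ_inverse_real_of_nat by (auto simp: inverse_eq_divide)
  \<comment> \<open>The choice \<rho> = s n / 2 makes the Gaussian exp (- |a|^2 / (s n)^2);
    rescaling a by s n fixes the Gaussian and moves the concentration into the argument of
    \<open>F\<close>.\<close>
  have scaled: "(\<integral>a. F (s n *\<^sub>R a) * of_real (exp (- (norm a)\<^sup>2)) \<partial>lborel) = 0" for n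
  proof -
    have "(norm (s n *\<^sub>R a))\<^sup>2 / (4 * (s n / 2)\<^sup>2) = (norm a)\<^sup>2" for a :: "real \<times> real"
      using s(2)[of n] by (simp add: power_mult_distrib power_divide)
    moreover have "(\<integral>a. F a * of_real (exp (- (norm a)\<^sup>2 / (4 * (s n / 2)\<^sup>2))) \<partial>lborel) = 0"
      using s(2)[of n] by (intro gauss0) simp
    ultimately show ?thesis
      using integral_affine_plane[of "s n" "\<lambda>a. F a * of_real (exp (- (norm a)\<^sup>2 / (4 * (s n / 2)\<^sup>2)))" 0] s(2)[of n]
      by (simp del: norm_scaleR)
  qed
  have gi: "integrable lborel (\<lambda>a :: real \<times> real. exp (- (norm a)\<^sup>2))"
    using integrable_norm[OF integral_gaussian_cis_plane(1)[of 1 0]] by (simp add: norm_mult)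
  have gv: "(\<integral>a. complex_of_real (exp (- (norm a)\<^sup>2)) \<partial>(lborel :: (real \<times> real) measure)) = of_real pi"
    using integral_gaussian_cis_plane(2)[of 1 0] by (simp add: sympl_def)
  have "(\<lambda>n. \<integral>a. F (s n *\<^sub>R a) * of_real (exp (- (norm a)\<^sup>2)) \<partial>lborel) \<longlonglongrightarrow> (\<integral>a. F 0 * of_real (exp (- (norm a)\<^sup>2)) \<partial>(lborel :: (real \<times> real) measure))"
  proof (rule integral_dominated_convergence[where w="\<lambda>a. norm w * norm w * exp (- (norm a)\<^sup>2)"])
    have "(\<lambda>n. F (s n *\<^sub>R a)) \<longlonglongrightarrow> F 0" for a
    proof -
      have "(\<lambda>n. s n *\<^sub>R a) \<longlonglongrightarrow> 0 *\<^sub>R a" by (intro tendsto_intros s)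
      moreover have "isCont F 0" using Fc by (metis UNIV_I continuous_on_eq_continuous_at open_UNIV)
      ultimately show ?thesis using isCont_tendsto_compose[of 0 F] by simp
    qed
    then show "AE a in lborel. (\<lambda>n. F (s n *\<^sub>R a) * of_real (exp (- (norm a)\<^sup>2))) \<longlonglongrightarrow> F 0 * of_real (exp (- (norm a)\<^sup>2))"
      by (intro AE_I2 tendsto_mult tendsto_const)
    show "AE a in lborel. norm (F (s n *\<^sub>R a) * of_real (exp (- (norm a)\<^sup>2))) \<le> norm w * norm w * exp (- (norm a)\<^sup>2)" for n
      using Fb by (intro AE_I2) (simp add: norm_mult mult_right_mono)
  qed (use gi in auto)
  then have "(\<integral>a. F 0 * of_real (exp (- (norm a)\<^sup>2)) \<partial>(lborel :: (real \<times> real) measure)) = 0"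
    unfolding scaled by (metis LIMSEQ_unique tendsto_const)
  then have "F 0 = 0" unfolding integral_mult_right_zero gv by simp
  then show False using w by (simp add: F_def V_0 cinner_self G_def)
qed

lemma vac_group_coefficient:
  "cinner (vac w) (\<rho> (x, y, z) (vac w)) = cis (l * (y - x * z / 2)) * of_real (G (x, z) * (norm (vac w))\<^sup>2)"
proof -
  have "(x, y, z) = (0, y - x * z / 2, 0) \<otimes>\<^bsub>heisenberg\<^esub> cs_section (x, z)"
    by (simp add: heisenberg_def cs_section_def)
  then have "\<rho> (x, y, z) (vac w) = cis (l * (y - x * z / 2)) *\<^sub>C V (x, z) (vac w)"
    by (metis V_def central rep_facts(4))
  then show ?thesis by (simp add: cinner_scaleC_right vac_coefficient)
qed

end

subsection \<open>The Stone-von Neumann theorem\<close>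

text \<open>Schur's lemma makes the center act by scalars, which form a continuous character. If
  \<open>l\<close> were 0, all operators would commute and be scalars, every line would be
  invariant, and irreducibility would contradict the infinite dimension of
  \<open>L2\<close>.\<close>

lemma irrep_central_character:
  assumes irr: "unitary_irrep heisenberg \<rho>"
  shows "\<exists>l. l \<noteq> 0 \<and> (\<forall>y u. \<rho> (0, y, 0) u = cis (l * y) *\<^sub>C u)"
proof -
  have car: "carrier heisenberg = UNIV" by (simp add: heisenberg_def)
  have rep: "unitary_rep heisenberg \<rho>" using irr by (simp add: unitary_irrep_def)
  note r = unitary_rep_facts[OF group_heisenberg car rep]
  note rl = clinear_L2D[OF r(1)]
  have mult: "\<rho> (x, y, z) (\<rho> (x', y', z') u) = \<rho> (x + x', y + y' + x * z', z + z') u" for x y z x' y' z' u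
    using r(4)[of "(x, y, z)" "(x', y', z')" u] by (simp add: heisenberg_def)
  have one: "\<rho> (0, 0, 0) u = u" for u using r(5)[of u] by (simp add: heisenberg_def)
  have fam: "irreducible_family (range \<rho>)"
    using irr car unfolding unitary_irrep_def irreducible_family_def by auto
  have R: "clinear_L2 T" "norm (T u) \<le> norm u" if "T \<in> range \<rho>" for T u
    using that r(1,6) by auto
  have scalar: "\<exists>c. \<forall>u. \<rho> (x, y, z) u = c *\<^sub>C u"
    if com: "\<And>g u. \<rho> g (\<rho> (x, y, z) u) = \<rho> (x, y, z) (\<rho> g u)" for x y z
  proof (rule schur_unitary[OF fam])
    show i1: "\<rho> (x, y, z) (\<rho> (- x, - y + x * z, - z) u) = u" and i2: "\<rho> (- x, - y + x * z, - z) (\<rho> (x, y, z) u) = u" for u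
      by (simp_all add: mult one)
    have "\<rho> g (\<rho> (- x, - y + x * z, - z) u) = \<rho> (- x, - y + x * z, - z) (\<rho> g u)" for g u
      using com[of g "\<rho> (- x, - y + x * z, - z) u"] by (metis i1 i2)
    then show "commutes_with (range \<rho>) (\<rho> (- x, - y + x * z, - z))" by (auto simp: commutes_with_def)
    show "commutes_with (range \<rho>) (\<rho> (x, y, z))" using com by (auto simp: commutes_with_def)
  qed (use R r(1,2) in auto)
  have "\<exists>c. \<forall>u. \<rho> (0, y, 0) u = c *\<^sub>C u" for y
  proof (rule scalar)
    show "\<rho> g (\<rho> (0, y, 0) u) = \<rho> (0, y, 0) (\<rho> g u)" for g u by (cases g) (simp add: mult add.commute)
  qed
  then obtain ch where ch: "\<And>y u. \<rho> (0, y, 0) u = ch y *\<^sub>C u" by metis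
  obtain w :: L2 where w: "w \<noteq> 0" using exists_nonzero_L2 by blast
  have ww: "cinner w w \<noteq> 0" using w by (simp add: cinner_self)
  have ch_eq: "ch y = cinner w (\<rho> (0, y, 0) w) / cinner w w" for y using ww by (simp add: ch cinner_scaleC_right)
  have "\<exists>l. \<forall>y. ch y = cis (l * y)"
  proof (rule continuous_character)
    have "continuous_on UNIV (\<lambda>y. \<rho> (0, y, 0) w)"
      by (rule continuous_on_compose2[OF r(8)]) (auto intro!: continuous_intros)
    then show "continuous_on UNIV ch" unfolding ch_eq using ww by (intro continuous_intros) auto
    fix x y
    have "ch (x + y) *\<^sub>C w = (ch x * ch y) *\<^sub>C w"
      using mult[of 0 x 0 0 y 0 w] by (simp add: ch scaleC_scaleC)
    then have "(ch (x + y) - ch x * ch y) *\<^sub>C w = 0" by (simp add: scaleC_diff_left)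
    then show "ch (x + y) = ch x * ch y" using w by (simp add: scaleC_eq_0_iff)
    have "norm (ch x *\<^sub>C w) = norm w" using r(6)[of "(0, x, 0)" w] by (simp add: ch)
    then show "cmod (ch x) = 1" using w by (simp add: norm_scaleC)
  qed
  then obtain l where l: "\<And>y. ch y = cis (l * y)" by blast
  have "l \<noteq> 0"
  proof
    assume "l = 0"
    then have triv: "\<rho> (0, y, 0) u = u" for y u by (simp add: ch l)
    have "\<rho> (x, y, z) (\<rho> g u) = \<rho> g (\<rho> (x, y, z) u)" for x y z g u
    proof -
      obtain x' y' z' where g: "g = (x', y', z')" by (cases g)
      \<comment> \<open>Commutators in the Heisenberg group are central, hence act trivially
        here.\<close>
      have "\<rho> (x, y, z) (\<rho> g u) = \<rho> (0, x * z' - x' * z, 0) (\<rho> (x', y', z') (\<rho> (x, y, z) u))"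
        unfolding g mult by (simp add: algebra_simps)
      then show ?thesis by (simp add: triv g)
    qed
    then have sc: "\<exists>c. \<forall>u. \<rho> g u = c *\<^sub>C u" for g by (cases g) (auto intro: scalar)
    \<comment> \<open>The complex line through \<open>w\<close>, described by an equation without
      division so that it is visibly closed.\<close>
    define S where "S = {u. cinner w w *\<^sub>C u = cinner w u *\<^sub>C w}"
    have "csubspace_L2 S"
      unfolding csubspace_L2_def S_def
      by (simp add: cinner_add_right scaleC_add_right scaleC_add_left cinner_scaleC_right scaleC_scaleC mult.commute)
         (metis mult.commute scaleC_scaleC)
    moreover have "closed S"
    proof -
      have "continuous_on UNIV (\<lambda>u. cinner w u *\<^sub>C w)"
      proof -
        have "bounded_linear (\<lambda>u. cinner w u *\<^sub>C w)"
        proof (rule bounded_linear_clinear)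
          show "clinear_L2 (\<lambda>u. cinner w u *\<^sub>C w)"
            by (simp add: clinear_L2_def cinner_add_right scaleC_add_left cinner_scaleC_right scaleC_scaleC)
          show "norm (cinner w u *\<^sub>C w) \<le> (norm w * norm w) * norm u" for u
            using mult_right_mono[OF cmod_cinner_le[of w u], of "norm w"] by (simp add: norm_scaleC mult_ac)
        qed
        then show ?thesis by (rule linear_continuous_on)
      qed
      then show ?thesis unfolding S_def by (intro closed_Collect_eq continuous_intros)
    qed
    moreover have "\<rho> g ` S \<subseteq> S" for g
    proof -
      obtain c where "\<And>u. \<rho> g u = c *\<^sub>C u" using sc by blast
      then show ?thesis using \<open>csubspace_L2 S\<close> by (auto simp: csubspace_L2_def)
    qed
    ultimately have "S = {0} \<or> S = UNIV" using irr unfolding unitary_irrep_def by blast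
    moreover have "w \<in> S" by (simp add: S_def)
    ultimately have S: "S = UNIV" using w by auto
    \<comment> \<open>\<open>span\<close> is the real span, so a complex line needs two
      generators.\<close>
    have "span {w, \<i> *\<^sub>C w} = UNIV"
    proof (intro equalityI subsetI UNIV_I)
      fix u :: L2
      define c where "c = cinner w u / cinner w w"
      have "cinner w w *\<^sub>C u = cinner w u *\<^sub>C w" using S by (auto simp: S_def)
      then have "(1 / cinner w w) *\<^sub>C cinner w w *\<^sub>C u = (1 / cinner w w) *\<^sub>C cinner w u *\<^sub>C w" by simp
      then have "u = c *\<^sub>C w" using ww by (simp add: scaleC_scaleC c_def)
      also have "\<dots> = (of_real (Re c) + of_real (Im c) * \<i>) *\<^sub>C w"
        by (rule arg_cong[where f="\<lambda>c. c *\<^sub>C w"]) (simp add: complex_eq_iff)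
      also have "\<dots> = Re c *\<^sub>R w + Im c *\<^sub>R \<i> *\<^sub>C w" by (simp add: scaleC_add_left scaleR_L2_def scaleC_scaleC)
      finally show "u \<in> span {w, \<i> *\<^sub>C w}"
        by (metis insertI1 insertI2 span_add span_base span_scale)
    qed
    then show False using infinite_dimensional_L2 by (metis finite.emptyI finite.insertI)
  qed
  then show ?thesis using ch l by auto
qed

text \<open>The matrix coefficient of a vacuum vector depends on the representation only through
  \<open>l\<close> and the norm of the vector, so after normalization the two coefficients
  agree.\<close>

theorem stone_von_neumann:
  assumes \<rho>: "unitary_irrep heisenberg \<rho>" and \<tau>: "unitary_irrep heisenberg \<tau>" and l: "l \<noteq> 0"
    and c: "\<And>y u. \<rho> (0, y, 0) u = cis (l * y) *\<^sub>C u" "\<And>y u. \<tau> (0, y, 0) u = cis (l * y) *\<^sub>C u"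
  shows "\<exists>W. W \<in> carrier unitary_group \<and> (\<forall>g u. W (\<rho> g u) = \<tau> g (W u))"
proof -
  interpret R: heisenberg_rep \<rho> l using \<rho> c l by unfold_locales (auto simp: unitary_irrep_def)
  interpret T: heisenberg_rep \<tau> l using \<tau> c l by unfold_locales (auto simp: unitary_irrep_def)
  obtain v where v: "R.vac v \<noteq> 0" using R.vac_nonzero by blast
  obtain w where w: "T.vac w \<noteq> 0" using T.vac_nonzero by blast
  define a where "a = (1 / norm (R.vac v)) *\<^sub>R R.vac v"
  define b where "b = (1 / norm (T.vac w)) *\<^sub>R T.vac w"
  have "cinner a (\<rho> g a) = cinner b (\<tau> g b)" for g
  proof -
    obtain x y z where g: "g = (x, y, z)" by (cases g)
    have "cinner a (\<rho> g a) = cis (l * (y - x * z / 2)) * of_real (R.G (x, z))"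
      using v by (simp add: a_def g R.rep_linear cinner_scaleR_left cinner_scaleR_right R.vac_group_coefficient
          power2_eq_square scaleR_conv_of_real)
    moreover have "cinner b (\<tau> g b) = cis (l * (y - x * z / 2)) * of_real (R.G (x, z))"
      using w by (simp add: b_def g T.rep_linear cinner_scaleR_left cinner_scaleR_right T.vac_group_coefficient
          power2_eq_square scaleR_conv_of_real R.G_def T.G_def)
    ultimately show ?thesis by simp
  qed
  then show ?thesis
    by (rule irreps_with_equal_coefficients[OF group_heisenberg R.carrier_heisenberg \<rho> \<tau>, of a b])
      (use v w in \<open>simp_all add: a_def b_def\<close>)
qed

subsection \<open>Transport along a unitary operator\<close>

lemma unitary_inverse:
  assumes W: "W \<in> carrier unitary_group"
  shows "\<And>u. W (inv_into UNIV W u) = u" "\<And>u. inv_into UNIV W (W u) = u" "inv_into UNIV W \<in> carrier unitary_group"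
    "\<And>u v. cinner u (inv_into UNIV W v) = cinner (W u) v" "\<And>u. norm (W u) = norm u"
proof -
  have lin: "clinear_L2 W" and iso: "\<And>u v. cinner (W u) (W v) = cinner u v" and surj: "surj W"
    using W by (auto simp: unitary_group_def isometric_L2_def)
  show n: "norm (W u) = norm u" for u by (simp add: norm_eq_sqrt_inner inner_L2_def iso)
  have "inj W"
  proof (rule injI)
    fix u v assume "W u = W v"
    then show "u = v" using n[of "u - v"] by (simp add: clinear_L2D[OF lin])
  qed
  then show 1: "inv_into UNIV W (W u) = u" for u by simp
  show 2: "W (inv_into UNIV W u) = u" for u using surj by (simp add: surj_f_inv_f)
  show "cinner u (inv_into UNIV W v) = cinner (W u) v" for u v using iso[of u "inv_into UNIV W v"] by (simp add: 2)
  have "inv_into UNIV W (u + v) = inv_into UNIV W u + inv_into UNIV W v" for u v by (metis 1 2 clinear_L2D(1)[OF lin])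
  moreover have "inv_into UNIV W (c *\<^sub>C u) = c *\<^sub>C inv_into UNIV W u" for c u by (metis 1 2 clinear_L2D(2)[OF lin])
  moreover have "cinner (inv_into UNIV W u) (inv_into UNIV W v) = cinner u v" for u v using iso[of "inv_into UNIV W u" "inv_into UNIV W v"] by (simp add: 2)
  moreover have "surj (inv_into UNIV W)" using 1 by (metis surj_def)
  ultimately show "inv_into UNIV W \<in> carrier unitary_group"
    by (simp add: unitary_group_def clinear_L2_def isometric_L2_def)
qed

lemma unitary_bounded_linear: "W \<in> carrier unitary_group \<Longrightarrow> bounded_linear W"
  using bounded_linear_clinear[of W 1] unitary_inverse(5)[of W] by (simp add: unitary_group_def)

lemma unitary_comp:
  assumes "V \<in> carrier unitary_group" "W \<in> carrier unitary_group"
  shows "(\<lambda>u. V (W u)) \<in> carrier unitary_group"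
  using assms comp_surj[of W V] by (simp add: unitary_group_def clinear_L2_def isometric_L2_def comp_def)

lemma unitary_irrep_conjugate:
  assumes W: "W \<in> carrier unitary_group" and \<rho>: "unitary_irrep G \<rho>"
  shows "unitary_irrep G (\<lambda>g u. inv_into UNIV W (\<rho> g (W u)))"
proof -
  note i = unitary_inverse[OF W]
  have blW: "bounded_linear W" and bli: "bounded_linear (inv_into UNIV W)"
    using unitary_bounded_linear W i(3) by auto
  have hom: "\<rho> \<in> hom G unitary_group" and cont: "\<And>v. continuous_on (carrier G) (\<lambda>g. \<rho> g v)"
    using \<rho> by (auto simp: unitary_irrep_def unitary_rep_def)
  have "(\<lambda>g u. inv_into UNIV W (\<rho> g (W u))) \<in> hom G unitary_group"
  proof (rule homI)
    fix g h assume gh: "g \<in> carrier G" "h \<in> carrier G"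
    show "(\<lambda>u. inv_into UNIV W (\<rho> g (W u))) \<in> carrier unitary_group"
      by (rule unitary_comp[OF i(3) unitary_comp[OF hom_in_carrier[OF hom gh(1)] W]])
    show "(\<lambda>u. inv_into UNIV W (\<rho> (g \<otimes>\<^bsub>G\<^esub> h) (W u))) = (\<lambda>u. inv_into UNIV W (\<rho> g (W u))) \<otimes>\<^bsub>unitary_group\<^esub> (\<lambda>u. inv_into UNIV W (\<rho> h (W u)))"
      using hom_mult[OF hom gh] by (simp add: unitary_group_def fun_eq_iff i(1))
  qed
  moreover have "continuous_on (carrier G) (\<lambda>g. inv_into UNIV W (\<rho> g (W v)))" for v
    by (rule bounded_linear.continuous_on[OF bli cont])
  moreover have "S = {0} \<or> S = UNIV"
    if S: "csubspace_L2 S" "closed S" and inv: "\<forall>g\<in>carrier G. (\<lambda>u. inv_into UNIV W (\<rho> g (W u))) ` S \<subseteq> S" for S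
  proof -
    have il: "clinear_L2 (inv_into UNIV W)" using i(3) by (simp add: unitary_group_def)
    define T where "T = inv_into UNIV W -` S"
    have "csubspace_L2 T" using S(1) by (simp add: csubspace_L2_def T_def clinear_L2D[OF il])
    moreover have "closed T"
      unfolding T_def using S(2) linear_continuous_on[OF bli, of UNIV] by (intro closed_vimage) auto
    moreover have "\<rho> g ` T \<subseteq> T" if g: "g \<in> carrier G" for g
    proof (rule image_subsetI)
      fix u assume "u \<in> T"
      then have "inv_into UNIV W (\<rho> g (W (inv_into UNIV W u))) \<in> S" using inv g by (auto simp: T_def)
      then show "\<rho> g u \<in> T" by (simp add: T_def i(1))
    qed
    ultimately have "T = {0} \<or> T = UNIV" using \<rho> unfolding unitary_irrep_def by blast
    then show ?thesis
    proof
      assume T: "T = {0}"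
      have "u = 0" if "u \<in> S" for u
      proof -
        have "W u \<in> T" using that by (simp add: T_def i(2))
        then have "W u = 0" using T by simp
        then show ?thesis using i(5)[of u] by simp
      qed
      moreover have "0 \<in> S" using S(1) by (simp add: csubspace_L2_def)
      ultimately show ?thesis by blast
    next
      assume T: "T = UNIV"
      have "u \<in> S" for u
      proof -
        have "W u \<in> T" using T by simp
        then show ?thesis by (simp add: T_def i(2))
      qed
      then show ?thesis by blast
    qed
  qed
  ultimately show ?thesis by (simp add: unitary_irrep_def unitary_rep_def)
qed

subsection \<open>Resolutions of the identity\<close>

text \<open>The defect \<open>D\<close> vanishes on the diagonal, hence is antisymmetric; replacing
  v by i v makes it symmetric as well, since it is conjugate linear in the first argument.\<close>

lemma sesquilinear_polarization:
  fixes B :: "L2 \<Rightarrow> L2 \<Rightarrow> complex"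
  assumes add: "\<And>u v w. B (u + v) w = B u w + B v w" "\<And>u v w. B u (v + w) = B u v + B u w"
    and scale: "\<And>c u v. B (c *\<^sub>C u) v = cnj c * B u v" "\<And>c u v. B u (c *\<^sub>C v) = c * B u v"
    and diag: "\<And>u. B u u = k * cinner u u"
  shows "B u v = k * cinner u v"
proof -
  define D where "D u v = B u v - k * cinner u v" for u v
  have Dadd: "D (u + v) w = D u w + D v w" "D u (v + w) = D u v + D u w" for u v w
    by (simp_all add: D_def add cinner_add_left cinner_add_right algebra_simps)
  have Dscale: "D u (c *\<^sub>C v) = c * D u v" "D (c *\<^sub>C u) v = cnj c * D u v" for u v c
    by (simp_all add: D_def scale cinner_scaleC_left cinner_scaleC_right algebra_simps)
  have D0: "D u u = 0" for u by (simp add: D_def diag)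
  have anti: "D u v + D v u = 0" for u v
  proof -
    have "0 = D (u + v) (u + v)" by (simp only: D0)
    also have "\<dots> = D u u + D v v + (D u v + D v u)" by (simp only: Dadd ac_simps)
    finally show ?thesis by (simp only: D0 add_0)
  qed
  from anti[of u "\<i> *\<^sub>C v"] have "\<i> * (D u v - D v u) = 0" by (simp add: Dscale algebra_simps)
  then have "D u v = D v u" by simp
  with anti[of u v] have "D u v = 0" by simp
  then show ?thesis by (simp add: D_def)
qed

text \<open>Polarization of the norm identity. The mixed integrand is dominated by the sum of the
  two diagonal ones.\<close>

lemma resolution_of_identity:
  fixes F :: "'a \<Rightarrow> L2"
  assumes m [measurable]: "\<And>u. (\<lambda>x. cinner u (F x)) \<in> borel_measurable M" and k: "k \<ge> 0"
    and nn: "\<And>u. (\<integral>\<^sup>+x. ennreal ((cmod (cinner u (F x)))\<^sup>2) \<partial>M) = ennreal (k * (norm u)\<^sup>2)"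
  shows "integrable M (\<lambda>x. cinner u (F x) * cinner (F x) v)"
    and "(\<integral>x. cinner u (F x) * cinner (F x) v \<partial>M) = of_real k * cinner u v"
proof -
  have sq: "integrable M (\<lambda>x. (cmod (cinner u (F x)))\<^sup>2)" for u
    using nn[of u] by (simp add: integrable_iff_bounded)
  have m' [measurable]: "(\<lambda>x. cinner (F x) u) \<in> borel_measurable M" for u
    by (subst cinner_commute) measurable
  have int: "integrable M (\<lambda>x. cinner u (F x) * cinner (F x) v)" for u v
  proof (rule Bochner_Integration.integrable_bound[OF Bochner_Integration.integrable_add[OF sq[of u] sq[of v]]])
    have ab: "a * b \<le> a\<^sup>2 + b\<^sup>2" if "a \<ge> 0" "b \<ge> 0" for a b :: real
    proof -
      have "0 \<le> (a - b)\<^sup>2 + a * b" using that by simp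
      also have "(a - b)\<^sup>2 + a * b = a\<^sup>2 + b\<^sup>2 - a * b" by (simp add: power2_eq_square algebra_simps)
      finally show ?thesis by simp
    qed
    have "cmod (cinner (F x) v) = cmod (cinner v (F x))" for x
      by (subst cinner_commute) simp
    then show "AE x in M. norm (cinner u (F x) * cinner (F x) v) \<le> norm ((cmod (cinner u (F x)))\<^sup>2 + (cmod (cinner v (F x)))\<^sup>2)"
      using ab by (simp add: norm_mult)
  qed measurable
  show "integrable M (\<lambda>x. cinner u (F x) * cinner (F x) v)" by (rule int)
  show "(\<integral>x. cinner u (F x) * cinner (F x) v \<partial>M) = of_real k * cinner u v"
  proof (rule sesquilinear_polarization)
    fix u
    have pw: "cinner u (F x) * cinner (F x) u = complex_of_real ((cmod (cinner u (F x)))\<^sup>2)" for x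
      using cinner_commute[of "F x" u] by (metis complex_norm_square of_real_power)
    have "(\<integral>x. (cmod (cinner u (F x)))\<^sup>2 \<partial>M) = k * (norm u)\<^sup>2"
      using nn[of u] nn_integral_eq_integral[OF sq[of u]] k by simp
    then show "(\<integral>x. cinner u (F x) * cinner (F x) u \<partial>M) = of_real k * cinner u u"
      unfolding pw by (simp add: cinner_self integral_complex_of_real[of M "\<lambda>x. (cmod (cinner u (F x)))\<^sup>2"] del: of_real_power)
  qed (simp_all add: cinner_add_left cinner_add_right cinner_scaleC_left cinner_scaleC_right distrib_left distrib_right
      int mult.assoc mult.left_commute)
qed

subsection \<open>The admissibility constant\<close>

text \<open>For \<epsilon> > 0 this is Calderon's constant, the integral of |h(\<omega>)|^2 /
  \<omega> for h = \<open>exp_pull \<epsilon> (L2_fun \<psi>)\<close>; for \<epsilon> = 0 it is the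
  squared norm.\<close>

definition exp_moment :: "L2 \<Rightarrow> real \<Rightarrow> real" where
  "exp_moment \<psi> \<epsilon> = (\<integral>s. (cmod (L2_fun \<psi> s))\<^sup>2 * exp (- \<epsilon> * s) \<partial>lborel)"

context
  fixes \<psi> :: L2
  assumes fin: "(\<integral>\<^sup>+s. ennreal ((cmod (L2_fun \<psi> s))\<^sup>2 * exp (- 1 * s)) \<partial>lborel) < \<infinity>"
begin

text \<open>The two endpoints dominate everything between: 1 serves for s \<ge> 0 and exp (- s) for
  s < 0. So one integrable bound works for all \<epsilon> in the unit interval.\<close>

lemma exp_moment_dominated:
  assumes "\<epsilon> \<in> {0..1}" shows "exp (- \<epsilon> * s) \<le> 1 + exp (- 1 * (s :: real))"
proof (cases "s \<ge> 0")
  case True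
  then have "exp (- \<epsilon> * s) \<le> 1" using assms by simp
  then show ?thesis using exp_gt_zero[of "- 1 * s"] by linarith
next
  case False
  then have "- \<epsilon> * s \<le> - 1 * s" using assms by (intro mult_right_mono_neg) auto
  then have "exp (- \<epsilon> * s) \<le> exp (- 1 * s)" by (simp only: exp_le_cancel_iff)
  then show ?thesis by linarith
qed

lemma exp_moment_integrable_dominant:
  "integrable lborel (\<lambda>s. (cmod (L2_fun \<psi> s))\<^sup>2 * (1 + exp (- 1 * s)))"
proof -
  have "integrable lborel (\<lambda>s. (cmod (L2_fun \<psi> s))\<^sup>2)"
    using square_integrable_L2_fun[of \<psi>] by (simp add: square_integrable_def)
  moreover have "integrable lborel (\<lambda>s. (cmod (L2_fun \<psi> s))\<^sup>2 * exp (- 1 * s))"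
    using fin by (simp add: integrable_iff_bounded)
  ultimately show ?thesis by (simp add: distrib_left)
qed

lemma exp_moment_bound:
  assumes "\<epsilon> \<in> {0..1}"
  shows "norm ((cmod (L2_fun \<psi> s))\<^sup>2 * exp (- \<epsilon> * s)) \<le> (cmod (L2_fun \<psi> s))\<^sup>2 * (1 + exp (- 1 * s))"
  using exp_moment_dominated[OF assms, of s] by (simp add: abs_mult mult_left_mono)

lemma exp_moment_integrable:
  assumes "\<epsilon> \<in> {0..1}" shows "integrable lborel (\<lambda>s. (cmod (L2_fun \<psi> s))\<^sup>2 * exp (- \<epsilon> * s))"
  by (rule Bochner_Integration.integrable_bound[OF exp_moment_integrable_dominant])
     (use exp_moment_bound[OF assms] in \<open>auto intro: order_trans[OF _ abs_ge_self]\<close>)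

lemma nn_exp_moment:
  assumes "\<epsilon> \<in> {0..1}"
  shows "(\<integral>\<^sup>+s. ennreal ((cmod (L2_fun \<psi> s))\<^sup>2 * exp (- \<epsilon> * s)) \<partial>lborel) = ennreal (exp_moment \<psi> \<epsilon>)"
  unfolding exp_moment_def by (rule nn_integral_eq_integral[OF exp_moment_integrable[OF assms]]) simp

lemma continuous_exp_moment: "continuous_on {0..1} (exp_moment \<psi>)"
proof (rule continuous_on_sequentiallyI)
  fix u :: "nat \<Rightarrow> real" and a assume u: "\<forall>n. u n \<in> {0..1}" "u \<longlonglongrightarrow> a"
  show "(\<lambda>n. exp_moment \<psi> (u n)) \<longlonglongrightarrow> exp_moment \<psi> a"
    unfolding exp_moment_def
  proof (rule integral_dominated_convergence[OF _ _ exp_moment_integrable_dominant])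
    show "AE s in lborel. (\<lambda>n. (cmod (L2_fun \<psi> s))\<^sup>2 * exp (- u n * s)) \<longlonglongrightarrow> (cmod (L2_fun \<psi> s))\<^sup>2 * exp (- a * s)"
      by (intro AE_I2 tendsto_intros u)
    show "AE s in lborel. norm ((cmod (L2_fun \<psi> s))\<^sup>2 * exp (- u n * s)) \<le> (cmod (L2_fun \<psi> s))\<^sup>2 * (1 + exp (- 1 * s))" for n
      using u(1) by (intro AE_I2 exp_moment_bound) blast
  qed measurable
qed

lemma exp_moment_pos:
  assumes "\<epsilon> \<in> {0..1}" "\<psi> \<noteq> 0" shows "exp_moment \<psi> \<epsilon> > 0"
proof -
  have "exp_moment \<psi> \<epsilon> \<noteq> 0"
  proof
    assume "exp_moment \<psi> \<epsilon> = 0"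
    then have "AE s in lborel. (cmod (L2_fun \<psi> s))\<^sup>2 * exp (- \<epsilon> * s) = 0"
      unfolding exp_moment_def
      by (subst (asm) integral_nonneg_eq_0_iff_AE[OF exp_moment_integrable[OF assms(1)]]) auto
    then have "AE s in lborel. L2_fun \<psi> s = 0" by (auto elim!: eventually_mono)
    then have "L2_of (L2_fun \<psi>) = 0" by (simp add: L2_of_eq_0_iff square_integrable_L2_fun)
    then show False using assms(2) by (simp add: L2_of_L2_fun)
  qed
  moreover have "exp_moment \<psi> \<epsilon> \<ge> 0" unfolding exp_moment_def by simp
  ultimately show ?thesis by simp
qed

end

subsection \<open>The contraction of wavelets to Gabor analysis\<close>

lemma G_eps_0: "G_eps 0 = heisenberg"
  by (simp add: G_eps_def)

lemma model_rep_central: "model_rep l \<epsilon> (0, y, 0) u = cis (l * y) *\<^sub>C u"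
proof -
  have "cis (l * y) *\<^sub>C L2_of (L2_fun u) = L2_of (\<lambda>t. cis (l * y) * L2_fun u t)"
    by (rule L2_of_scaleC[OF square_integrable_L2_fun])
  then show ?thesis by (simp add: model_rep_def phase_shift_def L2_of_L2_fun)
qed

theorem theoremI1:
  fixes \<pi>0 :: "real \<times> real \<times> real \<Rightarrow> L2 \<Rightarrow> L2"
  assumes "unitary_irrep heisenberg \<pi>0"
  shows "\<exists>\<pi> :: real \<Rightarrow> real \<times> real \<times> real \<Rightarrow> L2 \<Rightarrow> L2.
    (\<forall>\<epsilon>\<in>{0..1}. unitary_irrep (G_eps \<epsilon>) (\<pi> \<epsilon>)) \<and> \<pi> 0 = \<pi>0 \<and>
    (\<forall>g v. continuous_on {0..1} (\<lambda>\<epsilon>. \<pi> \<epsilon> g v) \<and> ((\<lambda>\<epsilon>. \<pi> \<epsilon> g v) \<longlongrightarrow> \<pi>0 g v) (at_right 0)) \<and>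
    (\<forall>\<epsilon>\<in>{0<..1}. \<exists>a b. b \<noteq> 0 \<and>
        unitarily_equivalent EA (\<pi> \<epsilon> \<circ> P_eps_inv \<epsilon>) (wavelet_rep a b) hardy) \<and>
    unitary_irrep heisenberg (\<pi> 0) \<and>
    (\<forall>\<psi>. \<psi> \<noteq> 0 \<and> (\<forall>\<epsilon>\<in>{0..1}. admissible \<epsilon> (\<pi> \<epsilon>) \<psi>) \<longrightarrow>
        (\<forall>q p. continuous_on {0..1} (\<lambda>\<epsilon>. coherent (\<pi> \<epsilon>) \<psi> (q, p))) \<and>
        continuous_on {0..1} (\<lambda>\<epsilon>. C_adm \<epsilon> (\<pi> \<epsilon>) \<psi>) \<and>
        (\<forall>\<epsilon>\<in>{0..1}. \<forall>u v.
            integrable (mu_eps \<epsilon>)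
              (\<lambda>x. cinner u (coherent (\<pi> \<epsilon>) \<psi> x) * cinner (coherent (\<pi> \<epsilon>) \<psi> x) v) \<and>
            cinner u v = of_real ((norm \<psi>)\<^sup>2 / enn2real (C_adm \<epsilon> (\<pi> \<epsilon>) \<psi>)) *
              (\<integral>x. cinner u (coherent (\<pi> \<epsilon>) \<psi> x) * cinner (coherent (\<pi> \<epsilon>) \<psi> x) v \<partial>mu_eps \<epsilon>)) \<and>
        (\<forall>u v. continuous_on {0..1} (\<lambda>\<epsilon>.
            \<integral>x. cinner u (coherent (\<pi> \<epsilon>) \<psi> x) * cinner (coherent (\<pi> \<epsilon>) \<psi> x) v \<partial>mu_eps \<epsilon>)) \<and>
        (\<forall>v. \<exists>w :: real \<Rightarrow> L2.
            (\<forall>\<epsilon>\<in>{0..1}.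
                has_weak_integral (mu_eps \<epsilon>)
                  (\<lambda>x. cinner (coherent (\<pi> \<epsilon>) \<psi> x) v *\<^sub>C coherent (\<pi> \<epsilon>) \<psi> x) (w \<epsilon>) \<and>
                v = of_real ((norm \<psi>)\<^sup>2 / enn2real (C_adm \<epsilon> (\<pi> \<epsilon>) \<psi>)) *\<^sub>C w \<epsilon>) \<and>
            continuous_on {0..1} w))"
proof -
  obtain l where l: "l \<noteq> 0" and c0: "\<And>y u. \<pi>0 (0, y, 0) u = cis (l * y) *\<^sub>C u"
    using irrep_central_character[OF assms] by blast
  have irr: "unitary_irrep (G_eps \<epsilon>) (model_rep l \<epsilon>)" if "\<epsilon> \<ge> 0" for \<epsilon>
    by (rule model_rep_irreducible[OF that l])
  have "\<exists>W. W \<in> carrier unitary_group \<and> (\<forall>g u. W (\<pi>0 g u) = model_rep l 0 g (W u))"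
    by (rule stone_von_neumann[OF assms _ l c0]) (use irr[of 0] in \<open>simp_all add: G_eps_0 model_rep_central\<close>)
  then obtain W where W: "W \<in> carrier unitary_group" and Wi: "\<And>g u. W (\<pi>0 g u) = model_rep l 0 g (W u)" by blast
  note i = unitary_inverse[OF W]
  have blW: "bounded_linear W" and bli: "bounded_linear (inv_into UNIV W)"
    using unitary_bounded_linear W i(3) by auto
  \<comment> \<open>The unitary \<open>W\<close> does not depend on \<epsilon>. At \<epsilon> = 0
    the conjugation restores the given representation, and continuity, irreducibility and
    equivalence carry over from the model.\<close>
  define \<pi> where "\<pi> \<epsilon> g u = inv_into UNIV W (model_rep l \<epsilon> g (W u))" for \<epsilon> g u
  have irr\<pi>: "unitary_irrep (G_eps \<epsilon>) (\<pi> \<epsilon>)" if "\<epsilon> \<ge> 0" for \<epsilon>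
    using unitary_irrep_conjugate[OF W irr[OF that]] by (simp add: \<pi>_def[abs_def])
  have \<pi>0: "\<pi> 0 = \<pi>0" by (simp add: fun_eq_iff \<pi>_def Wi[symmetric] i(2))
  have cont: "continuous_on UNIV (\<lambda>\<epsilon>. \<pi> \<epsilon> g v)" for g v
    unfolding \<pi>_def by (rule bounded_linear.continuous_on[OF bli continuous_model_rep_eps])
  have wavelet: "unitarily_equivalent EA (\<pi> \<epsilon> \<circ> P_eps_inv \<epsilon>) (wavelet_rep (l / \<epsilon>) (- (l / \<epsilon>))) hardy" if \<epsilon>: "\<epsilon> > 0" for \<epsilon>
  proof -
    obtain U where U: "clinear_L2 U" "isometric_L2 U" "range U = hardy"
      "\<And>g v. g \<in> carrier EA \<Longrightarrow> U (affine_rep l \<epsilon> g v) = wavelet_rep (l / \<epsilon>) (- (l / \<epsilon>)) g (U v)"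
      using affine_rep_wavelet[OF \<epsilon>, of l] unfolding unitarily_equivalent_def by blast
    show ?thesis
      unfolding unitarily_equivalent_def
    \<comment> \<open>First to the model, which is \<open>affine_rep\<close> composed with
      \<open>P_eps\<close>, then to the Hardy space.\<close>
    proof (intro exI[of _ "\<lambda>u. U (W u)"] conjI ballI allI)
      show "clinear_L2 (\<lambda>u. U (W u))" "isometric_L2 (\<lambda>u. U (W u))"
        using U(1,2) W by (simp_all add: unitary_group_def clinear_L2_def isometric_L2_def)
      have "surj W" using W by (simp add: unitary_group_def)
      then show "range (\<lambda>u. U (W u)) = hardy" using U(3) by (metis image_image)
      fix g v assume g: "g \<in> carrier EA"
      have "g \<in> range (P_eps \<epsilon>)" using g bij_betw_P_eps[of \<epsilon>] \<epsilon> by (simp add: bij_betw_def)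
      then have P: "P_eps \<epsilon> (P_eps_inv \<epsilon> g) = g" unfolding P_eps_inv_def by (rule f_inv_into_f)
      have "W ((\<pi> \<epsilon> \<circ> P_eps_inv \<epsilon>) g v) = affine_rep l \<epsilon> g (W v)"
        using \<epsilon> by (simp add: \<pi>_def i(1) model_rep_eq_affine_rep P)
      then show "U (W ((\<pi> \<epsilon> \<circ> P_eps_inv \<epsilon>) g v)) = wavelet_rep (l / \<epsilon>) (- (l / \<epsilon>)) g (U (W v))"
        using U(4)[OF g] by simp
    qed
  qed
  have coh: "cinner u (coherent (\<pi> \<epsilon>) \<psi> x) = cinner (W u) (coherent (model_rep l \<epsilon>) (W \<psi>) x)" for u \<epsilon> \<psi> x
    by (simp add: coherent_def \<pi>_def i(4))
  have nn: "(\<integral>\<^sup>+x. ennreal ((cmod (cinner u (coherent (\<pi> \<epsilon>) \<psi> x)))\<^sup>2) \<partial>mu_eps \<epsilon>)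
    = ennreal (2 * pi / \<bar>l\<bar>) * ennreal ((norm u)\<^sup>2) * (\<integral>\<^sup>+s. ennreal ((cmod (L2_fun (W \<psi>) s))\<^sup>2 * exp (- \<epsilon> * s)) \<partial>lborel)"
    if "\<epsilon> \<ge> 0" for u \<psi> \<epsilon>
    unfolding coh nn_coherent_model[OF that l] i(5) ..
  have meas: "(\<lambda>x. cinner u (coherent (\<pi> \<epsilon>) \<psi> x)) \<in> borel_measurable (mu_eps \<epsilon>)" if "\<epsilon> \<ge> 0" for u \<epsilon> \<psi>
  proof -
    have "continuous_on UNIV (\<lambda>g. \<pi> \<epsilon> g \<psi>)"
      using irr\<pi>[OF that] by (simp add: unitary_irrep_def unitary_rep_def)
    then have "continuous_on UNIV (\<lambda>x. \<pi> \<epsilon> (cs_section x) \<psi>)"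
      by (rule continuous_on_compose2) (auto simp: cs_section_def split_beta' intro!: continuous_intros)
    then have "continuous_on UNIV (\<lambda>x. cinner u (coherent (\<pi> \<epsilon>) \<psi> x))"
      unfolding coherent_def by (intro continuous_intros)
    then show ?thesis by (simp add: mu_eps_def borel_measurable_continuous_onI)
  qed
  have main: "(\<forall>q p. continuous_on {0..1} (\<lambda>\<epsilon>. coherent (\<pi> \<epsilon>) \<psi> (q, p))) \<and>
        continuous_on {0..1} (\<lambda>\<epsilon>. C_adm \<epsilon> (\<pi> \<epsilon>) \<psi>) \<and>
        (\<forall>\<epsilon>\<in>{0..1}. \<forall>u v.
            integrable (mu_eps \<epsilon>)
              (\<lambda>x. cinner u (coherent (\<pi> \<epsilon>) \<psi> x) * cinner (coherent (\<pi> \<epsilon>) \<psi> x) v) \<and>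
            cinner u v = of_real ((norm \<psi>)\<^sup>2 / enn2real (C_adm \<epsilon> (\<pi> \<epsilon>) \<psi>)) *
              (\<integral>x. cinner u (coherent (\<pi> \<epsilon>) \<psi> x) * cinner (coherent (\<pi> \<epsilon>) \<psi> x) v \<partial>mu_eps \<epsilon>)) \<and>
        (\<forall>u v. continuous_on {0..1} (\<lambda>\<epsilon>.
            \<integral>x. cinner u (coherent (\<pi> \<epsilon>) \<psi> x) * cinner (coherent (\<pi> \<epsilon>) \<psi> x) v \<partial>mu_eps \<epsilon>)) \<and>
        (\<forall>v. \<exists>w :: real \<Rightarrow> L2.
            (\<forall>\<epsilon>\<in>{0..1}.
                has_weak_integral (mu_eps \<epsilon>)
                  (\<lambda>x. cinner (coherent (\<pi> \<epsilon>) \<psi> x) v *\<^sub>C coherent (\<pi> \<epsilon>) \<psi> x) (w \<epsilon>) \<and>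
                v = of_real ((norm \<psi>)\<^sup>2 / enn2real (C_adm \<epsilon> (\<pi> \<epsilon>) \<psi>)) *\<^sub>C w \<epsilon>) \<and>
            continuous_on {0..1} w)"
    if \<psi>: "\<psi> \<noteq> 0" and adm: "\<forall>\<epsilon>\<in>{0..1}. admissible \<epsilon> (\<pi> \<epsilon>) \<psi>" for \<psi>
  proof -
    \<comment> \<open>Admissibility is a moment condition on the model vector and not on \<psi>
      itself.\<close>
    define \<phi> where "\<phi> = W \<psi>"
    have n: "(norm \<psi>)\<^sup>2 > 0" using \<psi> by simp
    have \<phi>: "\<phi> \<noteq> 0" using i(5)[of \<psi>] \<psi> by (auto simp: \<phi>_def)
    have "ennreal (2 * pi / \<bar>l\<bar>) * ennreal ((norm \<psi>)\<^sup>2) * (\<integral>\<^sup>+s. ennreal ((cmod (L2_fun \<phi> s))\<^sup>2 * exp (- 1 * s)) \<partial>lborel) < \<infinity>"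
      using bspec[OF adm, of 1] nn[of 1 \<psi> \<psi>] unfolding admissible_def C_adm_def \<phi>_def by simp
    \<comment> \<open>In [0, \<infinity>] a product with a nonzero factor is finite only if the
      other factor is finite.\<close>
    moreover have "ennreal (2 * pi / \<bar>l\<bar>) * ennreal ((norm \<psi>)\<^sup>2) \<noteq> 0"
      using n l by (simp flip: ennreal_mult)
    ultimately have fin: "(\<integral>\<^sup>+s. ennreal ((cmod (L2_fun \<phi> s))\<^sup>2 * exp (- 1 * s)) \<partial>lborel) < \<infinity>"
      by (auto simp: ennreal_mult_less_top)
    \<comment> \<open>The constant of the resolution of the identity. Since \<open>C_adm\<close> is
      \<open>k \<epsilon>\<close> times the squared norm of \<psi>, the normalizing ratio in the
      formulas is \<open>1 / k \<epsilon>\<close>.\<close>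
    define k where "k \<epsilon> = 2 * pi / \<bar>l\<bar> * exp_moment \<phi> \<epsilon>" for \<epsilon>
    have kpos: "k \<epsilon> > 0" if "\<epsilon> \<in> {0..1}" for \<epsilon>
      using exp_moment_pos[OF fin that \<phi>] l by (simp add: k_def)
    have kcont: "continuous_on {0..1} k"
      unfolding k_def by (intro continuous_intros continuous_exp_moment[OF fin])
    have nnk: "(\<integral>\<^sup>+x. ennreal ((cmod (cinner u (coherent (\<pi> \<epsilon>) \<psi> x)))\<^sup>2) \<partial>mu_eps \<epsilon>) = ennreal (k \<epsilon> * (norm u)\<^sup>2)"
      if \<epsilon>: "\<epsilon> \<in> {0..1}" for u \<epsilon>
    proof -
      have "exp_moment \<phi> \<epsilon> > 0" by (rule exp_moment_pos[OF fin \<epsilon> \<phi>])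
      moreover have "k \<epsilon> * (norm u)\<^sup>2 = 2 * pi / \<bar>l\<bar> * (norm u)\<^sup>2 * exp_moment \<phi> \<epsilon>" by (simp add: k_def)
      ultimately show ?thesis
        using \<epsilon> nn[of \<epsilon> u \<psi>] nn_exp_moment[OF fin \<epsilon>] unfolding \<phi>_def[symmetric]
        by (simp only: ennreal_mult mult_nonneg_nonneg divide_nonneg_nonneg pi_ge_zero abs_ge_zero zero_le_power2
            zero_le_numeral less_imp_le atLeastAtMost_iff)
    qed
    have C: "C_adm \<epsilon> (\<pi> \<epsilon>) \<psi> = ennreal (k \<epsilon> * (norm \<psi>)\<^sup>2)" if "\<epsilon> \<in> {0..1}" for \<epsilon>
      unfolding C_adm_def by (rule nnk[OF that])
    have ratio: "(norm \<psi>)\<^sup>2 / enn2real (C_adm \<epsilon> (\<pi> \<epsilon>) \<psi>) = 1 / k \<epsilon>" if "\<epsilon> \<in> {0..1}" for \<epsilon>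
      using kpos[OF that] n by (simp add: C[OF that])
    have res: "integrable (mu_eps \<epsilon>) (\<lambda>x. cinner u (coherent (\<pi> \<epsilon>) \<psi> x) * cinner (coherent (\<pi> \<epsilon>) \<psi> x) v)"
      "(\<integral>x. cinner u (coherent (\<pi> \<epsilon>) \<psi> x) * cinner (coherent (\<pi> \<epsilon>) \<psi> x) v \<partial>mu_eps \<epsilon>) = of_real (k \<epsilon>) * cinner u v"
      if \<epsilon>: "\<epsilon> \<in> {0..1}" for \<epsilon> u v
      using resolution_of_identity[of "coherent (\<pi> \<epsilon>) \<psi>" "mu_eps \<epsilon>" "k \<epsilon>", OF meas less_imp_le[OF kpos[OF \<epsilon>]] nnk[OF \<epsilon>]] \<epsilon>
      by auto
    show ?thesis
    proof (intro conjI allI ballI)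
      show "continuous_on {0..1} (\<lambda>\<epsilon>. coherent (\<pi> \<epsilon>) \<psi> (q, p))" for q p
        unfolding coherent_def by (rule continuous_on_subset[OF cont]) simp
      have "continuous_on {0..1} (\<lambda>\<epsilon>. ennreal (k \<epsilon> * (norm \<psi>)\<^sup>2))"
        by (intro continuous_on_ennreal continuous_intros kcont)
      then show "continuous_on {0..1} (\<lambda>\<epsilon>. C_adm \<epsilon> (\<pi> \<epsilon>) \<psi>)"
        by (rule continuous_on_cong[THEN iffD1, rotated 2]) (simp_all add: C)
      show "integrable (mu_eps \<epsilon>) (\<lambda>x. cinner u (coherent (\<pi> \<epsilon>) \<psi> x) * cinner (coherent (\<pi> \<epsilon>) \<psi> x) v)"
        if "\<epsilon> \<in> {0..1}" for \<epsilon> u v by (rule res(1)[OF that])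
      show "cinner u v = of_real ((norm \<psi>)\<^sup>2 / enn2real (C_adm \<epsilon> (\<pi> \<epsilon>) \<psi>)) *
              (\<integral>x. cinner u (coherent (\<pi> \<epsilon>) \<psi> x) * cinner (coherent (\<pi> \<epsilon>) \<psi> x) v \<partial>mu_eps \<epsilon>)"
        if "\<epsilon> \<in> {0..1}" for \<epsilon> u v
        unfolding ratio[OF that] res(2)[OF that] using kpos[OF that] by simp
      show "continuous_on {0..1} (\<lambda>\<epsilon>. \<integral>x. cinner u (coherent (\<pi> \<epsilon>) \<psi> x) * cinner (coherent (\<pi> \<epsilon>) \<psi> x) v \<partial>mu_eps \<epsilon>)" for u v
      proof -
        have "continuous_on {0..1} (\<lambda>\<epsilon>. complex_of_real (k \<epsilon>) * cinner u v)"
          by (intro continuous_intros kcont)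
        then show ?thesis by (rule continuous_on_cong[THEN iffD1, rotated 2]) (simp_all add: res(2))
      qed
      show "\<exists>w :: real \<Rightarrow> L2.
            (\<forall>\<epsilon>\<in>{0..1}.
                has_weak_integral (mu_eps \<epsilon>)
                  (\<lambda>x. cinner (coherent (\<pi> \<epsilon>) \<psi> x) v *\<^sub>C coherent (\<pi> \<epsilon>) \<psi> x) (w \<epsilon>) \<and>
                v = of_real ((norm \<psi>)\<^sup>2 / enn2real (C_adm \<epsilon> (\<pi> \<epsilon>) \<psi>)) *\<^sub>C w \<epsilon>) \<and>
            continuous_on {0..1} w" for v
      \<comment> \<open>The weak integral is the multiple \<open>k \<epsilon>\<close> of
        \<open>v\<close>, so its norm continuity in \<epsilon> is the continuity of
        \<open>k\<close>.\<close>
      proof (intro exI[of _ "\<lambda>\<epsilon>. k \<epsilon> *\<^sub>R v"] conjI ballI)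
        fix \<epsilon> :: real assume \<epsilon>: "\<epsilon> \<in> {0..1}"
        have e: "cinner u (cinner (coherent (\<pi> \<epsilon>) \<psi> x) v *\<^sub>C coherent (\<pi> \<epsilon>) \<psi> x)
          = cinner u (coherent (\<pi> \<epsilon>) \<psi> x) * cinner (coherent (\<pi> \<epsilon>) \<psi> x) v" for u x
          by (simp add: cinner_scaleC_right mult.commute)
        show "has_weak_integral (mu_eps \<epsilon>) (\<lambda>x. cinner (coherent (\<pi> \<epsilon>) \<psi> x) v *\<^sub>C coherent (\<pi> \<epsilon>) \<psi> x) (k \<epsilon> *\<^sub>R v)"
          unfolding has_weak_integral_def e
          by (simp add: res[OF \<epsilon>] cinner_scaleR_right scaleR_conv_of_real)
        show "v = of_real ((norm \<psi>)\<^sup>2 / enn2real (C_adm \<epsilon> (\<pi> \<epsilon>) \<psi>)) *\<^sub>C k \<epsilon> *\<^sub>R v"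
          unfolding ratio[OF \<epsilon>] scaleC_of_real using kpos[OF \<epsilon>] by simp
      qed (intro continuous_intros kcont)
    qed
  qed
  show ?thesis
  proof (intro exI[of _ \<pi>] conjI ballI allI impI)
    show "unitary_irrep (G_eps \<epsilon>) (\<pi> \<epsilon>)" if "\<epsilon> \<in> {0..1}" for \<epsilon> using that by (intro irr\<pi>) simp
    show "\<pi> 0 = \<pi>0" by (rule \<pi>0)
    show "continuous_on {0..1} (\<lambda>\<epsilon>. \<pi> \<epsilon> g v)" for g v by (rule continuous_on_subset[OF cont]) simp
    have "isCont (\<lambda>\<epsilon>. \<pi> \<epsilon> g v) 0" for g v
      using cont[of g v] by (simp add: continuous_on_eq_continuous_at)
    then have "((\<lambda>\<epsilon>. \<pi> \<epsilon> g v) \<longlongrightarrow> \<pi> 0 g v) (at 0)" for g v by (simp add: isCont_def)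
    then show "((\<lambda>\<epsilon>. \<pi> \<epsilon> g v) \<longlongrightarrow> \<pi>0 g v) (at_right 0)" for g v
      unfolding \<pi>0 by (rule filterlim_mono[OF _ order_refl at_le]) simp
    show "\<exists>a b. b \<noteq> 0 \<and> unitarily_equivalent EA (\<pi> \<epsilon> \<circ> P_eps_inv \<epsilon>) (wavelet_rep a b) hardy"
      if "\<epsilon> \<in> {0<..1}" for \<epsilon>
      using wavelet[of \<epsilon>] that l by (intro exI[of _ "l / \<epsilon>"] exI[of _ "- (l / \<epsilon>)"]) auto
    show "unitary_irrep heisenberg (\<pi> 0)" unfolding \<pi>0 by (rule assms)
  qed (use main in blast)+
qed

end
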